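(* Let $\Lambda$ be a lattice spanning the $s$-dimensional real vector space $V$ and $X$ a finite list of nonzero vectors in $\Lambda$, spanning $V$, with $0$ not in the convex hull of $X$. On the intersection of $\Lambda$ with the open set of regular points of $C(X)$ we have $$\mathcal P_X=\sum_{e^\phi\in P(X)}\widehat Q_\phi\,T_{X_\phi,\underline\phi}.$$
   Context: $\mathcal P_X(v):=\#\{(n_1,\dots,n_N)\in\mathbb N^N\mid\sum n_ia_i=v\}$ for $v\in\Lambda$, $X=(a_1,\dots,a_N)$ (with $0\in\mathbb N$). $C(A):=\{\sum_{a\in A}t_aa\mid t_a\ge0\}$. The regular points of $C(X)$ are the points of $C(X)$ not lying in any cone $C(A)$ with $A\subset X$ not spanning $V$; they form an open set. Lebesgue measure $dx$ on $V$ is normalized so that a fundamental domain of $\Lambda$ has volume $1$. For a list $Z$ of vectors from $X$ spanning $V$ and complex parameters $\underline\mu=(\mu_a)_{a\in Z}$, $T_{Z,\underline\mu}$ is the function on $V$ supported in $C(Z)$ characterized by $\int_Vf(x)T_{Z,\underline\mu}(x)dx=\int_{\mathbb R_+^{|Z|}}e^{-\sum_{a\in Z} t_a\mu_a}f(\sum_{a\in Z}t_aa)\,dt$ ($f$ continuous with compact support); $T_Z:=T_{Z,0}$. On regular points $T_Z$ is taken in its representative that is locally polynomial. $U_{\mathbb C}=\mathrm{Hom}_{\mathbb R}(V,\mathbb C)$; $T=\mathrm{Hom}(\Lambda,\mathbb C^* )$; $\phi\in U_{\mathbb C}$ defines $e^\phi\in T$, $a\mapsto e^{\langle\phi\mid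 a\rangle}$. $P(X)\subset T$ is the finite set of points $e^\phi$ for which there is a basis $\underline b$ of $V$ extracted from $X$ with $e^{\langle\phi\mid a\rangle}=1$ for all $a\in\underline b$; for each point of $P(X)$ one representative $\phi\in U_{\mathbb C}$ is chosen. $X_\phi:=\{a\in X\mid e^{\langle\phi\mid a\rangle}=1\}$ (a sublist, spanning $V$), and $\underline\phi$ is the list of parameters $\phi_a:=-\langle\phi\mid a\rangle$, $a\in X_\phi$; thus $T_{X_\phi,\underline\phi}(x)=e^{\langle\phi\mid x\rangle}T_{X_\phi}(x)$. $\widehat Q_\phi$ is the differential operator of infinite order $$\widehat Q_\phi=\prod_{a\in X,\,a\notin X_\phi}\frac1{1-e^{-\tilde a-\langle\phi\mid a\rangle}}\ \prod_{a\in X_\phi}\frac{\tilde a}{1-e^{-\tilde a}},\qquad \tilde a:=D_a-\langle\phi\mid a\rangle,$$ expanded as a power series in the commuting operators $\tilde a$, where $D_a$ is the directional derivative on functions on $V$. On a function of the form $e^{\langle\phi\mid x\rangle}g(x)$ with $g$ polynomial the operator $\tilde a$ acts by $e^{\langle\phi\mid x\rangle}g\mapsto e^{\langle\phi\mid x\rangle}D_ag$, so $\widehat Q_\phi$ is well defined on such functions; it is applied to $T_{X_\phi,\underline\phi}$ locally near each regular point, where $T_{X_\phi,\underline\phi}$ is of this form. *)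

theory Defs
  imports "HOL-Analysis.Analysis"
begin

section \<open>Lattices and the normalized Lebesgue measure\<close>

definition lattice_basis :: "'v::euclidean_space set \<Rightarrow> 'v set \<Rightarrow> bool" where
  "lattice_basis \<Lambda> B \<longleftrightarrow>
     independent B \<and> span B = UNIV \<and> \<Lambda> = {(\<Sum>b\<in>B. of_int (c b) *\<^sub>R b) | c :: 'v \<Rightarrow> int. True}"

definition spanning_lattice :: "'v::euclidean_space set \<Rightarrow> bool" where
  "spanning_lattice \<Lambda> \<longleftrightarrow> (\<exists>B. lattice_basis \<Lambda> B)"

definition half_open_parallelepiped :: "'v::euclidean_space set \<Rightarrow> 'v set" where
  "half_open_parallelepiped B = {(\<Sum>b\<in>B. t b *\<^sub>R b) | t. \<forall>b\<in>B. 0 \<le> t b \<and> t b < 1}"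

text \<open>
  The half-open parallelepiped on a lattice basis is a fundamental domain; its volume does not
  depend on the basis chosen. After rescaling, the inner product of the ambient type has no
  influence on this measure.
\<close>

definition lattice_lborel :: "'v::euclidean_space set \<Rightarrow> 'v measure" where
  "lattice_lborel \<Lambda> =
     scale_measure
       (inverse (emeasure lborel (half_open_parallelepiped (SOME B. lattice_basis \<Lambda> B)))) lborel"


section \<open>Partition function, cones and regular points\<close>

definition partition_function :: "'v::real_vector list \<Rightarrow> 'v \<Rightarrow> nat" where
  "partition_function X v =
     card {ns :: nat list. length ns = length X \<and> (\<Sum>i<length X. real (ns ! i) *\<^sub>R (X ! i)) = v}"

definition cone_of :: "'v::real_vector set \<Rightarrow> 'v set" where
  "cone_of A = {(\<Sum>a\<in>A. t a *\<^sub>R a) | t. \<forall>a\<in>A. 0 \<le> t a}"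

definition regular_points :: "'v::real_vector list \<Rightarrow> 'v set" where
  "regular_points X = cone_of (set X) - (\<Union>A\<in>{A. A \<subseteq> set X \<and> span A \<noteq> UNIV}. cone_of A)"


section \<open>Multivariate splines\<close>

text \<open>
  The parameters \<open>\<mu>\<close> form a list parallel to \<open>Z\<close>, so that repeated vectors of \<open>Z\<close> may carry
  different parameters. Only the class of \<open>F\<close> up to null sets is determined by this condition.
\<close>

definition is_spline ::
    "'v::euclidean_space set \<Rightarrow> 'v list \<Rightarrow> complex list \<Rightarrow> ('v \<Rightarrow> complex) \<Rightarrow> bool" where
  "is_spline \<Lambda> Z \<mu> F \<longleftrightarrow>
     (\<forall>x. x \<notin> cone_of (set Z) \<longrightarrow> F x = 0) \<and>
     (\<forall>f :: 'v \<Rightarrow> complex. continuous_on UNIV f \<and> compact (closure {x. f x \<noteq> 0}) \<longrightarrow>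
        integrable (lattice_lborel \<Lambda>) (\<lambda>x. f x * F x) \<and>
        (LINT x|lattice_lborel \<Lambda>. f x * F x) =
        (LINT t : PiE {..<length Z} (\<lambda>_. {0::real..}) | PiM {..<length Z} (\<lambda>_. lborel).
           exp (- (\<Sum>i<length Z. of_real (t i) * \<mu> ! i)) * f (\<Sum>i<length Z. t i *\<^sub>R (Z ! i))))"

text \<open>
  The representative: if \<open>\<mu>\<close> comes from a functional \<open>\<phi>\<close>, that is \<open>\<mu>\<^sub>a = - \<phi> a\<close>, it is required to
  be \<open>exp \<circ> \<phi>\<close> times a polynomial near each regular point; for \<open>\<mu> = 0\<close> this says that it is locally
  polynomial there. Such a representative is unique on the regular points of \<open>Z\<close> and is \<open>0\<close>
  outside \<open>cone_of (set Z)\<close>; the choice operator only affects the remaining singular points.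
\<close>

definition spline :: "'v::euclidean_space set \<Rightarrow> 'v list \<Rightarrow> complex list \<Rightarrow> 'v \<Rightarrow> complex" where
  "spline \<Lambda> Z \<mu> =
     (SOME F. is_spline \<Lambda> Z \<mu> F \<and>
        (\<forall>\<phi> :: 'v \<Rightarrow> complex. linear \<phi> \<and> \<mu> = map (\<lambda>a. - \<phi> a) Z \<longrightarrow>
           (\<forall>x\<in>regular_points Z. \<exists>g :: 'v \<Rightarrow> complex. polynomial_function g \<and>
              (\<forall>\<^sub>F y in nhds x. F y = exp (\<phi> y) * g y))))"


section \<open>Points of the torus attached to \<open>X\<close>\<close>

text \<open>
  The space of complex functionals is the set of real-linear maps from the ambient type to
  \<^typ>\<open>complex\<close>. Characters of \<open>\<Lambda>\<close> are functions on \<open>\<Lambda>\<close> extended by \<open>undefined\<close>, so that two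
  functionals give the same character iff they agree modulo \<open>2 * pi * \<i>\<close> on \<open>\<Lambda>\<close>.
\<close>

definition exp_char :: "'v set \<Rightarrow> ('v \<Rightarrow> complex) \<Rightarrow> ('v \<Rightarrow> complex)" where
  "exp_char \<Lambda> \<phi> = restrict (\<lambda>a. exp (\<phi> a)) \<Lambda>"

definition toric_points :: "'v::real_vector set \<Rightarrow> 'v list \<Rightarrow> ('v \<Rightarrow> complex) set" where
  "toric_points \<Lambda> X =
     {exp_char \<Lambda> \<phi> | \<phi>. linear \<phi> \<and>
        (\<exists>b \<subseteq> set X. independent b \<and> span b = UNIV \<and> (\<forall>a\<in>b. exp (\<phi> a) = 1))}"

definition sublist_at :: "'v list \<Rightarrow> ('v \<Rightarrow> complex) \<Rightarrow> 'v list" where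
  "sublist_at X \<phi> = filter (\<lambda>a. exp (\<phi> a) = 1) X"

definition params_at :: "'v list \<Rightarrow> ('v \<Rightarrow> complex) \<Rightarrow> complex list" where
  "params_at X \<phi> = map (\<lambda>a. - \<phi> a) (sublist_at X \<phi>)"


section \<open>The operator of infinite order\<close>

definition dir_deriv :: "'v::real_normed_vector \<Rightarrow> ('v \<Rightarrow> complex) \<Rightarrow> ('v \<Rightarrow> complex)" where
  "dir_deriv a h x = vector_derivative (\<lambda>t. h (x + t *\<^sub>R a)) (at 0)"

definition tilde_op ::
    "('v::real_normed_vector \<Rightarrow> complex) \<Rightarrow> 'v \<Rightarrow> ('v \<Rightarrow> complex) \<Rightarrow> ('v \<Rightarrow> complex)" where
  "tilde_op \<phi> a h x = dir_deriv a h x - \<phi> a * h x"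

definition fps_op ::
    "complex fps \<Rightarrow> (('v \<Rightarrow> complex) \<Rightarrow> ('v \<Rightarrow> complex)) \<Rightarrow> ('v \<Rightarrow> complex) \<Rightarrow> ('v \<Rightarrow> complex)" where
  "fps_op S L h x = (\<Sum>k. fps_nth S k * (L ^^ k) h x)"

text \<open>
  The product of operators is composition. All operators involved are local, and where \<open>h\<close> is
  \<open>exp \<circ> \<phi>\<close> times a polynomial near \<open>x\<close> only finitely many terms of each series are nonzero
  near \<open>x\<close> and the factors commute. The first series is defined since \<open>exp (- \<phi> a) \<noteq> 1\<close>; in the
  second, numerator and denominator both have order one at zero.
\<close>

definition Q_hat ::
    "'v::real_normed_vector list \<Rightarrow> ('v \<Rightarrow> complex) \<Rightarrow> ('v \<Rightarrow> complex) \<Rightarrow> ('v \<Rightarrow> complex)" where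
  "Q_hat X \<phi> h =
     foldr (\<lambda>a. fps_op (1 / (1 - fps_const (exp (- \<phi> a)) * fps_exp (- 1))) (tilde_op \<phi> a))
       (filter (\<lambda>a. exp (\<phi> a) \<noteq> 1) X)
       (foldr (\<lambda>a. fps_op (fps_X / (1 - fps_exp (- 1))) (tilde_op \<phi> a)) (sublist_at X \<phi>) h)"

end

theory Submission
  imports Defs
begin

text \<open>
  Near a point \<open>u\<close> outside the singular cones the spline of a list \<open>Y\<close> is a polynomial \<open>T\<^sub>Y\<close>, and
  \<open>D\<^sub>a T\<^sub>a\<^sub>Y = T\<^sub>Y\<close>. Hence the right-hand side of the formula, read as a function of the chamber of \<open>u\<close>
  and of an independent evaluation point \<open>l\<close>, satisfies the difference equation
  \<open>F\<^sub>a\<^sub>X(l) - F\<^sub>a\<^sub>X(l - a) = F\<^sub>X(l)\<close> of the partition function.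

  The identity is proved for almost every \<open>u\<close> and all lattice points \<open>l\<close> in \<open>u\<close> minus the zonotope of
  the list. In this form the difference equation transfers it from \<open>n a, R\<close> to \<open>a, R\<close>, and from
  \<open>a + b, b, R\<close> and \<open>a + b, a, R\<close> to \<open>a, b, R\<close>. An integral relation among the distinct vectors of
  the list becomes, after scaling, an equality of two subset sums; merging vectors on either side
  shortens it until two vectors coincide. So induction on the number of distinct vectors leaves the
  lists supported on a basis, where the spline is a monomial and orthogonality of characters
  finishes the computation. A regular lattice point \<open>v\<close> is then reached from a generic \<open>u\<close> near \<open>v\<close>
  with \<open>u - v\<close> in the zonotope.
\<close>

section \<open>Polynomial functions and power series in a directional derivative\<close>

text \<open>The difference equation in one direction determines a function only up to functions
  periodic in that direction, so the formula for a list does not follow from the formula with one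
  vector removed. This is why the induction replaces vectors and counts the distinct ones instead of
  shortening the list. The moves shift the evaluation point out of the chamber, hence an identity
  asserted on the chamber alone would not be transferred. The region \<open>u\<close> minus the
  zonotope is adapted to them: the parallelogram on \<open>a, b\<close> is cut by its diagonal into
  two triangles, which fit the zonotopes of the two merged lists, and the segment of
  \<open>n a\<close> is a union of \<open>n\<close> translates of the segment of \<open>a\<close>.
  The point \<open>u\<close> is only generic because the moves introduce new vectors, hence new
  singular cones, which may pass through a prescribed point; a null set is lost at each of finitely
  many steps. At the end the normalization of the volume meets the characters: for a basis
  \<open>B\<close> in \<Lambda> the number of characters trivial on \<open>B\<close> is the index of
  the lattice of \<open>B\<close>, which is also the ratio of the volumes of the two
  parallelepipeds.\<close>

lemma real_polynomial_expansion:
  fixes g :: "'a::real_normed_vector \<Rightarrow> real"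
  assumes "real_polynomial_function g"
  shows "\<exists>n c. (\<forall>k. real_polynomial_function (c k)) \<and> (\<forall>k>n. c k = (\<lambda>x. 0)) \<and>
           (\<forall>x t. g (x + t *\<^sub>R a) = (\<Sum>k\<le>n. c k x * t ^ k))"
  using assms
proof (induction g rule: real_polynomial_function.induct)
  case (linear f)
  then have bl: "bounded_linear f" .
  interpret bounded_linear f by fact
  let ?c = "\<lambda>k::nat. if k = 0 then f else if k = 1 then (\<lambda>x. f a) else (\<lambda>x. 0)"
  have "\<forall>k. real_polynomial_function (?c k)"
    using real_polynomial_function.intros(1)[OF bl] real_polynomial_function.intros(2) by auto
  moreover have "\<forall>x t. f (x + t *\<^sub>R a) = (\<Sum>k\<le>1. ?c k x * t ^ k)" by (simp add: add scaleR)
  ultimately show ?case by (intro exI[of _ 1] exI[of _ ?c]) auto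
next
  case (const c)
  show ?case by (rule exI[of _ 0], rule exI[of _ "\<lambda>k. if k = 0 then (\<lambda>x. c) else (\<lambda>x. 0)"]) auto
next
  case (add f g)
  then obtain n c m d where c: "\<forall>k. real_polynomial_function (c k)" "\<forall>k>n. c k = (\<lambda>x. 0)"
      "\<And>x t. f (x + t *\<^sub>R a) = (\<Sum>k\<le>n. c k x * t ^ k)"
    and d: "\<forall>k. real_polynomial_function (d k)" "\<forall>k>m. d k = (\<lambda>x. 0)"
      "\<And>x t. g (x + t *\<^sub>R a) = (\<Sum>k\<le>m. d k x * t ^ k)" by blast
  have "f (x + t *\<^sub>R a) = (\<Sum>k\<le>max n m. c k x * t ^ k)" for x t
    unfolding c(3) by (rule sum.mono_neutral_left) (use c(2) in auto)
  moreover have "g (x + t *\<^sub>R a) = (\<Sum>k\<le>max n m. d k x * t ^ k)" for x t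
    unfolding d(3) by (rule sum.mono_neutral_left) (use d(2) in auto)
  ultimately have "f (x + t *\<^sub>R a) + g (x + t *\<^sub>R a) = (\<Sum>k\<le>max n m. (c k x + d k x) * t ^ k)" for x t
    by (simp add: sum.distrib ring_distribs)
  then show ?case using c(1,2) d(1,2)
    by (intro exI[of _ "max n m"] exI[of _ "\<lambda>k x. c k x + d k x"]) (auto intro: real_polynomial_function.intros(3))
next
  case (mult f g)
  then obtain n c m d where c: "\<forall>k. real_polynomial_function (c k)" "\<forall>k>n. c k = (\<lambda>x. 0)"
      "\<And>x t. f (x + t *\<^sub>R a) = (\<Sum>k\<le>n. c k x * t ^ k)"
    and d: "\<forall>k. real_polynomial_function (d k)" "\<forall>k>m. d k = (\<lambda>x. 0)"
      "\<And>x t. g (x + t *\<^sub>R a) = (\<Sum>k\<le>m. d k x * t ^ k)" by blast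
  have "f (x + t *\<^sub>R a) * g (x + t *\<^sub>R a) = (\<Sum>r\<le>n + m. (\<Sum>k\<le>r. c k x * d (r - k) x) * t ^ r)" for x t
    unfolding c(3) d(3) by (rule polynomial_product) (use c(2) d(2) in auto)
  moreover have "(\<lambda>x. \<Sum>k\<le>r. c k x * d (r - k) x) = (\<lambda>x. 0)" if "r > n + m" for r
  proof -
    have "c k x * d (r - k) x = 0" if "k \<le> r" for k x
      using c(2) d(2) \<open>r > n + m\<close> by (cases "k > n") (auto simp: not_less)
    then show ?thesis by (intro ext sum.neutral) auto
  qed
  ultimately show ?case using c(1) d(1)
    by (intro exI[of _ "n + m"] exI[of _ "\<lambda>r x. \<Sum>k\<le>r. c k x * d (r - k) x"])
      (auto intro!: real_polynomial_function_sum real_polynomial_function.intros(4))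
qed

lemma polynomial_function_complex_iff:
  fixes g :: "'a::real_normed_vector \<Rightarrow> complex"
  shows "polynomial_function g \<longleftrightarrow>
    real_polynomial_function (\<lambda>x. Re (g x)) \<and> real_polynomial_function (\<lambda>x. Im (g x))"
proof
  assume "polynomial_function g"
  then show "real_polynomial_function (\<lambda>x. Re (g x)) \<and> real_polynomial_function (\<lambda>x. Im (g x))"
    unfolding polynomial_function_def o_def using bounded_linear_Re bounded_linear_Im by blast
next
  assume r: "real_polynomial_function (\<lambda>x. Re (g x)) \<and> real_polynomial_function (\<lambda>x. Im (g x))"
  show "polynomial_function g" unfolding polynomial_function_def o_def
  proof (intro allI impI)
    fix f :: "complex \<Rightarrow> real" assume "bounded_linear f"
    then interpret bounded_linear f .
    have "f (g x) = Re (g x) * f 1 + Im (g x) * f \<i>" for x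
      using arg_cong[OF complex_eq[of "g x"], of f] scaleR[of "Re (g x)" 1] scaleR[of "Im (g x)" \<i>]
      by (simp add: add scaleR_conv_of_real mult.commute)
    then show "real_polynomial_function (\<lambda>x. f (g x))" using r
      by (auto intro!: real_polynomial_function.intros(3) real_polynomial_function.intros(4))
  qed
qed

lemma polynomial_function_of_real:
  "real_polynomial_function g \<Longrightarrow> polynomial_function (\<lambda>x. complex_of_real (g x))"
  by (simp add: polynomial_function_complex_iff real_polynomial_function.intros(2))

lemma polynomial_function_complex_mult:
  fixes f g :: "'a::real_normed_vector \<Rightarrow> complex"
  assumes "polynomial_function f" "polynomial_function g"
  shows "polynomial_function (\<lambda>x. f x * g x)"
  using assms unfolding polynomial_function_complex_iff
  by (auto intro!: real_polynomial_function.intros(3) real_polynomial_function.intros(4) real_polynomial_function_diff)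

lemma polynomial_function_cmult:
  "polynomial_function g \<Longrightarrow> polynomial_function (\<lambda>x. (c::complex) * g x)"
  by (rule polynomial_function_complex_mult) auto

text \<open>Reduces directional calculus to the coefficients of a polynomial in one real variable.
  The coefficients stay polynomial in the base point, so they can be differentiated again, and their
  vanishing beyond \<open>n\<close> allows index shifts without a case distinction.\<close>

lemma polynomial_expansion:
  fixes g :: "'a::real_normed_vector \<Rightarrow> complex"
  assumes "polynomial_function g"
  obtains n c where "\<And>k. polynomial_function (c k)" "\<And>k. k > n \<Longrightarrow> c k = (\<lambda>x. 0)"
    "\<And>x t. g (x + t *\<^sub>R a) = (\<Sum>k\<le>n. c k x * of_real t ^ k)"
proof -
  obtain n c m d where c: "\<forall>k. real_polynomial_function (c k)" "\<forall>k>n. c k = (\<lambda>x. 0)"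
      "\<And>x t. Re (g (x + t *\<^sub>R a)) = (\<Sum>k\<le>n. c k x * t ^ k)"
    and d: "\<forall>k. real_polynomial_function (d k)" "\<forall>k>m. d k = (\<lambda>x. 0)"
      "\<And>x t. Im (g (x + t *\<^sub>R a)) = (\<Sum>k\<le>m. d k x * t ^ k)"
    using assms unfolding polynomial_function_complex_iff
    using real_polynomial_expansion[of "\<lambda>x. Re (g x)" a] real_polynomial_expansion[of "\<lambda>x. Im (g x)" a]
    by blast
  let ?e = "\<lambda>k x. Complex (c k x) (d k x)"
  have "Re (g (x + t *\<^sub>R a)) = (\<Sum>k\<le>max n m. c k x * t ^ k)" for x t
    unfolding c(3) by (rule sum.mono_neutral_left) (use c(2) in auto)
  moreover have "Im (g (x + t *\<^sub>R a)) = (\<Sum>k\<le>max n m. d k x * t ^ k)" for x t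
    unfolding d(3) by (rule sum.mono_neutral_left) (use d(2) in auto)
  ultimately have "g (x + t *\<^sub>R a) = (\<Sum>k\<le>max n m. ?e k x * of_real t ^ k)" for x t
    by (intro complex_eqI) (simp_all flip: of_real_power)
  moreover have "?e k = (\<lambda>x. 0)" if "k > max n m" for k using that c(2) d(2) by (auto simp: complex_eq_iff)
  moreover have "polynomial_function (?e k)" for k using c(1) d(1) by (simp add: polynomial_function_complex_iff)
  ultimately show ?thesis using that[of ?e "max n m"] by blast
qed

lemma polynomial_line_differentiable:
  fixes g :: "'a::real_normed_vector \<Rightarrow> complex"
  assumes "polynomial_function g"
  shows "((\<lambda>t. g (x + t *\<^sub>R a)) has_vector_derivative dir_deriv a g x) (at 0)"
proof -
  obtain n c where c: "\<And>x t. g (x + t *\<^sub>R a) = (\<Sum>k\<le>n. c k x * of_real t ^ k)"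
    by (rule polynomial_expansion[OF assms, of a]) blast
  have "(\<lambda>t. g (x + t *\<^sub>R a)) differentiable (at 0)"
  proof -
    have "(\<lambda>t. complex_of_real t ^ k) differentiable (at 0)" for k
    proof -
      have "((\<lambda>t. complex_of_real (t ^ k)) has_vector_derivative of_real (of_nat k * 0 ^ (k - 1))) (at 0)"
        by (intro has_vector_derivative_of_real)
          (auto intro!: derivative_eq_intros simp flip: has_real_derivative_iff_has_vector_derivative)
      then show ?thesis by (auto simp: has_vector_derivative_def differentiable_def)
    qed
    then show ?thesis unfolding c by (intro derivative_intros) auto
  qed
  then show ?thesis unfolding dir_deriv_def by (simp add: vector_derivative_works)
qed

lemma dir_deriv_expansion:
  fixes g :: "'a::real_normed_vector \<Rightarrow> complex"
  assumes "\<And>x t. g (x + t *\<^sub>R a) = (\<Sum>k\<le>n. c k x * of_real t ^ k)" and "\<And>k. k > n \<Longrightarrow> c k = (\<lambda>x. 0)"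
  shows "dir_deriv a g (x + s *\<^sub>R a) = (\<Sum>k\<le>n. (of_nat (Suc k) * c (Suc k) x) * of_real s ^ k)"
proof -
  have e: "g (x + s *\<^sub>R a + t *\<^sub>R a) = (\<Sum>k\<le>n. c k x * of_real (s + t) ^ k)" for t
    using assms(1)[of x "s + t"] by (simp add: algebra_simps)
  have "((\<lambda>t. complex_of_real (s + t) ^ k) has_vector_derivative of_nat k * of_real s ^ (k - 1)) (at 0)" for k
  proof -
    have "((\<lambda>t. (s + t) ^ k) has_real_derivative of_nat k * s ^ (k - 1)) (at 0)"
      by (auto intro!: derivative_eq_intros)
    then have "((\<lambda>t. complex_of_real ((s + t) ^ k)) has_vector_derivative of_real (of_nat k * s ^ (k - 1))) (at 0)"
      by (intro has_vector_derivative_of_real) (simp add: has_real_derivative_iff_has_vector_derivative)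
    then show ?thesis by simp
  qed
  then have "((\<lambda>t. g (x + s *\<^sub>R a + t *\<^sub>R a)) has_vector_derivative
      (\<Sum>k\<le>n. c k x * (of_nat k * of_real s ^ (k - 1)))) (at 0)"
    unfolding e by (intro has_vector_derivative_sum has_vector_derivative_mult_right) auto
  then have "dir_deriv a g (x + s *\<^sub>R a) = (\<Sum>k\<le>n. c k x * (of_nat k * of_real s ^ (k - 1)))"
    unfolding dir_deriv_def by (rule vector_derivative_at)
  also have "\<dots> = (\<Sum>k\<le>Suc n. c k x * (of_nat k * of_real s ^ (k - 1)))" using assms(2) by simp
  also have "\<dots> = (\<Sum>k\<le>n. (of_nat (Suc k) * c (Suc k) x) * of_real s ^ k)"
    by (subst sum.atMost_Suc_shift) (simp add: algebra_simps)
  finally show ?thesis .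
qed

lemma dir_deriv_power_expansion:
  fixes g :: "'a::real_normed_vector \<Rightarrow> complex"
  assumes "\<And>x t. g (x + t *\<^sub>R a) = (\<Sum>k\<le>n. c k x * of_real t ^ k)" and "\<And>k. k > n \<Longrightarrow> c k = (\<lambda>x. 0)"
  shows "(dir_deriv a ^^ j) g (x + s *\<^sub>R a) =
    (\<Sum>k\<le>n. (fact (k + j) / fact k * c (k + j) x) * of_real s ^ k)"
proof (induction j arbitrary: x s)
  case 0
  then show ?case using assms by simp
next
  case (Suc j)
  let ?d = "\<lambda>k x. fact (k + j) / fact k * c (k + j) x"
  have "dir_deriv a ((dir_deriv a ^^ j) g) (x + s *\<^sub>R a) =
      (\<Sum>k\<le>n. (of_nat (Suc k) * ?d (Suc k) x) * of_real s ^ k)"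
    by (rule dir_deriv_expansion) (use Suc assms(2) in auto)
  moreover have "of_nat (Suc k) * ?d (Suc k) x = fact (k + Suc j) / fact k * c (k + Suc j) x" for k
  proof -
    have "(of_nat (Suc k) :: complex) \<noteq> 0" by (rule of_nat_neq_0)
    then show ?thesis by (simp add: divide_simps del: of_nat_Suc)
  qed
  ultimately show ?case by simp
qed

text \<open>The coefficients along a line are the Taylor coefficients; nilpotency, the exact Taylor
  formula and the commutation of derivatives are read off from this.\<close>

lemma dir_deriv_power_coeff:
  fixes g :: "'a::real_normed_vector \<Rightarrow> complex"
  assumes "\<And>x t. g (x + t *\<^sub>R a) = (\<Sum>k\<le>n. c k x * of_real t ^ k)" and "\<And>k. k > n \<Longrightarrow> c k = (\<lambda>x. 0)"
  shows "(dir_deriv a ^^ j) g x = fact j * c j x"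
proof -
  have "(dir_deriv a ^^ j) g x = (\<Sum>k\<le>n. (fact (k + j) / fact k * c (k + j) x) * 0 ^ k)"
    using dir_deriv_power_expansion[OF assms, where j = j and x = x and s = 0] by simp
  also have "\<dots> = (\<Sum>k\<in>{0}. (fact (k + j) / fact k * c (k + j) x) * 0 ^ k)"
    by (rule sum.mono_neutral_right) auto
  finally show ?thesis by simp
qed

lemma polynomial_dir_deriv_power:
  fixes g :: "'a::real_normed_vector \<Rightarrow> complex"
  assumes "polynomial_function g"
  shows "polynomial_function ((dir_deriv a ^^ j) g)"
proof -
  obtain n c where c: "\<And>k. polynomial_function (c k)" "\<And>k. k > n \<Longrightarrow> c k = (\<lambda>x. 0)"
      "\<And>x t. g (x + t *\<^sub>R a) = (\<Sum>k\<le>n. c k x * of_real t ^ k)"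
    by (rule polynomial_expansion[OF assms, of a]) blast
  have "(dir_deriv a ^^ j) g = (\<lambda>x. fact j * c j x)"
    using dir_deriv_power_coeff[OF c(3) c(2)] by blast
  then show ?thesis using c(1) by (simp add: polynomial_function_cmult)
qed

text \<open>This is what gives a meaning to operators of infinite order: every power series in
  \<open>dir_deriv a\<close> acts on a polynomial by a finite sum.\<close>

lemma dir_deriv_nilpotent:
  fixes g :: "'a::real_normed_vector \<Rightarrow> complex"
  assumes "polynomial_function g"
  obtains n where "\<And>j. j \<ge> n \<Longrightarrow> (dir_deriv a ^^ j) g = (\<lambda>x. 0)"
proof -
  obtain n c where c: "\<And>k. k > n \<Longrightarrow> c k = (\<lambda>x. 0)"
      "\<And>x t. g (x + t *\<^sub>R a) = (\<Sum>k\<le>n. c k x * of_real t ^ k)"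
    by (rule polynomial_expansion[OF assms, of a]) blast
  have "(dir_deriv a ^^ j) g = (\<lambda>x. 0)" if "j \<ge> Suc n" for j
    using dir_deriv_power_coeff[OF c(2) c(1)] c(1)[of j] that by fastforce
  then show ?thesis by (rule that)
qed

lemma polynomial_taylor:
  fixes g :: "'a::real_normed_vector \<Rightarrow> complex"
  assumes "polynomial_function g" and "\<And>j. j \<ge> N \<Longrightarrow> (dir_deriv a ^^ j) g = (\<lambda>x. 0)"
  shows "g (x + t *\<^sub>R a) = (\<Sum>k<N. of_real t ^ k / fact k * (dir_deriv a ^^ k) g x)"
proof -
  obtain n c where c: "\<And>k. k > n \<Longrightarrow> c k = (\<lambda>x. 0)"
      "\<And>x t. g (x + t *\<^sub>R a) = (\<Sum>k\<le>n. c k x * of_real t ^ k)"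
    by (rule polynomial_expansion[OF assms(1), of a]) blast
  have d: "(dir_deriv a ^^ j) g x = fact j * c j x" for j x by (rule dir_deriv_power_coeff[OF c(2) c(1)])
  have z: "c k x = 0" if "k \<ge> N" for k using d[of k x] assms(2)[OF that] by simp
  have "g (x + t *\<^sub>R a) = (\<Sum>k<max N (Suc n). c k x * of_real t ^ k)"
    unfolding c(2) by (rule sum.mono_neutral_left) (use c(1) in auto)
  also have "\<dots> = (\<Sum>k<N. c k x * of_real t ^ k)"
    by (rule sum.mono_neutral_right) (use z in auto)
  finally show ?thesis by (simp add: d mult.commute)
qed

lemma dir_deriv_add:
  assumes "polynomial_function f" "polynomial_function g"
  shows "dir_deriv a (\<lambda>x. f x + g x :: complex) = (\<lambda>x. dir_deriv a f x + dir_deriv a g x)"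
  by (rule ext, unfold dir_deriv_def[of a "\<lambda>x. f x + g x"], rule vector_derivative_at,
      intro has_vector_derivative_add polynomial_line_differentiable assms)

lemma dir_deriv_cmult:
  assumes "polynomial_function g"
  shows "dir_deriv a (\<lambda>x. c * g x :: complex) = (\<lambda>x. c * dir_deriv a g x)"
  by (rule ext, unfold dir_deriv_def[of a "\<lambda>x. c * g x"], rule vector_derivative_at,
      intro has_vector_derivative_mult_right polynomial_line_differentiable assms)

lemma dir_deriv_sum:
  assumes "\<And>i. i \<in> I \<Longrightarrow> polynomial_function (f i)"
  shows "dir_deriv a (\<lambda>x. \<Sum>i\<in>I. f i x :: complex) = (\<lambda>x. \<Sum>i\<in>I. dir_deriv a (f i) x)"
  by (rule ext, unfold dir_deriv_def[of a "\<lambda>x. \<Sum>i\<in>I. f i x"], rule vector_derivative_at,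
      intro has_vector_derivative_sum polynomial_line_differentiable assms)

lemma dir_deriv_shift: "dir_deriv a (\<lambda>x. g (x + y)) x = dir_deriv a g (x + y)"
  by (simp add: dir_deriv_def algebra_simps)

lemma dir_deriv_mult:
  assumes "polynomial_function f" "polynomial_function g"
  shows "dir_deriv a (\<lambda>x. f x * g x :: complex) x = f x * dir_deriv a g x + dir_deriv a f x * g x"
  using has_vector_derivative_mult[OF polynomial_line_differentiable[OF assms(1)] polynomial_line_differentiable[OF assms(2)], of x a x a]
  unfolding dir_deriv_def[of a "\<lambda>x. f x * g x"] by (intro vector_derivative_at) simp

text \<open>No symmetry of second derivatives is invoked: in the expansion along \<open>b\<close>
  the operator \<open>dir_deriv a\<close> acts on each coefficient, and both sides are its value on
  the linear one.\<close>

lemma dir_deriv_commute: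
  fixes g :: "'a::real_normed_vector \<Rightarrow> complex"
  assumes "polynomial_function g"
  shows "dir_deriv a (dir_deriv b g) = dir_deriv b (dir_deriv a g)"
proof -
  obtain n c where c: "\<And>k. polynomial_function (c k)" "\<And>k. k > n \<Longrightarrow> c k = (\<lambda>x. 0)"
      "\<And>x t. g (x + t *\<^sub>R b) = (\<Sum>k\<le>n. c k x * of_real t ^ k)"
    by (rule polynomial_expansion[OF assms, of b]) blast
  have "dir_deriv b g = c 1"
    using dir_deriv_power_coeff[OF c(3) c(2), where j=1] by (simp add: fun_eq_iff)
  have "dir_deriv a g (x + t *\<^sub>R b) = (\<Sum>k\<le>n. dir_deriv a (c k) x * of_real t ^ k)" for x t
  proof -
    have "dir_deriv a g (x + t *\<^sub>R b) = dir_deriv a (\<lambda>x. \<Sum>k\<le>n. of_real t ^ k * c k x) x"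
      by (subst dir_deriv_shift[symmetric]) (simp add: c(3) mult.commute)
    also have "\<dots> = (\<Sum>k\<le>n. of_real t ^ k * dir_deriv a (c k) x)"
      using c(1) by (subst dir_deriv_sum) (auto intro!: polynomial_function_cmult simp: dir_deriv_cmult)
    finally show ?thesis by (simp add: mult.commute)
  qed
  moreover have "dir_deriv a (c k) = (\<lambda>x. 0)" if "k > n" for k
    using c(2)[OF that] by (simp add: dir_deriv_def fun_eq_iff)
  ultimately have "dir_deriv b (dir_deriv a g) = dir_deriv a (c 1)"
    using dir_deriv_power_coeff[where g = "dir_deriv a g" and a = b and n = n and c = "\<lambda>k. dir_deriv a (c k)" and j = 1] by (auto simp: fun_eq_iff)
  with \<open>dir_deriv b g = c 1\<close> show ?thesis by simp
qed

text \<open>The operator \<open>S(D)\<close> with \<open>D = dir_deriv a\<close>: what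
  \<open>fps_op\<close> becomes once the exponential factor has been split off.\<close>

definition fps_dir :: "complex fps \<Rightarrow> 'a::real_normed_vector \<Rightarrow> ('a \<Rightarrow> complex) \<Rightarrow> 'a \<Rightarrow> complex" where
  "fps_dir S a g x = (\<Sum>k. fps_nth S k * (dir_deriv a ^^ k) g x)"

lemma fps_dir_eq_sum:
  assumes "\<And>j. j \<ge> N \<Longrightarrow> (dir_deriv a ^^ j) g = (\<lambda>x. 0)"
  shows "fps_dir S a g x = (\<Sum>k<N. fps_nth S k * (dir_deriv a ^^ k) g x)"
  unfolding fps_dir_def by (rule suminf_finite) (use assms in \<open>auto simp: not_less\<close>)

lemma polynomial_fps_dir:
  assumes "polynomial_function g" shows "polynomial_function (fps_dir S a g)"
proof -
  obtain N where N: "\<And>j. j \<ge> N \<Longrightarrow> (dir_deriv a ^^ j) g = (\<lambda>x. 0)" by (rule dir_deriv_nilpotent[OF assms]) blast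
  have "fps_dir S a g = (\<lambda>x. \<Sum>k<N. fps_nth S k * (dir_deriv a ^^ k) g x)"
    using fps_dir_eq_sum[OF N] by blast
  then show ?thesis
    by (auto intro!: polynomial_function_sum polynomial_function_cmult polynomial_dir_deriv_power assms)
qed

lemma dir_deriv_power_sum:
  assumes "\<And>i. i \<in> I \<Longrightarrow> polynomial_function (f i)"
  shows "(dir_deriv a ^^ k) (\<lambda>x. \<Sum>i\<in>I. c i * f i x :: complex) = (\<lambda>x. \<Sum>i\<in>I. c i * (dir_deriv a ^^ k) (f i) x)"
proof (induction k)
  case (Suc k)
  have "(dir_deriv a ^^ Suc k) (\<lambda>x. \<Sum>i\<in>I. c i * f i x) = dir_deriv a (\<lambda>x. \<Sum>i\<in>I. c i * (dir_deriv a ^^ k) (f i) x)"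
    by (simp add: Suc)
  also have "\<dots> = (\<lambda>x. \<Sum>i\<in>I. c i * (dir_deriv a ^^ Suc k) (f i) x)"
    by (subst dir_deriv_sum)
      (auto intro!: polynomial_function_cmult polynomial_dir_deriv_power assms sum.cong simp: dir_deriv_cmult polynomial_dir_deriv_power assms)
  finally show ?case .
qed simp

lemma dir_deriv_power_zero: "(dir_deriv a ^^ k) (\<lambda>x. 0::complex) = (\<lambda>x. 0)"
  using dir_deriv_power_sum[where I = "{}::nat set" and k = k and a = a] by simp

lemma dir_deriv_power_commute:
  fixes g :: "'a::real_normed_vector \<Rightarrow> complex"
  assumes "polynomial_function g"
  shows "(dir_deriv a ^^ k) ((dir_deriv b ^^ j) g) = (dir_deriv b ^^ j) ((dir_deriv a ^^ k) g)"
proof -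
  have 1: "dir_deriv a ((dir_deriv b ^^ j) h) = (dir_deriv b ^^ j) (dir_deriv a h)"
    if "polynomial_function h" for h :: "'a \<Rightarrow> complex" and j
    by (induction j) (simp_all add: dir_deriv_commute[of _ a] polynomial_dir_deriv_power that)
  show ?thesis
    by (induction k) (simp_all add: 1 polynomial_dir_deriv_power assms)
qed

lemma dir_deriv_power_fps_dir:
  fixes g :: "'a::real_normed_vector \<Rightarrow> complex"
  assumes "polynomial_function g"
  shows "(dir_deriv a ^^ k) (fps_dir S b g) = fps_dir S b ((dir_deriv a ^^ k) g)"
proof -
  obtain N where N: "\<And>j. j \<ge> N \<Longrightarrow> (dir_deriv b ^^ j) g = (\<lambda>x. 0)" by (rule dir_deriv_nilpotent[OF assms]) blast
  have N': "(dir_deriv b ^^ j) ((dir_deriv a ^^ k) g) = (\<lambda>x. 0)" if "j \<ge> N" for j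
    by (simp add: dir_deriv_power_commute[OF assms, of j b k a] N[OF that] dir_deriv_power_zero)
  have "fps_dir S b g = (\<lambda>x. \<Sum>k<N. fps_nth S k * (dir_deriv b ^^ k) g x)"
    using fps_dir_eq_sum[OF N] by blast
  then have "(dir_deriv a ^^ k) (fps_dir S b g) = (\<lambda>x. \<Sum>i<N. fps_nth S i * (dir_deriv a ^^ k) ((dir_deriv b ^^ i) g) x)"
    by (simp add: dir_deriv_power_sum polynomial_dir_deriv_power assms)
  also have "\<dots> = fps_dir S b ((dir_deriv a ^^ k) g)"
    by (rule ext, subst fps_dir_eq_sum[OF N']) (auto simp: dir_deriv_power_commute[OF assms, of k a _ b])
  finally show ?thesis .
qed

lemma dir_deriv_fps_dir:
  "polynomial_function g \<Longrightarrow> dir_deriv a (fps_dir S b g) = fps_dir S b (dir_deriv a g)"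
  using dir_deriv_power_fps_dir[of g 1 a] by simp

text \<open>Since \<open>S\<close> to \<open>S(D)\<close> is multiplicative, inverting a formal
  series inverts the operator. Both sums are cut off at the nilpotency order and rearranged over the
  triangle \<open>k + j < N\<close>.\<close>

lemma fps_dir_mult:
  assumes "polynomial_function g"
  shows "fps_dir S a (fps_dir T a g) = fps_dir (S * T) a g"
proof
  fix x
  obtain N where N: "\<And>j. j \<ge> N \<Longrightarrow> (dir_deriv a ^^ j) g = (\<lambda>x. 0)" by (rule dir_deriv_nilpotent[OF assms]) blast
  have N': "(dir_deriv a ^^ j) ((dir_deriv a ^^ k) g) = (\<lambda>x. 0)" if "j + k \<ge> N" for j k
    using N[OF that] by (simp add: funpow_add)
  have z: "(dir_deriv a ^^ k) (fps_dir T a g) = (\<lambda>x. 0)" if "k \<ge> N" for k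
    unfolding dir_deriv_power_fps_dir[OF assms] N[OF that]
    by (auto simp: fps_dir_def dir_deriv_power_zero)
  have "fps_dir S a (fps_dir T a g) x = (\<Sum>k<N. fps_nth S k * fps_dir T a ((dir_deriv a ^^ k) g) x)"
    by (subst fps_dir_eq_sum[OF z]) (auto simp: dir_deriv_power_fps_dir assms)
  also have "\<dots> = (\<Sum>k<N. \<Sum>j<N - k. fps_nth S k * (fps_nth T j * (dir_deriv a ^^ (k + j)) g x))"
  proof (rule sum.cong[OF refl])
    fix k assume "k \<in> {..<N}"
    show "fps_nth S k * fps_dir T a ((dir_deriv a ^^ k) g) x =
        (\<Sum>j<N - k. fps_nth S k * (fps_nth T j * (dir_deriv a ^^ (k + j)) g x))"
      by (subst fps_dir_eq_sum[of "N - k"])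
        (auto intro: N' simp: sum_distrib_left add.commute[of k] funpow_add)
  qed
  also have "\<dots> = (\<Sum>(k, j)\<in>{(k, j). k + j < N}. fps_nth S k * (fps_nth T j * (dir_deriv a ^^ (k + j)) g x))"
    by (subst sum.Sigma) (auto intro!: sum.cong)
  also have "\<dots> = (\<Sum>m<N. \<Sum>i\<le>m. fps_nth S i * (fps_nth T (m - i) * (dir_deriv a ^^ m) g x))"
    by (subst sum.triangle_reindex) simp
  also have "\<dots> = (\<Sum>m<N. fps_nth (S * T) m * (dir_deriv a ^^ m) g x)"
    by (simp add: fps_mult_nth sum_distrib_right atLeast0AtMost mult.assoc)
  also have "\<dots> = fps_dir (S * T) a g x" by (rule fps_dir_eq_sum[OF N, symmetric])
  finally show "fps_dir S a (fps_dir T a g) x = fps_dir (S * T) a g x" .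
qed

lemma fps_dir_commute:
  fixes g :: "'a::real_normed_vector \<Rightarrow> complex"
  assumes "polynomial_function g"
  shows "fps_dir S a (fps_dir T b g) = fps_dir T b (fps_dir S a g)"
proof
  fix x
  obtain N where N: "\<And>j. j \<ge> N \<Longrightarrow> (dir_deriv b ^^ j) g = (\<lambda>x. 0)" by (rule dir_deriv_nilpotent[OF assms]) blast
  have N': "(dir_deriv b ^^ j) (fps_dir S a g) = (\<lambda>x. 0)" if "j \<ge> N" for j
    unfolding dir_deriv_power_fps_dir[OF assms] N[OF that]
    by (auto simp: fps_dir_def dir_deriv_power_zero)
  obtain M where M: "\<And>j. j \<ge> M \<Longrightarrow> (dir_deriv a ^^ j) g = (\<lambda>x. 0)" by (rule dir_deriv_nilpotent[OF assms]) blast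
  have M': "(dir_deriv a ^^ j) (fps_dir T b g) = (\<lambda>x. 0)" if "j \<ge> M" for j
    unfolding dir_deriv_power_fps_dir[OF assms] M[OF that]
    by (auto simp: fps_dir_def dir_deriv_power_zero)
  have N2: "(dir_deriv b ^^ j) ((dir_deriv a ^^ k) g) = (\<lambda>x. 0)" if "j \<ge> N" for j k
    using N[OF that] dir_deriv_power_commute[OF assms, of j b k a]
    by (simp add: dir_deriv_power_zero)
  have M2: "(dir_deriv a ^^ j) ((dir_deriv b ^^ k) g) = (\<lambda>x. 0)" if "j \<ge> M" for j k
    using M[OF that] dir_deriv_power_commute[OF assms, of j a k b]
    by (simp add: dir_deriv_power_zero)
  have "fps_dir S a (fps_dir T b g) x = (\<Sum>k<M. fps_nth S k * (\<Sum>j<N. fps_nth T j * (dir_deriv b ^^ j) ((dir_deriv a ^^ k) g) x))"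
    by (subst fps_dir_eq_sum[OF M']) (auto simp: dir_deriv_power_fps_dir assms fps_dir_eq_sum[OF N2])
  also have "\<dots> = (\<Sum>j<N. fps_nth T j * (\<Sum>k<M. fps_nth S k * (dir_deriv a ^^ k) ((dir_deriv b ^^ j) g) x))"
    by (simp add: sum_distrib_left dir_deriv_power_commute[OF assms, of _ b _ a] mult_ac sum.swap[of _ "{..<M}"])
  also have "\<dots> = fps_dir T b (fps_dir S a g) x"
    by (subst fps_dir_eq_sum[OF N']) (auto simp: dir_deriv_power_fps_dir assms fps_dir_eq_sum[OF M2])
  finally show "fps_dir S a (fps_dir T b g) x = fps_dir T b (fps_dir S a g) x" .
qed

lemma fps_dir_1: "fps_dir 1 a g = g"
proof
  fix x
  have "fps_dir 1 a g x = (\<Sum>k\<in>{0}. fps_nth 1 k * (dir_deriv a ^^ k) g x)"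
    unfolding fps_dir_def by (rule suminf_finite) auto
  then show "fps_dir 1 a g x = g x" by simp
qed

lemma fps_dir_X: "fps_dir fps_X a g = dir_deriv a g"
proof
  fix x
  have "fps_dir fps_X a g x = (\<Sum>k\<in>{1}. fps_nth fps_X k * (dir_deriv a ^^ k) g x)"
    unfolding fps_dir_def by (rule suminf_finite) auto
  then show "fps_dir fps_X a g x = dir_deriv a g x" by simp
qed

lemma fps_dir_lincomb:
  assumes "polynomial_function g"
  shows "fps_dir (S + fps_const c * T) a g x = fps_dir S a g x + c * fps_dir T a g x"
proof -
  obtain N where N: "\<And>j. j \<ge> N \<Longrightarrow> (dir_deriv a ^^ j) g = (\<lambda>x. 0)" by (rule dir_deriv_nilpotent[OF assms]) blast
  show ?thesis by (simp add: fps_dir_eq_sum[OF N] sum_distrib_left ring_distribs sum.distrib mult.assoc)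
qed

lemma fps_dir_lincomb_right:
  assumes "polynomial_function f" "polynomial_function g"
  shows "fps_dir S a (\<lambda>x. f x + c * g x) x = fps_dir S a f x + c * fps_dir S a g x"
proof -
  obtain N where N: "\<And>j. j \<ge> N \<Longrightarrow> (dir_deriv a ^^ j) f = (\<lambda>x. 0)" by (rule dir_deriv_nilpotent[OF assms(1)]) blast
  obtain M where M: "\<And>j. j \<ge> M \<Longrightarrow> (dir_deriv a ^^ j) g = (\<lambda>x. 0)" by (rule dir_deriv_nilpotent[OF assms(2)]) blast
  have l: "(dir_deriv a ^^ j) (\<lambda>x. f x + c * g x) = (\<lambda>x. (dir_deriv a ^^ j) f x + c * (dir_deriv a ^^ j) g x)" for j
    using dir_deriv_power_sum[where I = UNIV and f = "\<lambda>b. if b then f else g" and a = a and k = j and c = "\<lambda>b. if b then 1 else c"] assms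
    by (simp add: UNIV_bool add.commute)
  have 1: "fps_dir S a f x = (\<Sum>k<max N M. fps_nth S k * (dir_deriv a ^^ k) f x)" by (rule fps_dir_eq_sum) (simp add: N)
  have 2: "fps_dir S a g x = (\<Sum>k<max N M. fps_nth S k * (dir_deriv a ^^ k) g x)" by (rule fps_dir_eq_sum) (simp add: M)
  have "fps_dir S a (\<lambda>x. f x + c * g x) x = (\<Sum>k<max N M. fps_nth S k * (dir_deriv a ^^ k) (\<lambda>x. f x + c * g x) x)"
    by (rule fps_dir_eq_sum) (simp add: l N M)
  then show ?thesis unfolding 1 2 l by (simp add: sum_distrib_left ring_distribs sum.distrib mult_ac)
qed

text \<open>Taylor's formula, exact on polynomials: \<open>exp (- D)\<close> is a translation. It
  links the series in \<open>Q_hat\<close> with finite differences.\<close>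

lemma fps_dir_exp:
  assumes "polynomial_function g"
  shows "fps_dir (fps_exp (- 1)) a g x = g (x - a)"
proof -
  obtain N where N: "\<And>j. j \<ge> N \<Longrightarrow> (dir_deriv a ^^ j) g = (\<lambda>x. 0)" by (rule dir_deriv_nilpotent[OF assms]) blast
  have "g (x + (- 1) *\<^sub>R a) = fps_dir (fps_exp (- 1)) a g x"
    by (subst polynomial_taylor[OF assms N]) (simp_all add: fps_dir_eq_sum[OF N])
  then show ?thesis by simp
qed

lemma fps_dir_difference:
  assumes "polynomial_function g"
  shows "fps_dir (1 - fps_const c * fps_exp (- 1)) a g x = g x - c * g (x - a)"
  using fps_dir_lincomb[OF assms, of 1 "- c" "fps_exp (- 1)" a x]
  by (simp add: fps_dir_1 fps_dir_exp[OF assms] flip: fps_const_neg)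

text \<open>The commutation rule of the Weyl algebra: \<open>S(D)\<close> and multiplication by
  \<open>l\<close> commute up to \<open>l a\<close> times the derivative of the series, because this
  holds for each power of \<open>D\<close>.\<close>

lemma fps_dir_linear_mult:
  fixes g :: "'a::real_normed_vector \<Rightarrow> complex"
  assumes "polynomial_function g" and "bounded_linear l"
  shows "fps_dir S a (\<lambda>x. complex_of_real (l x) * g x) x =
     of_real (l x) * fps_dir S a g x + of_real (l a) * fps_dir (fps_deriv S) a g x"
proof -
  interpret bounded_linear l by fact
  have pl: "polynomial_function (\<lambda>x. complex_of_real (l x))"
    using assms(2) by (intro polynomial_function_of_real) auto
  have dl: "dir_deriv a (\<lambda>x. complex_of_real (l x)) x = of_real (l a)" for x
    unfolding dir_deriv_def add scaleR
    by (rule vector_derivative_at)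
      (auto intro!: derivative_eq_intros simp: has_vector_derivative_def scaleR_conv_of_real)
  have k: "(dir_deriv a ^^ k) (\<lambda>x. of_real (l x) * g x) =
     (\<lambda>x. of_real (l x) * (dir_deriv a ^^ k) g x + (of_nat k * of_real (l a)) * (dir_deriv a ^^ (k - 1)) g x)" for k
  proof (induction k)
    case (Suc k)
    have "(dir_deriv a ^^ Suc k) (\<lambda>x. of_real (l x) * g x) x = of_real (l x) * (dir_deriv a ^^ Suc k) g x
       + of_real (l a) * (dir_deriv a ^^ k) g x + (of_nat k * of_real (l a)) * dir_deriv a ((dir_deriv a ^^ (k - 1)) g) x" for x
      using assms(1) pl
      by (simp add: Suc dir_deriv_add dir_deriv_mult dl dir_deriv_cmult polynomial_function_complex_mult
          polynomial_dir_deriv_power polynomial_function_cmult)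
    then show ?case by (cases k) (auto simp: fun_eq_iff algebra_simps)
  qed simp
  obtain N where N: "\<And>j. j \<ge> N \<Longrightarrow> (dir_deriv a ^^ j) g = (\<lambda>x. 0)" by (rule dir_deriv_nilpotent[OF assms(1)]) blast
  have "fps_dir S a (\<lambda>x. of_real (l x) * g x) x =
      (\<Sum>k<Suc N. fps_nth S k * (dir_deriv a ^^ k) (\<lambda>x. of_real (l x) * g x) x)"
    by (rule fps_dir_eq_sum) (simp add: k N)
  also have "\<dots> = of_real (l x) * (\<Sum>k<Suc N. fps_nth S k * (dir_deriv a ^^ k) g x)
      + of_real (l a) * (\<Sum>k<Suc N. of_nat k * fps_nth S k * (dir_deriv a ^^ (k - 1)) g x)"
    unfolding k by (simp add: sum_distrib_left ring_distribs sum.distrib mult_ac)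
  also have "(\<Sum>k<Suc N. fps_nth S k * (dir_deriv a ^^ k) g x) = fps_dir S a g x"
    by (rule fps_dir_eq_sum[symmetric]) (simp add: N)
  also have "(\<Sum>k<Suc N. of_nat k * fps_nth S k * (dir_deriv a ^^ (k - 1)) g x) =
      (\<Sum>k<N. fps_nth (fps_deriv S) k * (dir_deriv a ^^ k) g x)"
    by (subst sum.lessThan_Suc_shift) simp
  also have "\<dots> = fps_dir (fps_deriv S) a g x" by (rule fps_dir_eq_sum[symmetric]) (rule N)
  finally show ?thesis .
qed

section \<open>Iterated integration along rays\<close>

text \<open>The set \<open>D\<close> is needed because the operators in question commute only on
  measurable functions, respectively on polynomials.\<close>

lemma foldr_permute_on:
  assumes "mset xs = mset ys" and "y \<in> D" and "\<And>a y. y \<in> D \<Longrightarrow> f a y \<in> D"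
    and "\<And>a b y. y \<in> D \<Longrightarrow> f a (f b y) = f b (f a y)"
  shows "foldr f xs y = foldr f ys y"
  using assms(1)
proof (induction xs arbitrary: ys)
  case Nil
  then show ?case by simp
next
  case (Cons a xs)
  have "a \<in> set ys" using Cons.prems by (metis list.set_intros(1) set_mset_mset)
  then obtain l r where ys: "ys = l @ a # r" by (meson split_list)
  have D: "foldr f zs y \<in> D" for zs by (induction zs) (auto intro: assms)
  have "foldr f (l @ a # r) y = f a (foldr f (l @ r) y)"
  proof (induction l)
    case (Cons b l)
    then show ?case using D[of "l @ r"] by (simp add: assms(4))
  qed simp
  moreover have "mset xs = mset (l @ r)" using Cons.prems ys by simp
  ultimately show ?case using Cons.IH[of "l @ r"] ys by simp
qed

text \<open>Valued in \<open>ennreal\<close>, so that exchanging integrals requires measurability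
  only. The iterate \<open>rays Y f z\<close> integrates \<open>f\<close> over all points
  \<open>z\<close> plus a nonnegative combination of \<open>Y\<close>, counted by the coefficients;
  its density at \<open>z = 0\<close> is the spline with zero parameters, up to the normalization of
  the volume.\<close>

definition ray :: "'v::euclidean_space \<Rightarrow> ('v \<Rightarrow> ennreal) \<Rightarrow> 'v \<Rightarrow> ennreal" where
  "ray a f z = (\<integral>\<^sup>+t. f (z + t *\<^sub>R a) * indicator {0..} t \<partial>lborel)"

definition rays :: "'v::euclidean_space list \<Rightarrow> ('v \<Rightarrow> ennreal) \<Rightarrow> 'v \<Rightarrow> ennreal" where
  "rays Y f = foldr ray Y f"

lemma rays_Nil [simp]: "rays [] f = f" and rays_Cons: "rays (a # Y) f = ray a (rays Y f)"
  and rays_append: "rays (Y @ Z) f = rays Y (rays Z f)"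
  by (simp_all add: rays_def)

lemma borel_measurable_ray_param:
  assumes [measurable]: "case_prod g \<in> borel_measurable (N \<Otimes>\<^sub>M borel)"
  shows "(\<lambda>(y, z). ray a (g y) z) \<in> borel_measurable (N \<Otimes>\<^sub>M borel)"
  unfolding ray_def by measurable

lemma borel_measurable_rays_param:
  assumes "case_prod g \<in> borel_measurable (N \<Otimes>\<^sub>M borel)"
  shows "(\<lambda>(y, z). rays Y (g y) z) \<in> borel_measurable (N \<Otimes>\<^sub>M borel)"
proof (induction Y)
  case (Cons a Y)
  then show ?case unfolding rays_Cons by (intro borel_measurable_ray_param) simp
qed (use assms in simp)

lemma borel_measurable_ray [measurable]:
  assumes [measurable]: "f \<in> borel_measurable borel" shows "ray a f \<in> borel_measurable borel"
  unfolding ray_def by measurable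

lemma borel_measurable_rays [measurable]:
  "f \<in> borel_measurable borel \<Longrightarrow> rays Y f \<in> borel_measurable borel"
  by (induction Y) (simp_all add: rays_Cons)

lemma ray_commute:
  assumes [measurable]: "f \<in> borel_measurable borel"
  shows "ray a (ray b f) = ray b (ray a f)"
proof
  fix z
  let ?h = "\<lambda>t s. f (z + t *\<^sub>R a + s *\<^sub>R b) * indicator {0..} s * indicator {0..} t"
  have "ray a (ray b f) z = (\<integral>\<^sup>+t. \<integral>\<^sup>+s. ?h t s \<partial>lborel \<partial>lborel)"
    unfolding ray_def by (intro nn_integral_cong nn_integral_multc[symmetric]) measurable
  also have "\<dots> = (\<integral>\<^sup>+s. \<integral>\<^sup>+t. ?h t s \<partial>lborel \<partial>lborel)"
    by (rule lborel_pair.Fubini'[symmetric]) measurable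
  also have "\<dots> = (\<integral>\<^sup>+s. \<integral>\<^sup>+t. f (z + s *\<^sub>R b + t *\<^sub>R a) * indicator {0..} t * indicator {0..} s \<partial>lborel \<partial>lborel)"
    by (intro nn_integral_cong) (simp add: algebra_simps)
  also have "\<dots> = ray b (ray a f) z"
    unfolding ray_def by (intro nn_integral_cong nn_integral_multc) measurable
  finally show "ray a (ray b f) z = ray b (ray a f) z" .
qed

lemma rays_permute:
  assumes "f \<in> borel_measurable borel" "mset Y = mset Z" shows "rays Y f = rays Z f"
  unfolding rays_def
  by (rule foldr_permute_on[where D = "borel_measurable borel"]) (use assms ray_commute in auto)

lemma rays_shift: "rays Y (\<lambda>x. f (x + w)) z = rays Y f (z + w)"
proof (induction Y arbitrary: z)
  case (Cons a Y)
  then show ?case by (simp add: rays_Cons ray_def algebra_simps)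
qed simp

lemma rays_mono: "(\<And>x. f x \<le> g x) \<Longrightarrow> rays Y f z \<le> rays Y g z"
proof (induction Y arbitrary: z)
  case (Cons a Y)
  then show ?case by (auto simp: rays_Cons ray_def intro!: nn_integral_mono mult_right_mono)
qed simp

lemma rays_cmult:
  assumes [measurable]: "f \<in> borel_measurable borel"
  shows "rays Y (\<lambda>x. c * f x) z = c * rays Y f z"
proof (induction Y arbitrary: z)
  case (Cons a Y)
  then show ?case
    by (simp add: rays_Cons ray_def mult.assoc nn_integral_cmult)
qed simp

lemma rays_nn_integral:
  assumes "sigma_finite_measure N" and m: "case_prod g \<in> borel_measurable (N \<Otimes>\<^sub>M borel)"
  shows "rays Y (\<lambda>x. \<integral>\<^sup>+y. g y x \<partial>N) z = (\<integral>\<^sup>+y. rays Y (g y) z \<partial>N)"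
proof (induction Y arbitrary: z)
  case (Cons a Y)
  interpret sigma_finite_measure N by fact
  interpret pair_sigma_finite N "lborel :: real measure" ..
  note [measurable] = borel_measurable_rays_param[OF m, of Y]
  have [measurable]: "(\<lambda>x. rays Y (g (fst x)) (z + snd x *\<^sub>R a)) \<in> borel_measurable (N \<Otimes>\<^sub>M borel)"
  proof -
    have "(\<lambda>x. (\<lambda>(y, z). rays Y (g y) z) (fst x, z + snd x *\<^sub>R a)) \<in> borel_measurable (N \<Otimes>\<^sub>M borel)"
      by measurable
    then show ?thesis by simp
  qed
  have [measurable]: "(\<lambda>y. rays Y (g y) x) \<in> borel_measurable N" for x
  proof -
    have "(\<lambda>y. (\<lambda>(y, z). rays Y (g y) z) (y, x)) \<in> borel_measurable N" by measurable
    then show ?thesis by simp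
  qed
  have "rays (a # Y) (\<lambda>x. \<integral>\<^sup>+y. g y x \<partial>N) z
      = (\<integral>\<^sup>+t. (\<integral>\<^sup>+y. rays Y (g y) (z + t *\<^sub>R a) * indicator {0..} t \<partial>N) \<partial>lborel)"
    by (simp add: rays_Cons ray_def Cons nn_integral_multc)
  also have "\<dots> = (\<integral>\<^sup>+y. (\<integral>\<^sup>+t. rays Y (g y) (z + t *\<^sub>R a) * indicator {0..} t \<partial>lborel) \<partial>N)"
    by (rule Fubini') (simp add: case_prod_beta)
  finally show ?case by (simp add: rays_Cons ray_def)
qed simp

section \<open>Finitely generated cones and finiteness of ray integrals\<close>

lemma cone_of_0 [simp]: "0 \<in> cone_of A"
  unfolding cone_of_def by (rule CollectI, rule exI[of _ "\<lambda>_. 0"]) simp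

lemma cone_of_add:
  assumes "x \<in> cone_of A" "y \<in> cone_of A" shows "x + y \<in> cone_of A"
proof -
  obtain s t where "x = (\<Sum>a\<in>A. s a *\<^sub>R a)" "\<forall>a\<in>A. 0 \<le> s a" "y = (\<Sum>a\<in>A. t a *\<^sub>R a)" "\<forall>a\<in>A. 0 \<le> t a"
    using assms unfolding cone_of_def by blast
  then have "x + y = (\<Sum>a\<in>A. (s a + t a) *\<^sub>R a)" "\<forall>a\<in>A. 0 \<le> s a + t a"
    by (simp_all add: scaleR_add_left sum.distrib)
  then show ?thesis unfolding cone_of_def by (intro CollectI exI conjI)
qed

lemma cone_of_scaleR:
  assumes "x \<in> cone_of A" "0 \<le> c" shows "c *\<^sub>R x \<in> cone_of A"
proof -
  obtain t where "x = (\<Sum>a\<in>A. t a *\<^sub>R a)" "\<forall>a\<in>A. 0 \<le> t a"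
    using assms unfolding cone_of_def by blast
  then have "c *\<^sub>R x = (\<Sum>a\<in>A. (c * t a) *\<^sub>R a)" "\<forall>a\<in>A. 0 \<le> c * t a"
    using assms(2) by (simp_all add: scaleR_sum_right)
  then show ?thesis unfolding cone_of_def by (intro CollectI exI conjI)
qed

lemma cone_of_superset: "\<lbrakk>finite A; a \<in> A\<rbrakk> \<Longrightarrow> a \<in> cone_of A"
  unfolding cone_of_def
  by (rule CollectI, rule exI[of _ "\<lambda>b. if b = a then 1 else 0"]) (auto simp: if_distrib[of "\<lambda>c. c *\<^sub>R _"] cong: if_cong)

lemma cone_of_least:
  assumes "x \<in> cone_of A" "0 \<in> S" and "\<And>a. a \<in> A \<Longrightarrow> a \<in> S"
    and "\<And>x y. \<lbrakk>x \<in> S; y \<in> S\<rbrakk> \<Longrightarrow> x + y \<in> S" and "\<And>x c. \<lbrakk>x \<in> S; (0::real) \<le> c\<rbrakk> \<Longrightarrow> c *\<^sub>R x \<in> S"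
  shows "x \<in> S"
proof -
  obtain t where t: "x = (\<Sum>a\<in>A. t a *\<^sub>R a)" "\<forall>a\<in>A. 0 \<le> t a" using assms(1) unfolding cone_of_def by blast
  have "(\<Sum>a\<in>A. t a *\<^sub>R a) \<in> S" using t(2) assms(3)
  proof (induction A rule: infinite_finite_induct)
    case (insert a A)
    then show ?case by (simp add: assms(4) assms(5))
  qed (use assms(2) in auto)
  with t show ?thesis by simp
qed

lemma cone_of_mono: "\<lbrakk>A \<subseteq> B; finite B\<rbrakk> \<Longrightarrow> cone_of A \<subseteq> cone_of B"
  by (rule subsetI, erule cone_of_least) (auto intro: cone_of_add cone_of_scaleR cone_of_superset)

lemma closed_cone_of:
  fixes A :: "'v::euclidean_space set"
  assumes "finite A" shows "closed (cone_of A)"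
proof -
  have "cone_of A = convex_cone hull A"
  proof
    have "convex_cone (convex_cone hull A)" by (rule convex_cone_convex_cone_hull)
    then show "cone_of A \<subseteq> convex_cone hull A"
      by (intro subsetI, erule_tac cone_of_least) (auto simp: convex_cone_hull_contains_0 hull_inc convex_cone_hull_add convex_cone_hull_mul)
    have "convex_cone (cone_of A)"
      unfolding convex_cone_iff using cone_of_0[of A] cone_of_add[of _ A] cone_of_scaleR[of _ A] by auto
    then show "convex_cone hull A \<subseteq> cone_of A"
      by (intro hull_minimal) (use assms cone_of_superset in blast)
  qed
  with polyhedron_convex_cone_hull[OF assms] polyhedron_imp_closed show ?thesis by metis
qed

lemma rays_eq_0:
  assumes "\<And>x. x \<in> cone_of (set Y) \<Longrightarrow> f (z + x) = 0" shows "rays Y f z = 0"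
  using assms
proof (induction Y arbitrary: z)
  case Nil
  then show ?case using Nil[of 0] by simp
next
  case (Cons a Y)
  have "rays Y f (z + t *\<^sub>R a) = 0" if "t \<ge> 0" for t
  proof (rule Cons.IH)
    fix x assume "x \<in> cone_of (set Y)"
    then have "t *\<^sub>R a + x \<in> cone_of (set (a # Y))"
      using that cone_of_mono[of "set Y" "set (a # Y)"]
      by (intro cone_of_add cone_of_scaleR) (auto intro: cone_of_superset)
    from Cons.prems[OF this] show "f (z + t *\<^sub>R a + x) = 0" by (simp add: add.assoc)
  qed
  then have "(\<lambda>t. rays Y f (z + t *\<^sub>R a) * indicator {0..} t) = (\<lambda>_. 0)"
    by (intro ext) (auto simp: indicator_def)
  then show ?case by (simp add: rays_Cons ray_def)
qed

text \<open>Exponentials are eigenfunctions of \<open>ray a\<close>, with eigenvalue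
  \<open>1 / (w \<bullet> a)\<close>.\<close>

lemma rays_exp:
  assumes "\<And>a. a \<in> set Y \<Longrightarrow> 0 < w \<bullet> a"
  shows "\<exists>K\<ge>0. rays Y (\<lambda>x. ennreal (exp (- (w \<bullet> x)))) = (\<lambda>z. ennreal (K * exp (- (w \<bullet> z))))"
  using assms
proof (induction Y)
  case Nil
  then show ?case by (intro exI[of _ 1]) auto
next
  case (Cons a Y)
  then obtain K where K: "K \<ge> 0" "rays Y (\<lambda>x. ennreal (exp (- (w \<bullet> x)))) = (\<lambda>z. ennreal (K * exp (- (w \<bullet> z))))"
    by auto
  have c: "0 < w \<bullet> a" using Cons.prems by simp
  have "rays (a # Y) (\<lambda>x. ennreal (exp (- (w \<bullet> x)))) z = ennreal (K / (w \<bullet> a) * exp (- (w \<bullet> z)))" for z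
  proof -
    let ?F = "\<lambda>t. - (K / (w \<bullet> a)) * exp (- (w \<bullet> (z + t *\<^sub>R a)))"
    have "LIM t at_top. t * (w \<bullet> a) + w \<bullet> z :> at_top"
      using filterlim_tendsto_add_at_top[OF tendsto_const filterlim_at_top_mult_tendsto_pos[OF tendsto_const c filterlim_ident], of "w \<bullet> z"]
      by (simp add: add.commute)
    then have "LIM t at_top. - (w \<bullet> (z + t *\<^sub>R a)) :> at_bot"
      by (simp add: filterlim_uminus_at_top inner_add_right add.commute)
    then have "((\<lambda>t. exp (- (w \<bullet> (z + t *\<^sub>R a)))) \<longlongrightarrow> 0) at_top"
      by (rule filterlim_compose[OF exp_at_bot])
    then have lim: "(?F \<longlongrightarrow> - (K / (w \<bullet> a)) * 0) at_top" by (intro tendsto_intros)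
    have "rays (a # Y) (\<lambda>x. ennreal (exp (- (w \<bullet> x)))) z =
        (\<integral>\<^sup>+t. ennreal (K * exp (- (w \<bullet> (z + t *\<^sub>R a)))) * indicator {0..} t \<partial>lborel)"
      by (simp add: rays_Cons ray_def K(2))
    also have "\<dots> = ennreal (- (K / (w \<bullet> a)) * 0 - ?F 0)"
    proof (rule nn_integral_FTC_atLeast[OF _ _ _ lim])
      show "((\<lambda>t. ?F t) has_real_derivative K * exp (- (w \<bullet> (z + t *\<^sub>R a)))) (at t)" for t
        unfolding inner_add_right inner_scaleR_right
        using c by (auto intro!: derivative_eq_intros simp: field_simps)
    qed (use K in auto)
    finally show ?thesis by simp
  qed
  moreover have "0 \<le> K / (w \<bullet> a)" using K(1) c by simp
  ultimately show ?case by blast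
qed

text \<open>A bounded function of bounded support lies below a multiple of
  \<open>exp (- (w \<bullet> x))\<close>, which the rays only multiply by a finite constant. This is
  where pointedness of the list guarantees convergence.\<close>

lemma rays_bounded_finite:
  assumes "\<And>a. a \<in> set Y \<Longrightarrow> 0 < w \<bullet> a" and "bounded B" and "\<And>x. f x \<le> ennreal C * indicator B x"
  shows "rays Y f z < \<infinity>"
proof -
  obtain M where M: "\<And>x. x \<in> B \<Longrightarrow> norm x \<le> M" using assms(2) unfolding bounded_iff by blast
  \<comment> \<open>On \<open>B\<close> the exponential is at least
    \<open>exp (- (norm w * M))\<close>; the constant compensates for this.\<close>
  have le: "f x \<le> ennreal (\<bar>C\<bar> * exp (norm w * M)) * ennreal (exp (- (w \<bullet> x)))" for x
  proof (cases "x \<in> B")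
    case True
    have "w \<bullet> x \<le> norm w * M"
      using M[OF True] Cauchy_Schwarz_ineq2[of w x] mult_left_mono[of "norm x" M "norm w"] by simp
    then have "1 \<le> exp (norm w * M) * exp (- (w \<bullet> x))" by (simp flip: exp_add)
    then have "C \<le> \<bar>C\<bar> * exp (norm w * M) * exp (- (w \<bullet> x))"
      using mult_left_mono[of 1 "exp (norm w * M) * exp (- (w \<bullet> x))" "\<bar>C\<bar>"] by (simp add: mult.assoc)
    then have "ennreal C \<le> ennreal (\<bar>C\<bar> * exp (norm w * M) * exp (- (w \<bullet> x)))" by (rule ennreal_leI)
    then have "ennreal C \<le> ennreal (\<bar>C\<bar> * exp (norm w * M)) * ennreal (exp (- (w \<bullet> x)))"
      by (simp add: ennreal_mult'')
    then show ?thesis using assms(3)[of x] True by simp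
  qed (use assms(3)[of x] in simp)
  obtain K where "rays Y (\<lambda>x. ennreal (exp (- (w \<bullet> x)))) = (\<lambda>z. ennreal (K * exp (- (w \<bullet> z))))"
    using rays_exp[OF assms(1)] by blast
  then have "rays Y (\<lambda>x. ennreal (\<bar>C\<bar> * exp (norm w * M)) * ennreal (exp (- (w \<bullet> x)))) z < \<infinity>"
    by (subst rays_cmult) (auto simp: ennreal_mult_less_top)
  with rays_mono[of f, OF le] show ?thesis by (meson le_less_trans)
qed

text \<open>Starting the ray in direction \<open>a\<close> earlier adds exactly one segment. This is
  the integrated form of the rule that the derivative along \<open>a\<close> turns the density of
  \<open>a # Y\<close> into that of \<open>Y\<close>; all regularity below is extracted from
  it.\<close>

lemma rays_increment:
  assumes [measurable]: "f \<in> borel_measurable borel" and "0 \<le> \<tau>"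
  shows "rays (a # Y) f (z - \<tau> *\<^sub>R a) =
    rays (a # Y) f z + (\<integral>\<^sup>+t. rays Y f (z - t *\<^sub>R a) * indicator {0..\<tau>} t \<partial>lborel)"
proof -
  let ?g = "rays Y f"
  have [measurable]: "?g \<in> borel_measurable borel" by measurable
  have "rays (a # Y) f (z - \<tau> *\<^sub>R a) = (\<integral>\<^sup>+t. ?g (z - \<tau> *\<^sub>R a + t *\<^sub>R a) * indicator {0..} t \<partial>lborel)"
    by (simp add: rays_Cons ray_def)
  also have "\<dots> = (\<integral>\<^sup>+t. ?g (z - \<tau> *\<^sub>R a + (\<tau> + 1 * t) *\<^sub>R a) * indicator {0..} (\<tau> + 1 * t) \<partial>lborel)"
    by (subst nn_integral_real_affine[where c = 1 and t = \<tau>]) auto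
  also have "\<dots> = (\<integral>\<^sup>+t. ?g (z + t *\<^sub>R a) * indicator {0..} t + ?g (z + t *\<^sub>R a) * indicator {-\<tau>..<0} t \<partial>lborel)"
    using assms(2) by (intro nn_integral_cong) (auto simp: algebra_simps indicator_def)
  also have "\<dots> = rays (a # Y) f z + (\<integral>\<^sup>+t. ?g (z + t *\<^sub>R a) * indicator {-\<tau>..<0} t \<partial>lborel)"
    by (subst nn_integral_add) (auto simp: rays_Cons ray_def)
  also have "(\<integral>\<^sup>+t. ?g (z + t *\<^sub>R a) * indicator {-\<tau>..<0} t \<partial>lborel) =
      (\<integral>\<^sup>+t. ?g (z + (0 + (-1) * t) *\<^sub>R a) * indicator {-\<tau>..<0} (0 + (-1) * t) \<partial>lborel)"
    by (subst nn_integral_real_affine[where c = "-1" and t = 0]) auto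
  also have "\<dots> = (\<integral>\<^sup>+t. ?g (z - t *\<^sub>R a) * indicator {0..\<tau>} t \<partial>lborel)"
    using AE_lborel_singleton[of "0::real"]
    by (intro nn_integral_cong_AE, eventually_elim) (auto simp: indicator_def)
  finally show ?thesis .
qed

text \<open>The measure by which \<open>is_spline\<close> describes a spline all of whose parameters
  are zero.\<close>

definition ray_measure :: "'v::euclidean_space list \<Rightarrow> 'v measure" where
  "ray_measure Y = distr
     (density (PiM {..<length Y} (\<lambda>_. lborel)) (indicator (PiE {..<length Y} (\<lambda>_. {0..})))) borel
     (\<lambda>t. \<Sum>i<length Y. t i *\<^sub>R Y ! i)"

lemma sets_ray_measure [simp, measurable_cong]: "sets (ray_measure Y) = sets borel"
  by (simp add: ray_measure_def)

lemma nn_integral_ray_measure: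
  assumes [measurable]: "f \<in> borel_measurable borel"
  shows "(\<integral>\<^sup>+x. f x \<partial>ray_measure Y) = rays Y f 0"
proof -
  interpret product_sigma_finite "\<lambda>_::nat. lborel :: real measure" ..
  have [measurable]: "PiE {..<n} (\<lambda>_. {0..}) \<in> sets (PiM {..<n} (\<lambda>_::nat. lborel :: real measure))" for n
    by (intro sets_PiM_I_finite) auto
  have "(\<integral>\<^sup>+t. indicator (PiE {..<length Y} (\<lambda>_. {0..})) t * f (\<Sum>i<length Y. t i *\<^sub>R Y ! i)
      \<partial>PiM {..<length Y} (\<lambda>_. lborel)) = rays Y f 0" if [measurable]: "f \<in> borel_measurable borel" for f
    using that
  \<comment> \<open>A product over an initial segment of indices grows at its last index, so the
    list is built up from its end; the last vector is then the innermost ray.\<close>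
  proof (induction Y arbitrary: f rule: rev_induct)
    case Nil
    then show ?case by (simp add: PiM_empty nn_integral_count_space_finite)
  next
    case (snoc a Y)
    note [measurable] = snoc.prems
    let ?n = "length Y"
    let ?M = "PiM {..<?n} (\<lambda>_. lborel)"
    let ?h = "\<lambda>t. indicator (PiE {..<Suc ?n} (\<lambda>_. {0..})) t * f (\<Sum>i<Suc ?n. t i *\<^sub>R (Y @ [a]) ! i) :: ennreal"
    have [measurable]: "?h \<in> borel_measurable (PiM (insert ?n {..<?n}) (\<lambda>_. lborel))"
      unfolding lessThan_Suc[symmetric] by measurable
    have split: "?h (t(?n := s)) = indicator (PiE {..<?n} (\<lambda>_. {0..})) t *
        (f ((\<Sum>i<?n. t i *\<^sub>R Y ! i) + s *\<^sub>R a) * indicator {0..} s)" if "t \<in> space ?M" for t s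
    proof -
      have "t(?n := s) \<in> PiE {..<Suc ?n} (\<lambda>_. {0..}) \<longleftrightarrow> t \<in> PiE {..<?n} (\<lambda>_. {0..}) \<and> 0 \<le> s"
        using that by (auto simp: space_PiM PiE_iff extensional_def less_Suc_eq)
      moreover have "(\<Sum>i<Suc ?n. (t(?n := s)) i *\<^sub>R (Y @ [a]) ! i) = (\<Sum>i<?n. t i *\<^sub>R Y ! i) + s *\<^sub>R a"
        by (simp add: nth_append)
      ultimately show ?thesis by (simp add: indicator_def)
    qed
    have "(\<integral>\<^sup>+t. ?h t \<partial>PiM {..<Suc ?n} (\<lambda>_. lborel)) = (\<integral>\<^sup>+t. \<integral>\<^sup>+s. ?h (t(?n := s)) \<partial>lborel \<partial>?M)"
      unfolding lessThan_Suc by (rule product_nn_integral_insert) (auto simp flip: lessThan_Suc)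
    also have "\<dots> = (\<integral>\<^sup>+t. indicator (PiE {..<?n} (\<lambda>_. {0..})) t * ray a f (\<Sum>i<?n. t i *\<^sub>R Y ! i) \<partial>?M)"
      unfolding ray_def by (intro nn_integral_cong, simp only: split) (simp add: nn_integral_cmult)
    also have "\<dots> = rays (Y @ [a]) f 0"
      by (subst snoc.IH) (simp_all add: rays_append rays_Cons)
    finally show ?case by simp
  qed
  then show ?thesis
    unfolding ray_measure_def by (subst nn_integral_distr) (auto simp: nn_integral_density)
qed

section \<open>Local polynomial densities\<close>

declare real_polynomial_function.intros [rule del]

text \<open>Separated variables are what makes an integral over one variable a polynomial in the
  other.\<close>

lemma real_polynomial_separable:
  fixes Q :: "'a::real_normed_vector \<times> 'b::real_normed_vector \<Rightarrow> real"
  assumes "real_polynomial_function Q"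
  shows "\<exists>l. (\<forall>p\<in>set l. real_polynomial_function (fst p) \<and> real_polynomial_function (snd p)) \<and>
           (\<forall>x y. Q (x, y) = (\<Sum>p\<leftarrow>l. fst p x * snd p y))"
  using assms
proof (induction Q rule: real_polynomial_function.induct)
  case (linear f)
  then have bl: "bounded_linear f" .
  have "bounded_linear (\<lambda>x::'a. (x, 0::'b))" "bounded_linear (\<lambda>y::'b. (0::'a, y))"
    by (auto intro!: bounded_linear_Pair bounded_linear_ident bounded_linear_zero)
  then have rp: "real_polynomial_function (\<lambda>x. f (x, 0))" "real_polynomial_function (\<lambda>y. f (0, y))"
    using bounded_linear_compose[OF bl, of "\<lambda>x. (x, 0)"] bounded_linear_compose[OF bl, of "\<lambda>y. (0, y)"]
    by (simp_all add: real_polynomial_function.intros(1))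
  let ?l = "[(\<lambda>x. f (x, 0), \<lambda>_. 1), (\<lambda>_. 1, \<lambda>y. f (0, y))]"
  have "\<forall>p\<in>set ?l. real_polynomial_function (fst p) \<and> real_polynomial_function (snd p)"
    using rp by (simp add: real_polynomial_function.intros(2))
  moreover have "f (x, y) = (\<Sum>p\<leftarrow>?l. fst p x * snd p y)" for x y
    using linear_add[OF bounded_linear.linear[OF bl], of "(x, 0)" "(0, y)"] by simp
  ultimately show ?case by blast
next
  case (const c)
  show ?case
    by (intro exI[of _ "[(\<lambda>x. c, \<lambda>_. 1)]"]) (auto intro: real_polynomial_function.intros(2))
next
  case (add f g)
  then obtain l m where
    "\<forall>p\<in>set l. real_polynomial_function (fst p) \<and> real_polynomial_function (snd p)"
    "\<forall>x y. f (x, y) = (\<Sum>p\<leftarrow>l. fst p x * snd p y)"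
    "\<forall>p\<in>set m. real_polynomial_function (fst p) \<and> real_polynomial_function (snd p)"
    "\<forall>x y. g (x, y) = (\<Sum>p\<leftarrow>m. fst p x * snd p y)" by blast
  then show ?case by (intro exI[of _ "l @ m"]) auto
next
  case (mult f g)
  then obtain l m where
    l: "\<forall>p\<in>set l. real_polynomial_function (fst p) \<and> real_polynomial_function (snd p)"
    "\<forall>x y. f (x, y) = (\<Sum>p\<leftarrow>l. fst p x * snd p y)" and
    m: "\<forall>p\<in>set m. real_polynomial_function (fst p) \<and> real_polynomial_function (snd p)"
    "\<forall>x y. g (x, y) = (\<Sum>p\<leftarrow>m. fst p x * snd p y)" by blast
  let ?prod = "\<lambda>p q. (\<lambda>x. fst p x * fst q x, \<lambda>y. snd p y * snd q y)"
  let ?k = "concat (map (\<lambda>p. map (?prod p) m) l)"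
  have "(\<Sum>p\<leftarrow>concat (map (\<lambda>p. map (?prod p) m) l). fst p x * snd p y) =
      (\<Sum>p\<leftarrow>l. fst p x * snd p y) * (\<Sum>p\<leftarrow>m. fst p x * snd p y)" for l x y
    by (induction l)
      (simp_all add: o_def ring_distribs sum_list_const_mult[symmetric] mult_ac)
  then have "\<forall>x y. f (x, y) * g (x, y) = (\<Sum>p\<leftarrow>?k. fst p x * snd p y)" using l(2) m(2) by simp
  moreover have "\<forall>p\<in>set ?k. real_polynomial_function (fst p) \<and> real_polynomial_function (snd p)"
    using l(1) m(1) by (auto intro: real_polynomial_function.intros(4))
  ultimately show ?case by blast
qed

lemma continuous_on_real_polynomial:
  "real_polynomial_function (g :: 'a::euclidean_space \<Rightarrow> real) \<Longrightarrow> continuous_on S g"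
  by (simp add: real_polynomial_function_eq continuous_on_polymonial_function)

lemma borel_measurable_real_polynomial:
  "real_polynomial_function (g :: 'a::euclidean_space \<Rightarrow> real) \<Longrightarrow> g \<in> borel_measurable borel"
  by (intro borel_measurable_continuous_onI continuous_on_real_polynomial)

lemma real_polynomial_compose:
  "\<lbrakk>real_polynomial_function g; polynomial_function f\<rbrakk> \<Longrightarrow> real_polynomial_function (\<lambda>x. g (f x))"
  using real_polynomial_function_compose[of f g] by (simp add: o_def)

lemma real_polynomial_sum_list:
  "(\<And>p. p \<in> set l \<Longrightarrow> real_polynomial_function (f p)) \<Longrightarrow> real_polynomial_function (\<lambda>x. \<Sum>p\<leftarrow>l. f p x)"
proof (induction l)
  case Nil
  show ?case unfolding list.map sum_list.Nil by (rule real_polynomial_function.intros(2))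
next
  case (Cons p l)
  have 1: "real_polynomial_function (f p)" by (rule Cons.prems) simp
  have "real_polynomial_function (\<lambda>x. \<Sum>p\<leftarrow>l. f p x)" by (rule Cons.IH, rule Cons.prems) simp
  with 1 have "real_polynomial_function (\<lambda>x. f p x + (\<Sum>p\<leftarrow>l. f p x))" by (rule real_polynomial_function.intros(3))
  then show ?case by simp
qed

lemma integrable_real_polynomial:
  fixes g :: "'a::euclidean_space \<Rightarrow> real"
  assumes "real_polynomial_function g" "bounded K" "K \<in> sets borel"
  shows "integrable lborel (\<lambda>x. indicator K x * g x)"
proof -
  obtain r where r: "K \<subseteq> cball 0 r"
    using assms(2) unfolding bounded_iff by (auto simp: subset_iff)
  have "integrable lborel (\<lambda>x. indicator (cball 0 r) x *\<^sub>R g x)"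
    by (intro borel_integrable_compact continuous_on_real_polynomial assms) simp
  from integrable_mult_indicator[OF _ this, of K] assms(3)
  have "integrable lborel (\<lambda>x. indicator K x *\<^sub>R indicator (cball 0 r) x *\<^sub>R g x)" by simp
  moreover have "(\<lambda>x. indicator K x *\<^sub>R indicator (cball 0 r) x *\<^sub>R g x) = (\<lambda>x. indicator K x * g x)"
    using r by (auto simp: indicator_def fun_eq_iff)
  ultimately show ?thesis by simp
qed

lemma polynomial_parameter_integral:
  fixes Q :: "'a::real_normed_vector \<times> 'b::euclidean_space \<Rightarrow> real"
  assumes "real_polynomial_function Q" "bounded K" "K \<in> sets borel"
  obtains p where "real_polynomial_function p"
    "\<And>y. (\<And>x. x \<in> K \<Longrightarrow> 0 \<le> Q (y, x)) \<Longrightarrow>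
       0 \<le> p y \<and> (\<integral>\<^sup>+x. ennreal (Q (y, x)) * indicator K x \<partial>lborel) = ennreal (p y)"
proof -
  obtain l where l: "\<And>p. p \<in> set l \<Longrightarrow> real_polynomial_function (fst p) \<and> real_polynomial_function (snd p)"
    "\<And>x y. Q (x, y) = (\<Sum>p\<leftarrow>l. fst p x * snd p y)"
    using real_polynomial_separable[OF assms(1)] by blast
  let ?p = "\<lambda>y. \<Sum>p\<leftarrow>l. fst p y * (\<integral>x. indicator K x * snd p x \<partial>lborel)"
  have 1: "real_polynomial_function ?p"
    by (intro real_polynomial_sum_list real_polynomial_function.intros(4) real_polynomial_function.intros(2)) (use l(1) in blast)
  have int: "integrable lborel (\<lambda>x. indicator K x * (\<Sum>p\<leftarrow>m. fst p y * snd p x)) \<and>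
      (\<integral>x. indicator K x * (\<Sum>p\<leftarrow>m. fst p y * snd p x) \<partial>lborel) =
      (\<Sum>p\<leftarrow>m. fst p y * (\<integral>x. indicator K x * snd p x \<partial>lborel))" if "set m \<subseteq> set l" for m y
    using that
  proof (induction m)
    case (Cons p m)
    have i: "integrable lborel (\<lambda>x. indicator K x * snd p x)"
      using Cons.prems l(1) assms by (intro integrable_real_polynomial) auto
    have "(\<lambda>x. indicator K x * (\<Sum>p\<leftarrow>p # m. fst p y * snd p x)) =
       (\<lambda>x. fst p y * (indicator K x * snd p x) + indicator K x * (\<Sum>p\<leftarrow>m. fst p y * snd p x))"
      by (auto simp: algebra_simps)
    then show ?case using Cons i by simp
  qed simp
  have 2: "0 \<le> ?p y \<and> (\<integral>\<^sup>+x. ennreal (Q (y, x)) * indicator K x \<partial>lborel) = ennreal (?p y)"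
    if "\<And>x. x \<in> K \<Longrightarrow> 0 \<le> Q (y, x)" for y
  proof -
    have nn: "0 \<le> indicator K x * Q (y, x)" for x using that by (auto simp: indicator_def)
    have "(\<integral>\<^sup>+x. ennreal (Q (y, x)) * indicator K x \<partial>lborel) = (\<integral>\<^sup>+x. ennreal (indicator K x * Q (y, x)) \<partial>lborel)"
      by (intro nn_integral_cong) (auto simp: indicator_def)
    also have "\<dots> = ennreal (\<integral>x. indicator K x * Q (y, x) \<partial>lborel)"
      using int[of l y] nn unfolding l(2) by (intro nn_integral_eq_integral) auto
    finally have "(\<integral>\<^sup>+x. ennreal (Q (y, x)) * indicator K x \<partial>lborel) = ennreal (\<integral>x. indicator K x * Q (y, x) \<partial>lborel)" .
    moreover have "0 \<le> (\<integral>x. indicator K x * Q (y, x) \<partial>lborel)" using nn by (simp add: integral_nonneg_AE)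
    ultimately show ?thesis using int[of l y] unfolding l(2) by simp
  qed
  from that[OF 1 2] show ?thesis .
qed

text \<open>On the segment from \<open>u\<close> to \<open>x\<close> the polynomial has infinitely
  many zeros, hence vanishes up to \<open>x\<close>.\<close>

lemma real_polynomial_eq_0:
  fixes g :: "'a::real_normed_vector \<Rightarrow> real"
  assumes "real_polynomial_function g" "0 < e" and z: "\<And>x. x \<in> ball u e \<Longrightarrow> g x = 0"
  shows "g x = 0"
proof -
  obtain n c where c: "\<And>y t. g (y + t *\<^sub>R (x - u)) = (\<Sum>k\<le>n. c k y * t ^ k)"
    using real_polynomial_expansion[OF assms(1), of "x - u"] by blast
  define d where "d = e / (1 + norm (x - u))"
  have d: "d > 0" using assms(2) by (simp add: d_def add_pos_nonneg)
  have "g (u + t *\<^sub>R (x - u)) = 0" if "t \<in> {0..<d}" for t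
  proof (rule z)
    have "norm (t *\<^sub>R (x - u)) \<le> t * (1 + norm (x - u))" using that by (simp add: distrib_left)
    also have "\<dots> < d * (1 + norm (x - u))" using that by (intro mult_strict_right_mono) (auto simp: add_pos_nonneg)
    also have "\<dots> = e" by (simp add: d_def add_pos_nonneg less_imp_neq[THEN not_sym])
    finally show "u + t *\<^sub>R (x - u) \<in> ball u e" by (simp add: dist_norm)
  qed
  then have "{0..<d} \<subseteq> {t. (\<Sum>k\<le>n. c k u * t ^ k) = 0}" by (auto simp: c)
  then have "infinite {t. (\<Sum>k\<le>n. c k u * t ^ k) = 0}"
    using d infinite_Ico[of 0 d] finite_subset by blast
  then have "\<forall>k\<le>n. c k u = 0" using polyfun_finite_roots[of "\<lambda>k. c k u" n] by auto
  then have "g (u + 1 *\<^sub>R (x - u)) = 0" unfolding c by simp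
  then show ?thesis by simp
qed

lemma nn_integral_lborel_shift:
  fixes f :: "'a::euclidean_space \<Rightarrow> ennreal"
  assumes [measurable]: "f \<in> borel_measurable borel"
  shows "(\<integral>\<^sup>+x. f (x + w) \<partial>lborel) = (\<integral>\<^sup>+x. f x \<partial>lborel)"
proof -
  have "(\<integral>\<^sup>+x. f x \<partial>lborel) = (\<integral>\<^sup>+x. f x \<partial>distr lborel borel ((+) w))" by (simp add: lborel_distr_plus)
  also have "\<dots> = (\<integral>\<^sup>+x. f (w + x) \<partial>lborel)" by (rule nn_integral_distr) auto
  finally show ?thesis by (simp add: add.commute)
qed

lemma nn_integral_lborel_reflect:
  fixes f :: "'a::euclidean_space \<Rightarrow> ennreal"
  assumes [measurable]: "f \<in> borel_measurable borel"
  shows "(\<integral>\<^sup>+x. f (w - x) \<partial>lborel) = (\<integral>\<^sup>+x. f x \<partial>lborel)"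
proof -
  have "(\<integral>\<^sup>+x. f x \<partial>lborel) = (\<integral>\<^sup>+x. f x \<partial>distr lborel borel (\<lambda>x. w + (-1) *\<^sub>R x))"
    by (subst lborel_affine[of "-1" w]) (simp_all add: density_1)
  also have "\<dots> = (\<integral>\<^sup>+x. f (w - x) \<partial>lborel)" by (subst nn_integral_distr) auto
  finally show ?thesis by simp
qed

text \<open>Used instead of \<open>regular_points\<close> because off these cones the spline is
  locally polynomial also outside \<open>cone_of (set Y)\<close>, where it is zero; the inductions
  then need no case distinction on the position of \<open>u\<close>.\<close>

definition singular_points :: "'v::real_vector list \<Rightarrow> 'v set" where
  "singular_points Y = (\<Union>A\<in>{A. A \<subseteq> set Y \<and> span A \<noteq> UNIV}. cone_of A)"

lemma singular_points_mono: "set Y \<subseteq> set Z \<Longrightarrow> singular_points Y \<subseteq> singular_points Z"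
  unfolding singular_points_def by blast

lemma closed_singular_points: "closed (singular_points (Y :: 'v::euclidean_space list))"
  unfolding singular_points_def
  using finite_subset[OF _ finite_set[of Y]] by (intro closed_UN) (auto intro!: closed_cone_of)

text \<open>Locality is expressed by test functions vanishing off the ball. Nonnegativity is
  demanded on the ball only: elsewhere the polynomial may take either sign, and
  \<open>ennreal\<close> would truncate it.\<close>

definition density_near :: "'v::euclidean_space list \<Rightarrow> 'v \<Rightarrow> ('v \<Rightarrow> real) \<Rightarrow> real \<Rightarrow> bool" where
  "density_near Y u q e \<longleftrightarrow> real_polynomial_function q \<and> 0 < e \<and> (\<forall>x\<in>ball u e. 0 \<le> q x) \<and>
     (\<forall>f\<in>borel_measurable borel. (\<forall>x. x \<notin> ball u e \<longrightarrow> f x = 0) \<longrightarrow>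
        rays Y f 0 = (\<integral>\<^sup>+x. f x * ennreal (q x) \<partial>lborel))"

lemma density_nearD:
  assumes "density_near Y u q e"
  shows "real_polynomial_function q" "0 < e" "\<And>x. x \<in> ball u e \<Longrightarrow> 0 \<le> q x"
    "\<And>f. \<lbrakk>f \<in> borel_measurable borel; \<And>x. x \<notin> ball u e \<Longrightarrow> f x = 0\<rbrakk> \<Longrightarrow>
       rays Y f 0 = (\<integral>\<^sup>+x. f x * ennreal (q x) \<partial>lborel)"
  using assms unfolding density_near_def by blast+

lemma density_near_subset:
  assumes "density_near Y u q e" "0 < d" "ball u' d \<subseteq> ball u e"
  shows "density_near Y u' q d"
  using assms unfolding density_near_def by (meson subsetD)

text \<open>Moving the starting point by \<open>- w\<close> amounts to translating the density by
  \<open>w\<close>, as long as the translated support stays in the ball.\<close>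

lemma rays_shift_density:
  assumes "density_near Y u q e" and [measurable]: "f \<in> borel_measurable borel"
    and f: "\<And>y. f y \<noteq> 0 \<Longrightarrow> y + w \<in> ball u e"
  shows "rays Y f (- w) = (\<integral>\<^sup>+y. f y * ennreal (q (y + w)) \<partial>lborel)"
proof -
  note D = density_nearD[OF assms(1)]
  note [measurable] = borel_measurable_real_polynomial[OF D(1)]
  have "rays Y f (- w) = rays Y (\<lambda>z. f (z - w)) 0" using rays_shift[of Y f "- w" 0] by simp
  also have "\<dots> = (\<integral>\<^sup>+y. f (y - w) * ennreal (q y) \<partial>lborel)"
    by (rule D(4)) (use f[of "_ - w"] in auto)
  also have "\<dots> = (\<integral>\<^sup>+y. f (y + w - w) * ennreal (q (y + w)) \<partial>lborel)"
    by (rule nn_integral_lborel_shift[symmetric]) measurable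
  finally show ?thesis by simp
qed

lemma density_near_permute: "mset Y = mset Z \<Longrightarrow> density_near Y u q e = density_near Z u q e"
  unfolding density_near_def using rays_permute[of _ Y Z] by auto

lemma continuous_nonneg_AE_ball:
  fixes g :: "'a::euclidean_space \<Rightarrow> real"
  assumes "continuous_on UNIV g" "open S" "AE x in lborel. x \<in> S \<longrightarrow> 0 \<le> g x" "x \<in> S"
  shows "0 \<le> g x"
proof (rule ccontr)
  assume n: "\<not> 0 \<le> g x"
  let ?O = "S \<inter> {x. g x < 0}"
  have "open ?O" using assms(1,2) by (auto intro!: open_Int open_Collect_less continuous_on_const)
  moreover have "?O \<noteq> {}" using n assms(4) by (auto intro!: exI[of _ x])
  moreover have "AE x in lborel. x \<notin> ?O" using assms(3) by eventually_elim auto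
  then have "?O \<in> null_sets lborel" using \<open>open ?O\<close> by (subst AE_iff_null_sets) auto
  ultimately show False
    using open_not_negligible negligible_iff_null_sets null_sets_completionI by blast
qed

text \<open>Test on the part \<open>E\<close> of the ball where \<open>q < p\<close>. The integral
  of \<open>q\<close> over \<open>E\<close> is finite and can be cancelled, so \<open>p - q\<close>
  integrates to zero there; continuity turns the resulting almost-everywhere inequality into one at
  every point.\<close>

lemma ennreal_density_le:
  fixes p q :: "'a::euclidean_space \<Rightarrow> real"
  assumes p: "real_polynomial_function p" and q: "real_polynomial_function q"
    and nn: "\<And>x. x \<in> ball u e \<Longrightarrow> 0 \<le> p x" "\<And>x. x \<in> ball u e \<Longrightarrow> 0 \<le> q x"
    and le: "\<And>E. \<lbrakk>E \<in> sets borel; E \<subseteq> ball u e\<rbrakk> \<Longrightarrow>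
      (\<integral>\<^sup>+x. indicator E x * ennreal (p x) \<partial>lborel) \<le> (\<integral>\<^sup>+x. indicator E x * ennreal (q x) \<partial>lborel)"
    and x: "x \<in> ball u e"
  shows "p x \<le> q x"
proof -
  note [measurable] = borel_measurable_real_polynomial[OF p] borel_measurable_real_polynomial[OF q]
  let ?E = "ball u e \<inter> {x. q x < p x}"
  have [measurable]: "?E \<in> sets borel" by measurable
  then have E: "?E \<in> sets borel" "?E \<subseteq> ball u e" by auto
  have fin: "(\<integral>\<^sup>+x. indicator ?E x * ennreal (q x) \<partial>lborel) < \<infinity>"
  proof -
    have "(\<integral>\<^sup>+x. indicator ?E x * ennreal (q x) \<partial>lborel) = (\<integral>\<^sup>+x. ennreal (indicator ?E x * q x) \<partial>lborel)"
      by (intro nn_integral_cong) (auto simp: indicator_def)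
    also have "\<dots> = ennreal (\<integral>x. indicator ?E x * q x \<partial>lborel)"
      using nn(2) by (intro nn_integral_eq_integral integrable_real_polynomial q)
        (auto simp: indicator_def intro: bounded_subset[OF bounded_ball])
    finally show ?thesis by simp
  qed
  have "(\<integral>\<^sup>+x. indicator ?E x * ennreal (q x) \<partial>lborel) + (\<integral>\<^sup>+x. indicator ?E x * ennreal (p x - q x) \<partial>lborel)
      = (\<integral>\<^sup>+x. indicator ?E x * ennreal (q x) + indicator ?E x * ennreal (p x - q x) \<partial>lborel)"
    by (rule nn_integral_add[symmetric]) auto
  also have "\<dots> = (\<integral>\<^sup>+x. indicator ?E x * ennreal (p x) \<partial>lborel)"
  proof (rule nn_integral_cong)
    fix x
    show "indicator ?E x * ennreal (q x) + indicator ?E x * ennreal (p x - q x) = indicator ?E x * ennreal (p x)"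
      using ennreal_plus[of "q x" "p x - q x"] nn(2)[of x] by (auto simp: indicator_def)
  qed
  also have "\<dots> \<le> (\<integral>\<^sup>+x. indicator ?E x * ennreal (q x) \<partial>lborel) + 0" using le[OF E] by simp
  finally have "(\<integral>\<^sup>+x. indicator ?E x * ennreal (p x - q x) \<partial>lborel) \<le> 0"
    using fin by (subst (asm) ennreal_add_left_cancel_le) auto
  then have "AE x in lborel. indicator ?E x * ennreal (p x - q x) = 0"
    by (subst nn_integral_0_iff_AE[symmetric]) auto
  then have "AE x in lborel. x \<in> ball u e \<longrightarrow> 0 \<le> q x - p x"
    by eventually_elim (auto simp: indicator_def split: if_splits)
  then have "0 \<le> q x - p x"
    by (rule continuous_nonneg_AE_ball[rotated 2]) (use x in \<open>auto intro!: continuous_intros continuous_on_real_polynomial p q\<close>)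
  then show ?thesis by simp
qed

lemma density_near_unique:
  assumes "density_near Y u p d" "density_near Y u q e"
  shows "p = q"
proof -
  define r where "r = min d e"
  note D = density_nearD[OF assms(1)] and E = density_nearD[OF assms(2)]
  have r: "0 < r" "ball u r \<subseteq> ball u d" "ball u r \<subseteq> ball u e" using D(2) E(2) by (auto simp: r_def)
  have eq: "(\<integral>\<^sup>+x. indicator A x * ennreal (p x) \<partial>lborel) = (\<integral>\<^sup>+x. indicator A x * ennreal (q x) \<partial>lborel)"
    if A: "A \<in> sets borel" "A \<subseteq> ball u r" for A
  proof -
    have "rays Y (indicator A) 0 = (\<integral>\<^sup>+x. indicator A x * ennreal (p x) \<partial>lborel)"
      by (rule D(4)) (use A r(2) in \<open>auto simp: indicator_def\<close>)
    moreover have "rays Y (indicator A) 0 = (\<integral>\<^sup>+x. indicator A x * ennreal (q x) \<partial>lborel)"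
      by (rule E(4)) (use A r(3) in \<open>auto simp: indicator_def\<close>)
    ultimately show ?thesis by simp
  qed
  have "p x - q x = 0" if "x \<in> ball u r" for x
  proof -
    have p: "0 \<le> p x" if "x \<in> ball u r" for x using D(3) r(2) that by blast
    have q: "0 \<le> q x" if "x \<in> ball u r" for x using E(3) r(3) that by blast
    have "p x \<le> q x" by (rule ennreal_density_le[OF D(1) E(1) p q _ that]) (simp_all add: eq)
    moreover have "q x \<le> p x" by (rule ennreal_density_le[OF E(1) D(1) q p _ that]) (simp_all add: eq)
    ultimately show ?thesis by simp
  qed
  then have "p x - q x = 0" for x
    by (rule real_polynomial_eq_0[OF real_polynomial_function_diff[OF D(1) E(1)] r(1)])
  then show ?thesis by (simp add: fun_eq_iff)
qed

lemma density_near_outside_cone: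
  assumes "u \<notin> cone_of (set Y)" shows "\<exists>e. density_near Y u (\<lambda>_. 0) e"
proof -
  obtain e where e: "e > 0" "ball u e \<subseteq> - cone_of (set Y)"
    using assms closed_cone_of[of "set Y"] open_contains_ball[of "- cone_of (set Y)"] by (auto simp: closed_def)
  have "rays Y f 0 = 0" if "\<forall>x. x \<notin> ball u e \<longrightarrow> f x = 0" for f
    by (rule rays_eq_0) (use that e in fastforce)
  then show ?thesis using e(1) unfolding density_near_def
    by (intro exI[of _ e]) (auto intro: real_polynomial_function.intros(2))
qed

section \<open>Coordinates with respect to a basis of the space\<close>

lemma linear_representation:
  assumes "independent B" "span B = UNIV"
  shows "bounded_linear (\<lambda>x::'v::euclidean_space. representation B x b)"
proof -
  have "linear (\<lambda>x. representation B x b)"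
    using assms by (intro linearI) (simp_all add: representation_add representation_scale)
  then show ?thesis by (simp add: linear_conv_bounded_linear)
qed

lemma sum_representation:
  assumes "independent B" "span B = UNIV"
  shows "(\<Sum>b\<in>B. representation B x b *\<^sub>R b) = (x::'v::euclidean_space)"
  using assms by (intro sum_representation_eq) (auto simp: independent_imp_finite)

lemma representation_sum:
  fixes B :: "'v::euclidean_space set"
  assumes "independent B" "span B = UNIV" "b \<in> B"
  shows "representation B (\<Sum>c\<in>B. t c *\<^sub>R c) b = (t b :: real)"
proof -
  interpret bounded_linear "\<lambda>x. representation B x b" using assms(1,2) by (rule linear_representation)
  have fin: "finite B" using assms(1) by (rule independent_imp_finite)
  have "representation B (\<Sum>c\<in>B. t c *\<^sub>R c) b = (\<Sum>c\<in>B. t c * (if b = c then 1 else 0))"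
    using assms by (simp add: sum scaleR representation_basis)
  also have "\<dots> = t b" using fin assms(3) by (simp add: if_distrib cong: if_cong)
  finally show ?thesis .
qed

lemma norm_le_box:
  assumes "independent B" "span B = UNIV" "\<And>b. b \<in> B \<Longrightarrow> \<bar>representation B x b\<bar> \<le> d"
  shows "norm (x::'v::euclidean_space) \<le> d * (\<Sum>b\<in>B. norm b)"
proof -
  have "norm x = norm (\<Sum>b\<in>B. representation B x b *\<^sub>R b)" by (simp add: sum_representation assms)
  also have "\<dots> \<le> (\<Sum>b\<in>B. d * norm b)"
    by (intro sum_norm_le) (auto intro!: mult_right_mono assms(3))
  finally show ?thesis by (simp add: sum_distrib_left)
qed

lemma nn_integral_polynomial_segment:
  assumes "\<And>t. t \<in> {0..\<tau>} \<Longrightarrow> 0 \<le> (\<Sum>k\<le>n. c k * t ^ k)" "0 \<le> \<tau>"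
  shows "0 \<le> (\<Sum>k\<le>n. c k * \<tau> ^ Suc k / Suc k)"
    and "(\<integral>\<^sup>+t. ennreal (\<Sum>k\<le>n. c k * t ^ k) * indicator {0..\<tau>} t \<partial>lborel) = ennreal (\<Sum>k\<le>n. c k * \<tau> ^ Suc k / Suc k)"
proof -
  let ?F = "\<lambda>t. \<Sum>k\<le>n. c k * t ^ Suc k / Suc k"
  have d: "(?F has_real_derivative (\<Sum>k\<le>n. c k * t ^ k)) (at t)" for t
    by (auto intro!: derivative_eq_intros sum.cong simp del: power_Suc of_nat_Suc)
  have "?F 0 \<le> ?F \<tau>"
    by (rule DERIV_nonneg_imp_nondecreasing[OF assms(2)]) (use d assms(1) in force)
  then show "0 \<le> ?F \<tau>" by simp
  have "(\<integral>\<^sup>+t. ennreal (\<Sum>k\<le>n. c k * t ^ k) * indicator {0..\<tau>} t \<partial>lborel) = ?F \<tau> - ?F 0"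
    by (rule nn_integral_FTC_Icc)
      (use assms d in \<open>auto intro: DERIV_subset simp: has_real_derivative_iff_has_vector_derivative
        intro: has_vector_derivative_at_within\<close>)
  then show "(\<integral>\<^sup>+t. ennreal (\<Sum>k\<le>n. c k * t ^ k) * indicator {0..\<tau>} t \<partial>lborel) = ennreal (?F \<tau>)" by simp
qed

text \<open>
  The path from \<open>0\<close> to \<open>- x\<close> is taken one basis direction at a time; each segment integrates the
  density of a list with one vector less.
\<close>

lemma rays_box_increment:
  fixes Y :: "'v::euclidean_space list"
  assumes ind: "independent B" and sp: "span B = UNIV" and BY: "B \<subseteq> set Y"
    and dens: "\<And>b. b \<in> B \<Longrightarrow> density_near (remove1 b Y) u (q b) e"
    and d: "0 < d" "d * (\<Sum>b\<in>B. norm b) \<le> e / 2"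
  defines "K \<equiv> {x. \<forall>b\<in>B. 0 \<le> representation B x b \<and> representation B x b \<le> d}"
  shows "\<exists>r. real_polynomial_function r \<and> (\<forall>x\<in>K. (\<forall>y\<in>ball u (e / 2). 0 \<le> r (y, x)) \<and>
     (\<forall>f\<in>borel_measurable borel. (\<forall>y. y \<notin> ball u (e / 2) \<longrightarrow> f y = 0) \<longrightarrow>
        rays Y f (- x) = rays Y f 0 + (\<integral>\<^sup>+y. f y * ennreal (r (y, x)) \<partial>lborel)))"
proof -
  let ?c = "\<lambda>b x. representation B x b"
  have fin: "finite B" using ind by (rule independent_imp_finite)
  \<comment> \<open>Induction on the set \<open>C\<close> of directions in which \<open>x\<close>
    may have a nonzero coordinate; the empty set forces \<open>x = 0\<close>.\<close>
  have "\<exists>r. real_polynomial_function r \<and> (\<forall>x\<in>K. (\<forall>b\<in>B - C. ?c b x = 0) \<longrightarrow> (\<forall>y\<in>ball u (e / 2). 0 \<le> r (y, x)) \<and>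
     (\<forall>f\<in>borel_measurable borel. (\<forall>y. y \<notin> ball u (e / 2) \<longrightarrow> f y = 0) \<longrightarrow>
        rays Y f (- x) = rays Y f 0 + (\<integral>\<^sup>+y. f y * ennreal (r (y, x)) \<partial>lborel)))" if "C \<subseteq> B" for C
    using finite_subset[OF that fin] that
  proof (induction C rule: finite_induct)
    case empty
    have x0: "x = 0" if "\<forall>b\<in>B - {}. ?c b x = 0" for x
      using sum_representation[OF ind sp, of x] that by simp
    show ?case
    proof (rule exI[of _ "\<lambda>_. 0"], intro conjI ballI impI)
      show "real_polynomial_function (\<lambda>_. 0)" by (rule real_polynomial_function.intros(2))
      fix x f assume "\<forall>b\<in>B - {}. ?c b x = 0"
      then have "x = 0" by (rule x0)
      then show "rays Y f (- x) = rays Y f 0 + (\<integral>\<^sup>+y. f y * ennreal 0 \<partial>lborel)" by simp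
    qed simp
  next
    case (insert b C)
    then have b: "b \<in> B" "b \<notin> C" and CB: "C \<subseteq> B" by auto
    obtain r where r: "real_polynomial_function r" and rK: "\<forall>x\<in>K. (\<forall>b\<in>B - C. ?c b x = 0) \<longrightarrow>
       (\<forall>y\<in>ball u (e / 2). 0 \<le> r (y, x)) \<and>
       (\<forall>f\<in>borel_measurable borel. (\<forall>y. y \<notin> ball u (e / 2) \<longrightarrow> f y = 0) \<longrightarrow>
          rays Y f (- x) = rays Y f 0 + (\<integral>\<^sup>+y. f y * ennreal (r (y, x)) \<partial>lborel))"
      using insert.IH[OF CB] by (elim exE conjE)
    have r_nonneg: "0 \<le> r (y, x)"
      if "x \<in> K" "\<forall>b\<in>B - C. ?c b x = 0" "y \<in> ball u (e / 2)" for x y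
      using rK[THEN bspec, OF that(1), THEN mp, OF that(2), THEN conjunct1, THEN bspec, OF that(3)] .
    have r_eq: "rays Y f (- x) = rays Y f 0 + (\<integral>\<^sup>+y. f y * ennreal (r (y, x)) \<partial>lborel)"
      if "x \<in> K" "\<forall>b\<in>B - C. ?c b x = 0" "f \<in> borel_measurable borel" "\<forall>y. y \<notin> ball u (e / 2) \<longrightarrow> f y = 0" for x f
      using rK[THEN bspec, OF that(1), THEN mp, OF that(2), THEN conjunct2, THEN bspec, OF that(3), THEN mp, OF that(4)] .
    note D = density_nearD[OF dens[OF b(1)]]
    obtain n c where c: "\<And>k. real_polynomial_function (c k)" "\<And>z t. q b (z + t *\<^sub>R b) = (\<Sum>k\<le>n. c k z * t ^ k)"
      using real_polynomial_expansion[OF D(1), of b] by blast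
    have lb: "bounded_linear (?c b)" using ind sp by (rule linear_representation)
    \<comment> \<open>\<open>L\<close> deletes the \<open>b\<close>-coordinate: the path first leads
      to \<open>- L x\<close> and then moves along \<open>b\<close>. The second piece contributes
      \<open>p\<close>, the integral of \<open>q b\<close> over the segment, which is polynomial in
      \<open>y\<close> and \<open>x\<close> together.\<close>
    define L where "L x = x - ?c b x *\<^sub>R b" for x
    have blL: "bounded_linear L" unfolding L_def
      by (intro bounded_linear_sub bounded_linear_ident bounded_linear_scaleR_const lb)
    have pL: "polynomial_function (\<lambda>p. (fst p, L (snd p)))" "polynomial_function (\<lambda>p. fst p + L (snd p))"
      by (intro polynomial_function_bounded_linear bounded_linear_Pair bounded_linear_add bounded_linear_fst
        bounded_linear_compose[OF blL] bounded_linear_snd)+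
    define p where "p = (\<lambda>(y, x). \<Sum>k\<le>n. c k (y + L x) * ?c b x ^ Suc k / Suc k)"
    have rp: "real_polynomial_function (\<lambda>z. r (fst z, L (snd z)) + p z)"
    proof (intro real_polynomial_function.intros(3))
      show "real_polynomial_function (\<lambda>z. r (fst z, L (snd z)))" by (rule real_polynomial_compose[OF r pL(1)])
      have "real_polynomial_function (\<lambda>z. ?c b (snd z))"
        by (intro real_polynomial_function.intros(1) bounded_linear_compose[OF lb] bounded_linear_snd)
      then show "real_polynomial_function p" unfolding p_def case_prod_unfold
        by (intro real_polynomial_function_sum finite_atMost real_polynomial_function_divide
          real_polynomial_function.intros(4) real_polynomial_function_power real_polynomial_compose[OF c(1) pL(2)])
    qed
    have step: "(\<forall>y\<in>ball u (e / 2). 0 \<le> r (y, L x) + p (y, x)) \<and>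
       (\<forall>f\<in>borel_measurable borel. (\<forall>y. y \<notin> ball u (e / 2) \<longrightarrow> f y = 0) \<longrightarrow>
        rays Y f (- x) = rays Y f 0 + (\<integral>\<^sup>+y. f y * ennreal (r (y, L x) + p (y, x)) \<partial>lborel))"
      if xK: "x \<in> K" and x0: "\<forall>b\<in>B - insert b C. ?c b x = 0" for x
    proof -
      define \<tau> where "\<tau> = ?c b x"
      have \<tau>: "0 \<le> \<tau>" "\<tau> \<le> d" using xK b(1) by (auto simp: K_def \<tau>_def)
      have cL: "?c a (L x) = (if a = b then 0 else ?c a x)" for a
      proof -
        interpret bounded_linear "?c a" using ind sp by (rule linear_representation)
        show ?thesis using ind b(1) by (simp add: L_def diff scaleR representation_basis)
      qed
      have LK: "L x \<in> K" "\<forall>b\<in>B - C. ?c b (L x) = 0" using xK x0 d(1) by (auto simp: K_def cL)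
      \<comment> \<open>Here the bound on \<open>d\<close> enters: displacements inside the box have
        norm at most \<open>e / 2\<close>, so from the half ball one stays in the ball on which the
        densities \<open>q b\<close> are valid.\<close>
      have near: "y + L x + t *\<^sub>R b \<in> ball u e" if "y \<in> ball u (e / 2)" "t \<in> {0..\<tau>}" for y t
      proof -
        have "?c a (L x + t *\<^sub>R b) = (if a = b then t else ?c a x)" for a
        proof -
          interpret bounded_linear "?c a" using ind sp by (rule linear_representation)
          show ?thesis using ind b(1) by (simp add: add scaleR cL representation_basis)
        qed
        then have "norm (L x + t *\<^sub>R b) \<le> d * (\<Sum>b\<in>B. norm b)"
          using xK \<tau> that(2) by (intro norm_le_box[OF ind sp]) (auto simp: K_def)
        with d(2) have "norm (L x + t *\<^sub>R b) \<le> e / 2" by simp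
        moreover have "dist u (y + L x + t *\<^sub>R b) \<le> dist u y + norm (L x + t *\<^sub>R b)"
          using norm_triangle_ineq4[of "u - y" "L x + t *\<^sub>R b"] by (simp add: dist_norm diff_diff_add add.assoc)
        ultimately show ?thesis using that(1) by simp
      qed
      have seg: "0 \<le> p (y, x)" "(\<integral>\<^sup>+t. ennreal (q b (y + L x + t *\<^sub>R b)) * indicator {0..\<tau>} t \<partial>lborel) = ennreal (p (y, x))"
        if "y \<in> ball u (e / 2)" for y
      proof -
        have "0 \<le> (\<Sum>k\<le>n. c k (y + L x) * t ^ k)" if "t \<in> {0..\<tau>}" for t
          using D(3)[OF near[OF \<open>y \<in> ball u (e / 2)\<close> that]] by (simp add: c(2))
        note s = nn_integral_polynomial_segment[where \<tau> = \<tau> and n = n and c = "\<lambda>k. c k (y + L x)", OF this \<tau>(1)]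
        show "0 \<le> p (y, x)" using s(1) by (simp add: p_def \<tau>_def)
        show "(\<integral>\<^sup>+t. ennreal (q b (y + L x + t *\<^sub>R b)) * indicator {0..\<tau>} t \<partial>lborel) = ennreal (p (y, x))"
          using s(2) by (simp add: p_def \<tau>_def c(2))
      qed
      have "rays Y f (- x) = rays Y f 0 + (\<integral>\<^sup>+y. f y * ennreal (r (y, L x) + p (y, x)) \<partial>lborel)"
        if [measurable]: "f \<in> borel_measurable borel" and f0: "\<forall>y. y \<notin> ball u (e / 2) \<longrightarrow> f y = 0" for f
      proof -
        note [measurable] = borel_measurable_real_polynomial[OF D(1)] borel_measurable_real_polynomial[OF r]
        have [measurable]: "(\<lambda>y. p (y, x)) \<in> borel_measurable borel" "(\<lambda>y. r (y, L x)) \<in> borel_measurable borel"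
        proof -
          have "polynomial_function (\<lambda>y. (y, z))" for z :: 'v
            using polynomial_function_add[OF polynomial_function_bounded_linear[OF bounded_linear_Pair[OF bounded_linear_ident bounded_linear_zero]] polynomial_function_const[of "(0, z)"]]
            by simp
          note g = real_polynomial_compose[OF _ this]
          have "real_polynomial_function (\<lambda>y. r (y, L x) + p (y, x))" using g[OF rp, of x] by simp
          moreover have r': "real_polynomial_function (\<lambda>y. r (y, L x))" using g[OF r, of "L x"] by simp
          ultimately have "real_polynomial_function (\<lambda>y. (r (y, L x) + p (y, x)) - r (y, L x))"
            by (rule real_polynomial_function_diff)
          then show "(\<lambda>y. p (y, x)) \<in> borel_measurable borel" using borel_measurable_real_polynomial by auto
          show "(\<lambda>y. r (y, L x)) \<in> borel_measurable borel" using r' by (rule borel_measurable_real_polynomial)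
        qed
        let ?Y = "remove1 b Y"
        have "mset Y = mset (b # ?Y)" using b(1) BY by auto
        then have perm: "rays Y f = rays (b # ?Y) f" by (intro rays_permute that)
        have inner: "rays ?Y f (- L x - t *\<^sub>R b) = (\<integral>\<^sup>+y. f y * ennreal (q b (y + L x + t *\<^sub>R b)) \<partial>lborel)"
          if "t \<in> {0..\<tau>}" for t
        proof -
          have "rays ?Y f (- (L x + t *\<^sub>R b)) = (\<integral>\<^sup>+y. f y * ennreal (q b (y + (L x + t *\<^sub>R b))) \<partial>lborel)"
            by (rule rays_shift_density[OF dens[OF b(1)] \<open>f \<in> borel_measurable borel\<close>])
              (use f0 near[OF _ \<open>t \<in> {0..\<tau>}\<close>] in \<open>metis add.assoc\<close>)
          then show ?thesis by (simp add: add.assoc)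
        qed
        have "- x = - L x - \<tau> *\<^sub>R b" by (simp add: L_def \<tau>_def)
        then have "rays Y f (- x) = rays Y f (- L x) + (\<integral>\<^sup>+t. rays ?Y f (- L x - t *\<^sub>R b) * indicator {0..\<tau>} t \<partial>lborel)"
          unfolding perm using rays_increment[OF that(1) \<tau>(1), of b ?Y "- L x"] by simp
        also have "(\<integral>\<^sup>+t. rays ?Y f (- L x - t *\<^sub>R b) * indicator {0..\<tau>} t \<partial>lborel) =
            (\<integral>\<^sup>+t. \<integral>\<^sup>+y. f y * (ennreal (q b (y + L x + t *\<^sub>R b)) * indicator {0..\<tau>} t) \<partial>lborel \<partial>lborel)"
        proof (rule nn_integral_cong)
          fix t
          show "rays ?Y f (- L x - t *\<^sub>R b) * indicator {0..\<tau>} t =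
              (\<integral>\<^sup>+y. f y * (ennreal (q b (y + L x + t *\<^sub>R b)) * indicator {0..\<tau>} t) \<partial>lborel)"
            using inner[of t] by (cases "t \<in> {0..\<tau>}") simp_all
        qed
        also have "\<dots> = (\<integral>\<^sup>+y. \<integral>\<^sup>+t. f y * (ennreal (q b (y + L x + t *\<^sub>R b)) * indicator {0..\<tau>} t) \<partial>lborel \<partial>lborel)"
          by (rule lborel_pair.Fubini') measurable
        also have "\<dots> = (\<integral>\<^sup>+y. f y * ennreal (p (y, x)) \<partial>lborel)"
        proof (rule nn_integral_cong)
          fix y
          show "(\<integral>\<^sup>+t. f y * (ennreal (q b (y + L x + t *\<^sub>R b)) * indicator {0..\<tau>} t) \<partial>lborel) = f y * ennreal (p (y, x))"
            by (subst nn_integral_cmult) (use f0 seg(2)[of y] in \<open>cases "y \<in> ball u (e / 2)"; simp\<close>)+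
        qed
        also have "rays Y f (- L x) = rays Y f 0 + (\<integral>\<^sup>+y. f y * ennreal (r (y, L x)) \<partial>lborel)"
          by (rule r_eq[OF LK that])
        also have "rays Y f 0 + (\<integral>\<^sup>+y. f y * ennreal (r (y, L x)) \<partial>lborel) + (\<integral>\<^sup>+y. f y * ennreal (p (y, x)) \<partial>lborel) =
            rays Y f 0 + (\<integral>\<^sup>+y. f y * ennreal (r (y, L x)) + f y * ennreal (p (y, x)) \<partial>lborel)"
          by (subst nn_integral_add) (auto simp: add.assoc)
        also have "(\<integral>\<^sup>+y. f y * ennreal (r (y, L x)) + f y * ennreal (p (y, x)) \<partial>lborel) =
            (\<integral>\<^sup>+y. f y * ennreal (r (y, L x) + p (y, x)) \<partial>lborel)"
        proof (rule nn_integral_cong)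
          fix y
          show "f y * ennreal (r (y, L x)) + f y * ennreal (p (y, x)) = f y * ennreal (r (y, L x) + p (y, x))"
            using f0 r_nonneg[OF LK, of y] seg(1)[of y]
            by (cases "y \<in> ball u (e / 2)") (simp_all add: distrib_left)
        qed
        finally show ?thesis .
      qed
      then show ?thesis using r_nonneg[OF LK] seg(1) by auto
    qed
    show ?case by (rule exI[of _ "\<lambda>z. r (fst z, L (snd z)) + p z"]) (use rp step in simp)
  qed
  from this[OF subset_refl] show ?thesis by simp
qed

text \<open>The average is a convolution, and substituting \<open>z - y\<close> for \<open>x\<close>
  moves the translation from \<open>f\<close> to the box.\<close>

lemma nn_integral_box_average:
  fixes Y :: "'v::euclidean_space list"
  assumes [measurable]: "f \<in> borel_measurable borel" "K \<in> sets borel"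
  shows "(\<integral>\<^sup>+x. rays Y f (- x) * indicator K x \<partial>lborel) =
    (\<integral>\<^sup>+y. f y * rays Y (\<lambda>z. indicator K (z - y)) 0 \<partial>lborel)"
proof -
  have shift: "rays Y (\<lambda>z. f (z - x)) 0 = rays Y f (- x)" for x using rays_shift[of Y f "- x" 0] by simp
  have "(\<integral>\<^sup>+x. rays Y f (- x) * indicator K x \<partial>lborel) = (\<integral>\<^sup>+x. rays Y (\<lambda>z. indicator K x * f (z - x)) 0 \<partial>lborel)"
    by (intro nn_integral_cong, subst rays_cmult, measurable)
      (simp add: shift mult.commute)
  also have "\<dots> = rays Y (\<lambda>z. \<integral>\<^sup>+x. indicator K x * f (z - x) \<partial>lborel) 0"
    by (rule rays_nn_integral[OF sigma_finite_lborel, symmetric]) measurable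
  also have "(\<lambda>z. \<integral>\<^sup>+x. indicator K x * f (z - x) \<partial>lborel) = (\<lambda>z. \<integral>\<^sup>+y. f y * indicator K (z - y) \<partial>lborel)"
  proof
    fix z
    show "(\<integral>\<^sup>+x. indicator K x * f (z - x) \<partial>lborel) = (\<integral>\<^sup>+y. f y * indicator K (z - y) \<partial>lborel)"
      by (subst nn_integral_lborel_reflect[of _ z, symmetric]) (simp_all add: mult.commute)
  qed
  also have "rays Y (\<lambda>z. \<integral>\<^sup>+y. f y * indicator K (z - y) \<partial>lborel) 0 = (\<integral>\<^sup>+y. rays Y (\<lambda>z. f y * indicator K (z - y)) 0 \<partial>lborel)"
    by (rule rays_nn_integral[OF sigma_finite_lborel]) measurable
  also have "\<dots> = (\<integral>\<^sup>+y. f y * rays Y (\<lambda>z. indicator K (z - y)) 0 \<partial>lborel)"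
    by (intro nn_integral_cong rays_cmult) measurable
  finally show ?thesis .
qed

lemma density_near_from_sets:
  assumes q: "real_polynomial_function q" and e: "0 < e" and nn: "\<And>x. x \<in> ball u e \<Longrightarrow> 0 \<le> q x"
    and sets: "\<And>E. \<lbrakk>E \<in> sets borel; E \<subseteq> ball u e\<rbrakk> \<Longrightarrow>
      rays Y (indicator E) 0 = (\<integral>\<^sup>+x. indicator E x * ennreal (q x) \<partial>lborel)"
  shows "density_near Y u q e"
proof -
  note [measurable] = borel_measurable_real_polynomial[OF q]
  have [measurable]: "ball u e \<in> sets (ray_measure Y)" by simp
  have eq: "density (ray_measure Y) (indicator (ball u e)) = density lborel (\<lambda>x. indicator (ball u e) x * ennreal (q x))"
  proof (rule measure_eqI)
    fix A assume "A \<in> sets (density (ray_measure Y) (indicator (ball u e)))"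
    then have A[measurable]: "A \<in> sets borel" by simp
    have "emeasure (density (ray_measure Y) (indicator (ball u e))) A = (\<integral>\<^sup>+x. indicator (ball u e \<inter> A) x \<partial>ray_measure Y)"
      by (subst emeasure_density) (auto intro!: nn_integral_cong simp del: nn_integral_indicator simp: indicator_inter_arith)
    also have "\<dots> = (\<integral>\<^sup>+x. indicator (ball u e \<inter> A) x * ennreal (q x) \<partial>lborel)"
      by (subst nn_integral_ray_measure) (auto intro!: sets)
    also have "\<dots> = emeasure (density lborel (\<lambda>x. indicator (ball u e) x * ennreal (q x))) A"
      by (subst emeasure_density) (auto simp: indicator_inter_arith mult_ac)
    finally show "emeasure (density (ray_measure Y) (indicator (ball u e))) A = \<dots>" .
  qed simp
  have "rays Y f 0 = (\<integral>\<^sup>+x. f x * ennreal (q x) \<partial>lborel)"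
    if [measurable]: "f \<in> borel_measurable borel" and f: "\<forall>x. x \<notin> ball u e \<longrightarrow> f x = 0" for f
  proof -
    have i: "indicator (ball u e) x * f x = f x" for x using f by (auto simp: indicator_def)
    have "rays Y f 0 = (\<integral>\<^sup>+x. f x \<partial>density (ray_measure Y) (indicator (ball u e)))"
      by (subst nn_integral_density) (auto simp: i nn_integral_ray_measure)
    also have "\<dots> = (\<integral>\<^sup>+x. indicator (ball u e) x * ennreal (q x) * f x \<partial>lborel)"
      unfolding eq by (subst nn_integral_density) auto
    also have "\<dots> = (\<integral>\<^sup>+x. f x * ennreal (q x) \<partial>lborel)"
      by (intro nn_integral_cong) (metis i mult.assoc mult.commute)
    finally show ?thesis .
  qed
  then show ?thesis unfolding density_near_def using q e nn by blast
qed

text \<open>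
  The increment formula alone says nothing about \<open>rays Y f 0\<close> itself. Averaging it over a box \<open>K\<close> of
  starting points turns the left-hand side into the integral of \<open>f\<close> against the mass that the rays
  give to the translates of \<open>K\<close>, and that mass is a polynomial in the translation, again by the
  increment formula. This avoids any regularity argument for distributions.
\<close>

lemma density_near_step:
  fixes Y :: "'v::euclidean_space list"
  assumes pos: "\<And>a. a \<in> set Y \<Longrightarrow> 0 < w \<bullet> a"
    and ind: "independent B" and sp: "span B = UNIV" and BY: "B \<subseteq> set Y"
    and dens: "\<And>b. b \<in> B \<Longrightarrow> density_near (remove1 b Y) u (q b) e" and e: "0 < e"
  shows "\<exists>q e. density_near Y u q e"
proof -
  let ?c = "\<lambda>b x. representation B x b"
  have fin: "finite B" using ind by (rule independent_imp_finite)
  define s where "s = (\<Sum>b\<in>B. norm b)"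
  define d where "d = e / (2 * (1 + s))"
  have s: "0 \<le> s" by (simp add: s_def sum_nonneg)
  have d: "0 < d" "d * s \<le> e / 2" using e s by (auto simp: d_def field_simps)
  define K where "K = {x. \<forall>b\<in>B. 0 \<le> ?c b x \<and> ?c b x \<le> d}"
  have cont: "continuous_on UNIV (\<lambda>x. ?c b x)" for b
    using linear_representation[OF ind sp] by (rule linear_continuous_on)
  have "K = (\<Inter>b\<in>B. {x. 0 \<le> ?c b x} \<inter> {x. ?c b x \<le> d})" by (auto simp: K_def)
  also have "closed \<dots>" by (intro closed_INT ballI closed_Int closed_Collect_le cont continuous_on_const)
  finally have clK: "closed K" .
  then have [measurable]: "K \<in> sets borel" by simp
  have normK: "norm x \<le> d * s" if "x \<in> K" for x
    unfolding s_def by (rule norm_le_box[OF ind sp]) (use that in \<open>auto simp: K_def\<close>)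
  then have bK: "bounded K" unfolding bounded_iff by blast
  \<comment> \<open>\<open>m0\<close> is the centre of the box and \<open>y0\<close> is chosen to
    bring it to \<open>u\<close>. Then \<open>y - y0\<close> lies in \<open>K\<close> for all
    \<open>y\<close> near \<open>u\<close>, and the translate \<open>K'\<close> of \<open>K\<close>
    by \<open>y0\<close> lies in the half ball; both are required for applying the increment formula
    to the indicator of \<open>K'\<close>.\<close>
  define m0 where "m0 = (d / 2) *\<^sub>R (\<Sum>b\<in>B. b)"
  define y0 where "y0 = u - m0"
  define O1 where "O1 = {x. \<forall>b\<in>B. 0 < ?c b x \<and> ?c b x < d}"
  have "O1 = (\<Inter>b\<in>B. {x. 0 < ?c b x} \<inter> {x. ?c b x < d})" by (auto simp: O1_def)
  also have "open \<dots>" by (intro open_INT fin ballI open_Int open_Collect_less cont continuous_on_const)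
  finally have opO: "open O1" .
  have O1K: "O1 \<subseteq> K" by (auto simp: O1_def K_def intro: less_imp_le)
  have cm0: "?c b m0 = d / 2" if "b \<in> B" for b
    using representation_sum[OF ind sp that, of "\<lambda>_. d / 2"] by (simp add: m0_def scaleR_sum_right)
  have m0: "m0 \<in> O1" using d by (auto simp: O1_def cm0)
  obtain \<rho>0 where \<rho>0: "\<rho>0 > 0" "ball m0 \<rho>0 \<subseteq> O1" using opO m0 open_contains_ball by blast
  define \<rho> where "\<rho> = min \<rho>0 (e / 2)"
  have \<rho>: "0 < \<rho>" "ball u \<rho> \<subseteq> ball u (e / 2)" using \<rho>0 e by (auto simp: \<rho>_def)
  have inK: "y - y0 \<in> K" if "y \<in> ball u \<rho>" for y
  proof -
    have "dist m0 (y - y0) = dist u y" by (simp add: y0_def dist_norm algebra_simps)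
    then have "y - y0 \<in> ball m0 \<rho>0" using that by (simp add: \<rho>_def)
    then show ?thesis using \<rho>0 O1K by blast
  qed
  define K' where "K' = {z. z - y0 \<in> K}"
  have [measurable]: "K' \<in> sets borel"
  proof -
    have "(\<lambda>z. z - y0) -` K \<inter> space borel \<in> sets borel" by (rule measurable_sets) measurable
    then show ?thesis by (simp add: K'_def vimage_def)
  qed
  have indK': "indicator K' = (\<lambda>z. indicator K (z - y0) :: ennreal)"
    by (simp add: K'_def indicator_def fun_eq_iff)
  have K'u: "K' \<subseteq> ball u (e / 2)"
  proof
    fix z assume "z \<in> K'"
    then have zK: "z - y0 \<in> K" by (simp add: K'_def)
    have "\<bar>?c b (z - y0 - m0)\<bar> \<le> d / 2" if "b \<in> B" for b
    proof -
      interpret bounded_linear "?c b" using ind sp by (rule linear_representation)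
      have "?c b (z - y0 - m0) = ?c b (z - y0) - d / 2"
        using diff[of "z - y0" m0] by (simp only: cm0[OF that])
      moreover have "0 \<le> ?c b (z - y0)" "?c b (z - y0) \<le> d" using zK that unfolding K_def by blast+
      ultimately show ?thesis by linarith
    qed
    then have "norm (z - y0 - m0) \<le> d / 2 * s" unfolding s_def by (intro norm_le_box[OF ind sp])
    also have "\<dots> \<le> e / 4" using d(2) by simp
    also have "\<dots> < e / 2" using e by simp
    finally show "z \<in> ball u (e / 2)" by (simp add: y0_def dist_norm norm_minus_commute)
  qed
  then have bK': "bounded K'" using bounded_subset[OF bounded_ball] by blast
  obtain r where r: "real_polynomial_function r" and rK: "\<forall>x\<in>K. (\<forall>y\<in>ball u (e / 2). 0 \<le> r (y, x)) \<and>
     (\<forall>f\<in>borel_measurable borel. (\<forall>y. y \<notin> ball u (e / 2) \<longrightarrow> f y = 0) \<longrightarrow>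
        rays Y f (- x) = rays Y f 0 + (\<integral>\<^sup>+y. f y * ennreal (r (y, x)) \<partial>lborel))"
    by (rule exE[OF rays_box_increment[OF ind sp BY _ d(1) d(2)[unfolded s_def], where q = q, folded K_def]])
      (erule dens, erule conjE, rule that, assumption+)
  have r_nonneg: "0 \<le> r (y, x)" if "x \<in> K" "y \<in> ball u (e / 2)" for x y
    using rK[THEN bspec, OF that(1), THEN conjunct1, THEN bspec, OF that(2)] .
  have r_eq: "rays Y f (- x) = rays Y f 0 + (\<integral>\<^sup>+y. f y * ennreal (r (y, x)) \<partial>lborel)"
    if "x \<in> K" "f \<in> borel_measurable borel" and f: "\<And>y. y \<notin> ball u (e / 2) \<Longrightarrow> f y = 0" for x f
    using rK[THEN bspec, OF that(1), THEN conjunct2, THEN bspec, OF that(2)] f by (elim mp) simp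
  obtain R where R: "real_polynomial_function R"
    "\<And>y. (\<And>x. x \<in> K \<Longrightarrow> 0 \<le> r (y, x)) \<Longrightarrow>
       0 \<le> R y \<and> (\<integral>\<^sup>+x. ennreal (r (y, x)) * indicator K x \<partial>lborel) = ennreal (R y)"
    by (rule polynomial_parameter_integral[OF r bK \<open>K \<in> sets borel\<close>]) (erule that, blast)
  have "polynomial_function (\<lambda>p. (snd p, fst p) :: 'v \<times> 'v)"
    by (intro polynomial_function_bounded_linear bounded_linear_Pair bounded_linear_fst bounded_linear_snd)
  from real_polynomial_compose[OF r this] have rs: "real_polynomial_function (\<lambda>p. r (snd p, fst p))" .
  obtain P where P: "real_polynomial_function P"
    "\<And>x. (\<And>y. y \<in> K' \<Longrightarrow> 0 \<le> r (y, x)) \<Longrightarrow>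
       0 \<le> P x \<and> (\<integral>\<^sup>+y. ennreal (r (y, x)) * indicator K' y \<partial>lborel) = ennreal (P x)"
    by (rule polynomial_parameter_integral[OF rs bK' \<open>K' \<in> sets borel\<close>, unfolded fst_conv snd_conv]) (erule that, blast)
  let ?m = "\<lambda>y. rays Y (\<lambda>z. indicator K (z - y)) 0"
  define M where "M = enn2real (?m y0)"
  have fin_m: "?m y0 = ennreal M"
  proof -
    have "?m y0 < \<infinity>"
      by (rule rays_bounded_finite[OF pos bK', where C = 1]) (auto simp: K'_def indicator_def)
    then show ?thesis by (simp add: M_def)
  qed
  \<comment> \<open>The mass given to the translate of \<open>K\<close> by \<open>y\<close> is the
    one given to \<open>K'\<close>, seen from the start \<open>- (y - y0)\<close>. It is therefore
    the constant \<open>M\<close> plus an increment, which is polynomial in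
    \<open>y - y0\<close>.\<close>
  define \<mu> where "\<mu> y = M + P (y - y0)" for y
  have \<mu>p: "real_polynomial_function \<mu>"
    unfolding \<mu>_def
    by (intro real_polynomial_function.intros(3) real_polynomial_function.intros(2) real_polynomial_compose[OF P(1)]
        polynomial_function_diff polynomial_function_id polynomial_function_const)
  have \<mu>: "0 \<le> \<mu> y" "?m y = ennreal (\<mu> y)" if y: "y \<in> ball u \<rho>" for y
  proof -
    have x: "y - y0 \<in> K" by (rule inK[OF y])
    have Px: "0 \<le> P (y - y0)" "(\<integral>\<^sup>+y'. ennreal (r (y', y - y0)) * indicator K' y' \<partial>lborel) = ennreal (P (y - y0))"
      using P(2)[of "y - y0"] r_nonneg[OF x] K'u by blast+
    show "0 \<le> \<mu> y" using Px(1) by (simp add: \<mu>_def M_def)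
    have "?m y = rays Y (\<lambda>z. indicator K' (z + - (y - y0))) 0" by (simp add: indK' algebra_simps)
    also have "\<dots> = rays Y (indicator K') (- (y - y0))" by (simp only: rays_shift add_0)
    also have "\<dots> = rays Y (indicator K') 0 + (\<integral>\<^sup>+y'. indicator K' y' * ennreal (r (y', y - y0)) \<partial>lborel)"
      by (rule r_eq[OF x]) (use K'u in \<open>auto simp: indicator_def\<close>)
    also have "rays Y (indicator K') 0 = ennreal M" using fin_m by (simp add: indK')
    finally show "?m y = ennreal (\<mu> y)" using Px by (simp add: \<mu>_def M_def mult.commute)
  qed
  have R': "0 \<le> R y" "(\<integral>\<^sup>+x. ennreal (r (y, x)) * indicator K x \<partial>lborel) = ennreal (R y)" if "y \<in> ball u \<rho>" for y
    using R(2)[of y] r_nonneg[of _ y] that \<rho>(2) by blast+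
  define V where "V = measure lborel K"
  have eV: "emeasure lborel K = ennreal V"
    unfolding V_def using emeasure_bounded_finite[OF bK] by (simp add: emeasure_eq_ennreal_measure)
  have V: "0 < V"
  proof -
    have "0 < emeasure lborel O1"
      using opO m0 open_not_negligible[OF opO] by (auto simp: negligible_iff_null_sets zero_less_iff_neq_zero null_sets_def)
    also have "\<dots> \<le> emeasure lborel K" by (intro emeasure_mono O1K) auto
    finally show ?thesis by (simp add: eV)
  qed
  note [measurable] = borel_measurable_real_polynomial[OF r] borel_measurable_real_polynomial[OF \<mu>p]
    borel_measurable_real_polynomial[OF R(1)]
  \<comment> \<open>Two evaluations of the integral of \<open>rays Y f (- x)\<close> over
    \<open>x\<close> in \<open>K\<close>: by the increment formula, with \<open>R\<close> the
    integral of \<open>r\<close> over \<open>K\<close>, and by the exchange of integrals. Solving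
    for \<open>rays Y f 0\<close> gives the density \<open>(\<mu> - R) / V\<close>.\<close>
  have key: "ennreal V * rays Y f 0 + (\<integral>\<^sup>+y. f y * ennreal (R y) \<partial>lborel) = (\<integral>\<^sup>+y. f y * ennreal (\<mu> y) \<partial>lborel)"
    if [measurable]: "f \<in> borel_measurable borel" and f0: "\<And>y. y \<notin> ball u \<rho> \<Longrightarrow> f y = 0" for f
  proof -
    have f0': "\<And>y. y \<notin> ball u (e / 2) \<Longrightarrow> f y = 0" using f0 \<rho>(2) by blast
    have "(\<integral>\<^sup>+y. f y * ennreal (\<mu> y) \<partial>lborel) = (\<integral>\<^sup>+y. f y * ?m y \<partial>lborel)"
      by (intro nn_integral_cong) (metis \<mu>(2) f0 mult_zero_left)
    also have "\<dots> = (\<integral>\<^sup>+x. rays Y f (- x) * indicator K x \<partial>lborel)"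
      by (rule nn_integral_box_average[symmetric]) measurable
    also have "\<dots> = (\<integral>\<^sup>+x. rays Y f 0 * indicator K x +
        (\<integral>\<^sup>+y. f y * (ennreal (r (y, x)) * indicator K x) \<partial>lborel) \<partial>lborel)"
    proof (rule nn_integral_cong)
      fix x
      show "rays Y f (- x) * indicator K x = rays Y f 0 * indicator K x +
        (\<integral>\<^sup>+y. f y * (ennreal (r (y, x)) * indicator K x) \<partial>lborel)"
        using r_eq[of x f, OF _ that(1) f0'] by (cases "x \<in> K") simp_all
    qed
    also have "\<dots> = (\<integral>\<^sup>+x. rays Y f 0 * indicator K x \<partial>lborel) +
        (\<integral>\<^sup>+x. (\<integral>\<^sup>+y. f y * (ennreal (r (y, x)) * indicator K x) \<partial>lborel) \<partial>lborel)"
      by (rule nn_integral_add) measurable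
    also have "(\<integral>\<^sup>+x. (\<integral>\<^sup>+y. f y * (ennreal (r (y, x)) * indicator K x) \<partial>lborel) \<partial>lborel) =
        (\<integral>\<^sup>+y. (\<integral>\<^sup>+x. f y * (ennreal (r (y, x)) * indicator K x) \<partial>lborel) \<partial>lborel)"
      by (rule lborel_pair.Fubini') measurable
    also have "\<dots> = (\<integral>\<^sup>+y. f y * ennreal (R y) \<partial>lborel)"
    proof (rule nn_integral_cong)
      fix y
      show "(\<integral>\<^sup>+x. f y * (ennreal (r (y, x)) * indicator K x) \<partial>lborel) = f y * ennreal (R y)"
        by (subst nn_integral_cmult, measurable) (use f0[of y] R'(2)[of y] in \<open>cases "y \<in> ball u \<rho>"; simp\<close>)
    qed
    also have "(\<integral>\<^sup>+x. rays Y f 0 * indicator K x \<partial>lborel) = ennreal V * rays Y f 0"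
      by (subst nn_integral_cmult_indicator) (simp_all add: eV mult.commute)
    finally show ?thesis by simp
  qed
  have le: "R x \<le> \<mu> x" if "x \<in> ball u \<rho>" for x
  proof (rule ennreal_density_le[OF R(1) \<mu>p R'(1) \<mu>(1) _ that])
    fix E :: "'v set" assume "E \<in> sets borel" "E \<subseteq> ball u \<rho>"
    then have "ennreal V * rays Y (indicator E) 0 + (\<integral>\<^sup>+y. indicator E y * ennreal (R y) \<partial>lborel) =
        (\<integral>\<^sup>+y. indicator E y * ennreal (\<mu> y) \<partial>lborel)"
      by (intro key) (auto simp: indicator_def)
    then show "(\<integral>\<^sup>+y. indicator E y * ennreal (R y) \<partial>lborel) \<le> (\<integral>\<^sup>+y. indicator E y * ennreal (\<mu> y) \<partial>lborel)"
      by (metis add.commute le_iff_add)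
  qed
  define h where "h x = (\<mu> x - R x) / V" for x
  have hp: "real_polynomial_function h" unfolding h_def
    by (intro real_polynomial_function_divide real_polynomial_function_diff \<mu>p R(1))
  note [measurable] = borel_measurable_real_polynomial[OF hp]
  have h: "0 \<le> h x" "ennreal (\<mu> x) = ennreal V * ennreal (h x) + ennreal (R x)" if "x \<in> ball u \<rho>" for x
    using le[OF that] V R'(1)[OF that] by (auto simp: h_def simp flip: ennreal_mult' ennreal_plus)
  have "density_near Y u h \<rho>"
  proof (rule density_near_from_sets[OF hp \<rho>(1) h(1)])
    fix E :: "'v set" assume E[measurable]: "E \<in> sets borel" and Eu: "E \<subseteq> ball u \<rho>"
    let ?I = "\<integral>\<^sup>+y. indicator E y * ennreal (R y) \<partial>lborel"
    have finI: "?I \<noteq> \<infinity>"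
    proof -
      have "?I = (\<integral>\<^sup>+y. ennreal (indicator E y * R y) \<partial>lborel)"
        by (intro nn_integral_cong) (auto simp: indicator_def)
      also have "\<dots> = ennreal (\<integral>y. indicator E y * R y \<partial>lborel)"
      proof (intro nn_integral_eq_integral integrable_real_polynomial R(1) E)
        show "bounded E" using Eu by (rule bounded_subset[OF bounded_ball])
        have "0 \<le> indicator E y * R y" for y using R'(1)[of y] Eu by (cases "y \<in> E") auto
        then show "AE y in lborel. 0 \<le> indicator E y * R y" by simp
      qed
      finally show ?thesis by simp
    qed
    have "ennreal V * rays Y (indicator E) 0 + ?I = (\<integral>\<^sup>+y. indicator E y * ennreal (\<mu> y) \<partial>lborel)"
      using Eu by (intro key) (auto simp: indicator_def)
    also have "\<dots> = (\<integral>\<^sup>+y. ennreal V * (indicator E y * ennreal (h y)) + indicator E y * ennreal (R y) \<partial>lborel)"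
      using h(2) Eu by (intro nn_integral_cong) (auto simp: indicator_def)
    also have "\<dots> = ennreal V * (\<integral>\<^sup>+y. indicator E y * ennreal (h y) \<partial>lborel) + ?I"
      by (subst nn_integral_add) (auto simp: nn_integral_cmult)
    finally have "ennreal V * rays Y (indicator E) 0 = ennreal V * (\<integral>\<^sup>+y. indicator E y * ennreal (h y) \<partial>lborel)"
      using finI unfolding add.commute[of _ ?I] ennreal_add_left_cancel by simp
    then show "rays Y (indicator E) 0 = (\<integral>\<^sup>+y. indicator E y * ennreal (h y) \<partial>lborel)"
      using V by (simp add: ennreal_mult_cancel_left)
  qed
  then show ?thesis by blast
qed

text \<open>Induction on the length. The whole cone of a list that does not span is singular, so
  there the density is zero. Otherwise a basis extracted from the list provides the directions;
  removing one vector leaves fewer singular cones, so the induction hypothesis applies at the same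
  \<open>u\<close>.\<close>

theorem density_near_exists:
  fixes Y :: "'v::euclidean_space list"
  assumes "\<And>a. a \<in> set Y \<Longrightarrow> 0 < w \<bullet> a" and "u \<notin> singular_points Y"
  shows "\<exists>q e. density_near Y u q e"
  using assms
proof (induction "length Y" arbitrary: Y rule: less_induct)
  case less
  show ?case
  proof (cases "span (set Y) = UNIV")
    case False
    then have "u \<notin> cone_of (set Y)" using less.prems(2) unfolding singular_points_def by blast
    then show ?thesis using density_near_outside_cone by blast
  next
    case True
    obtain B where B: "B \<subseteq> set Y" "independent B" "set Y \<subseteq> span B"
      using maximal_independent_subset by blast
    then have sp: "span B = UNIV" using True span_mono[of "set Y" "span B"] by (auto simp: span_span)
    have fin: "finite B" using B(2) by (rule independent_imp_finite)
    have "\<forall>b\<in>B. \<exists>q e. density_near (remove1 b Y) u q e"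
    proof
      fix b assume "b \<in> B"
      then have "b \<in> set Y" using B(1) by blast
      then have "length (remove1 b Y) < length Y"
        using length_pos_if_in_set[of b Y] by (simp add: length_remove1)
      moreover have "set (remove1 b Y) \<subseteq> set Y" by (rule set_remove1_subset)
      ultimately show "\<exists>q e. density_near (remove1 b Y) u q e"
        using less.prems singular_points_mono[of "remove1 b Y" Y] by (intro less.hyps) auto
    qed
    then obtain q e where qe: "\<And>b. b \<in> B \<Longrightarrow> density_near (remove1 b Y) u (q b) (e b)" by metis
    define e0 where "e0 = Min (insert 1 (e ` B))"
    have e0: "0 < e0" using fin density_nearD(2)[OF qe] by (auto simp: e0_def)
    have "density_near (remove1 b Y) u (q b) e0" if "b \<in> B" for b
      by (rule density_near_subset[OF qe[OF that] e0]) (use fin that in \<open>auto simp: e0_def\<close>)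
    from density_near_step[OF less.prems(1) B(2) sp B(1) this e0] show ?thesis .
  qed
qed

text \<open>
  Arbitrary at singular points, where no density exists in general.
\<close>

definition local_density :: "'v::euclidean_space list \<Rightarrow> 'v \<Rightarrow> 'v \<Rightarrow> real" where
  "local_density Y u = (SOME q. \<exists>e. density_near Y u q e)"

lemma local_density_eq: "density_near Y u q e \<Longrightarrow> local_density Y u = q"
  unfolding local_density_def by (rule some_equality) (auto dest: density_near_unique)

lemma density_near_local_density:
  assumes "\<And>a. a \<in> set Y \<Longrightarrow> 0 < w \<bullet> a" and "u \<notin> singular_points Y"
  obtains e where "density_near Y u (local_density Y u) e"
proof -
  obtain q e where "density_near Y u q e" using density_near_exists[OF assms] by blast
  with local_density_eq[OF this] show ?thesis using that by blast
qed

lemma local_density_permute: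
  assumes "mset Y = mset Z" shows "local_density Y u = local_density Z u"
proof -
  have "density_near Y u = density_near Z u" by (intro ext density_near_permute assms)
  then show ?thesis by (simp add: local_density_def)
qed

lemma local_density_outside_cone: "u \<notin> cone_of (set Y) \<Longrightarrow> local_density Y u = (\<lambda>_. 0)"
  using density_near_outside_cone local_density_eq by blast

lemma local_density_not_spanning:
  "\<lbrakk>span (set Y) \<noteq> UNIV; u \<notin> singular_points Y\<rbrakk> \<Longrightarrow> local_density Y u = (\<lambda>_. 0)"
  by (rule local_density_outside_cone) (auto simp: singular_points_def)

lemma local_density_ball:
  assumes "density_near Y u q e" "v \<in> ball u e" shows "local_density Y v = q"
proof -
  have "0 < e - dist u v" using assms(2) by simp
  moreover have "ball v (e - dist u v) \<subseteq> ball u e"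
  proof
    fix x assume "x \<in> ball v (e - dist u v)"
    then show "x \<in> ball u e" using dist_triangle[of u x v] by simp
  qed
  ultimately show ?thesis using density_near_subset[OF assms(1)] local_density_eq by blast
qed

lemma real_polynomial_local_density:
  assumes "\<And>a. a \<in> set Y \<Longrightarrow> 0 < w \<bullet> a" and "u \<notin> singular_points Y"
  shows "real_polynomial_function (local_density Y u)"
  by (rule density_near_local_density[OF assms]) (auto dest: density_nearD(1))

text \<open>The increment formula read on densities: shifting the test sets by a small multiple of
  \<open>a\<close> stays inside both balls, so the two sides agree near \<open>u\<close> and, being
  polynomials, everywhere.\<close>

lemma local_density_increment:
  fixes Y :: "'v::euclidean_space list"
  assumes pos: "\<And>b. b \<in> set (a # Y) \<Longrightarrow> 0 < w \<bullet> b" and u: "u \<notin> singular_points (a # Y)"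
    and c: "\<And>k. real_polynomial_function (c k)"
      "\<And>z t. local_density Y u (z + t *\<^sub>R a) = (\<Sum>k\<le>n. c k z * t ^ k)"
  obtains d where "d > 0" "\<And>x \<tau>. \<tau> \<in> {0..d} \<Longrightarrow>
    local_density (a # Y) u (x + \<tau> *\<^sub>R a) = local_density (a # Y) u x + (\<Sum>k\<le>n. c k x * \<tau> ^ Suc k / Suc k)"
proof -
  let ?T = "local_density Y u" and ?T' = "local_density (a # Y) u"
  have u': "u \<notin> singular_points Y" using u singular_points_mono[of Y "a # Y"] by auto
  obtain e1 e2 where "density_near Y u ?T e1" "density_near (a # Y) u ?T' e2"
    using density_near_local_density[OF pos u] density_near_local_density[OF _ u', of w] pos by (metis list.set_intros(2))
  note E = this
  have DD: "density_near Y u ?T (min e1 e2)" "density_near (a # Y) u ?T' (min e1 e2)"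
    using density_nearD(2)[OF E(1)] density_nearD(2)[OF E(2)]
    by (auto intro!: density_near_subset[OF E(1)] density_near_subset[OF E(2)])
  define e where "e = min e1 e2"
  note D = density_nearD[OF DD(1)[folded e_def]] and D' = density_nearD[OF DD(2)[folded e_def]]
  note [measurable] = borel_measurable_real_polynomial[OF D(1)] borel_measurable_real_polynomial[OF D'(1)]
    borel_measurable_real_polynomial[OF c(1)]
  have e: "0 < e" by (rule D(2))
  define d where "d = e / (2 * (1 + norm a))"
  have d: "0 < d" "d * norm a < e / 2" using e by (auto simp: d_def field_simps add_pos_nonneg)
  have near: "y + t *\<^sub>R a \<in> ball u e" if "y \<in> ball u (e / 2)" "t \<in> {0..d}" for y t
  proof -
    have "norm (t *\<^sub>R a) \<le> d * norm a" using that(2) by (simp add: mult_right_mono)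
    then have "dist u (y + t *\<^sub>R a) < dist u y + e / 2"
      using norm_triangle_ineq4[of "u - y" "t *\<^sub>R a"] d(2) by (simp add: dist_norm diff_diff_add)
    then show ?thesis using that(1) by simp
  qed
  define p where "p \<tau> y = (\<Sum>k\<le>n. c k y * \<tau> ^ Suc k / Suc k)" for \<tau> y
  have pp: "real_polynomial_function (p \<tau>)" for \<tau>
    unfolding p_def by (intro real_polynomial_function_sum finite_atMost real_polynomial_function_divide
      real_polynomial_function.intros(4) real_polynomial_function.intros(2) c(1))
  have "?T' (x + \<tau> *\<^sub>R a) = ?T' x + p \<tau> x" if \<tau>: "\<tau> \<in> {0..d}" for x \<tau>
  proof -
    note [measurable] = borel_measurable_real_polynomial[OF pp]
    let ?L = "\<lambda>y. ?T' (y + \<tau> *\<^sub>R a)" and ?R = "\<lambda>y. ?T' y + p \<tau> y"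
    have L: "real_polynomial_function ?L"
      by (intro real_polynomial_compose[OF D'(1)] polynomial_function_add polynomial_function_id polynomial_function_const)
    have R: "real_polynomial_function ?R" by (intro real_polynomial_function.intros(3) D'(1) pp)
    have seg: "0 \<le> p \<tau> y" "(\<integral>\<^sup>+t. ennreal (?T (y + t *\<^sub>R a)) * indicator {0..\<tau>} t \<partial>lborel) = ennreal (p \<tau> y)"
      if y: "y \<in> ball u (e / 2)" for y
    proof -
      have "0 \<le> (\<Sum>k\<le>n. c k y * t ^ k)" if "t \<in> {0..\<tau>}" for t
        using D(3)[OF near[OF y, of t]] that \<tau> by (simp add: c(2))
      note s = nn_integral_polynomial_segment[where \<tau> = \<tau> and n = n and c = "\<lambda>k. c k y", OF this]
      show "0 \<le> p \<tau> y" using s(1) \<tau> by (simp add: p_def)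
      show "(\<integral>\<^sup>+t. ennreal (?T (y + t *\<^sub>R a)) * indicator {0..\<tau>} t \<partial>lborel) = ennreal (p \<tau> y)"
        using s(2) \<tau> by (simp add: p_def c(2))
    qed
    have nnL: "0 \<le> ?L y" if "y \<in> ball u (e / 2)" for y by (rule D'(3)[OF near[OF that \<tau>]])
    have sub: "ball u (e / 2) \<subseteq> ball u e" using e by auto
    have nnR: "0 \<le> ?R y" if "y \<in> ball u (e / 2)" for y
      using seg(1)[OF that] D'(3)[of y] that sub by (metis add_nonneg_nonneg subsetD)
    have eq: "(\<integral>\<^sup>+y. indicator E y * ennreal (?L y) \<partial>lborel) = (\<integral>\<^sup>+y. indicator E y * ennreal (?R y) \<partial>lborel)"
      if E[measurable]: "E \<in> sets borel" and Eu: "E \<subseteq> ball u (e / 2)" for E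
    proof -
      let ?f = "indicator E :: 'v \<Rightarrow> ennreal"
      have fE: "?f y \<noteq> 0 \<Longrightarrow> y \<in> ball u (e / 2)" for y using Eu by (auto simp: indicator_def split: if_splits)
      have "(\<integral>\<^sup>+y. ?f y * ennreal (?L y) \<partial>lborel) = rays (a # Y) ?f (- (\<tau> *\<^sub>R a))"
        by (rule rays_shift_density[OF DD(2)[folded e_def], symmetric]) (use near[OF fE _] \<tau> in auto)
      also have "\<dots> = rays (a # Y) ?f 0 + (\<integral>\<^sup>+t. rays Y ?f (0 - t *\<^sub>R a) * indicator {0..\<tau>} t \<partial>lborel)"
        using rays_increment[of ?f \<tau> a Y 0] \<tau> by simp
      also have "rays (a # Y) ?f 0 = (\<integral>\<^sup>+y. ?f y * ennreal (?T' y) \<partial>lborel)"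
        by (rule D'(4)) (use Eu sub in \<open>auto simp: indicator_def\<close>)
      also have "(\<integral>\<^sup>+t. rays Y ?f (0 - t *\<^sub>R a) * indicator {0..\<tau>} t \<partial>lborel) =
          (\<integral>\<^sup>+t. \<integral>\<^sup>+y. ?f y * (ennreal (?T (y + t *\<^sub>R a)) * indicator {0..\<tau>} t) \<partial>lborel \<partial>lborel)"
      proof (rule nn_integral_cong)
        fix t
        show "rays Y ?f (0 - t *\<^sub>R a) * indicator {0..\<tau>} t =
            (\<integral>\<^sup>+y. ?f y * (ennreal (?T (y + t *\<^sub>R a)) * indicator {0..\<tau>} t) \<partial>lborel)"
        proof (cases "t \<in> {0..\<tau>}")
          case True
          have "rays Y ?f (- (t *\<^sub>R a)) = (\<integral>\<^sup>+y. ?f y * ennreal (?T (y + t *\<^sub>R a)) \<partial>lborel)"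
            by (rule rays_shift_density[OF DD(1)[folded e_def]]) (use near[OF fE _, of _ t] \<tau> True in auto)
          then show ?thesis using True by simp
        qed simp
      qed
      also have "\<dots> = (\<integral>\<^sup>+y. \<integral>\<^sup>+t. ?f y * (ennreal (?T (y + t *\<^sub>R a)) * indicator {0..\<tau>} t) \<partial>lborel \<partial>lborel)"
        by (rule lborel_pair.Fubini') measurable
      also have "\<dots> = (\<integral>\<^sup>+y. ?f y * ennreal (p \<tau> y) \<partial>lborel)"
      proof (rule nn_integral_cong)
        fix y
        show "(\<integral>\<^sup>+t. ?f y * (ennreal (?T (y + t *\<^sub>R a)) * indicator {0..\<tau>} t) \<partial>lborel) = ?f y * ennreal (p \<tau> y)"
          by (subst nn_integral_cmult, measurable) (use fE[of y] seg(2)[of y] in \<open>cases "?f y = 0"; simp\<close>)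
      qed
      also have "(\<integral>\<^sup>+y. ?f y * ennreal (?T' y) \<partial>lborel) + (\<integral>\<^sup>+y. ?f y * ennreal (p \<tau> y) \<partial>lborel) =
          (\<integral>\<^sup>+y. ?f y * ennreal (?T' y) + ?f y * ennreal (p \<tau> y) \<partial>lborel)"
        by (rule nn_integral_add[symmetric]) measurable
      also have "\<dots> = (\<integral>\<^sup>+y. ?f y * ennreal (?R y) \<partial>lborel)"
      proof (rule nn_integral_cong)
        fix y
        show "?f y * ennreal (?T' y) + ?f y * ennreal (p \<tau> y) = ?f y * ennreal (?R y)"
        proof (cases "?f y = 0")
          case False
          then have "y \<in> ball u (e / 2)" by (rule fE)
          then show ?thesis using seg(1)[of y] D'(3)[of y] sub
            by (metis distrib_left ennreal_plus subsetD)
        qed simp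
      qed
      finally show ?thesis .
    qed
    have "?L y - ?R y = 0" if "y \<in> ball u (e / 2)" for y
    proof -
      have "?L y \<le> ?R y" by (rule ennreal_density_le[OF L R nnL nnR _ that]) (simp_all add: eq)
      moreover have "?R y \<le> ?L y" by (rule ennreal_density_le[OF R L nnR nnL _ that]) (simp_all add: eq)
      ultimately show ?thesis by simp
    qed
    from real_polynomial_eq_0[OF real_polynomial_function_diff[OF L R] _ this, where e = "e / 2" and u = u and x = x] e
    show ?thesis by simp
  qed
  from that[OF d(1) this[unfolded p_def]] show ?thesis .
qed

lemma dir_deriv_local_density:
  fixes Y :: "'v::euclidean_space list"
  assumes pos: "\<And>b. b \<in> set (a # Y) \<Longrightarrow> 0 < w \<bullet> b" and u: "u \<notin> singular_points (a # Y)"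
  shows "dir_deriv a (\<lambda>x. complex_of_real (local_density (a # Y) u x)) = (\<lambda>x. of_real (local_density Y u x))"
proof
  fix x
  let ?T = "local_density Y u" and ?T' = "local_density (a # Y) u"
  have u': "u \<notin> singular_points Y" using u singular_points_mono[of Y "a # Y"] by auto
  have "real_polynomial_function ?T" using pos by (intro real_polynomial_local_density[OF _ u']) auto
  from real_polynomial_expansion[OF this, of a] obtain n c where
    c: "\<And>k. real_polynomial_function (c k)" "\<And>z t. ?T (z + t *\<^sub>R a) = (\<Sum>k\<le>n. c k z * t ^ k)" by blast
  obtain d where d: "d > 0" "\<And>x \<tau>. \<tau> \<in> {0..d} \<Longrightarrow> ?T' (x + \<tau> *\<^sub>R a) = ?T' x + (\<Sum>k\<le>n. c k x * \<tau> ^ Suc k / Suc k)"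
    by (rule local_density_increment[OF pos u c]) blast+
  let ?g = "\<lambda>\<tau>. complex_of_real (?T' x + (\<Sum>k\<le>n. c k x * \<tau> ^ Suc k / Suc k))"
  have "((\<lambda>\<tau>. ?T' x + (\<Sum>k\<le>n. c k x * \<tau> ^ Suc k / Suc k)) has_real_derivative (\<Sum>k\<le>n. c k x * t ^ k)) (at t)" for t
    by (auto intro!: derivative_eq_intros sum.cong simp del: power_Suc of_nat_Suc)
  \<comment> \<open>Only shifts with \<open>\<tau> \<ge> 0\<close> are known, so derivatives at
    \<open>0\<close> are taken from the right. The two-sided derivative of the polynomial exists and
    must coincide with this one.\<close>
  from this[of 0] have "(?g has_vector_derivative of_real (\<Sum>k\<le>n. c k x * 0 ^ k)) (at 0 within {0..d})"
    by (intro has_vector_derivative_of_real)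
      (auto simp: has_real_derivative_iff_has_vector_derivative intro: has_vector_derivative_at_within)
  moreover have "(\<Sum>k\<le>n. c k x * 0 ^ k) = ?T x" using c(2)[of x 0] by simp
  ultimately have 1: "(?g has_vector_derivative of_real (?T x)) (at 0 within {0..d})" by simp
  have "polynomial_function (\<lambda>x. complex_of_real (?T' x))"
    by (intro polynomial_function_of_real real_polynomial_local_density[OF pos u])
  from has_vector_derivative_at_within[OF polynomial_line_differentiable[OF this, of x a]]
  have "((\<lambda>t. complex_of_real (?T' (x + t *\<^sub>R a))) has_vector_derivative
      dir_deriv a (\<lambda>x. complex_of_real (?T' x)) x) (at 0 within {0..d})" .
  then have "(?g has_vector_derivative dir_deriv a (\<lambda>x. complex_of_real (?T' x)) x) (at 0 within {0..d})"
    by (rule has_vector_derivative_transform[rotated 2]) (use d in auto)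
  from vector_derivative_unique_within[OF _ this 1] d(1)
  show "dir_deriv a (\<lambda>x. complex_of_real (?T' x)) x = of_real (?T x)"
    by (simp add: trivial_limit_within islimpt_Icc)
qed

section \<open>Singular points form a null set\<close>

lemma AE_not_in_proper_subspace:
  fixes A :: "'v::euclidean_space set"
  assumes "span A \<noteq> UNIV" shows "AE x in lborel. x \<notin> span A"
proof -
  have "dim (span A) < DIM('v)"
    using assms dim_eq_full[of A] dim_subset_UNIV[of A] by (simp add: le_less)
  then have "negligible (span A)" by (rule negligible_lowdim)
  then have "emeasure lebesgue (span A) = 0" by (simp add: negligible_iff_emeasure0 closed_span)
  moreover have "span A \<in> sets lborel" using closed_span[of A] by simp
  ultimately have "span A \<in> null_sets lborel" by (simp add: null_sets_def)
  then show ?thesis by (rule AE_not_in)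
qed

lemma cone_of_subset_span: "cone_of A \<subseteq> span A"
  by (rule subsetI, erule cone_of_least) (auto intro: span_base span_add span_scale span_zero)

lemma AE_not_singular: "AE x in lborel. x \<notin> singular_points (Y :: 'v::euclidean_space list)"
proof -
  let ?\<A> = "{A. A \<subseteq> set Y \<and> span A \<noteq> UNIV}"
  have "finite ?\<A>" by (rule finite_subset[of _ "Pow (set Y)"]) auto
  moreover have "AE x in lborel. x \<notin> cone_of A" if "A \<in> ?\<A>" for A
    using AE_not_in_proper_subspace[of A] that cone_of_subset_span[of A] by (auto elim!: eventually_mono)
  ultimately have "AE x in lborel. \<forall>A\<in>?\<A>. x \<notin> cone_of A" by (intro AE_finite_allI)
  then show ?thesis by (rule eventually_mono) (auto simp: singular_points_def)
qed

section \<open>Existence and uniqueness of the spline\<close>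

text \<open>Some vector of a spanning list is not in the subspace; placed innermost, its rays meet
  the subspace in at most one point each. Thus the push-forward measure gives no mass to singular
  cones, on which the local densities carry no information.\<close>

lemma rays_proper_subspace:
  fixes Y :: "'v::euclidean_space list"
  assumes sp: "span (set Y) = UNIV" and A: "span A \<noteq> UNIV"
  shows "rays Y (indicator (span A)) z = 0"
proof -
  obtain a where a: "a \<in> set Y" "a \<notin> span A"
  proof (rule ccontr)
    assume "\<not> thesis"
    then have "set Y \<subseteq> span A" using that by blast
    then have "span (set Y) \<subseteq> span A" using span_mono span_span by metis
    with sp A show False by blast
  qed
  have [measurable]: "span A \<in> sets borel" using closed_span[of A] by simp
  have "mset Y = mset (remove1 a Y @ [a])" using a(1) by simp
  then have "rays Y (indicator (span A)) = rays (remove1 a Y @ [a]) (indicator (span A) :: 'v \<Rightarrow> ennreal)"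
    by (intro rays_permute) auto
  also have "\<dots> = rays (remove1 a Y) (ray a (indicator (span A)))" by (simp add: rays_append rays_Cons)
  also have "ray a (indicator (span A)) = (\<lambda>_. 0 :: ennreal)"
  proof
    fix z
    have one: "t = s" if "z + t *\<^sub>R a \<in> span A" "z + s *\<^sub>R a \<in> span A" for t s
    proof (rule ccontr)
      assume "t \<noteq> s"
      have "(t - s) *\<^sub>R a \<in> span A" using span_diff[OF that] by (simp add: algebra_simps)
      then have "(1 / (t - s)) *\<^sub>R ((t - s) *\<^sub>R a) \<in> span A" by (rule span_scale)
      with a(2) \<open>t \<noteq> s\<close> show False by simp
    qed
    have "\<exists>s. \<forall>t. t \<noteq> s \<longrightarrow> z + t *\<^sub>R a \<notin> span A" using one by metis
    then obtain s where s: "\<forall>t. t \<noteq> s \<longrightarrow> z + t *\<^sub>R a \<notin> span A" by blast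
    have "AE t in lborel. (indicator (span A) (z + t *\<^sub>R a) * indicator {0..} t :: ennreal) = 0"
      using AE_lborel_singleton[of s] by eventually_elim (use s in \<open>auto simp: indicator_def\<close>)
    then show "ray a (indicator (span A)) z = (0 :: ennreal)"
      unfolding ray_def by (subst nn_integral_0_iff_AE) auto
  qed
  also have "rays (remove1 a Y) (\<lambda>_. 0) = (\<lambda>_. 0 :: ennreal)" by (intro ext rays_eq_0) simp
  finally show ?thesis by simp
qed

text \<open>Glues the local densities: each point is evaluated in the polynomial of its own chamber.
  The value at singular points only affects a null set.\<close>

definition density_fun :: "'v::euclidean_space list \<Rightarrow> 'v \<Rightarrow> real" where
  "density_fun Y x = (if x \<in> regular_points Y then local_density Y x x else 0)"

lemma regular_points_eq: "regular_points Y = cone_of (set Y) - singular_points Y"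
  by (simp add: regular_points_def singular_points_def)

lemma density_fun_local:
  assumes "density_near Y u q e" "x \<in> ball u e" "x \<notin> singular_points Y"
  shows "density_fun Y x = q x"
  using local_density_ball[OF assms(1,2)] local_density_outside_cone[of x Y] assms(3)
  by (cases "x \<in> cone_of (set Y)") (auto simp: density_fun_def regular_points_eq)

lemma density_near_avoiding_singular:
  fixes Y :: "'v::euclidean_space list"
  assumes "\<And>a. a \<in> set Y \<Longrightarrow> 0 < w \<bullet> a" and "u \<notin> singular_points Y"
  obtains e where "density_near Y u (local_density Y u) e" "ball u e \<inter> singular_points Y = {}"
proof -
  obtain e1 where e1: "density_near Y u (local_density Y u) e1" by (rule density_near_local_density[OF assms])
  obtain e2 where e2: "0 < e2" "ball u e2 \<subseteq> - singular_points Y"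
    using assms(2) closed_singular_points[of Y] open_contains_ball[of "- singular_points Y"] by (auto simp: closed_def)
  have "density_near Y u (local_density Y u) (min e1 e2)"
    by (rule density_near_subset[OF e1]) (use e2(1) density_nearD(2)[OF e1] in auto)
  moreover have "ball u (min e1 e2) \<inter> singular_points Y = {}" using e2(2) by auto
  ultimately show ?thesis by (rule that)
qed

lemma density_fun_nonneg:
  fixes Y :: "'v::euclidean_space list"
  assumes "\<And>a. a \<in> set Y \<Longrightarrow> 0 < w \<bullet> a" shows "0 \<le> density_fun Y x"
proof (cases "x \<in> singular_points Y")
  case False
  obtain e where e: "density_near Y x (local_density Y x) e" by (rule density_near_local_density[OF assms False])
  with density_nearD(2,3)[OF e] show ?thesis by (auto simp: density_fun_def)
qed (simp add: density_fun_def regular_points_eq)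

lemma borel_measurable_density_fun:
  fixes Y :: "'v::euclidean_space list"
  assumes "\<And>a. a \<in> set Y \<Longrightarrow> 0 < w \<bullet> a" shows "density_fun Y \<in> borel_measurable borel"
proof -
  let ?O = "- singular_points Y"
  have opO: "open ?O" using closed_singular_points[of Y] by (simp add: closed_def)
  have "continuous_on ?O (density_fun Y)" unfolding continuous_on_eq_continuous_at[OF opO]
  proof
    fix u assume "u \<in> ?O"
    then have u: "u \<notin> singular_points Y" by simp
    obtain e where e: "density_near Y u (local_density Y u) e" "ball u e \<inter> singular_points Y = {}"
      by (rule density_near_avoiding_singular[OF assms u])
    have "eventually (\<lambda>x. x \<in> ball u e) (nhds u)"
      using density_nearD(2)[OF e(1)] by (intro eventually_nhds_in_open) auto
    then have "eventually (\<lambda>x. density_fun Y x = local_density Y u x) (nhds u)"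
      by eventually_elim (use e density_fun_local in blast)
    then have "isCont (density_fun Y) u = isCont (local_density Y u) u" by (rule isCont_cong)
    moreover have "isCont (local_density Y u) u"
      using continuous_on_real_polynomial[OF density_nearD(1)[OF e(1)], of UNIV] by (simp add: continuous_on_eq_continuous_at)
    ultimately show "isCont (density_fun Y) u" by simp
  qed
  then have "(\<lambda>x. indicator ?O x *\<^sub>R density_fun Y x) \<in> borel_measurable borel"
    by (rule borel_measurable_continuous_on_indicator[rotated]) (use opO in auto)
  moreover have "(\<lambda>x. indicator ?O x *\<^sub>R density_fun Y x) = density_fun Y"
    by (auto simp: fun_eq_iff indicator_def density_fun_def regular_points_eq)
  ultimately show ?thesis by simp
qed

text \<open>Both measures vanish on the singular set, and its complement is covered by balls on
  which they agree by definition of the local density.\<close>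

lemma ray_measure_eq_density:
  fixes Y :: "'v::euclidean_space list"
  assumes pos: "\<And>a. a \<in> set Y \<Longrightarrow> 0 < w \<bullet> a" and sp: "span (set Y) = UNIV"
  shows "ray_measure Y = density lborel (\<lambda>x. ennreal (density_fun Y x))"
proof (rule measure_eqI)
  let ?M = "ray_measure Y" and ?N = "density lborel (\<lambda>x. ennreal (density_fun Y x))"
  let ?S = "singular_points Y"
  note [measurable] = borel_measurable_density_fun[OF pos]
  fix A assume "A \<in> sets ?M"
  then have A[measurable]: "A \<in> sets borel" by simp
  have S[measurable]: "?S \<in> sets borel" using closed_singular_points[of Y] by simp
  have emM: "emeasure ?M E = rays Y (indicator E) 0" if "E \<in> sets borel" for E
    using nn_integral_ray_measure[of "indicator E" Y] that by simp
  have S0: "emeasure ?M ?S = 0"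
  proof -
    let ?\<A> = "{A. A \<subseteq> set Y \<and> span A \<noteq> UNIV}"
    have fin: "finite ?\<A>" by (rule finite_subset[of _ "Pow (set Y)"]) auto
    have "span A \<in> null_sets ?M" if "A \<in> ?\<A>" for A
      using that closed_span[of A] rays_proper_subspace[OF sp, of A 0] emM[of "span A"] by (auto simp: null_sets_def)
    then have N: "(\<Union>A\<in>?\<A>. span A) \<in> null_sets ?M" using fin by (intro null_sets_UN') (auto intro: countable_finite)
    have sub: "?S \<subseteq> (\<Union>A\<in>?\<A>. span A)" unfolding singular_points_def
      by (intro UN_mono cone_of_subset_span order_refl)
    have "?S \<in> null_sets ?M" by (rule null_sets_subset[OF N _ sub]) (simp add: S)
    then show ?thesis by (rule null_setsD1)
  qed
  have "AE x in lborel. ennreal (density_fun Y x) * indicator ?S x = 0"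
    using AE_not_singular[of Y] by eventually_elim simp
  then have S1: "emeasure ?N ?S = 0" by (subst emeasure_density) (auto simp: nn_integral_0_iff_AE)
  \<comment> \<open>Countably many balls of this kind suffice; made disjoint, they allow countable
    additivity.\<close>
  define \<B> where "\<B> = {ball u e | u e. density_near Y u (local_density Y u) e \<and> ball u e \<inter> ?S = {}}"
  have "\<And>B. B \<in> \<B> \<Longrightarrow> open B" by (auto simp: \<B>_def)
  then obtain \<C> where \<C>: "\<C> \<subseteq> \<B>" "countable \<C>" "\<Union>\<C> = \<Union>\<B>" by (rule Lindelof)
  define D where "D = disjointed (from_nat_into (insert {} \<C>))"
  have cov: "\<Union>\<C> = - ?S"
  proof -
    have "u \<in> \<Union>\<B>" if u: "u \<notin> ?S" for u
    proof -
      obtain e where e: "density_near Y u (local_density Y u) e" "ball u e \<inter> ?S = {}"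
        by (rule density_near_avoiding_singular[OF pos u])
      then have "ball u e \<in> \<B>" unfolding \<B>_def by blast
      then show ?thesis using density_nearD(2)[OF e(1)] by (intro UnionI[of "ball u e"]) simp_all
    qed
    moreover have "B \<subseteq> - ?S" if "B \<in> \<B>" for B using that unfolding \<B>_def by blast
    ultimately show ?thesis unfolding \<C>(3) by blast
  qed
  have range: "range (from_nat_into (insert {} \<C>)) = insert {} \<C>" using \<C>(2) by (intro range_from_nat_into) auto
  then have UD: "(\<Union>n. D n) = - ?S" unfolding D_def UN_disjointed_eq using cov by simp
  have Ball: "from_nat_into (insert {} \<C>) n = {} \<or> from_nat_into (insert {} \<C>) n \<in> \<B>" for n
    using range \<C>(1) by blast
  have [measurable]: "D n \<in> sets borel" for n
  proof -
    have "range (from_nat_into (insert {} \<C>)) \<subseteq> sets borel" using range \<C>(1) by (auto simp: \<B>_def)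
    from sets.range_disjointed_sets[OF this] show ?thesis by (auto simp: D_def)
  qed
  have piece: "emeasure ?M (A \<inter> D n) = emeasure ?N (A \<inter> D n)" for n
  proof -
    have sub: "D n \<subseteq> from_nat_into (insert {} \<C>) n" unfolding D_def by (rule disjointed_subset)
    show ?thesis
    proof (cases "from_nat_into (insert {} \<C>) n = {}")
      case False
      then obtain u e where ue: "from_nat_into (insert {} \<C>) n = ball u e" "density_near Y u (local_density Y u) e" "ball u e \<inter> ?S = {}"
        using Ball[of n] unfolding \<B>_def by blast
      let ?E = "A \<inter> D n"
      have E: "?E \<in> sets borel" "?E \<subseteq> ball u e" using sub ue(1) by auto
      have "emeasure ?M ?E = rays Y (indicator ?E) 0" by (rule emM[OF E(1)])
      also have "\<dots> = (\<integral>\<^sup>+x. indicator ?E x * ennreal (local_density Y u x) \<partial>lborel)"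
        by (rule density_nearD(4)[OF ue(2)]) (use E in \<open>auto simp: indicator_def\<close>)
      also have "\<dots> = (\<integral>\<^sup>+x. ennreal (density_fun Y x) * indicator ?E x \<partial>lborel)"
      proof (rule nn_integral_cong)
        fix x
        have "density_fun Y x = local_density Y u x" if "x \<in> ?E"
          using density_fun_local[OF ue(2), of x] E(2) ue(3) that by blast
        then show "indicator ?E x * ennreal (local_density Y u x) = ennreal (density_fun Y x) * indicator ?E x"
          by (cases "x \<in> ?E") auto
      qed
      also have "\<dots> = emeasure ?N ?E" by (rule emeasure_density[symmetric]) (use E in auto)
      finally show ?thesis .
    qed (use sub in auto)
  qed
  have dec: "emeasure L A = (\<Sum>n. emeasure L (A \<inter> D n))" if "sets L = sets borel" "emeasure L ?S = 0" for L :: "'v measure"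
  proof -
    have m: "\<And>n. D n \<in> sets L" "A \<in> sets L" "?S \<in> sets L" using that by auto
    have "(\<Sum>n. emeasure L (A \<inter> D n)) = emeasure L (\<Union>n. A \<inter> D n)"
      by (rule suminf_emeasure) (use m disjoint_family_disjointed[of "from_nat_into (insert {} \<C>)"] in \<open>auto simp: disjoint_family_on_def D_def\<close>)
    also have "(\<Union>n. A \<inter> D n) = A - ?S" using UD by blast
    also have "emeasure L (A - ?S) = emeasure L A" using m that(2) by (intro emeasure_Diff_null_set) (auto simp: null_sets_def)
    finally show ?thesis by simp
  qed
  show "emeasure ?M A = emeasure ?N A" using dec[of ?M] dec[of ?N] S0 S1 piece by simp
qed simp

section \<open>Splines tested against continuous functions of compact support\<close>

lemma bounded_support:
  fixes f :: "'a::euclidean_space \<Rightarrow> complex"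
  assumes "continuous_on UNIV f" "compact (closure {x. f x \<noteq> 0})"
  obtains C where "\<And>x. norm (f x) \<le> C * indicator (closure {x. f x \<noteq> 0}) x"
proof -
  let ?K = "closure {x. f x \<noteq> 0}"
  have "bounded (f ` ?K)"
    using assms by (intro compact_imp_bounded compact_continuous_image) (auto intro: continuous_on_subset)
  then obtain C where C: "\<And>x. x \<in> ?K \<Longrightarrow> norm (f x) \<le> C" unfolding bounded_iff by blast
  have "norm (f x) \<le> C * indicator ?K x" for x
  proof (cases "x \<in> ?K")
    case False
    then have "f x = 0" using closure_subset[of "{x. f x \<noteq> 0}"] by auto
    then show ?thesis using False by simp
  qed (use C in simp)
  then show ?thesis by (rule that)
qed

lemma integrable_ray_measure:
  fixes f :: "'v::euclidean_space \<Rightarrow> complex"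
  assumes pos: "\<And>a. a \<in> set Z \<Longrightarrow> 0 < w \<bullet> a"
    and f: "continuous_on UNIV f" "compact (closure {x. f x \<noteq> 0})"
  shows "integrable (ray_measure Z) f"
proof (rule integrableI_bounded)
  show [measurable]: "f \<in> borel_measurable (ray_measure Z)"
    using borel_measurable_continuous_onI[OF f(1)] by simp
  obtain C where C: "\<And>x. norm (f x) \<le> C * indicator (closure {x. f x \<noteq> 0}) x"
    by (rule bounded_support[OF f]) blast
  have "(\<integral>\<^sup>+x. ennreal (norm (f x)) \<partial>ray_measure Z) = rays Z (\<lambda>x. ennreal (norm (f x))) 0"
    using borel_measurable_continuous_onI[OF f(1)] by (intro nn_integral_ray_measure) measurable
  also have "\<dots> < \<infinity>"
  proof (rule rays_bounded_finite[OF pos compact_imp_bounded[OF f(2)]])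
    fix x
    show "ennreal (norm (f x)) \<le> ennreal C * indicator (closure {x. f x \<noteq> 0}) x"
      using ennreal_leI[OF C[of x]] by (auto simp: indicator_def split: if_splits)
  qed
  finally show "(\<integral>\<^sup>+x. ennreal (norm (f x)) \<partial>ray_measure Z) < \<infinity>" .
qed

lemma integral_ray_measure:
  fixes f :: "'v::euclidean_space \<Rightarrow> complex"
  assumes [measurable]: "f \<in> borel_measurable borel"
  shows "(LINT x|ray_measure Z. f x) =
    (LINT t : PiE {..<length Z} (\<lambda>_. {0::real..}) | PiM {..<length Z} (\<lambda>_. lborel). f (\<Sum>i<length Z. t i *\<^sub>R (Z ! i)))"
proof -
  let ?P = "PiM {..<length Z} (\<lambda>_. lborel :: real measure)" and ?O = "PiE {..<length Z} (\<lambda>_. {0::real..})"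
  have [measurable]: "?O \<in> sets ?P" by (intro sets_PiM_I_finite) auto
  have i: "indicator ?O = (\<lambda>t. ennreal (indicator ?O t))" by (auto simp: indicator_def)
  have "(LINT x|ray_measure Z. f x) = (\<integral>t. f (\<Sum>i<length Z. t i *\<^sub>R (Z ! i)) \<partial>density ?P (indicator ?O))"
    unfolding ray_measure_def by (rule integral_distr) measurable
  also have "\<dots> = (\<integral>t. indicator ?O t *\<^sub>R f (\<Sum>i<length Z. t i *\<^sub>R (Z ! i)) \<partial>?P)"
    unfolding i by (rule integral_density) auto
  finally show ?thesis by (simp add: set_lebesgue_integral_def)
qed

lemma integral_ray_measure_near:
  fixes f :: "'v::euclidean_space \<Rightarrow> complex"
  assumes dens: "density_near Z v q e" and [measurable]: "f \<in> borel_measurable borel"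
    and f0: "\<And>x. x \<notin> ball v e \<Longrightarrow> f x = 0"
  shows "(LINT x|ray_measure Z. f x) = (LINT x|lborel. of_real (q x) * f x)"
proof -
  note D = density_nearD[OF dens]
  note [measurable] = borel_measurable_real_polynomial[OF D(1)]
  have [measurable]: "ball v e \<in> sets (ray_measure Z)" by simp
  have eq: "density (ray_measure Z) (indicator (ball v e)) = density lborel (\<lambda>x. ennreal (indicator (ball v e) x * q x))"
  proof (rule measure_eqI)
    fix A assume "A \<in> sets (density (ray_measure Z) (indicator (ball v e)))"
    then have A[measurable]: "A \<in> sets borel" by simp
    have "emeasure (density (ray_measure Z) (indicator (ball v e))) A = (\<integral>\<^sup>+x. indicator (ball v e \<inter> A) x \<partial>ray_measure Z)"
      by (subst emeasure_density) (auto intro!: nn_integral_cong simp del: nn_integral_indicator simp: indicator_inter_arith)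
    also have "\<dots> = rays Z (indicator (ball v e \<inter> A)) 0" by (rule nn_integral_ray_measure) measurable
    also have "\<dots> = (\<integral>\<^sup>+x. indicator (ball v e \<inter> A) x * ennreal (q x) \<partial>lborel)"
      by (rule D(4)) (auto simp: indicator_def)
    also have "\<dots> = emeasure (density lborel (\<lambda>x. ennreal (indicator (ball v e) x * q x))) A"
      by (subst emeasure_density) (auto simp: indicator_def intro!: nn_integral_cong)
    finally show "emeasure (density (ray_measure Z) (indicator (ball v e))) A = \<dots>" .
  qed simp
  have i: "indicator (ball v e) x *\<^sub>R f x = f x" for x
  proof (cases "x \<in> ball v e")
    case False
    show ?thesis unfolding f0[OF False] by simp
  qed simp
  have "(LINT x|ray_measure Z. f x) = (LINT x|density (ray_measure Z) (\<lambda>x. ennreal (indicator (ball v e) x)). f x)"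
    by (subst integral_density) (auto simp: i)
  also have "(\<lambda>x. ennreal (indicator (ball v e) x)) = indicator (ball v e)" by (auto simp: indicator_def)
  also have "(LINT x|density (ray_measure Z) (indicator (ball v e)). f x) =
      (LINT x|lborel. (indicator (ball v e) x * q x) *\<^sub>R f x)"
    unfolding eq using D(3) by (intro integral_density) (auto simp: indicator_def)
  also have "\<dots> = (LINT x|lborel. of_real (q x) * f x)"
  proof (rule Bochner_Integration.integral_cong[OF refl])
    fix x
    show "(indicator (ball v e) x * q x) *\<^sub>R f x = of_real (q x) * f x"
    proof (cases "x \<in> ball v e")
      case False
      show ?thesis unfolding f0[OF False] by simp
    qed (simp add: scaleR_conv_of_real)
  qed
  finally show ?thesis .
qed

text \<open>Dividing the measure by \<kappa> multiplies densities by \<kappa>; this is the origin of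
  the factor \<kappa> in front of the local densities below.\<close>

lemma integral_scale_lborel:
  fixes h :: "'v::euclidean_space \<Rightarrow> complex"
  assumes [measurable]: "h \<in> borel_measurable borel" and \<kappa>: "0 < \<kappa>"
  shows "integrable (scale_measure (inverse (ennreal \<kappa>)) lborel) h \<longleftrightarrow> integrable lborel h"
    and "(LINT x|scale_measure (inverse (ennreal \<kappa>)) lborel. h x) = (LINT x|lborel. h x) / \<kappa>"
proof -
  have eq: "scale_measure (inverse (ennreal \<kappa>)) lborel = density lborel (\<lambda>_. ennreal (1 / \<kappa>))"
    using \<kappa> by (intro measure_eqI) (auto simp: emeasure_density nn_integral_cmult inverse_ennreal divide_inverse)
  have "integrable (density lborel (\<lambda>_. ennreal (1 / \<kappa>))) h \<longleftrightarrow> integrable lborel (\<lambda>x. (1 / \<kappa>) *\<^sub>R h x)"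
    using \<kappa> by (intro integrable_density) auto
  moreover have "integrable lborel (\<lambda>x. (1 / \<kappa>) *\<^sub>R h x) \<longleftrightarrow> integrable lborel h"
    using integrable_scaleR_right[of "1 / \<kappa>" lborel h] integrable_scaleR_right[of \<kappa> lborel "\<lambda>x. (1 / \<kappa>) *\<^sub>R h x"] \<kappa>
    by auto
  ultimately show "integrable (scale_measure (inverse (ennreal \<kappa>)) lborel) h \<longleftrightarrow> integrable lborel h"
    unfolding eq by simp
  have "(LINT x|density lborel (\<lambda>_. ennreal (1 / \<kappa>)). h x) = (LINT x|lborel. (1 / \<kappa>) *\<^sub>R h x)"
    using \<kappa> by (intro integral_density) auto
  then show "(LINT x|scale_measure (inverse (ennreal \<kappa>)) lborel. h x) = (LINT x|lborel. h x) / \<kappa>"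
    unfolding eq by (simp add: scaleR_conv_of_real)
qed

lemma exp_linear_sum:
  fixes \<phi> :: "'v::euclidean_space \<Rightarrow> complex"
  assumes "linear \<phi>"
  shows "exp (- (\<Sum>i<length Z. of_real (t i) * map (\<lambda>a. - \<phi> a) Z ! i)) = exp (\<phi> (\<Sum>i<length Z. t i *\<^sub>R (Z ! i)))"
proof -
  interpret linear \<phi> by fact
  have "\<phi> (\<Sum>i<length Z. t i *\<^sub>R (Z ! i)) = (\<Sum>i<length Z. of_real (t i) * \<phi> (Z ! i))"
    by (simp add: sum scale scaleR_conv_of_real)
  moreover have "(\<Sum>i<length Z. of_real (t i) * map (\<lambda>a. - \<phi> a) Z ! i) = - (\<Sum>i<length Z. of_real (t i) * \<phi> (Z ! i))"
    by (simp flip: sum_negf)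
  ultimately show ?thesis by simp
qed

text \<open>The identity that the spline with parameters from \<phi> is
  \<open>exp \<circ> \<phi>\<close> times the spline with zero parameters: the exponential is moved
  to the test function, which stays continuous with compact support.\<close>

lemma spline_exists:
  fixes \<Lambda> :: "'v::euclidean_space set" and \<phi> :: "'v \<Rightarrow> complex"
  assumes pos: "\<And>a. a \<in> set Z \<Longrightarrow> 0 < w \<bullet> a" and sp: "span (set Z) = UNIV" and \<phi>: "linear \<phi>"
    and \<kappa>: "lattice_lborel \<Lambda> = scale_measure (inverse (ennreal \<kappa>)) lborel" "0 < \<kappa>"
  defines "F \<equiv> (\<lambda>x. exp (\<phi> x) * of_real (\<kappa> * density_fun Z x))"
  shows "is_spline \<Lambda> Z (map (\<lambda>a. - \<phi> a) Z) F"
  unfolding is_spline_def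
proof (intro conjI allI impI)
  fix x assume "x \<notin> cone_of (set Z)"
  then show "F x = 0" by (simp add: F_def density_fun_def regular_points_eq)
next
  note [measurable] = borel_measurable_density_fun[OF pos]
  fix f :: "'v \<Rightarrow> complex" assume f: "continuous_on UNIV f \<and> compact (closure {x. f x \<noteq> 0})"
  have cont: "continuous_on UNIV \<phi>" using \<phi> by (simp add: linear_continuous_on linear_conv_bounded_linear)
  let ?g = "\<lambda>x. exp (\<phi> x) * f x"
  have gc: "continuous_on UNIV ?g" using f cont by (intro continuous_intros) auto
  have gs: "compact (closure {x. ?g x \<noteq> 0})" using f by simp
  have [measurable]: "?g \<in> borel_measurable borel" by (rule borel_measurable_continuous_onI[OF gc])
  have int: "integrable (ray_measure Z) ?g" by (rule integrable_ray_measure[OF pos gc gs])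
  have eq: "f x * F x = \<kappa> *\<^sub>R (density_fun Z x *\<^sub>R ?g x)" for x
    by (simp add: F_def scaleR_conv_of_real mult_ac)
  have nn: "0 \<le> density_fun Z x" for x by (rule density_fun_nonneg[OF pos])
  have rd: "ray_measure Z = density lborel (\<lambda>x. ennreal (density_fun Z x))" by (rule ray_measure_eq_density[OF pos sp])
  have "integrable (density lborel (\<lambda>x. ennreal (density_fun Z x))) ?g \<longleftrightarrow> integrable lborel (\<lambda>x. density_fun Z x *\<^sub>R ?g x)"
    by (rule integrable_density) (simp_all add: nn)
  then have int': "integrable lborel (\<lambda>x. density_fun Z x *\<^sub>R ?g x)" using int by (simp add: rd)
  show "integrable (lattice_lborel \<Lambda>) (\<lambda>x. f x * F x)"
    unfolding \<kappa>(1) eq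
    by (rule integral_scale_lborel(1)[THEN iffD2, OF _ \<kappa>(2) integrable_scaleR_right[OF int']]) measurable
  have "(LINT x|lattice_lborel \<Lambda>. f x * F x) = (LINT x|lborel. density_fun Z x *\<^sub>R ?g x)"
    unfolding \<kappa>(1) eq by (subst integral_scale_lborel(2)) (use \<kappa>(2) in \<open>auto simp: scaleR_conv_of_real\<close>)
  also have "\<dots> = (LINT x|ray_measure Z. ?g x)"
    unfolding rd by (rule integral_density[symmetric]) (simp_all add: nn)
  also have "\<dots> = (LINT t : PiE {..<length Z} (\<lambda>_. {0::real..}) | PiM {..<length Z} (\<lambda>_. lborel).
           exp (- (\<Sum>i<length Z. of_real (t i) * map (\<lambda>a. - \<phi> a) Z ! i)) * f (\<Sum>i<length Z. t i *\<^sub>R (Z ! i)))"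
    unfolding exp_linear_sum[OF \<phi>] by (rule integral_ray_measure) measurable
  finally show "(LINT x|lattice_lborel \<Lambda>. f x * F x) = \<dots>" .
qed

lemma polynomial_eq_on_ball:
  fixes g h :: "'v::euclidean_space \<Rightarrow> complex"
  assumes "polynomial_function g" "polynomial_function h" "0 < e" "\<And>x. x \<in> ball u e \<Longrightarrow> g x = h x"
  shows "g = h"
proof
  fix x
  have p: "real_polynomial_function (\<lambda>x. Re (g x - h x))" "real_polynomial_function (\<lambda>x. Im (g x - h x))"
    using polynomial_function_diff[OF assms(1,2)] unfolding polynomial_function_complex_iff by auto
  have "Re (g x - h x) = 0" by (rule real_polynomial_eq_0[OF p(1) assms(3), of u]) (simp add: assms(4))
  moreover have "Im (g x - h x) = 0" by (rule real_polynomial_eq_0[OF p(2) assms(3), of u]) (simp add: assms(4))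
  ultimately show "g x = h x" by (simp add: complex_eq_iff)
qed

text \<open>With \<open>h\<close> the difference of the two polynomials, the test function is a bump
  at \<open>v\<close> times the conjugate of \<open>h\<close> times \<open>exp (- \<phi> x)\<close>.
  The spline condition then makes the integral of the bump times the square of
  \<open>norm (h x)\<close> zero.\<close>

lemma spline_polynomial_unique:
  fixes \<Lambda> :: "'v::euclidean_space set" and \<phi> :: "'v \<Rightarrow> complex"
  assumes pos: "\<And>a. a \<in> set Z \<Longrightarrow> 0 < w \<bullet> a" and \<phi>: "linear \<phi>"
    and \<kappa>: "lattice_lborel \<Lambda> = scale_measure (inverse (ennreal \<kappa>)) lborel" "0 < \<kappa>"
    and F: "is_spline \<Lambda> Z (map (\<lambda>a. - \<phi> a) Z) F"
    and g: "polynomial_function g" "\<forall>\<^sub>F y in nhds v. F y = exp (\<phi> y) * g y"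
    and v: "v \<notin> singular_points Z"
  shows "g = (\<lambda>x. of_real (\<kappa> * local_density Z v x))"
proof -
  let ?T = "local_density Z v"
  obtain e1 where e1: "density_near Z v ?T e1" by (rule density_near_local_density[OF pos v])
  obtain e2 where e2: "0 < e2" "\<And>y. y \<in> ball v e2 \<Longrightarrow> F y = exp (\<phi> y) * g y"
    using g(2) unfolding eventually_nhds_metric by (auto simp: dist_commute)
  define e where "e = min e1 e2"
  have dens: "density_near Z v ?T e"
    by (rule density_near_subset[OF e1]) (use density_nearD(2)[OF e1] e2(1) in \<open>auto simp: e_def\<close>)
  note D = density_nearD[OF dens]
  have Fe: "F y = exp (\<phi> y) * g y" if "y \<in> ball v e" for y using e2(2) that by (simp add: e_def)
  let ?h = "\<lambda>x. g x - of_real (\<kappa> * ?T x)"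
  have Tp: "polynomial_function (\<lambda>x. of_real (\<kappa> * ?T x) :: complex)"
    by (intro polynomial_function_of_real real_polynomial_function.intros(4) real_polynomial_function.intros(2) D(1))
  have hc: "continuous_on UNIV ?h"
    by (intro continuous_on_polymonial_function polynomial_function_diff g(1) Tp)
  have gc: "continuous_on UNIV g" by (rule continuous_on_polymonial_function[OF g(1)])
  have Tc: "continuous_on UNIV (\<lambda>x. of_real (?T x) :: complex)"
    by (intro continuous_on_polymonial_function polynomial_function_of_real D(1))
  have \<phi>c: "continuous_on UNIV \<phi>" using \<phi> by (simp add: linear_continuous_on linear_conv_bounded_linear)
  define r where "r = e / 2"
  have r: "0 < r" "cball v r \<subseteq> ball v e" using D(2) by (auto simp: r_def)
  \<comment> \<open>A tent function suffices, since \<open>is_spline\<close> admits all continuous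
    test functions. Its support is a closed ball inside the ball of radius \<open>e\<close>, where
    both descriptions of the spline hold.\<close>
  let ?b = "\<lambda>x. max 0 (r - dist v x)"
  let ?f = "\<lambda>x. of_real (?b x) * cnj (?h x)"
  have bc: "continuous_on UNIV (\<lambda>x. complex_of_real (?b x))" by (intro continuous_intros)
  have f0: "?f x = 0" if "x \<notin> cball v r" for x using that by simp
  have f0e: "?f x = 0" if "x \<notin> ball v e" for x by (rule f0) (use that r(2) in blast)
  have supp: "compact (closure {x. k x * ?f x \<noteq> 0})" for k :: "'v \<Rightarrow> complex"
  proof -
    have "{x. k x * ?f x \<noteq> 0} \<subseteq> cball v r" using f0 by fastforce
    then have "bounded {x. k x * ?f x \<noteq> 0}" by (rule bounded_subset[OF bounded_cball])
    then show ?thesis by (simp add: compact_closure)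
  qed
  have fc: "continuous_on UNIV ?f" by (rule continuous_on_mult[OF bc continuous_on_cnj[OF hc]])
  have int: "integrable lborel (\<lambda>x. k x * ?f x)" if "continuous_on UNIV k" for k :: "'v \<Rightarrow> complex"
  proof -
    have "integrable lborel (\<lambda>x. indicator (cball v r) x *\<^sub>R (k x * ?f x))"
      by (rule borel_integrable_compact[OF compact_cball continuous_on_subset[OF continuous_on_mult[OF that fc] subset_UNIV]])
    moreover have "(\<lambda>x. indicator (cball v r) x *\<^sub>R (k x * ?f x)) = (\<lambda>x. k x * ?f x)"
      using f0 by (auto simp: fun_eq_iff indicator_def)
    ultimately show ?thesis by simp
  qed
  let ?k = "\<lambda>x. exp (- \<phi> x) * ?f x"
  have kc: "continuous_on UNIV ?k"
    by (rule continuous_on_mult[OF continuous_on_exp[OF continuous_on_minus[OF \<phi>c]] fc])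
  have [measurable]: "?f \<in> borel_measurable borel" "g \<in> borel_measurable borel"
    using borel_measurable_continuous_onI fc gc by blast+
  have "(LINT x|lattice_lborel \<Lambda>. ?k x * F x) =
      (LINT t : PiE {..<length Z} (\<lambda>_. {0::real..}) | PiM {..<length Z} (\<lambda>_. lborel).
           exp (- (\<Sum>i<length Z. of_real (t i) * map (\<lambda>a. - \<phi> a) Z ! i)) * ?k (\<Sum>i<length Z. t i *\<^sub>R (Z ! i)))"
    using F kc supp[of "\<lambda>x. exp (- \<phi> x)"] unfolding is_spline_def by blast
  also have "\<dots> = (LINT t : PiE {..<length Z} (\<lambda>_. {0::real..}) | PiM {..<length Z} (\<lambda>_. lborel).
           ?f (\<Sum>i<length Z. t i *\<^sub>R (Z ! i)))"
    unfolding exp_linear_sum[OF \<phi>] mult.assoc[symmetric] exp_add[symmetric] by simp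
  also have "\<dots> = (LINT x|ray_measure Z. ?f x)" by (rule integral_ray_measure[symmetric]) measurable
  also have "\<dots> = (LINT x|lborel. of_real (?T x) * ?f x)"
    by (rule integral_ray_measure_near[OF dens _ f0e]) measurable
  finally have A: "(LINT x|lattice_lborel \<Lambda>. ?k x * F x) = (LINT x|lborel. of_real (?T x) * ?f x)" .
  have "(LINT x|lattice_lborel \<Lambda>. ?k x * F x) = (LINT x|lattice_lborel \<Lambda>. g x * ?f x)"
  proof (rule Bochner_Integration.integral_cong[OF refl])
    fix x
    show "?k x * F x = g x * ?f x"
    proof (cases "x \<in> ball v e")
      case True
      have "exp (- \<phi> x) * exp (\<phi> x) = 1" by (simp flip: exp_add)
      then have "exp (- \<phi> x) * y * (exp (\<phi> x) * z) = z * y" for y z by (metis (no_types, opaque_lifting) mult.assoc mult.commute mult.left_neutral)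
      then show ?thesis unfolding Fe[OF True] by blast
    next
      case False
      show ?thesis unfolding f0e[OF False] by simp
    qed
  qed
  also have "\<dots> = (LINT x|lborel. g x * ?f x) / \<kappa>"
    unfolding \<kappa>(1)
    by (rule integral_scale_lborel(2)[OF borel_measurable_continuous_onI[OF continuous_on_mult[OF gc fc]] \<kappa>(2)])
  finally have "(LINT x|lborel. g x * ?f x) = of_real \<kappa> * (LINT x|lborel. of_real (?T x) * ?f x)"
    using A \<kappa>(2) by (simp add: field_simps)
  then have "(LINT x|lborel. ?h x * ?f x) = 0"
    using int[OF gc] int[OF Tc] by (simp add: left_diff_distrib mult.assoc)
  moreover have hf: "?h x * ?f x = of_real (?b x * (norm (?h x))\<^sup>2)" for x
    using complex_norm_square[of "?h x"] by simp
  ultimately have "(LINT x|lborel. ?b x * (norm (?h x))\<^sup>2) = 0"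
    by (simp only: hf integral_complex_of_real of_real_eq_0_iff)
  moreover have intb: "integrable lborel (\<lambda>x. ?b x * (norm (?h x))\<^sup>2)"
    using int[OF hc] by (simp only: hf complex_of_real_integrable_eq)
  ultimately have "AE x in lborel. ?b x * (norm (?h x))\<^sup>2 = 0"
    by (subst (asm) integral_nonneg_eq_0_iff_AE) auto
  then have AE0: "AE x in lborel. x \<in> ball v r \<longrightarrow> 0 \<le> - norm (?h x)"
    by eventually_elim auto
  have "g x = of_real (\<kappa> * ?T x)" if "x \<in> ball v r" for x
    using continuous_nonneg_AE_ball[OF continuous_on_minus[OF continuous_on_norm[OF hc]] open_ball AE0 that] by simp
  then show ?thesis by (rule polynomial_eq_on_ball[OF g(1) Tp r(1)])
qed

text \<open>The glued density witnesses that the choice in \<open>spline\<close> has a solution; the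
  uniqueness of the polynomial then describes whichever solution is chosen.\<close>

lemma spline_near:
  fixes \<Lambda> :: "'v::euclidean_space set" and \<phi> :: "'v \<Rightarrow> complex"
  assumes pos: "\<And>a. a \<in> set Z \<Longrightarrow> 0 < w \<bullet> a" and sp: "span (set Z) = UNIV" and \<phi>: "linear \<phi>"
    and \<kappa>: "lattice_lborel \<Lambda> = scale_measure (inverse (ennreal \<kappa>)) lborel" "0 < \<kappa>"
    and v: "v \<notin> singular_points Z"
  shows "\<forall>\<^sub>F y in nhds v. spline \<Lambda> Z (map (\<lambda>a. - \<phi> a) Z) y = exp (\<phi> y) * of_real (\<kappa> * local_density Z v y)"
proof -
  let ?\<mu> = "map (\<lambda>a. - \<phi> a) Z"
  let ?P = "\<lambda>F. is_spline \<Lambda> Z ?\<mu> F \<and>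
        (\<forall>\<phi> :: 'v \<Rightarrow> complex. linear \<phi> \<and> ?\<mu> = map (\<lambda>a. - \<phi> a) Z \<longrightarrow>
           (\<forall>x\<in>regular_points Z. \<exists>g :: 'v \<Rightarrow> complex. polynomial_function g \<and>
              (\<forall>\<^sub>F y in nhds x. F y = exp (\<phi> y) * g y)))"
  have "?P (\<lambda>x. exp (\<phi> x) * of_real (\<kappa> * density_fun Z x))"
  proof (intro conjI allI impI ballI)
    show "is_spline \<Lambda> Z ?\<mu> (\<lambda>x. exp (\<phi> x) * of_real (\<kappa> * density_fun Z x))"
      by (rule spline_exists[OF pos sp \<phi> \<kappa>])
    fix \<psi> :: "'v \<Rightarrow> complex" and x assume \<psi>: "linear \<psi> \<and> ?\<mu> = map (\<lambda>a. - \<psi> a) Z" and "x \<in> regular_points Z"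
    then have x: "x \<notin> singular_points Z" by (simp add: regular_points_eq)
    have "\<phi> a = \<psi> a" if "a \<in> set Z" for a using \<psi> that by simp
    \<comment> \<open>The list spans, so its parameters determine the functional: the quantifier
      over functionals in \<open>spline\<close> concerns only \<phi>.\<close>
    then have "\<phi> = \<psi>" using linear_eq_on_span[OF \<phi>, of \<psi> "set Z"] \<psi> sp by blast
    obtain e where e: "density_near Z x (local_density Z x) e" "ball x e \<inter> singular_points Z = {}"
      by (rule density_near_avoiding_singular[OF pos x])
    have "\<forall>\<^sub>F y in nhds x. y \<in> ball x e"
      using density_nearD(2)[OF e(1)] by (intro eventually_nhds_in_open) auto
    then have ev: "\<forall>\<^sub>F y in nhds x. exp (\<phi> y) * of_real (\<kappa> * density_fun Z y) = exp (\<psi> y) * complex_of_real (\<kappa> * local_density Z x y)"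
    proof eventually_elim
      case (elim y)
      then have "y \<notin> singular_points Z" using e(2) by blast
      from density_fun_local[OF e(1) elim this] show ?case by (simp add: \<open>\<phi> = \<psi>\<close>)
    qed
    have "polynomial_function (\<lambda>y. complex_of_real (\<kappa> * local_density Z x y))"
      by (intro polynomial_function_of_real real_polynomial_function.intros(4) real_polynomial_function.intros(2)
          density_nearD(1)[OF e(1)])
    with ev show "\<exists>g. polynomial_function g \<and>
       (\<forall>\<^sub>F y in nhds x. exp (\<phi> y) * of_real (\<kappa> * density_fun Z y) = exp (\<psi> y) * g y)" by blast
  qed
  then have S: "?P (spline \<Lambda> Z ?\<mu>)" unfolding spline_def by (rule someI[where P = ?P])
  show ?thesis
  proof (cases "v \<in> cone_of (set Z)")
    case True
    then have "v \<in> regular_points Z" using v by (simp add: regular_points_eq)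
    then obtain g where g: "polynomial_function g" "\<forall>\<^sub>F y in nhds v. spline \<Lambda> Z ?\<mu> y = exp (\<phi> y) * g y"
      using S \<phi> by blast
    have "g = (\<lambda>x. of_real (\<kappa> * local_density Z v x))"
      by (rule spline_polynomial_unique[OF pos \<phi> \<kappa> conjunct1[OF S] g v])
    with g(2) show ?thesis by simp
  next
    case False
    have "open (- cone_of (set Z))" using closed_cone_of[of "set Z"] by (simp add: closed_def)
    then have "\<forall>\<^sub>F y in nhds v. y \<in> - cone_of (set Z)" using False by (intro eventually_nhds_in_open) auto
    then show ?thesis
    proof eventually_elim
      case (elim y)
      then have "spline \<Lambda> Z ?\<mu> y = 0" using S unfolding is_spline_def by blast
      then show ?case using local_density_outside_cone[OF False] by simp
    qed
  qed
qed

section \<open>The operator of infinite order on exponential polynomials\<close>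

text \<open>Both kinds of factors of \<open>Q_hat\<close> in one family, with \<open>z\<close> in
  the place of \<open>exp (\<phi> a)\<close>. The series depends on the character only, not on the
  representative \<phi>.\<close>

definition char_series :: "complex \<Rightarrow> complex fps" where
  "char_series z = (if z = 1 then fps_X / (1 - fps_exp (- 1))
     else 1 / (1 - fps_const (inverse z) * fps_exp (- 1)))"

text \<open>The first factor is the symbol of the twisted difference
  \<open>g x - inverse z * g (x - a)\<close>. For \<open>z = 1\<close> it has order one, so it
  divides \<open>fps_X\<close>; otherwise it is a unit.\<close>

lemma char_series_mult:
  assumes "z \<noteq> 0"
  shows "(1 - fps_const (inverse z) * fps_exp (- 1)) * char_series z = (if z = 1 then fps_X else 1)"
proof (cases "z = 1")
  case True
  let ?f = "1 - fps_exp (- 1) :: complex fps"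
  have "fps_nth ?f 1 \<noteq> 0" by simp
  then have "subdegree ?f \<le> 1" and "?f \<noteq> 0" by (auto intro: subdegree_leI)
  then have "?f dvd fps_X" by (subst fps_dvd_iff) auto
  then show ?thesis using True by (simp add: char_series_def dvd_mult_div_cancel)
next
  case False
  let ?f = "1 - fps_const (inverse z) * fps_exp (- 1)"
  have "fps_nth ?f 0 \<noteq> 0" using False assms by (simp add: field_simps)
  then have "?f dvd 1" by simp
  then show ?thesis using False by (simp add: char_series_def dvd_mult_div_cancel)
qed

text \<open>
  For \<open>c a = exp (\<phi> a)\<close> this is the polynomial factor of \<open>Q_hat\<close> applied to the spline: conjugation by
  \<open>exp \<circ> \<phi>\<close> turns \<open>tilde_op \<phi> a\<close> into the plain derivative. The point \<open>u\<close> only selects the chamber.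
\<close>

definition char_poly :: "real \<Rightarrow> 'v::euclidean_space list \<Rightarrow> ('v \<Rightarrow> complex) \<Rightarrow> 'v \<Rightarrow> 'v \<Rightarrow> complex" where
  "char_poly \<kappa> X c u = foldr (\<lambda>a. fps_dir (char_series (c a)) a) X
     (\<lambda>x. of_real (\<kappa> * local_density (filter (\<lambda>a. c a = 1) X) u x))"

lemma polynomial_foldr_fps_dir:
  "polynomial_function g \<Longrightarrow> polynomial_function (foldr (\<lambda>a. fps_dir (S a) a) X g)"
  by (induction X) (simp_all add: polynomial_fps_dir)

lemma foldr_fps_dir_permute:
  assumes "mset X = mset Y" "polynomial_function g"
  shows "foldr (\<lambda>a. fps_dir (S a) a) X g = foldr (\<lambda>a. fps_dir (S a) a) Y g"
  by (rule foldr_permute_on[where D = "{g. polynomial_function g}"])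
    (use assms in \<open>auto intro: polynomial_fps_dir fps_dir_commute\<close>)

lemma dir_deriv_foldr:
  assumes "polynomial_function g"
  shows "dir_deriv b (foldr (\<lambda>a. fps_dir (S a) a) X g) = foldr (\<lambda>a. fps_dir (S a) a) X (dir_deriv b g)"
  by (induction X) (simp_all add: dir_deriv_fps_dir polynomial_foldr_fps_dir assms)

lemma polynomial_local_density:
  assumes "\<And>a. a \<in> set X \<Longrightarrow> 0 < w \<bullet> a" "u \<notin> singular_points X"
  shows "polynomial_function (\<lambda>x. complex_of_real (\<kappa> * local_density (filter P X) u x))"
proof -
  have "u \<notin> singular_points (filter P X)" using assms(2) singular_points_mono[of "filter P X" X] by auto
  then have "real_polynomial_function (local_density (filter P X) u)"
    by (rule real_polynomial_local_density[rotated]) (use assms(1) in auto)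
  then show ?thesis
    by (intro polynomial_function_of_real real_polynomial_function.intros(4) real_polynomial_function.intros(2))
qed

lemma char_poly_permute:
  assumes "mset X = mset Y" "\<And>a. a \<in> set X \<Longrightarrow> 0 < w \<bullet> a" "u \<notin> singular_points X"
  shows "char_poly \<kappa> X c u = char_poly \<kappa> Y c u"
proof -
  have "local_density (filter (\<lambda>a. c a = 1) X) u = local_density (filter (\<lambda>a. c a = 1) Y) u"
    by (rule local_density_permute) (simp add: assms(1))
  then show ?thesis unfolding char_poly_def
    using foldr_fps_dir_permute[OF assms(1) polynomial_local_density[OF assms(2,3)]] by metis
qed

lemma char_poly_cong:
  assumes "\<And>a. a \<in> set X \<Longrightarrow> c a = d a" shows "char_poly \<kappa> X c u = char_poly \<kappa> X d u"
proof -
  have "filter (\<lambda>a. c a = 1) X = filter (\<lambda>a. d a = 1) X" by (rule filter_cong) (simp_all add: assms)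
  then show ?thesis unfolding char_poly_def by (intro foldr_cong) (simp_all add: assms)
qed

text \<open>Allows sums over characters to be extended to the larger set of points attached to a
  longer list.\<close>

lemma char_poly_not_spanning:
  assumes "span (set (filter (\<lambda>a. c a = 1) X)) \<noteq> UNIV" "u \<notin> singular_points X"
  shows "char_poly \<kappa> X c u = (\<lambda>_. 0)"
proof -
  have "u \<notin> singular_points (filter (\<lambda>a. c a = 1) X)"
    using assms(2) singular_points_mono[of "filter (\<lambda>a. c a = 1) X" X] by auto
  then have "local_density (filter (\<lambda>a. c a = 1) X) u = (\<lambda>_. 0)" by (rule local_density_not_spanning[OF assms(1)])
  moreover have "foldr (\<lambda>a. fps_dir (S a) a) X (\<lambda>_. 0) = (\<lambda>_. 0)" for S :: "'a \<Rightarrow> complex fps"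
    by (induction X) (simp_all add: fps_dir_def dir_deriv_power_zero)
  ultimately show ?thesis by (simp add: char_poly_def)
qed

text \<open>The twisted difference cancels the series of \<open>a\<close>. If \<open>c a = 1\<close>
  a derivative along \<open>a\<close> is left over, which removes \<open>a\<close> from the list of
  the density; if not, nothing is left over and \<open>a\<close> was not in that list.\<close>

lemma char_poly_difference:
  fixes X :: "'v::euclidean_space list"
  assumes pos: "\<And>b. b \<in> set (a # X) \<Longrightarrow> 0 < w \<bullet> b" and u: "u \<notin> singular_points (a # X)" and c: "c a \<noteq> 0"
  shows "char_poly \<kappa> (a # X) c u x - inverse (c a) * char_poly \<kappa> (a # X) c u (x - a) = char_poly \<kappa> X c u x"
proof -
  let ?L = "\<lambda>X x. complex_of_real (\<kappa> * local_density (filter (\<lambda>a. c a = 1) X) u x)"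
  let ?f = "\<lambda>a. fps_dir (char_series (c a)) a"
  let ?d = "1 - fps_const (inverse (c a)) * fps_exp (- 1)"
  have pL: "polynomial_function (?L (a # X))" by (rule polynomial_local_density[OF pos u])
  note pF = polynomial_foldr_fps_dir[OF pL, of "\<lambda>a. char_series (c a)" X]
  have "char_poly \<kappa> (a # X) c u x - inverse (c a) * char_poly \<kappa> (a # X) c u (x - a) =
      fps_dir ?d a (fps_dir (char_series (c a)) a (foldr ?f X (?L (a # X)))) x"
    unfolding char_poly_def foldr.simps o_def by (rule fps_dir_difference[symmetric]) (rule polynomial_fps_dir[OF pF])
  also have "\<dots> = fps_dir (if c a = 1 then fps_X else 1) a (foldr ?f X (?L (a # X))) x"
    unfolding fps_dir_mult[OF pF] char_series_mult[OF c] ..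
  also have "\<dots> = foldr ?f X (?L X) x"
  proof (cases "c a = 1")
    case True
    let ?F = "filter (\<lambda>a. c a = 1) X"
    have u': "u \<notin> singular_points (a # ?F)" using u singular_points_mono[of "a # ?F" "a # X"] by auto
    have pos': "\<And>b. b \<in> set (a # ?F) \<Longrightarrow> 0 < w \<bullet> b" using pos by auto
    have pT: "polynomial_function (\<lambda>x. complex_of_real (local_density (a # ?F) u x))"
      by (intro polynomial_function_of_real real_polynomial_local_density[OF pos' u'])
    have D: "dir_deriv a (?L (a # X)) = ?L X"
      using dir_deriv_cmult[OF pT, of a "of_real \<kappa>"] dir_deriv_local_density[OF pos' u'] True by simp
    show ?thesis unfolding if_P[OF True] fps_dir_X dir_deriv_foldr[OF pL] D ..
  qed (simp add: fps_dir_1)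
  finally show ?thesis by (simp add: char_poly_def)
qed

lemma tilde_op_exp:
  fixes \<phi> :: "'v::euclidean_space \<Rightarrow> complex"
  assumes \<phi>: "linear \<phi>" and g: "polynomial_function g" and U: "open U" "x \<in> U"
    and h: "\<And>y. y \<in> U \<Longrightarrow> h y = exp (\<phi> y) * g y"
  shows "tilde_op \<phi> a h x = exp (\<phi> x) * dir_deriv a g x"
proof -
  interpret linear \<phi> by fact
  have 1: "((\<lambda>t. exp (\<phi> (x + t *\<^sub>R a))) has_vector_derivative \<phi> a * exp (\<phi> x)) (at 0)"
  proof -
    have "((\<lambda>t. exp (t *\<^sub>R \<phi> a)) has_vector_derivative \<phi> a * exp (0 *\<^sub>R \<phi> a)) (at 0)"
      by (rule exp_scaleR_has_vector_derivative_left)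
    then have "((\<lambda>t. exp (\<phi> x) * exp (t *\<^sub>R \<phi> a)) has_vector_derivative exp (\<phi> x) * (\<phi> a * exp (0 *\<^sub>R \<phi> a))) (at 0)"
      by (rule has_vector_derivative_mult_right)
    then show ?thesis by (simp add: add scale exp_add mult.commute)
  qed
  from has_vector_derivative_mult[OF 1 polynomial_line_differentiable[OF g, of x a]]
  have 2: "((\<lambda>t. exp (\<phi> (x + t *\<^sub>R a)) * g (x + t *\<^sub>R a)) has_vector_derivative
      exp (\<phi> x) * dir_deriv a g x + \<phi> a * exp (\<phi> x) * g x) (at 0)" by simp
  have "open ((\<lambda>t. x + t *\<^sub>R a) -` U)"
    by (rule open_vimage[OF U(1)]) (intro continuous_intros)
  then have "((\<lambda>t. h (x + t *\<^sub>R a)) has_vector_derivative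
      exp (\<phi> x) * dir_deriv a g x + \<phi> a * exp (\<phi> x) * g x) (at 0)"
    by (rule has_vector_derivative_transform_within_open[OF 2]) (use U(2) h in auto)
  then have "dir_deriv a h x = exp (\<phi> x) * dir_deriv a g x + \<phi> a * exp (\<phi> x) * g x"
    unfolding dir_deriv_def by (rule vector_derivative_at)
  then show ?thesis using h[OF U(2)] by (simp add: tilde_op_def)
qed

text \<open>The open set matters: iterating the operator needs the exponential form of
  \<open>h\<close> around \<open>x\<close>, not only at \<open>x\<close>.\<close>

lemma fps_op_exp:
  fixes \<phi> :: "'v::euclidean_space \<Rightarrow> complex"
  assumes \<phi>: "linear \<phi>" and g: "polynomial_function g" and U: "open U"
    and h: "\<And>y. y \<in> U \<Longrightarrow> h y = exp (\<phi> y) * g y" and x: "x \<in> U"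
  shows "fps_op S (tilde_op \<phi> a) h x = exp (\<phi> x) * fps_dir S a g x"
proof -
  have k: "(tilde_op \<phi> a ^^ k) h y = exp (\<phi> y) * (dir_deriv a ^^ k) g y" if "y \<in> U" for k y
    using that
  proof (induction k arbitrary: y)
    case (Suc k)
    show ?case unfolding funpow.simps o_def
      by (rule tilde_op_exp[OF \<phi> polynomial_dir_deriv_power[OF g] U]) (use Suc in auto)
  qed (simp add: h)
  obtain N where N: "\<And>j. j \<ge> N \<Longrightarrow> (dir_deriv a ^^ j) g = (\<lambda>x. 0)" by (rule dir_deriv_nilpotent[OF g]) blast
  have "fps_op S (tilde_op \<phi> a) h x = (\<Sum>k<N. fps_nth S k * (exp (\<phi> x) * (dir_deriv a ^^ k) g x))"
    unfolding fps_op_def k[OF x] by (rule suminf_finite) (auto simp: N)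
  then show ?thesis by (simp add: fps_dir_eq_sum[OF N] sum_distrib_left mult_ac)
qed

lemma foldr_fps_op_exp:
  fixes \<phi> :: "'v::euclidean_space \<Rightarrow> complex"
  assumes \<phi>: "linear \<phi>" and g: "polynomial_function g" and U: "open U"
    and h: "\<And>y. y \<in> U \<Longrightarrow> h y = exp (\<phi> y) * g y" and x: "x \<in> U"
  shows "foldr (\<lambda>a. fps_op (S a) (tilde_op \<phi> a)) X h x = exp (\<phi> x) * foldr (\<lambda>a. fps_dir (S a) a) X g x"
  using x
proof (induction X arbitrary: x)
  case (Cons a X)
  show ?case unfolding foldr.simps o_def
    by (rule fps_op_exp[OF \<phi> polynomial_foldr_fps_dir[OF g] U Cons.IH Cons.prems])
qed (simp add: h)

text \<open>Beyond the conjugation by the exponential, the two groups of factors have to be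
  interleaved into the order of \<open>X\<close>, which is possible because series in directional
  derivatives commute on polynomials.\<close>

lemma Q_hat_spline:
  fixes \<Lambda> :: "'v::euclidean_space set" and \<phi> :: "'v \<Rightarrow> complex"
  assumes pos: "\<And>a. a \<in> set X \<Longrightarrow> 0 < w \<bullet> a" and \<phi>: "linear \<phi>"
    and sp: "span (set (sublist_at X \<phi>)) = UNIV"
    and \<kappa>: "lattice_lborel \<Lambda> = scale_measure (inverse (ennreal \<kappa>)) lborel" "0 < \<kappa>"
    and v: "v \<notin> singular_points X"
  shows "Q_hat X \<phi> (spline \<Lambda> (sublist_at X \<phi>) (params_at X \<phi>)) v =
    exp (\<phi> v) * char_poly \<kappa> X (\<lambda>a. exp (\<phi> a)) v v"
proof -
  let ?Z = "sublist_at X \<phi>" and ?W = "filter (\<lambda>a. exp (\<phi> a) \<noteq> 1) X"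
  let ?S = "\<lambda>a. char_series (exp (\<phi> a))"
  let ?g = "\<lambda>x. complex_of_real (\<kappa> * local_density ?Z v x)"
  let ?h = "spline \<Lambda> ?Z (params_at X \<phi>)"
  have posZ: "\<And>a. a \<in> set ?Z \<Longrightarrow> 0 < w \<bullet> a" using pos by (auto simp: sublist_at_def)
  have vZ: "v \<notin> singular_points ?Z"
    using v singular_points_mono[of ?Z X] by (auto simp: sublist_at_def)
  have g: "polynomial_function ?g" unfolding sublist_at_def by (rule polynomial_local_density[OF pos v])
  obtain U where U: "open U" "v \<in> U" "\<And>y. y \<in> U \<Longrightarrow> ?h y = exp (\<phi> y) * ?g y"
    using spline_near[OF posZ sp \<phi> \<kappa> vZ] unfolding eventually_nhds params_at_def by blast
  have "foldr (\<lambda>a. fps_op (fps_X / (1 - fps_exp (- 1))) (tilde_op \<phi> a)) ?Z ?h =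
      foldr (\<lambda>a. fps_op (?S a) (tilde_op \<phi> a)) ?Z ?h"
    by (intro foldr_cong) (auto simp: sublist_at_def char_series_def)
  moreover have "foldr (\<lambda>a. fps_op (1 / (1 - fps_const (exp (- \<phi> a)) * fps_exp (- 1))) (tilde_op \<phi> a)) ?W k =
      foldr (\<lambda>a. fps_op (?S a) (tilde_op \<phi> a)) ?W k" for k
    by (intro foldr_cong) (auto simp: char_series_def exp_minus)
  ultimately have "Q_hat X \<phi> ?h v = foldr (\<lambda>a. fps_op (?S a) (tilde_op \<phi> a)) (?W @ ?Z) ?h v"
    by (simp add: Q_hat_def)
  also have "\<dots> = exp (\<phi> v) * foldr (\<lambda>a. fps_dir (?S a) a) (?W @ ?Z) ?g v"
    by (rule foldr_fps_op_exp[OF \<phi> g U(1,3,2)])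
  also have "foldr (\<lambda>a. fps_dir (?S a) a) (?W @ ?Z) ?g = foldr (\<lambda>a. fps_dir (?S a) a) X ?g"
    by (rule foldr_fps_dir_permute[OF _ g])
      (simp add: sublist_at_def add.commute flip: multiset_partition)
  also have "\<dots> = char_poly \<kappa> X (\<lambda>a. exp (\<phi> a)) v" by (simp add: char_poly_def sublist_at_def)
  finally show ?thesis .
qed

section \<open>Partition functions and zonotopes\<close>

lemma mset_invariant:
  assumes "mset X = mset Y" and swap: "\<And>a b X. H (a # b # X) = H (b # a # X)"
    and cong: "\<And>a X Y. H X = H Y \<Longrightarrow> H (a # X) = H (a # Y)"
  shows "H X = H Y"
  using assms(1)
proof (induction X arbitrary: Y)
  case (Cons a X)
  have "a \<in> set Y" using Cons.prems by (metis list.set_intros(1) set_mset_mset)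
  then obtain l r where Y: "Y = l @ a # r" by (meson split_list)
  have "H (l @ a # r) = H (a # l @ r)"
  proof (induction l)
    case (Cons b l)
    from cong[OF Cons] have "H (b # l @ a # r) = H (b # a # l @ r)" .
    also have "\<dots> = H (a # b # l @ r)" by (rule swap)
    finally show ?case by simp
  qed simp
  moreover have "mset X = mset (l @ r)" using Cons.prems Y by simp
  ultimately show ?case using Cons.IH[of "l @ r"] cong[of X "l @ r" a] Y by simp
qed simp

definition solutions :: "'v::real_vector list \<Rightarrow> 'v \<Rightarrow> nat list set" where
  "solutions X v = {ns. length ns = length X \<and> (\<Sum>i<length X. real (ns ! i) *\<^sub>R (X ! i)) = v}"

lemma partition_function_eq: "partition_function X v = card (solutions X v)"
  by (simp add: partition_function_def solutions_def)

lemma Cons_in_solutions: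
  "n # ns \<in> solutions (a # X) v \<longleftrightarrow> ns \<in> solutions X (v - real n *\<^sub>R a)"
  by (auto simp: solutions_def sum.lessThan_Suc_shift algebra_simps simp del: sum.lessThan_Suc)

lemma solutions_Nil: "solutions [] v = (if v = 0 then {[]} else {})"
  by (auto simp: solutions_def)

lemma solutions_Cons: "solutions (a # X) v = (\<Union>n. (#) n ` solutions X (v - real n *\<^sub>R a))"
proof (intro equalityI subsetI)
  fix ns assume ns: "ns \<in> solutions (a # X) v"
  then obtain n ms where "ns = n # ms" by (cases ns) (auto simp: solutions_def)
  then show "ns \<in> (\<Union>n. (#) n ` solutions X (v - real n *\<^sub>R a))" using ns by (auto simp: Cons_in_solutions)
qed (auto simp: Cons_in_solutions)

lemma solutions_outside_cone: "v \<notin> cone_of (set X) \<Longrightarrow> solutions X v = {}"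
proof (induction X arbitrary: v)
  case (Cons a X)
  have "v - real n *\<^sub>R a \<notin> cone_of (set X)" for n
  proof
    assume "v - real n *\<^sub>R a \<in> cone_of (set X)"
    then have "(v - real n *\<^sub>R a) + real n *\<^sub>R a \<in> cone_of (set (a # X))"
      using cone_of_mono[of "set X" "set (a # X)"] by (intro cone_of_add cone_of_scaleR) (auto intro: cone_of_superset)
    then show False using Cons.prems by simp
  qed
  then show ?case unfolding solutions_Cons using Cons.IH by simp
qed (auto simp: solutions_Nil)

lemma partition_function_outside_cone: "v \<notin> cone_of (set X) \<Longrightarrow> partition_function X v = 0"
  by (simp add: partition_function_eq solutions_outside_cone)

lemma cone_of_inner_nonneg:
  assumes "x \<in> cone_of A" "\<And>a. a \<in> A \<Longrightarrow> 0 < w \<bullet> a" shows "0 \<le> w \<bullet> x"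
  using cone_of_least[OF assms(1), of "{x. 0 \<le> w \<bullet> x}"] assms(2) by (auto simp: inner_add_right intro: less_imp_le)

text \<open>Pairing with \<open>w\<close> bounds every coefficient. Finiteness is essential because
  \<open>partition_function\<close> is a \<open>card\<close>, which would be \<open>0\<close> on an
  infinite set.\<close>

lemma finite_solutions:
  assumes "\<And>a. a \<in> set X \<Longrightarrow> 0 < w \<bullet> a" shows "finite (solutions X v)"
  using assms
proof (induction X arbitrary: v)
  case (Cons a X)
  have wa: "0 < w \<bullet> a" using Cons.prems by simp
  let ?K = "nat \<lceil>(w \<bullet> v) / (w \<bullet> a)\<rceil>"
  have empty: "solutions X (v - real n *\<^sub>R a) = {}" if "n > ?K" for n
  proof (rule solutions_outside_cone)
    have "(w \<bullet> v) / (w \<bullet> a) < real n" using that by linarith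
    then have "w \<bullet> (v - real n *\<^sub>R a) < 0" using wa by (simp add: inner_diff_right field_simps)
    then show "v - real n *\<^sub>R a \<notin> cone_of (set X)"
      using cone_of_inner_nonneg[of "v - real n *\<^sub>R a" "set X" w] Cons.prems by fastforce
  qed
  have "solutions (a # X) v \<subseteq> (\<Union>n\<in>{..?K}. (#) n ` solutions X (v - real n *\<^sub>R a))"
  proof
    fix ns assume "ns \<in> solutions (a # X) v"
    then obtain n where n: "ns \<in> (#) n ` solutions X (v - real n *\<^sub>R a)" unfolding solutions_Cons by blast
    then have "n \<le> ?K" using empty[of n] by (cases "n > ?K") auto
    with n show "ns \<in> (\<Union>n\<in>{..?K}. (#) n ` solutions X (v - real n *\<^sub>R a))" by blast
  qed
  moreover have "finite (\<Union>n\<in>{..?K}. (#) n ` solutions X (v - real n *\<^sub>R a))" using Cons by auto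
  ultimately show ?case by (rule finite_subset)
qed (simp add: solutions_Nil)

text \<open>Solutions are split according to whether the coefficient of \<open>a\<close> is zero; a
  positive one is lowered by one.\<close>

lemma partition_function_difference:
  assumes "\<And>b. b \<in> set (a # X) \<Longrightarrow> 0 < w \<bullet> b"
  shows "partition_function (a # X) v = partition_function X v + partition_function (a # X) (v - a)"
proof -
  let ?s = "\<lambda>ns. Suc (hd ns) # tl ns"
  have eq: "solutions (a # X) v = (#) 0 ` solutions X v \<union> ?s ` solutions (a # X) (v - a)"
  proof (intro equalityI subsetI)
    fix ns assume ns: "ns \<in> solutions (a # X) v"
    then obtain n ms where nm: "ns = n # ms" by (cases ns) (auto simp: solutions_def)
    show "ns \<in> (#) 0 ` solutions X v \<union> ?s ` solutions (a # X) (v - a)"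
    proof (cases n)
      case 0
      then show ?thesis using ns nm by (auto simp: Cons_in_solutions)
    next
      case (Suc k)
      have "k # ms \<in> solutions (a # X) (v - a)" using ns nm Suc by (simp add: Cons_in_solutions algebra_simps)
      then show ?thesis using nm Suc by (auto intro!: image_eqI[of _ _ "k # ms"])
    qed
  next
    fix ns assume "ns \<in> (#) 0 ` solutions X v \<union> ?s ` solutions (a # X) (v - a)"
    then show "ns \<in> solutions (a # X) v"
    proof
      assume "ns \<in> ?s ` solutions (a # X) (v - a)"
      then obtain ms where ms: "ms \<in> solutions (a # X) (v - a)" "ns = ?s ms" by blast
      then obtain k ks where "ms = k # ks" by (cases ms) (auto simp: solutions_def)
      then show ?thesis using ms by (simp add: Cons_in_solutions algebra_simps)
    qed (auto simp: Cons_in_solutions)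
  qed
  have fin: "finite (solutions X v)" "finite (solutions (a # X) (v - a))" using finite_solutions[of X w] finite_solutions[of "a # X" w] assms by auto
  have inj: "inj_on ?s (solutions (a # X) (v - a))"
  proof (rule inj_onI)
    fix x y assume "x \<in> solutions (a # X) (v - a)" "y \<in> solutions (a # X) (v - a)" "?s x = ?s y"
    then show "x = y" by (cases x; cases y) (auto simp: solutions_def)
  qed
  have "card (solutions (a # X) v) = card ((#) 0 ` solutions X v) + card (?s ` solutions (a # X) (v - a))"
    unfolding eq using fin by (intro card_Un_disjoint) auto
  then show ?thesis unfolding partition_function_eq using inj by (simp add: card_image)
qed

lemma partition_function_permute:
  assumes "mset X = mset Y" and pos: "\<And>a. a \<in> set X \<Longrightarrow> 0 < w \<bullet> a"
  shows "partition_function X v = partition_function Y v"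
proof -
  have le: "card (solutions X v) \<le> card (solutions Y v)"
    if eq: "mset X = mset Y" and pos: "\<And>a. a \<in> set Y \<Longrightarrow> 0 < w \<bullet> a" for X Y
  proof -
    obtain f where f: "f permutes {..<length X}" "permute_list f X = Y"
      by (rule mset_eq_permutation[OF eq[symmetric]])
    have len: "length Y = length X" using eq by (metis mset_eq_length)
    have nth: "permute_list f xs ! i = xs ! f i" if "length xs = length X" "i < length X" for xs :: "'c list" and i
      using f(1) that by (intro permute_list_nth) auto
    have "permute_list f ns \<in> solutions Y v" if ns: "ns \<in> solutions X v" for ns
    proof -
      have l: "length ns = length X" using ns by (simp add: solutions_def)
      have "(\<Sum>i<length Y. real (permute_list f ns ! i) *\<^sub>R (Y ! i)) = (\<Sum>i<length X. real (ns ! f i) *\<^sub>R (X ! f i))"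
        unfolding len using nth[OF l] nth[of X] f(2) by (intro sum.cong) auto
      also have "\<dots> = (\<Sum>i<length X. real (ns ! i) *\<^sub>R (X ! i))"
        using sum.permute[OF f(1), of "\<lambda>i. real (ns ! i) *\<^sub>R (X ! i)"] by (simp add: o_def)
      finally show ?thesis using ns len l by (simp add: solutions_def)
    qed
    moreover have "inj_on (permute_list f) (solutions X v)"
    proof (rule inj_onI)
      fix ms ns assume mn: "ms \<in> solutions X v" "ns \<in> solutions X v" "permute_list f ms = permute_list f ns"
      then have l: "length ms = length X" "length ns = length X" by (simp_all add: solutions_def)
      show "ms = ns"
      proof (rule nth_equalityI)
        fix i assume "i < length ms"
        then obtain j where j: "j < length X" "i = f j" using permutes_image[OF f(1)] l(1) by (metis image_iff lessThan_iff)
        then show "ms ! i = ns ! i" using nth[OF l(1) j(1)] nth[OF l(2) j(1)] mn(3) by simp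
      qed (simp add: l)
    qed
    ultimately show ?thesis using finite_solutions[OF pos] by (intro card_inj_on_le) auto
  qed
  have set: "set X = set Y" using assms(1) by (metis set_mset_mset)
  show ?thesis unfolding partition_function_eq
    by (rule antisym; rule le) (use assms set in auto)
qed

fun zonotope :: "'v::real_vector list \<Rightarrow> 'v set" where
  "zonotope [] = {0}"
| "zonotope (a # X) = {t *\<^sub>R a + z | t z. 0 \<le> t \<and> t \<le> 1 \<and> z \<in> zonotope X}"

lemma zonotope_ConsI: "\<lbrakk>z = t *\<^sub>R a + y; 0 \<le> t; t \<le> 1; y \<in> zonotope X\<rbrakk> \<Longrightarrow> z \<in> zonotope (a # X)"
  unfolding zonotope.simps by (intro CollectI exI conjI)

lemma zonotope_permute: "mset X = mset Y \<Longrightarrow> zonotope X = zonotope Y"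
proof (erule mset_invariant)
  have "zonotope (a # b # X) \<subseteq> zonotope (b # a # X)" for a b and X :: "'a list"
  proof
    fix x assume "x \<in> zonotope (a # b # X)"
    then obtain t s z where "0 \<le> t" "t \<le> 1" "0 \<le> s" "s \<le> 1" "z \<in> zonotope X" "x = t *\<^sub>R a + (s *\<^sub>R b + z)" by auto
    moreover from this(6) have "x = s *\<^sub>R b + (t *\<^sub>R a + z)" by (simp add: algebra_simps)
    ultimately show "x \<in> zonotope (b # a # X)" by auto
  qed
  then show "zonotope (a # b # X) = zonotope (b # a # X)" for a b and X :: "'a list" by blast
qed simp

lemma zonotope_subset_cone: "zonotope X \<subseteq> cone_of (set X)"
proof (induction X)
  case (Cons a X)
  show ?case
  proof
    fix x assume "x \<in> zonotope (a # X)"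
    then obtain t z where "x = t *\<^sub>R a + z" "0 \<le> t" "z \<in> zonotope X" by auto
    then show "x \<in> cone_of (set (a # X))"
      using Cons cone_of_mono[of "set X" "set (a # X)"]
      by (auto intro!: cone_of_add cone_of_scaleR intro: cone_of_superset)
  qed
qed simp

section \<open>Reduction modulo the lattice of a basis\<close>

definition int_span :: "'v::real_vector set \<Rightarrow> 'v set" where
  "int_span B = {(\<Sum>b\<in>B. of_int (c b) *\<^sub>R b) | c. True}"

lemma int_span_zero [simp]: "0 \<in> int_span B"
  unfolding int_span_def by (rule CollectI, rule exI[of _ "\<lambda>_. 0"]) simp

lemma int_span_diff:
  assumes "x \<in> int_span B" "y \<in> int_span B" shows "x - y \<in> int_span B"
proof -
  obtain c d where "x = (\<Sum>b\<in>B. of_int (c b) *\<^sub>R b)" "y = (\<Sum>b\<in>B. of_int (d b) *\<^sub>R b)"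
    using assms unfolding int_span_def by blast
  then have "x - y = (\<Sum>b\<in>B. of_int (c b - d b) *\<^sub>R b)" by (simp add: scaleR_left_diff_distrib sum_subtractf)
  then show ?thesis unfolding int_span_def by (intro CollectI exI[of _ "\<lambda>b. c b - d b"]) simp
qed

lemma int_span_minus: "x \<in> int_span B \<Longrightarrow> - x \<in> int_span B"
  using int_span_diff[of 0 B x] by simp

lemma int_span_add: "\<lbrakk>x \<in> int_span B; y \<in> int_span B\<rbrakk> \<Longrightarrow> x + y \<in> int_span B"
  using int_span_diff[of x B "- y"] int_span_minus[of y B] by simp

lemma int_span_scale: assumes "x \<in> int_span B" shows "of_int n *\<^sub>R x \<in> int_span B"
proof -
  obtain c where "x = (\<Sum>b\<in>B. of_int (c b) *\<^sub>R b)" using assms unfolding int_span_def by blast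
  then have "of_int n *\<^sub>R x = (\<Sum>b\<in>B. of_int (n * c b) *\<^sub>R b)" by (simp add: scaleR_sum_right)
  then show ?thesis unfolding int_span_def by (intro CollectI exI[of _ "\<lambda>b. n * c b"]) simp
qed

lemma int_span_base: assumes "finite B" "b \<in> B" shows "b \<in> int_span B"
  unfolding int_span_def
  by (rule CollectI, rule exI[of _ "\<lambda>c. if c = b then 1 else 0"])
    (use assms in \<open>simp add: if_distrib[of "\<lambda>c. c *\<^sub>R _"] if_distrib[of of_int] sum.delta cong: if_cong\<close>)

lemma int_span_subset:
  assumes "B \<subseteq> int_span C" shows "int_span B \<subseteq> int_span C"
proof
  fix x assume "x \<in> int_span B"
  then obtain c where x: "x = (\<Sum>b\<in>B. of_int (c b) *\<^sub>R b)" unfolding int_span_def by blast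
  have "(\<Sum>b\<in>B. of_int (c b) *\<^sub>R b) \<in> int_span C" using assms
    by (induction B rule: infinite_finite_induct) (auto intro!: int_span_add int_span_scale)
  with x show "x \<in> int_span C" by simp
qed

text \<open>The representative of \<open>x\<close> modulo the lattice of \<open>B\<close> in the
  half-open parallelepiped.\<close>

definition reduce :: "'v::euclidean_space set \<Rightarrow> 'v \<Rightarrow> 'v" where
  "reduce B x = x - (\<Sum>b\<in>B. of_int \<lfloor>representation B x b\<rfloor> *\<^sub>R b)"

locale euclidean_basis =
  fixes B :: "'v::euclidean_space set"
  assumes indep: "independent B" and spanning: "span B = UNIV"
begin

abbreviation "coord b x \<equiv> representation B x b"

lemma finite_B: "finite B" using indep by (rule independent_imp_finite)

lemma bounded_linear_coord: "bounded_linear (coord b)"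
  by (rule linear_representation[OF indep spanning])

lemmas coord_sum = representation_sum[OF indep spanning]
lemmas sum_coord = sum_representation[OF indep spanning]

lemma coord_diff: "coord b (x - y) = coord b x - coord b y"
  and coord_add: "coord b (x + y) = coord b x + coord b y"
  and coord_scaleR: "coord b (r *\<^sub>R x) = r * coord b x"
  using linear_diff[OF bounded_linear_coord[of b, THEN bounded_linear.linear]]
    linear_add[OF bounded_linear_coord[of b, THEN bounded_linear.linear]]
    linear_scale[OF bounded_linear_coord[of b, THEN bounded_linear.linear]]
  by simp_all

lemma coord_basis: "c \<in> B \<Longrightarrow> coord b c = (if b = c then 1 else 0)"
  using indep by (simp add: representation_basis)

lemma int_span_iff: "x \<in> int_span B \<longleftrightarrow> (\<forall>b\<in>B. coord b x \<in> \<int>)"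
proof
  assume "x \<in> int_span B"
  then obtain c where "x = (\<Sum>b\<in>B. of_int (c b) *\<^sub>R b)" unfolding int_span_def by blast
  then show "\<forall>b\<in>B. coord b x \<in> \<int>" using coord_sum[of _ "\<lambda>b. of_int (c b)"] by simp
next
  assume "\<forall>b\<in>B. coord b x \<in> \<int>"
  then have "\<forall>b\<in>B. coord b x = of_int \<lfloor>coord b x\<rfloor>" by (simp add: of_int_floor)
  then have "(\<Sum>b\<in>B. coord b x *\<^sub>R b) = (\<Sum>b\<in>B. of_int \<lfloor>coord b x\<rfloor> *\<^sub>R b)"
    by (intro sum.cong refl) (metis (no_types))
  then have "x = (\<Sum>b\<in>B. of_int \<lfloor>coord b x\<rfloor> *\<^sub>R b)" by (simp only: sum_coord)
  then show "x \<in> int_span B" unfolding int_span_def by (intro CollectI exI[of _ "\<lambda>b. \<lfloor>coord b x\<rfloor>"]) simp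
qed

lemma parallelepiped_iff: "x \<in> half_open_parallelepiped B \<longleftrightarrow> (\<forall>b\<in>B. 0 \<le> coord b x \<and> coord b x < 1)"
proof
  assume "x \<in> half_open_parallelepiped B"
  then obtain t where "x = (\<Sum>b\<in>B. t b *\<^sub>R b)" "\<forall>b\<in>B. 0 \<le> t b \<and> t b < 1" unfolding half_open_parallelepiped_def by blast
  then show "\<forall>b\<in>B. 0 \<le> coord b x \<and> coord b x < 1" using coord_sum[of _ t] by simp
next
  assume "\<forall>b\<in>B. 0 \<le> coord b x \<and> coord b x < 1"
  then show "x \<in> half_open_parallelepiped B"
    unfolding half_open_parallelepiped_def using sum_coord[of x]
    by (intro CollectI exI[of _ "\<lambda>b. coord b x"]) simp
qed

lemma coord_reduce: "b \<in> B \<Longrightarrow> coord b (reduce B x) = frac (coord b x)"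
  unfolding reduce_def coord_diff by (subst coord_sum) (simp_all add: frac_def)

lemma reduce_in: "reduce B x \<in> half_open_parallelepiped B"
  unfolding parallelepiped_iff by (simp add: coord_reduce frac_lt_1)

lemma reduce_diff: "x - reduce B x \<in> int_span B"
  unfolding reduce_def int_span_def by auto

lemma parallelepiped_unique:
  assumes "x \<in> half_open_parallelepiped B" "y \<in> half_open_parallelepiped B" "x - y \<in> int_span B"
  shows "x = y"
proof -
  have "coord b x = coord b y" if "b \<in> B" for b
  proof -
    have "coord b x - coord b y \<in> \<int>" using assms(3) that by (simp add: int_span_iff coord_diff)
    then obtain k where k: "coord b x - coord b y = of_int k" by (auto elim: Ints_cases)
    moreover have "- 1 < coord b x - coord b y" "coord b x - coord b y < 1"
      using assms(1,2) that unfolding parallelepiped_iff by (smt (verit))+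
    ultimately have "k = 0" by linarith
    with k show ?thesis by simp
  qed
  then have "(\<Sum>b\<in>B. coord b x *\<^sub>R b) = (\<Sum>b\<in>B. coord b y *\<^sub>R b)" by (intro sum.cong refl) simp
  then show ?thesis by (simp only: sum_coord)
qed

lemma norm_parallelepiped: "x \<in> half_open_parallelepiped B \<Longrightarrow> norm x \<le> (\<Sum>b\<in>B. norm b)"
  using norm_le_box[OF indep spanning, of x 1] by (auto simp: parallelepiped_iff less_imp_le)

lemma bounded_parallelepiped: "bounded (half_open_parallelepiped B)"
  unfolding bounded_iff using norm_parallelepiped by blast

lemma continuous_coord: "continuous_on UNIV (coord b)"
  using bounded_linear_coord by (rule linear_continuous_on)

lemma borel_measurable_coord [measurable]: "coord b \<in> borel_measurable borel"
  by (rule borel_measurable_continuous_onI[OF continuous_coord])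

lemma parallelepiped_measurable [measurable]: "half_open_parallelepiped B \<in> sets borel"
proof -
  have "half_open_parallelepiped B = (\<Inter>b\<in>B. {x. 0 \<le> coord b x} \<inter> {x. coord b x < 1}) \<inter> UNIV"
    by (auto simp: parallelepiped_iff)
  also have "\<dots> \<in> sets borel"
  proof (cases "B = {}")
    case False
    then show ?thesis using finite_B by (intro sets.Int sets.finite_INT) auto
  qed simp
  finally show ?thesis .
qed

definition orthant :: "'v set" where "orthant = {x. \<forall>b\<in>B. 0 < coord b x}"

lemma open_orthant: "open orthant"
proof -
  have "orthant = (\<Inter>b\<in>B. {x. 0 < coord b x})" by (auto simp: orthant_def)
  then show ?thesis using finite_B by (auto intro!: open_Collect_less continuous_coord continuous_on_const)
qed

lemma emeasure_parallelepiped: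
  shows "emeasure lborel (half_open_parallelepiped B) = ennreal (measure lborel (half_open_parallelepiped B))"
    and "0 < measure lborel (half_open_parallelepiped B)"
proof -
  show 1: "emeasure lborel (half_open_parallelepiped B) = ennreal (measure lborel (half_open_parallelepiped B))"
    using emeasure_bounded_finite[OF bounded_parallelepiped] by (simp add: emeasure_eq_ennreal_measure)
  let ?O = "orthant \<inter> (\<Inter>b\<in>B. {x. coord b x < 1})"
  have "open ?O" using finite_B open_orthant by (auto intro!: open_Collect_less continuous_coord continuous_on_const)
  moreover have "(\<Sum>b\<in>B. (1 / 2) *\<^sub>R b) \<in> ?O" unfolding orthant_def by (auto simp only: coord_sum)
  ultimately have "0 < emeasure lborel ?O"
    using open_not_negligible[of ?O] by (auto simp: negligible_iff_null_sets zero_less_iff_neq_zero null_sets_def)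
  also have "\<dots> \<le> emeasure lborel (half_open_parallelepiped B)"
    by (intro emeasure_mono) (auto simp: orthant_def parallelepiped_iff less_imp_le)
  finally show "0 < measure lborel (half_open_parallelepiped B)" by (simp add: 1)
qed

end

section \<open>Characters of a lattice\<close>

lemma int_span_least:
  assumes "x \<in> int_span B" "0 \<in> S" "\<And>b. b \<in> B \<Longrightarrow> b \<in> S" and diff: "\<And>x y. \<lbrakk>x \<in> S; y \<in> S\<rbrakk> \<Longrightarrow> x - y \<in> S"
  shows "x \<in> S"
proof -
  obtain c where x: "x = (\<Sum>b\<in>B. of_int (c b) *\<^sub>R b)" using assms(1) unfolding int_span_def by blast
  have minus: "- x \<in> S" if "x \<in> S" for x using diff[OF assms(2) that] by simp
  have add: "x + y \<in> S" if "x \<in> S" "y \<in> S" for x y using diff[OF that(1) minus[OF that(2)]] by simp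
  have nat: "real n *\<^sub>R b \<in> S" if "b \<in> S" for n b
    by (induction n) (use assms(2) add[OF that] in \<open>auto simp: scaleR_add_left\<close>)
  have int: "of_int n *\<^sub>R b \<in> S" if "b \<in> S" for n b
    using nat[OF that, of "nat n"] minus[OF nat[OF that, of "nat (- n)"]] by (cases "0 \<le> n") simp_all
  have "(\<Sum>b\<in>B. of_int (c b) *\<^sub>R b) \<in> S" using assms(3)
    by (induction B rule: infinite_finite_induct) (use assms(2) add int in auto)
  with x show ?thesis by simp
qed

locale lattice = E: euclidean_basis E for E :: "'v::euclidean_space set" +
  fixes \<Lambda> :: "'v set"
  assumes \<Lambda>: "\<Lambda> = int_span E"
begin

lemma lat_0 [simp]: "0 \<in> \<Lambda>" by (simp add: \<Lambda>)
lemma lat_diff: "\<lbrakk>x \<in> \<Lambda>; y \<in> \<Lambda>\<rbrakk> \<Longrightarrow> x - y \<in> \<Lambda>" unfolding \<Lambda> by (rule int_span_diff)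
lemma lat_add: "\<lbrakk>x \<in> \<Lambda>; y \<in> \<Lambda>\<rbrakk> \<Longrightarrow> x + y \<in> \<Lambda>" unfolding \<Lambda> by (rule int_span_add)
lemma lat_scale: "x \<in> \<Lambda> \<Longrightarrow> of_int n *\<^sub>R x \<in> \<Lambda>" unfolding \<Lambda> by (rule int_span_scale)
lemma lat_scale_nat: "x \<in> \<Lambda> \<Longrightarrow> real n *\<^sub>R x \<in> \<Lambda>" using lat_scale[of x "int n"] by simp
lemma int_span_lat: "B \<subseteq> \<Lambda> \<Longrightarrow> int_span B \<subseteq> \<Lambda>" unfolding \<Lambda> by (rule int_span_subset)
lemma E_lat: "E \<subseteq> \<Lambda>" unfolding \<Lambda> using int_span_base[OF E.finite_B] by blast

definition is_char :: "('v \<Rightarrow> complex) \<Rightarrow> bool" where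
  "is_char \<theta> \<longleftrightarrow> (\<exists>\<phi>. linear \<phi> \<and> \<theta> = exp_char \<Lambda> \<phi>)"

lemma char_0: "is_char \<theta> \<Longrightarrow> \<theta> 0 = 1"
  by (auto simp: is_char_def exp_char_def linear_0)

lemma char_add: "\<lbrakk>is_char \<theta>; x \<in> \<Lambda>; y \<in> \<Lambda>\<rbrakk> \<Longrightarrow> \<theta> (x + y) = \<theta> x * \<theta> y"
  by (auto simp: is_char_def exp_char_def lat_add linear_add exp_add)

lemma char_nonzero: "\<lbrakk>is_char \<theta>; x \<in> \<Lambda>\<rbrakk> \<Longrightarrow> \<theta> x \<noteq> 0"
  by (auto simp: is_char_def exp_char_def)

lemma char_diff: "\<lbrakk>is_char \<theta>; x \<in> \<Lambda>; y \<in> \<Lambda>\<rbrakk> \<Longrightarrow> \<theta> (x - y) = \<theta> x * inverse (\<theta> y)"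
  by (auto simp: is_char_def exp_char_def lat_diff linear_diff exp_diff divide_inverse)

lemma char_scale_nat: "\<lbrakk>is_char \<theta>; x \<in> \<Lambda>\<rbrakk> \<Longrightarrow> \<theta> (real n *\<^sub>R x) = \<theta> x ^ n"
  by (induction n) (simp_all add: char_0 scaleR_add_left char_add lat_scale_nat)

lemma char_int_span:
  assumes "is_char \<theta>" "B \<subseteq> \<Lambda>" "\<And>b. b \<in> B \<Longrightarrow> \<theta> b = 1" "x \<in> int_span B"
  shows "\<theta> x = 1"
proof -
  have "x \<in> {x \<in> \<Lambda>. \<theta> x = 1}"
    by (rule int_span_least[OF assms(4)]) (use assms in \<open>auto simp: char_0 char_diff lat_diff\<close>)
  then show ?thesis by simp
qed

lemma char_ext:
  assumes "is_char \<theta>" "is_char \<psi>" "\<And>e. e \<in> E \<Longrightarrow> \<theta> e = \<psi> e"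
  shows "\<theta> = \<psi>"
proof
  fix x
  show "\<theta> x = \<psi> x"
  proof (cases "x \<in> \<Lambda>")
    case True
    then have "x \<in> {x \<in> \<Lambda>. \<theta> x = \<psi> x}" unfolding \<Lambda>
      by (rule int_span_least) (use assms E_lat in \<open>auto simp: char_0 char_diff lat_diff \<Lambda>[symmetric]\<close>)
    then show ?thesis by simp
  qed (use assms(1,2) in \<open>auto simp: is_char_def exp_char_def\<close>)
qed

lemma finite_lattice_bounded:
  assumes "bounded S" shows "finite (\<Lambda> \<inter> S)"
proof -
  have "bounded (E.coord e ` S)" for e
    by (rule bounded_linear_image[OF assms E.bounded_linear_coord])
  then have "\<forall>e. \<exists>M. \<forall>x\<in>S. \<bar>E.coord e x\<bar> \<le> M" unfolding bounded_iff by auto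
  then obtain M where M: "\<And>e x. x \<in> S \<Longrightarrow> \<bar>E.coord e x\<bar> \<le> M e" by metis
  let ?C = "PiE E (\<lambda>e. {- \<lceil>M e\<rceil>..\<lceil>M e\<rceil>})"
  have "\<Lambda> \<inter> S \<subseteq> (\<lambda>c. \<Sum>e\<in>E. of_int (c e) *\<^sub>R e) ` ?C"
  proof
    fix x assume x: "x \<in> \<Lambda> \<inter> S"
    then obtain c where c: "x = (\<Sum>e\<in>E. of_int (c e) *\<^sub>R e)" unfolding \<Lambda> int_span_def by blast
    have "\<bar>of_int (c e)\<bar> \<le> M e" if "e \<in> E" for e
      using M[of x e] x E.coord_sum[OF that, of "\<lambda>e. of_int (c e)"] c by simp
    then have "- \<lceil>M e\<rceil> \<le> c e \<and> c e \<le> \<lceil>M e\<rceil>" if "e \<in> E" for e using that by (smt (verit) le_of_int_ceiling of_int_le_iff of_int_minus)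
    then have "restrict c E \<in> ?C" by auto
    moreover have "x = (\<Sum>e\<in>E. of_int (restrict c E e) *\<^sub>R e)" using c by simp
    ultimately show "x \<in> (\<lambda>c. \<Sum>e\<in>E. of_int (c e) *\<^sub>R e) ` ?C" by blast
  qed
  moreover have "finite ?C" using E.finite_B by (intro finite_PiE) auto
  ultimately show ?thesis using finite_surj by blast
qed

lemma reduce_lat:
  assumes "euclidean_basis B" "B \<subseteq> \<Lambda>" "x \<in> \<Lambda>" shows "reduce B x \<in> \<Lambda>"
proof -
  interpret B: euclidean_basis B by fact
  have "x - reduce B x \<in> \<Lambda>" using B.reduce_diff[of x] int_span_lat[OF assms(2)] by blast
  from lat_diff[OF assms(3) this] have "x - (x - reduce B x) \<in> \<Lambda>" .
  then show ?thesis by simp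
qed

text \<open>Pigeonhole: the multiples of \<open>x\<close> have only finitely many reductions modulo
  the lattice of \<open>B\<close>, so two of them differ by an element of it.\<close>

lemma multiple_in_int_span:
  assumes "euclidean_basis B" "B \<subseteq> \<Lambda>" "x \<in> \<Lambda>"
  obtains n where "n > 0" "real n *\<^sub>R x \<in> int_span B"
proof -
  interpret B: euclidean_basis B by fact
  let ?f = "\<lambda>k. reduce B (real k *\<^sub>R x)"
  have "range ?f \<subseteq> \<Lambda> \<inter> half_open_parallelepiped B"
    using reduce_lat[OF assms(1,2)] lat_scale_nat[OF assms(3)] B.reduce_in by auto
  then have "finite (range ?f)" using finite_lattice_bounded[OF B.bounded_parallelepiped] finite_subset by blast
  then have "\<not> inj ?f" using finite_imageD by blast
  then obtain j k where jk: "j < k" "?f j = ?f k" unfolding inj_def by (metis linorder_neqE_nat)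
  have "(real k *\<^sub>R x - ?f k) - (real j *\<^sub>R x - ?f j) \<in> int_span B" by (intro int_span_diff B.reduce_diff)
  then have "real (k - j) *\<^sub>R x \<in> int_span B" using jk by (simp add: of_nat_diff algebra_simps)
  then show ?thesis using jk(1) that[of "k - j"] by simp
qed

text \<open>For a basis \<open>B\<close> in the lattice this is the character group of the finite
  quotient of \<Lambda> by \<open>int_span B\<close>.\<close>

definition dual :: "'v set \<Rightarrow> ('v \<Rightarrow> complex) set" where
  "dual B = {\<theta>. is_char \<theta> \<and> (\<forall>b\<in>B. \<theta> b = 1)}"

text \<open>Some multiple of each lattice generator lies in \<open>int_span B\<close>, so the values
  of such a character on \<open>E\<close> are roots of unity of bounded order, and they determine
  it.\<close>

lemma finite_dual:
  assumes "euclidean_basis B" "B \<subseteq> \<Lambda>" shows "finite (dual B)"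
proof -
  have "\<forall>e\<in>E. \<exists>n>0. real n *\<^sub>R e \<in> int_span B" using multiple_in_int_span[OF assms] E_lat by (metis subsetD)
  then obtain n where n: "\<And>e. e \<in> E \<Longrightarrow> n e > 0" "\<And>e. e \<in> E \<Longrightarrow> real (n e) *\<^sub>R e \<in> int_span B" by metis
  let ?R = "PiE E (\<lambda>e. {z::complex. z ^ n e = 1})"
  have "finite ?R" using E.finite_B n(1) by (intro finite_PiE) (auto intro!: finite_roots_unity simp: Suc_le_eq)
  moreover have "(\<lambda>\<theta>. restrict \<theta> E) ` dual B \<subseteq> ?R"
  proof (rule image_subsetI)
    fix \<theta> assume "\<theta> \<in> dual B"
    then have t: "is_char \<theta>" "\<And>b. b \<in> B \<Longrightarrow> \<theta> b = 1" by (simp_all add: dual_def)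
    have "\<theta> e ^ n e = 1" if e: "e \<in> E" for e
    proof -
      have "\<theta> (real (n e) *\<^sub>R e) = 1" by (rule char_int_span[OF t(1) assms(2) t(2) n(2)[OF e]])
      then show ?thesis using char_scale_nat[OF t(1), of e "n e"] e E_lat by (metis subsetD)
    qed
    then show "restrict \<theta> E \<in> ?R" by simp
  qed
  moreover have "inj_on (\<lambda>\<theta>. restrict \<theta> E) (dual B)"
  proof (rule inj_onI)
    fix \<theta> \<psi> assume t: "\<theta> \<in> dual B" "\<psi> \<in> dual B" "restrict \<theta> E = restrict \<psi> E"
    show "\<theta> = \<psi>"
    proof (rule char_ext)
      fix e assume "e \<in> E"
      then show "\<theta> e = \<psi> e" using fun_cong[OF t(3), of e] by simp
    qed (use t(1,2) in \<open>simp_all add: dual_def\<close>)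
  qed
  ultimately show ?thesis using inj_on_finite by blast
qed

text \<open>Replaces the existence of a basis by a spanning condition that mentions only the
  character itself, not a functional representing it.\<close>

lemma toric_points_iff:
  assumes "set X \<subseteq> \<Lambda>"
  shows "p \<in> toric_points \<Lambda> X \<longleftrightarrow> is_char p \<and> span {a \<in> set X. p a = 1} = UNIV"
proof
  assume "p \<in> toric_points \<Lambda> X"
  then obtain \<phi> b where \<phi>: "p = exp_char \<Lambda> \<phi>" "linear \<phi>" and b: "b \<subseteq> set X" "span b = UNIV" "\<forall>a\<in>b. exp (\<phi> a) = 1"
    unfolding toric_points_def by blast
  have "b \<subseteq> {a \<in> set X. p a = 1}" using b assms by (auto simp: \<phi>(1) exp_char_def)
  then have "span {a \<in> set X. p a = 1} = UNIV" using b(2) span_mono by blast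
  then show "is_char p \<and> span {a \<in> set X. p a = 1} = UNIV" using \<phi> by (auto simp: is_char_def)
next
  assume p: "is_char p \<and> span {a \<in> set X. p a = 1} = UNIV"
  then obtain \<phi> where \<phi>: "linear \<phi>" "p = exp_char \<Lambda> \<phi>" by (auto simp: is_char_def)
  obtain b where b: "b \<subseteq> {a \<in> set X. p a = 1}" "independent b" "{a \<in> set X. p a = 1} \<subseteq> span b"
    using maximal_independent_subset by blast
  have "span b = UNIV" using p span_mono[OF b(3)] by (simp add: span_span top.extremum_uniqueI)
  moreover have "\<forall>a\<in>b. exp (\<phi> a) = 1"
  proof
    fix a assume "a \<in> b"
    then have "a \<in> set X" "p a = 1" using b(1) by auto
    then show "exp (\<phi> a) = 1" using assms by (auto simp: \<phi>(2) exp_char_def)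
  qed
  ultimately show "p \<in> toric_points \<Lambda> X" unfolding toric_points_def using \<phi> b by blast
qed

lemma finite_toric_points:
  assumes "set X \<subseteq> \<Lambda>" shows "finite (toric_points \<Lambda> X)"
proof -
  let ?B = "{B. B \<subseteq> set X \<and> euclidean_basis B}"
  have "toric_points \<Lambda> X \<subseteq> (\<Union>B\<in>?B. dual B)"
  proof
    fix p assume "p \<in> toric_points \<Lambda> X"
    then obtain \<phi> b where \<phi>: "p = exp_char \<Lambda> \<phi>" "linear \<phi>"
      and b: "b \<subseteq> set X" "independent b" "span b = UNIV" "\<forall>a\<in>b. exp (\<phi> a) = 1"
      unfolding toric_points_def by blast
    have "p \<in> dual b" using \<phi> b assms by (auto simp: dual_def is_char_def exp_char_def)
    then show "p \<in> (\<Union>B\<in>?B. dual B)" using b by (auto simp: euclidean_basis_def)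
  qed
  moreover have "finite ?B" by (rule finite_subset[of _ "Pow (set X)"]) auto
  then have "finite (\<Union>B\<in>?B. dual B)" using assms by (auto intro!: finite_dual)
  ultimately show ?thesis by (rule finite_subset)
qed

lemma exp_char_in_dual:
  assumes "linear \<phi>" "B \<subseteq> \<Lambda>" "\<And>b. b \<in> B \<Longrightarrow> exp (\<phi> b) = 1" shows "exp_char \<Lambda> \<phi> \<in> dual B"
  using assms by (auto simp: dual_def is_char_def exp_char_def)

text \<open>A non-integral coordinate of \<open>x\<close> is detected by the character that
  exponentiates \<open>2 * pi * \<i>\<close> times this coordinate.\<close>

lemma char_separates:
  assumes "euclidean_basis B" "B \<subseteq> \<Lambda>" "x \<in> \<Lambda>" "x \<notin> int_span B"
  obtains \<theta> where "\<theta> \<in> dual B" "\<theta> x \<noteq> 1"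
proof -
  interpret B: euclidean_basis B by fact
  obtain b where b: "b \<in> B" "B.coord b x \<notin> \<int>" using assms(4) unfolding B.int_span_iff by blast
  let ?\<phi> = "\<lambda>x. of_real (B.coord b x) * (2 * of_real pi * \<i>)"
  have lin: "linear ?\<phi>"
    by (intro linearI) (simp_all add: B.coord_add B.coord_scaleR algebra_simps scaleR_conv_of_real)
  have ex: "exp (?\<phi> y) = 1 \<longleftrightarrow> B.coord b y \<in> \<int>" for y
  proof -
    have "exp (?\<phi> y) = 1 \<longleftrightarrow> (\<exists>n::int. B.coord b y * (2 * pi) = of_int (2 * n) * pi)"
      by (simp add: exp_eq_1)
    also have "\<dots> \<longleftrightarrow> (\<exists>n::int. B.coord b y = of_int n)" by (auto simp: field_simps)
    finally show ?thesis by (auto simp: Ints_def)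
  qed
  have "exp_char \<Lambda> ?\<phi> \<in> dual B"
    by (rule exp_char_in_dual[OF lin assms(2)]) (use ex in \<open>auto simp: B.coord_basis\<close>)
  moreover have "exp_char \<Lambda> ?\<phi> x \<noteq> 1" using ex[of x] b(2) assms(3) by (simp add: exp_char_def)
  ultimately show ?thesis by (rule that)
qed

lemma char_times:
  assumes "is_char \<theta>" "is_char \<psi>" shows "is_char (restrict (\<lambda>x. \<theta> x * \<psi> x) \<Lambda>)"
proof -
  obtain \<phi> \<phi>' where p: "linear \<phi>" "\<theta> = exp_char \<Lambda> \<phi>" "linear \<phi>'" "\<psi> = exp_char \<Lambda> \<phi>'"
    using assms by (auto simp: is_char_def)
  have "restrict (\<lambda>x. \<theta> x * \<psi> x) \<Lambda> = exp_char \<Lambda> (\<lambda>x. \<phi> x + \<phi>' x)"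
    by (auto simp: exp_char_def p exp_add fun_eq_iff)
  then show ?thesis unfolding is_char_def using linear_compose_add[OF p(1,3)] by blast
qed

text \<open>Orthogonality: multiplication by a character that is not \<open>1\<close> at
  \<open>x\<close> permutes \<open>dual B\<close>, so the sum equals a multiple of itself by a
  factor other than \<open>1\<close>.\<close>

lemma sum_dual:
  assumes B: "euclidean_basis B" "B \<subseteq> \<Lambda>" and x: "x \<in> \<Lambda>"
  shows "(\<Sum>\<theta>\<in>dual B. \<theta> x) = (if x \<in> int_span B then of_nat (card (dual B)) else 0)"
proof (cases "x \<in> int_span B")
  case True
  then have "\<theta> x = 1" if "\<theta> \<in> dual B" for \<theta> using that char_int_span[OF _ B(2)] by (auto simp: dual_def)
  then have "(\<Sum>\<theta>\<in>dual B. \<theta> x) = (\<Sum>\<theta>\<in>dual B. 1)" by (intro sum.cong refl)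
  then show ?thesis using True by simp
next
  case False
  obtain \<psi> where \<psi>: "\<psi> \<in> dual B" "\<psi> x \<noteq> 1" by (rule char_separates[OF B x False])
  let ?m = "\<lambda>\<theta>. restrict (\<lambda>y. \<psi> y * \<theta> y) \<Lambda>"
  have into: "?m ` dual B \<subseteq> dual B" using \<psi>(1) B(2) by (auto simp: dual_def char_times)
  have inj: "inj_on ?m (dual B)"
  proof (rule inj_onI)
    fix \<theta> \<theta>' assume c: "\<theta> \<in> dual B" "\<theta>' \<in> dual B" "?m \<theta> = ?m \<theta>'"
    show "\<theta> = \<theta>'"
    proof (rule char_ext)
      fix e assume "e \<in> E"
      then have e: "e \<in> \<Lambda>" using E_lat by blast
      then have "\<psi> e * \<theta> e = \<psi> e * \<theta>' e" using fun_cong[OF c(3), of e] by simp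
      then show "\<theta> e = \<theta>' e" using char_nonzero[OF _ e, of \<psi>] \<psi>(1) by (simp add: dual_def)
    qed (use c in \<open>auto simp: dual_def\<close>)
  qed
  have "?m ` dual B = dual B" using finite_dual[OF B] into inj by (rule endo_inj_surj)
  then have "(\<Sum>\<theta>\<in>dual B. \<theta> x) = (\<Sum>\<theta>\<in>?m ` dual B. \<theta> x)" by simp
  also have "\<dots> = (\<Sum>\<theta>\<in>dual B. \<psi> x * \<theta> x)" using inj x by (simp add: sum.reindex)
  also have "\<dots> = \<psi> x * (\<Sum>\<theta>\<in>dual B. \<theta> x)" by (simp add: sum_distrib_left)
  finally have "(\<psi> x - 1) * (\<Sum>\<theta>\<in>dual B. \<theta> x) = 0" by (simp add: algebra_simps)
  then show ?thesis using \<psi>(2) False by simp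
qed

text \<open>Representatives of the quotient of \<Lambda> by \<open>int_span B\<close>, provided that
  \<open>B\<close> is a basis in \<Lambda>.\<close>

definition cosets :: "'v set \<Rightarrow> 'v set" where
  "cosets B = \<Lambda> \<inter> half_open_parallelepiped B"

lemma finite_cosets: "euclidean_basis B \<Longrightarrow> finite (cosets B)"
  unfolding cosets_def by (intro finite_lattice_bounded euclidean_basis.bounded_parallelepiped)

text \<open>The dual orthogonality relation: translation by some \<open>y\<close> with
  \<open>\<theta> y \<noteq> 1\<close>, followed by reduction, permutes the representatives.\<close>

lemma sum_cosets:
  assumes B: "euclidean_basis B" "B \<subseteq> \<Lambda>" and \<theta>: "\<theta> \<in> dual B"
  shows "(\<Sum>x\<in>cosets B. \<theta> x) = (if \<theta> = exp_char \<Lambda> (\<lambda>_. 0) then of_nat (card (cosets B)) else 0)"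
proof (cases "\<theta> = exp_char \<Lambda> (\<lambda>_. 0)")
  case True
  then show ?thesis by (simp add: cosets_def exp_char_def)
next
  case False
  interpret B: euclidean_basis B by fact
  have ch: "is_char \<theta>" using \<theta> by (simp add: dual_def)
  have "\<exists>y\<in>\<Lambda>. \<theta> y \<noteq> 1"
  proof (rule ccontr)
    assume "\<not> ?thesis"
    then have "\<theta> = exp_char \<Lambda> (\<lambda>_. 0)" using ch by (auto simp: is_char_def exp_char_def fun_eq_iff)
    with False show False by blast
  qed
  then obtain y where y: "y \<in> \<Lambda>" "\<theta> y \<noteq> 1" by blast
  let ?m = "\<lambda>x. reduce B (x + y)"
  have into: "?m ` cosets B \<subseteq> cosets B"
    using reduce_lat[OF B] y(1) B.reduce_in by (auto simp: cosets_def lat_add)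
  have inj: "inj_on ?m (cosets B)"
  proof (rule inj_onI)
    fix x z assume x: "x \<in> cosets B" and z: "z \<in> cosets B" and eq: "?m x = ?m z"
    have "(x + y - ?m x) - (z + y - ?m z) \<in> int_span B" by (intro int_span_diff B.reduce_diff)
    then show "x = z" using x z eq by (intro B.parallelepiped_unique) (auto simp: cosets_def)
  qed
  have val: "\<theta> (?m x) = \<theta> y * \<theta> x" if "x \<in> cosets B" for x
  proof -
    have x: "x \<in> \<Lambda>" using that by (simp add: cosets_def)
    have "\<theta> (x + y - ?m x) = 1"
      using \<theta> by (intro char_int_span[OF ch B(2) _ B.reduce_diff]) (auto simp: dual_def)
    then have "\<theta> x * \<theta> y * inverse (\<theta> (?m x)) = 1"
      using char_diff[OF ch lat_add[OF x y(1)] reduce_lat[OF B lat_add[OF x y(1)]]] char_add[OF ch x y(1)] by simp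
    then show ?thesis using char_nonzero[OF ch reduce_lat[OF B lat_add[OF x y(1)]]] by (simp add: field_simps)
  qed
  have "?m ` cosets B = cosets B" using finite_cosets[OF B(1)] into inj by (rule endo_inj_surj)
  then have "(\<Sum>x\<in>cosets B. \<theta> x) = (\<Sum>x\<in>?m ` cosets B. \<theta> x)" by simp
  also have "\<dots> = (\<Sum>x\<in>cosets B. \<theta> y * \<theta> x)" using inj val by (simp add: sum.reindex)
  also have "\<dots> = \<theta> y * (\<Sum>x\<in>cosets B. \<theta> x)" by (simp add: sum_distrib_left)
  finally have "(\<theta> y - 1) * (\<Sum>x\<in>cosets B. \<theta> x) = 0" by (simp add: algebra_simps)
  then show ?thesis using y(2) False by simp
qed

text \<open>The double sum of \<open>\<theta> x\<close> over characters and representatives,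
  evaluated in both orders by the two orthogonality relations.\<close>

lemma card_dual:
  assumes B: "euclidean_basis B" "B \<subseteq> \<Lambda>" shows "card (dual B) = card (cosets B)"
proof -
  interpret B: euclidean_basis B by fact
  have triv: "exp_char \<Lambda> (\<lambda>_. 0) \<in> dual B"
    by (rule exp_char_in_dual[OF _ B(2)]) (auto intro: linearI)
  have zero: "x \<in> int_span B \<longleftrightarrow> x = 0" if "x \<in> cosets B" for x
  proof
    assume "x \<in> int_span B"
    moreover have "0 \<in> half_open_parallelepiped B" unfolding B.parallelepiped_iff by (simp add: representation_zero)
    ultimately show "x = 0" using that by (intro B.parallelepiped_unique) (auto simp: cosets_def)
  qed simp
  have 0: "0 \<in> cosets B" unfolding cosets_def using B.parallelepiped_iff[of 0] by (simp add: representation_zero)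
  have "(of_nat (card (dual B)) :: complex) = (\<Sum>x\<in>cosets B. if x = 0 then of_nat (card (dual B)) else 0)"
    using 0 finite_cosets[OF B(1)] by simp
  also have "\<dots> = (\<Sum>x\<in>cosets B. \<Sum>\<theta>\<in>dual B. \<theta> x)"
  proof (rule sum.cong[OF refl])
    fix x assume x: "x \<in> cosets B"
    then have "x \<in> \<Lambda>" by (simp add: cosets_def)
    then show "(if x = 0 then of_nat (card (dual B)) else 0) = (\<Sum>\<theta>\<in>dual B. \<theta> x)"
      by (simp only: sum_dual[OF B] zero[OF x])
  qed
  also have "\<dots> = (\<Sum>\<theta>\<in>dual B. \<Sum>x\<in>cosets B. \<theta> x)" by (rule sum.swap)
  also have "\<dots> = (\<Sum>\<theta>\<in>dual B. if \<theta> = exp_char \<Lambda> (\<lambda>_. 0) then of_nat (card (cosets B)) else 0)"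
    by (intro sum.cong refl sum_cosets[OF B])
  also have "\<dots> = of_nat (card (cosets B))" using triv finite_dual[OF B] by simp
  finally show ?thesis by (simp only: of_nat_eq_iff)
qed

text \<open>
  Integrates, over \<open>(x, l)\<close> with \<open>x\<close> in the parallelepiped of \<open>B\<close> and \<open>x - l\<close> in that of \<open>E\<close>, the
  constant \<open>1\<close> in both orders.
\<close>

lemma volume_parallelepiped:
  assumes B: "euclidean_basis B" "B \<subseteq> \<Lambda>"
  shows "measure lborel (half_open_parallelepiped B) = real (card (cosets B)) * measure lborel (half_open_parallelepiped E)"
proof -
  interpret B: euclidean_basis B by fact
  let ?P = "half_open_parallelepiped B" and ?Q = "half_open_parallelepiped E"
  \<comment> \<open>Only these lattice points can bring a point of one parallelepiped into the
    other, and they are finitely many.\<close>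
  define L where "L = \<Lambda> \<inter> {x - y | x y. x \<in> ?P \<and> y \<in> ?Q}"
  have bdd: "bounded {x - y | x y. x \<in> ?P \<and> y \<in> ?Q}"
  proof -
    have "{x - y | x y. x \<in> ?P \<and> y \<in> ?Q} = (\<lambda>(x, y). x - y) ` (?P \<times> ?Q)" by force
    then show ?thesis using bounded_minus[OF B.bounded_parallelepiped E.bounded_parallelepiped] by simp
  qed
  have finL: "finite L" unfolding L_def by (rule finite_lattice_bounded[OF bdd])
  have one: "(\<Sum>l\<in>L. indicator ?Q (x - l)) = (1 :: ennreal)" if "x \<in> ?P" for x
  proof -
    let ?l = "x - reduce E x"
    have l: "?l \<in> L" using E.reduce_diff[of x] E.reduce_in[of x] that by (auto simp: L_def \<Lambda>)
    have "indicator ?Q (x - l) = (if l = ?l then 1 else 0 :: ennreal)" if "l \<in> L" for l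
    proof -
      have only: "l = ?l" if "x - l \<in> ?Q"
      proof -
        have "l \<in> int_span E" using \<open>l \<in> L\<close> by (simp add: L_def \<Lambda>)
        then have "(x - l) - reduce E x \<in> int_span E"
          using int_span_diff[OF E.reduce_diff[of x]] by (simp add: algebra_simps)
        then have "x - l = reduce E x" by (rule E.parallelepiped_unique[OF that E.reduce_in])
        then show ?thesis by (simp add: algebra_simps)
      qed
      show ?thesis
      proof (cases "l = ?l")
        case True
        then have "x - l = reduce E x" by simp
        then have i: "indicator ?Q (x - l) = (1 :: ennreal)" using E.reduce_in[of x] by simp
        show ?thesis unfolding i if_P[OF True] ..
      next
        case False
        then have "x - l \<notin> ?Q" using only by blast
        then show ?thesis using False by simp
      qed
    qed
    then have "(\<Sum>l\<in>L. indicator ?Q (x - l)) = (\<Sum>l\<in>L. if l = ?l then 1 else 0 :: ennreal)" by (intro sum.cong refl)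
    then show ?thesis using finL l by simp
  qed
  \<comment> \<open>For fixed \<open>y\<close> the translate of \<open>?P\<close> by
    \<open>- y\<close> is again a fundamental domain of \<open>int_span B\<close>, so its lattice
    points represent every coset once; reduction is the bijection.\<close>
  have cnt: "(\<Sum>l\<in>L. indicator ?P (y + l)) = (of_nat (card (cosets B)) :: ennreal)" if y: "y \<in> ?Q" for y
  proof -
    let ?A = "{l \<in> L. y + l \<in> ?P}"
    have "bij_betw (reduce B) ?A (cosets B)"
    proof (intro bij_betw_imageI inj_onI equalityI subsetI)
      fix l m assume lm: "l \<in> ?A" "m \<in> ?A" "reduce B l = reduce B m"
      have "(l - reduce B l) - (m - reduce B m) \<in> int_span B" by (intro int_span_diff B.reduce_diff)
      then have "y + l = y + m" using lm by (intro B.parallelepiped_unique) auto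
      then show "l = m" by simp
    next
      fix x assume "x \<in> reduce B ` ?A"
      then show "x \<in> cosets B" using reduce_lat[OF B] B.reduce_in by (auto simp: cosets_def L_def)
    next
      fix x assume x: "x \<in> cosets B"
      let ?l = "reduce B (x + y) - y"
      have d: "x + y - reduce B (x + y) \<in> int_span B" by (rule B.reduce_diff)
      have "x - (x + y - reduce B (x + y)) \<in> \<Lambda>"
        by (rule lat_diff) (use x d int_span_lat[OF B(2)] in \<open>auto simp: cosets_def\<close>)
      then have "?l \<in> \<Lambda>" by (simp add: algebra_simps)
      then have lA: "?l \<in> ?A" using y B.reduce_in[of "x + y"] by (auto simp: L_def)
      have "reduce B ?l = x"
      proof (rule B.parallelepiped_unique[OF B.reduce_in])
        have "(- (x + y - reduce B (x + y))) - (?l - reduce B ?l) \<in> int_span B"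
          by (intro int_span_diff int_span_minus d B.reduce_diff)
        then show "reduce B ?l - x \<in> int_span B" by (simp add: algebra_simps)
      qed (use x in \<open>simp add: cosets_def\<close>)
      with lA show "x \<in> reduce B ` ?A" by (intro image_eqI[of _ _ ?l]) auto
    qed
    then have "card ?A = card (cosets B)" by (rule bij_betw_same_card)
    moreover have "(\<Sum>l\<in>L. indicator ?P (y + l)) = (of_nat (card ?A) :: ennreal)"
      using finL by (simp add: indicator_def sum.If_cases Int_def)
    ultimately show ?thesis by simp
  qed
  have "ennreal (measure lborel ?P) = (\<integral>\<^sup>+x. indicator ?P x \<partial>lborel)" by (simp add: B.emeasure_parallelepiped(1))
  also have "\<dots> = (\<integral>\<^sup>+x. (\<Sum>l\<in>L. indicator ?P x * indicator ?Q (x - l)) \<partial>lborel)"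
  proof (rule nn_integral_cong)
    fix x
    show "indicator ?P x = (\<Sum>l\<in>L. indicator ?P x * indicator ?Q (x - l) :: ennreal)"
      using one[of x] by (cases "x \<in> ?P") (simp_all flip: sum_distrib_left)
  qed
  also have "\<dots> = (\<Sum>l\<in>L. \<integral>\<^sup>+x. indicator ?P x * indicator ?Q (x - l) \<partial>lborel)"
    by (rule nn_integral_sum) measurable
  also have "\<dots> = (\<Sum>l\<in>L. \<integral>\<^sup>+y. indicator ?P (y + l) * indicator ?Q y \<partial>lborel)"
  proof (rule sum.cong[OF refl])
    fix l
    have "(\<integral>\<^sup>+x. indicator ?P x * indicator ?Q (x - l) \<partial>lborel) =
        (\<integral>\<^sup>+x. indicator ?P (x + l) * indicator ?Q (x + l - l) \<partial>lborel :: ennreal)"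
      by (rule nn_integral_lborel_shift[symmetric]) measurable
    then show "(\<integral>\<^sup>+x. indicator ?P x * indicator ?Q (x - l) \<partial>lborel) =
        (\<integral>\<^sup>+y. indicator ?P (y + l) * indicator ?Q y \<partial>lborel :: ennreal)" by simp
  qed
  also have "\<dots> = (\<integral>\<^sup>+y. (\<Sum>l\<in>L. indicator ?P (y + l) * indicator ?Q y) \<partial>lborel)"
    by (rule nn_integral_sum[symmetric]) measurable
  also have "\<dots> = (\<integral>\<^sup>+y. of_nat (card (cosets B)) * indicator ?Q y \<partial>lborel)"
  proof (rule nn_integral_cong)
    fix y
    show "(\<Sum>l\<in>L. indicator ?P (y + l) * indicator ?Q y) = (of_nat (card (cosets B)) * indicator ?Q y :: ennreal)"
      using cnt[of y] by (cases "y \<in> ?Q") (simp_all flip: sum_distrib_right)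
  qed
  also have "\<dots> = of_nat (card (cosets B)) * ennreal (measure lborel ?Q)"
    by (subst nn_integral_cmult_indicator) (auto simp: E.emeasure_parallelepiped(1))
  also have "\<dots> = ennreal (real (card (cosets B)) * measure lborel ?Q)"
    by (simp add: ennreal_mult ennreal_of_nat_eq_real_of_nat)
  finally show ?thesis by (subst (asm) ennreal_inj) auto
qed

end

section \<open>Lists supported on a basis\<close>

text \<open>
  The Todd series \<open>T = X / (1 - exp (- X))\<close> satisfies \<open>X T' = T + X T - T\<^sup>2\<close>; this is what
  lets one evaluate the operator on monomials without knowing its coefficients.
\<close>

lemma todd_identity:
  "char_series 1 * char_series 1 = char_series 1 - fps_deriv (char_series 1) * fps_X + char_series 1 * fps_X"
proof -
  let ?T = "char_series 1" and ?E = "1 - fps_exp (- 1) :: complex fps"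
  have ET: "?E * ?T = fps_X" using char_series_mult[of 1] by simp
  have d: "fps_deriv ?E = 1 - ?E" by (simp add: fps_eq_iff)
  have "fps_deriv (?E * ?T) = 1" unfolding ET by simp
  then have dET: "?E * fps_deriv ?T = 1 - (1 - ?E) * ?T" unfolding fps_deriv_mult d by (simp add: algebra_simps)
  have "?E * (?T * ?T) = fps_X * ?T" using ET by (simp add: mult.assoc[symmetric])
  moreover have "?E * (?T - fps_deriv ?T * fps_X + ?T * fps_X) =
      (?E * ?T) - (?E * fps_deriv ?T) * fps_X + (?E * ?T) * fps_X" by (simp add: algebra_simps)
  moreover have "\<dots> = fps_X - (1 - (1 - ?E) * ?T) * fps_X + fps_X * fps_X" unfolding ET dET ..
  moreover have "\<dots> = fps_X * ?T - (?E * ?T) * fps_X + fps_X * fps_X" by (simp add: algebra_simps)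
  moreover have "\<dots> = fps_X * ?T" unfolding ET by simp
  ultimately have "?E * (?T * ?T) = ?E * (?T - fps_deriv ?T * fps_X + ?T * fps_X)" by simp
  moreover have "fps_nth ?E 1 \<noteq> 0" by simp
  then have "?E \<noteq> 0" by (metis fps_zero_nth)
  ultimately show ?thesis by (metis mult_left_cancel)
qed

text \<open>The case \<open>m = 1\<close> is the preceding identity; the general one follows from
  the derivative of a power and serves vectors that occur \<open>m\<close> times.\<close>

lemma todd_power_identity:
  "of_nat m * char_series 1 ^ Suc m =
    of_nat m * char_series 1 ^ m - fps_deriv (char_series 1 ^ m) * fps_X + of_nat m * char_series 1 ^ m * fps_X"
proof (cases m)
  case (Suc k)
  let ?T = "char_series 1"
  have "fps_deriv (?T ^ Suc k) = of_nat (Suc k) * fps_deriv ?T * ?T ^ k" for k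
    by (induction k) (simp_all add: algebra_simps)
  from this[of k] have "fps_deriv (?T ^ m) = of_nat m * fps_deriv ?T * ?T ^ k" by (simp only: Suc)
  then have "of_nat m * ?T ^ m - fps_deriv (?T ^ m) * fps_X + of_nat m * ?T ^ m * fps_X =
     of_nat m * ?T ^ k * (?T - fps_deriv ?T * fps_X + ?T * fps_X)"
    by (simp add: Suc algebra_simps)
  also have "\<dots> = of_nat m * ?T ^ Suc m" unfolding todd_identity[symmetric] by (simp add: Suc mult_ac)
  finally show ?thesis by simp
qed simp

lemma todd_nth_0: "fps_nth (char_series 1) 0 = 1"
proof -
  have "fps_nth ((1 - fps_exp (- 1)) * char_series 1) 1 = 1" using char_series_mult[of 1] by simp
  then show ?thesis by (simp add: fps_mult_nth)
qed

lemma fps_dir_cmult: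
  assumes "polynomial_function g" shows "fps_dir S a (\<lambda>x. c * g x) = (\<lambda>x. c * fps_dir S a g x)"
  using fps_dir_lincomb_right[of "\<lambda>_. 0" g S a c] assms
  by (auto simp: fun_eq_iff fps_dir_def dir_deriv_power_zero)

lemma foldr_fps_dir_cmult:
  assumes "polynomial_function g"
  shows "foldr (\<lambda>a. fps_dir (S a) a) X (\<lambda>x. c * g x) = (\<lambda>x. c * foldr (\<lambda>a. fps_dir (S a) a) X g x)"
  by (induction X) (simp_all add: fps_dir_cmult polynomial_foldr_fps_dir assms)

lemma foldr_fps_dir_linear_mult:
  fixes g :: "'v::real_normed_vector \<Rightarrow> complex"
  assumes "polynomial_function g" "bounded_linear l" "\<And>b. b \<in> set X \<Longrightarrow> l b = 0"
  shows "foldr (\<lambda>a. fps_dir (S a) a) X (\<lambda>x. of_real (l x) * g x) = (\<lambda>x. of_real (l x) * foldr (\<lambda>a. fps_dir (S a) a) X g x)"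
  using assms(3)
proof (induction X)
  case (Cons b X)
  then have eq: "foldr (\<lambda>a. fps_dir (S a) a) X (\<lambda>x. of_real (l x) * g x) =
      (\<lambda>x. of_real (l x) * foldr (\<lambda>a. fps_dir (S a) a) X g x)" by simp
  have "l b = 0" using Cons.prems by simp
  then show ?case unfolding foldr.simps o_def eq
    by (intro ext) (simp add: fps_dir_linear_mult[OF polynomial_foldr_fps_dir[OF assms(1)] assms(2)])
qed simp

lemma foldr_replicate_fps_dir:
  assumes "polynomial_function g"
  shows "foldr (\<lambda>a. fps_dir (S a) a) (replicate m a) g = fps_dir (S a ^ m) a g"
  by (induction m) (simp_all add: fps_dir_1 fps_dir_mult assms)

lemma mset_replicate_filter: "mset X = mset (replicate (count_list X a) a @ filter (\<lambda>b. b \<noteq> a) X)"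
  by (induction X) auto

text \<open>Operators of the other vectors commute with multiplication by \<open>l\<close>, so only
  a power of the Todd series in direction \<open>a\<close> has to be followed. With \<open>G\<close>
  and \<open>W\<close> the images of \<open>g\<close> and \<open>l g\<close> under those operators
  one has \<open>W = l G\<close> and \<open>D W = m G\<close>. The commutation rule produces the
  derivative of the series, and the power identity eliminates it, leaving the single factor
  \<open>(l + m) / m\<close>.\<close>

lemma foldr_todd_step:
  fixes g :: "'v::real_normed_vector \<Rightarrow> complex"
  assumes g: "polynomial_function g" and l: "bounded_linear l" "l a = 1" "\<And>b. b \<in> set X \<Longrightarrow> b \<noteq> a \<Longrightarrow> l b = 0"
    and m: "m = count_list X a" "m > 0" and d: "dir_deriv a (\<lambda>x. of_real (l x) * g x) = (\<lambda>x. of_nat m * g x)"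
  defines "P \<equiv> \<lambda>X. foldr (\<lambda>a. fps_dir (char_series 1) a) X"
  shows "P (a # X) (\<lambda>x. (1 / of_nat m) * (of_real (l x) * g x)) x = (of_real (l x) + of_nat m) / of_nat m * P X g x"
proof -
  let ?T = "char_series 1" and ?R = "filter (\<lambda>b. b \<noteq> a) X"
  have perm: "P Y h = P Z h" if "mset Y = mset Z" "polynomial_function h" for Y Z h
    unfolding P_def by (rule foldr_fps_dir_permute[where S = "\<lambda>_. ?T", OF that])
  have rep: "P (replicate k a @ ?R) h = fps_dir (?T ^ k) a (P ?R h)" if "polynomial_function h" for k h
    unfolding P_def foldr_append o_def
    by (rule foldr_replicate_fps_dir[where S = "\<lambda>_. ?T"]) (rule polynomial_foldr_fps_dir[where S = "\<lambda>_. ?T", OF that])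
  have pl: "polynomial_function (\<lambda>x. complex_of_real (l x) * g x)"
    by (intro polynomial_function_complex_mult g polynomial_function_of_real real_polynomial_function.intros(1) l)
  define G where "G = P ?R g"
  have pG: "polynomial_function G" unfolding G_def P_def by (rule polynomial_foldr_fps_dir[where S = "\<lambda>_. ?T", OF g])
  define W where "W = (\<lambda>x. complex_of_real (l x) * G x)"
  have pW: "polynomial_function W" unfolding W_def
    by (intro polynomial_function_complex_mult pG polynomial_function_of_real real_polynomial_function.intros(1) l)
  have W: "P ?R (\<lambda>x. of_real (l x) * g x) = W"
    unfolding P_def W_def G_def by (rule foldr_fps_dir_linear_mult[OF g l(1)]) (use l(3) in auto)
  have DW: "dir_deriv a W = (\<lambda>x. of_nat m * G x)"
    unfolding W[symmetric] unfolding P_def dir_deriv_foldr[where S = "\<lambda>_. ?T", OF pl] d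
    by (simp add: foldr_fps_dir_cmult[OF g, where S = "\<lambda>_. ?T"] G_def P_def)
  have ms: "mset (a # X) = mset (replicate (Suc m) a @ ?R)" using mset_replicate_filter[of X a] m(1) by simp
  have "P (a # X) (\<lambda>x. (1 / of_nat m) * (of_real (l x) * g x)) = fps_dir (?T ^ Suc m) a (P ?R (\<lambda>x. (1 / of_nat m) * (of_real (l x) * g x)))"
    unfolding perm[OF ms polynomial_function_cmult[OF pl]] by (rule rep[OF polynomial_function_cmult[OF pl]])
  also have "P ?R (\<lambda>x. (1 / of_nat m) * (of_real (l x) * g x)) = (\<lambda>x. (1 / of_nat m) * W x)"
    unfolding W[symmetric] P_def by (rule foldr_fps_dir_cmult[where S = "\<lambda>_. ?T", OF pl])
  finally have L: "P (a # X) (\<lambda>x. (1 / of_nat m) * (of_real (l x) * g x)) x = (1 / of_nat m) * fps_dir (?T ^ Suc m) a W x"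
    unfolding fps_dir_cmult[OF pW] by (rule fun_cong)
  have R: "P X g = fps_dir (?T ^ m) a G"
    unfolding G_def rep[OF g, symmetric] using perm[OF mset_replicate_filter g] m(1) by simp
  \<comment> \<open>From \<open>D W = m G\<close>: operators on \<open>G\<close> become operators on
    \<open>W\<close>, where the identity between power series can be applied.\<close>
  have XG: "of_nat m * fps_dir S a G x = fps_dir (S * fps_X) a W x" for S
    unfolding fps_dir_mult[OF pW, symmetric] fps_dir_X DW by (simp add: fps_dir_cmult[OF pG])
  have c: "fps_dir (of_nat m * S) a W x = of_nat m * fps_dir S a W x" for S
    using fps_dir_lincomb[OF pW, of 0 "of_nat m" S a x] by (simp add: fps_of_nat fps_dir_def)
  have s: "fps_dir (A - B + C) a W x = fps_dir A a W x - fps_dir B a W x + fps_dir C a W x" for A B C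
    using fps_dir_lincomb[OF pW, of A "- 1" B a x] fps_dir_lincomb[OF pW, of "A - B" 1 C a x]
    by (simp flip: fps_const_neg)
  have "of_nat m * (of_nat m * fps_dir (?T ^ Suc m) a W x) = of_nat m * fps_dir (of_nat m * ?T ^ Suc m) a W x" by (simp only: c)
  also have "\<dots> = of_nat m * (of_nat m * fps_dir (?T ^ m) a W x - of_nat m * fps_dir (fps_deriv (?T ^ m)) a G x
      + of_nat m * (of_nat m * fps_dir (?T ^ m) a G x))"
    unfolding todd_power_identity s c XG by (simp add: mult.assoc c)
  finally have "of_nat m * fps_dir (?T ^ Suc m) a W x = of_nat m * fps_dir (?T ^ m) a W x - of_nat m * fps_dir (fps_deriv (?T ^ m)) a G x
      + of_nat m * (of_nat m * fps_dir (?T ^ m) a G x)"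
    using m(2) by (simp only: mult_cancel_left) simp
  then have "of_nat m * fps_dir (?T ^ Suc m) a W x =
      of_nat m * (fps_dir (?T ^ m) a W x - fps_dir (fps_deriv (?T ^ m)) a G x + of_nat m * fps_dir (?T ^ m) a G x)"
    by (simp add: algebra_simps)
  then have "fps_dir (?T ^ Suc m) a W x =
      fps_dir (?T ^ m) a W x - fps_dir (fps_deriv (?T ^ m)) a G x + of_nat m * fps_dir (?T ^ m) a G x"
    using m(2) by (simp only: mult_cancel_left) simp
  also have "fps_dir (?T ^ m) a W x = of_real (l x) * fps_dir (?T ^ m) a G x + fps_dir (fps_deriv (?T ^ m)) a G x"
    unfolding W_def using fps_dir_linear_mult[OF pG l(1), of "?T ^ m" a x] l(2) by simp
  finally have "fps_dir (?T ^ Suc m) a W x = (of_real (l x) + of_nat m) * fps_dir (?T ^ m) a G x"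
    by (simp add: algebra_simps)
  then show ?thesis unfolding L R by simp
qed

context euclidean_basis
begin

text \<open>Each direction in turn meets the box in a parameter interval of length one. For all of
  \<open>B\<close> this says that the box receives mass \<open>1\<close>, which fixes the constant
  density of a basis.\<close>

lemma rays_parallelepiped:
  assumes "distinct cs" "set cs \<subseteq> B" "\<And>b. b \<in> set cs \<Longrightarrow> coord b z = 0"
  shows "rays cs (indicator (half_open_parallelepiped B)) z =
    (indicator {z. \<forall>b\<in>B - set cs. 0 \<le> coord b z \<and> coord b z < 1} z :: ennreal)"
  using assms
proof (induction cs arbitrary: z)
  case Nil
  then show ?case by (simp add: indicator_def parallelepiped_iff)
next
  case (Cons a cs)
  let ?I = "indicator {z. \<forall>b\<in>B - set (a # cs). 0 \<le> coord b z \<and> coord b z < 1} z :: ennreal"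
  have a: "a \<in> B" "coord a z = 0" "a \<notin> set cs" using Cons.prems by auto
  have c: "coord b (z + t *\<^sub>R a) = coord b z + (if b = a then t else 0)" for b t
    using a(1) by (simp add: coord_add coord_scaleR coord_basis)
  have eq: "rays cs (indicator (half_open_parallelepiped B)) (z + t *\<^sub>R a) * indicator {0..} t = ?I * indicator {0..<1} t" for t
  proof -
    have "rays cs (indicator (half_open_parallelepiped B)) (z + t *\<^sub>R a) =
        (indicator {z. \<forall>b\<in>B - set cs. 0 \<le> coord b z \<and> coord b z < 1} (z + t *\<^sub>R a) :: ennreal)"
      by (rule Cons.IH) (use Cons.prems in \<open>auto simp: c\<close>)
    moreover have "B - set cs = insert a (B - set (a # cs))" using a by auto
    ultimately show ?thesis using a(2) by (auto simp: indicator_def c)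
  qed
  have "rays (a # cs) (indicator (half_open_parallelepiped B)) z = (\<integral>\<^sup>+t. ?I * indicator {0..<1::real} t \<partial>lborel)"
    unfolding rays_Cons ray_def eq ..
  also have "\<dots> = ?I" by (subst nn_integral_cmult_indicator) simp_all
  finally show ?case .
qed

lemma coord_span:
  assumes "A \<subseteq> B" "b \<in> B - A" "x \<in> span A" shows "coord b x = 0"
proof -
  have "span A \<subseteq> {x. coord b x = 0}"
  proof (rule span_minimal)
    show "A \<subseteq> {x. coord b x = 0}" using assms(1,2) by (auto simp: coord_basis)
    show "subspace {x. coord b x = 0}"
      by (auto simp: subspace_def coord_add coord_scaleR representation_zero)
  qed
  then show ?thesis using assms(3) by blast
qed

lemma span_subset_B:
  assumes "A \<subseteq> B" "b \<in> B - A" shows "span A \<noteq> UNIV"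
proof
  assume "span A = UNIV"
  then have "coord b b = 0" using coord_span[OF assms, of b] by simp
  then show False using coord_basis[of b b] assms(2) by simp
qed

lemma not_spanning_subset:
  assumes "A \<subseteq> B" "span A \<noteq> UNIV" shows "\<exists>b. b \<in> B - A"
proof (rule ccontr)
  assume "\<not> ?thesis"
  then have "A = B" using assms(1) by blast
  then show False using assms(2) spanning by simp
qed

lemma orthant_not_singular:
  assumes "set X = B" "u \<in> orthant" shows "u \<notin> singular_points X"
proof
  assume "u \<in> singular_points X"
  then obtain A where A: "A \<subseteq> B" "span A \<noteq> UNIV" "u \<in> cone_of A" using assms(1) by (auto simp: singular_points_def)
  obtain b where b: "b \<in> B - A" using not_spanning_subset[OF A(1,2)] by blast
  have "coord b u = 0" using coord_span[OF A(1) b] A(3) cone_of_subset_span by blast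
  then show False using assms(2) b by (auto simp: orthant_def)
qed

lemma cone_of_B: "x \<in> cone_of B \<longleftrightarrow> (\<forall>b\<in>B. 0 \<le> coord b x)"
proof
  assume "x \<in> cone_of B"
  then obtain t where "x = (\<Sum>b\<in>B. t b *\<^sub>R b)" "\<forall>b\<in>B. 0 \<le> t b" unfolding cone_of_def by blast
  then show "\<forall>b\<in>B. 0 \<le> coord b x" using coord_sum[of _ t] by simp
next
  assume "\<forall>b\<in>B. 0 \<le> coord b x"
  then show "x \<in> cone_of B" unfolding cone_of_def using sum_coord[of x]
    by (intro CollectI exI[of _ "\<lambda>b. coord b x"]) simp
qed

text \<open>A vanishing coordinate would put \<open>u\<close> into the cone of the remaining basis
  vectors, which do not span. So the orthant is the only chamber inside the cone.\<close>

lemma cone_not_singular: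
  assumes "set X = B" "u \<notin> singular_points X" "u \<in> cone_of B" shows "u \<in> orthant"
  unfolding orthant_def
proof (intro CollectI ballI)
  fix b assume b: "b \<in> B"
  have "coord b u \<noteq> 0"
  proof
    assume "coord b u = 0"
    then have "u = (\<Sum>c\<in>B - {b}. coord c u *\<^sub>R c)"
      using sum_coord[of u] b finite_B by (simp add: sum.remove[of B b])
    then have "u \<in> cone_of (B - {b})" unfolding cone_of_def using assms(3)
      by (intro CollectI exI[of _ "\<lambda>c. coord c u"]) (auto simp: cone_of_B)
    moreover have "span (B - {b}) \<noteq> UNIV" using span_subset_B[of "B - {b}" b] b by blast
    ultimately show False using assms(1,2) by (auto simp: singular_points_def)
  qed
  moreover have "0 \<le> coord b u" using assms(3) b by (simp add: cone_of_B)
  ultimately show "0 < coord b u" by simp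
qed

lemma polynomial_constant:
  assumes g: "polynomial_function g" and z: "\<And>b. b \<in> B \<Longrightarrow> dir_deriv b g = (\<lambda>_. 0)"
  shows "g x = (g 0 :: complex)"
proof -
  have shift: "g (y + t *\<^sub>R b) = g y" if "b \<in> B" for y t b
  proof -
    have "(dir_deriv b ^^ j) g = (\<lambda>_. 0)" if j: "j \<ge> 1" for j
    proof -
      obtain k where "j = Suc k" using j by (cases j) auto
      then show ?thesis using z[OF \<open>b \<in> B\<close>] by (simp add: funpow_Suc_right dir_deriv_power_zero del: funpow.simps)
    qed
    from polynomial_taylor[OF g this, where x = y and t = t] show ?thesis by simp
  qed
  have "g (\<Sum>b\<in>C. coord b x *\<^sub>R b) = g 0" if "C \<subseteq> B" for C
    using finite_subset[OF that finite_B] that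
  proof (induction C rule: finite_induct)
    case (insert b C)
    then show ?case using shift[of b "\<Sum>b\<in>C. coord b x *\<^sub>R b" "coord b x"] by (simp add: add.commute)
  qed simp
  from this[OF subset_refl] show ?thesis by (simp add: sum_coord)
qed

lemma convex_orthant: "convex orthant"
proof -
  have "orthant = (\<Inter>b\<in>B. coord b -` {0<..})" by (auto simp: orthant_def)
  also have "convex \<dots>"
    by (intro convex_INT convex_linear_vimage bounded_linear.linear bounded_linear_coord convex_real_interval)
  finally show ?thesis .
qed

text \<open>The derivative of the density along a basis vector is the density of a list that no
  longer spans, hence zero. So the density is locally constant on the orthant, constant because the
  orthant is connected, and determined by the mass of the box.\<close>

lemma rays_basis:
  assumes bs: "distinct bs" "set bs = B" and pos: "\<And>b. b \<in> B \<Longrightarrow> 0 < w \<bullet> b"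
    and [measurable]: "f \<in> borel_measurable borel"
  shows "rays bs f 0 = (\<integral>\<^sup>+y. f y * (indicator orthant y * ennreal (1 / measure lborel (half_open_parallelepiped B))) \<partial>lborel)"
proof -
  have pos': "\<And>b. b \<in> set bs \<Longrightarrow> 0 < w \<bullet> b" using pos bs by simp
  have const: "\<exists>c. local_density bs u = (\<lambda>_. c)" if u: "u \<in> orthant" for u
  proof -
    have us: "u \<notin> singular_points bs" by (rule orthant_not_singular[OF bs(2) u])
    let ?g = "\<lambda>x. complex_of_real (local_density bs u x)"
    have g: "polynomial_function ?g"
      by (intro polynomial_function_of_real real_polynomial_local_density[OF pos' us])
    have "dir_deriv b ?g = (\<lambda>_. 0)" if b: "b \<in> B" for b
    proof -
      let ?r = "remove1 b bs"
      have ms: "mset bs = mset (b # ?r)" using b bs by simp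
      have set: "set (b # ?r) = B" "set ?r = B - {b}" using bs b by auto
      have us': "u \<notin> singular_points (b # ?r)" by (rule orthant_not_singular[OF set(1) u])
      have pr: "\<And>a. a \<in> set (b # ?r) \<Longrightarrow> 0 < w \<bullet> a" using pos set(1) by blast
      have "dir_deriv b ?g = (\<lambda>x. complex_of_real (local_density ?r u x))"
        unfolding local_density_permute[OF ms] by (rule dir_deriv_local_density[OF pr us'])
      also have "local_density ?r u = (\<lambda>_. 0)"
      proof (rule local_density_not_spanning)
        show "span (set ?r) \<noteq> UNIV" unfolding set(2) using span_subset_B[of "B - {b}" b] b by blast
        show "u \<notin> singular_points ?r" using us' singular_points_mono[of ?r "b # ?r"] by auto
      qed
      finally show ?thesis by simp
    qed
    from polynomial_constant[OF g this] have "complex_of_real (local_density bs u x) = of_real (local_density bs u 0)" for x .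
    then show ?thesis by (intro exI[of _ "local_density bs u 0"]) (simp add: fun_eq_iff)
  qed
  have fun_const: "density_fun bs u = density_fun bs v" if "u \<in> orthant" "v \<in> orthant" for u v
  proof (rule connected_local_const[OF convex_connected[OF convex_orthant] that])
    show "\<forall>u\<in>orthant. \<forall>\<^sub>F x in at u within orthant. density_fun bs u = density_fun bs x"
    proof
      fix u assume u: "u \<in> orthant"
      have us: "u \<notin> singular_points bs" by (rule orthant_not_singular[OF bs(2) u])
      obtain e where e: "density_near bs u (local_density bs u) e" "ball u e \<inter> singular_points bs = {}"
        by (rule density_near_avoiding_singular[OF pos' us])
      obtain c where c: "local_density bs u = (\<lambda>_. c)" using const[OF u] by blast
      have val: "density_fun bs x = c" if "x \<in> ball u e" for x
      proof -
        have "x \<notin> singular_points bs" using e(2) that by blast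
        then show ?thesis using density_fun_local[OF e(1) that] c by simp
      qed
      have e0: "0 < e" by (rule density_nearD(2)[OF e(1)])
      have "\<forall>\<^sub>F x in nhds u. x \<in> ball u e" using e0 by (intro eventually_nhds_in_open) auto
      then have "\<forall>\<^sub>F x in nhds u. density_fun bs u = density_fun bs x"
        by eventually_elim (use val e0 in auto)
      then show "\<forall>\<^sub>F x in at u within orthant. density_fun bs u = density_fun bs x"
        by (rule filter_leD[OF at_within_le_nhds])
    qed
  qed
  let ?p = "\<Sum>b\<in>B. b"
  have p: "?p \<in> orthant" using coord_sum[of _ "\<lambda>_. 1"] by (simp add: orthant_def)
  define c where "c = density_fun bs ?p"
  have c0: "0 \<le> c" unfolding c_def by (rule density_fun_nonneg[OF pos'])
  have off: "indicator orthant y = (indicator (cone_of B) y :: ennreal) \<and> density_fun bs y = indicator orthant y * c"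
    if ns: "y \<notin> singular_points bs" for y
  proof (cases "y \<in> orthant")
    case True
    then show ?thesis using fun_const[OF True p] by (auto simp: c_def cone_of_B orthant_def less_imp_le)
  next
    case False
    then have "y \<notin> cone_of B" using cone_not_singular[OF bs(2) ns] by blast
    then show ?thesis using False bs(2) by (simp add: density_fun_def regular_points_eq)
  qed
  have AEo: "AE y in lborel. indicator orthant y = (indicator (cone_of B) y :: ennreal) \<and> density_fun bs y = indicator orthant y * c"
    using AE_not_singular[of bs] by eventually_elim (rule off)
  note [measurable] = borel_measurable_density_fun[OF pos'] open_orthant[THEN borel_open]
  have sp: "span (set bs) = UNIV" using bs(2) spanning by simp
  have main: "rays bs f 0 = (\<integral>\<^sup>+y. f y * (indicator orthant y * ennreal c) \<partial>lborel)"
    if [measurable]: "f \<in> borel_measurable borel" for f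
  proof -
    have "rays bs f 0 = (\<integral>\<^sup>+y. ennreal (density_fun bs y) * f y \<partial>lborel)"
      unfolding nn_integral_ray_measure[OF that, symmetric] ray_measure_eq_density[OF pos' sp, simplified]
      by (subst nn_integral_density) auto
    also have "\<dots> = (\<integral>\<^sup>+y. f y * (indicator orthant y * ennreal c) \<partial>lborel)"
      using AEo by (intro nn_integral_cong_AE, eventually_elim) (auto simp: indicator_def mult.commute)
    finally show ?thesis .
  qed
  let ?P = "half_open_parallelepiped B"
  \<comment> \<open>The box lies in the closed cone, so up to a null set it lies in the orthant: its
    mass is the constant times its volume.\<close>
  have "1 = rays bs (indicator ?P) 0" using rays_parallelepiped[OF bs(1), of 0] bs(2) by (simp add: representation_zero)
  also have "\<dots> = (\<integral>\<^sup>+y. indicator ?P y * (indicator orthant y * ennreal c) \<partial>lborel)" by (rule main) measurable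
  also have "\<dots> = (\<integral>\<^sup>+y. ennreal c * indicator ?P y \<partial>lborel)"
    using AEo
  proof (intro nn_integral_cong_AE, eventually_elim)
    case (elim y)
    have "y \<in> cone_of B" if "y \<in> ?P" using that by (simp add: cone_of_B parallelepiped_iff)
    then show ?case using elim by (cases "y \<in> ?P") auto
  qed
  also have "\<dots> = ennreal c * ennreal (measure lborel ?P)"
    by (subst nn_integral_cmult_indicator) (auto simp: emeasure_parallelepiped(1))
  also have "\<dots> = ennreal (c * measure lborel ?P)" using c0 by (simp add: ennreal_mult)
  finally have "ennreal 1 = ennreal (c * measure lborel ?P)" by simp
  then have "c * measure lborel ?P = 1" using c0 by (subst (asm) ennreal_inj) auto
  then have "c = 1 / measure lborel ?P" using emeasure_parallelepiped(2) by (simp add: field_simps)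
  then show ?thesis using main[of f] by simp
qed

text \<open>
  With \<open>es\<close> appended to the basis, this is the product of the \<open>c\<^sub>b ^ m\<^sub>b / m\<^sub>b!\<close> divided by the volume,
  \<open>c\<^sub>b\<close> being the coordinates and \<open>m\<^sub>b\<close> the multiplicities in \<open>es\<close>.
\<close>

primrec basis_density :: "'v list \<Rightarrow> 'v \<Rightarrow> real" where
  "basis_density [] y = 1 / measure lborel (half_open_parallelepiped B)"
| "basis_density (a # es) y = coord a y / Suc (count_list es a) * basis_density es y"

lemma real_polynomial_coord: "real_polynomial_function (coord b)"
  using bounded_linear_coord by (rule real_polynomial_function.intros(1))

lemma real_polynomial_basis_density: "real_polynomial_function (basis_density es)"
proof (induction es)
  case Nil
  show ?case unfolding basis_density.simps by (rule real_polynomial_function.intros(2))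
next
  case (Cons a es)
  show ?case unfolding basis_density.simps
    by (intro real_polynomial_function.intros(4) real_polynomial_function_divide real_polynomial_coord Cons)
qed

lemma basis_density_nonneg:
  assumes "y \<in> orthant" "set es \<subseteq> B" shows "0 \<le> basis_density es y"
  using assms(2) by (induction es) (use assms(1) in \<open>auto simp: orthant_def less_imp_le intro!: mult_nonneg_nonneg\<close>)

text \<open>Only the factors belonging to \<open>a\<close> change. Multiplying by the power of the
  coordinate avoids a division where it vanishes.\<close>

lemma basis_density_shift:
  assumes "a \<in> B" "set es \<subseteq> B"
  shows "basis_density es (y + s *\<^sub>R a) * coord a y ^ count_list es a = (coord a y + s) ^ count_list es a * basis_density es y"
  using assms(2)
proof (induction es)
  case (Cons b es)
  have c: "coord b (y + s *\<^sub>R a) = coord b y + (if b = a then s else 0)"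
    using assms(1) by (simp add: coord_add coord_scaleR coord_basis)
  have "basis_density (b # es) (y + s *\<^sub>R a) * coord a y ^ count_list (b # es) a =
      (coord b y + (if b = a then s else 0)) * (if b = a then coord a y else 1) / Suc (count_list es b) *
      (basis_density es (y + s *\<^sub>R a) * coord a y ^ count_list es a)"
    by (simp add: c)
  also have "\<dots> = (coord b y + (if b = a then s else 0)) * (if b = a then coord a y else 1) / Suc (count_list es b) *
      ((coord a y + s) ^ count_list es a * basis_density es y)"
    using Cons by simp
  also have "\<dots> = (coord a y + s) ^ count_list (b # es) a * basis_density (b # es) y" by simp
  finally show ?case .
qed simp

lemma basis_density_integral:
  assumes "a \<in> B" "set es \<subseteq> B" "y \<in> orthant"
  shows "(\<integral>\<^sup>+t. ennreal (basis_density es (y - t *\<^sub>R a)) * indicator {0..coord a y} t \<partial>lborel) = ennreal (basis_density (a # es) y)"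
proof -
  let ?k = "count_list es a" and ?Y = "coord a y"
  have Y: "0 < ?Y" using assms(1,3) by (simp add: orthant_def)
  have sh: "basis_density es (y - t *\<^sub>R a) = (?Y - t) ^ ?k / ?Y ^ ?k * basis_density es y" for t
    using basis_density_shift[OF assms(1,2), of y "- t"] Y by (simp add: field_simps)
  let ?F = "\<lambda>t. - ((?Y - t) ^ Suc ?k / (Suc ?k * ?Y ^ ?k) * basis_density es y)"
  have "(\<integral>\<^sup>+t. ennreal (basis_density es (y - t *\<^sub>R a)) * indicator {0..?Y} t \<partial>lborel) = ?F ?Y - ?F 0"
  proof (rule nn_integral_FTC_Icc)
    fix t assume t: "t \<in> {0..?Y}"
    show "0 \<le> basis_density es (y - t *\<^sub>R a)"
      unfolding sh using t Y basis_density_nonneg[OF assms(3,2)] by simp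
    have "(?F has_real_derivative basis_density es (y - t *\<^sub>R a)) (at t)"
      unfolding sh using Y by (auto intro!: derivative_eq_intros simp del: power_Suc of_nat_Suc)
    then show "(?F has_real_derivative basis_density es (y - t *\<^sub>R a)) (at t)" .
  next
    have "continuous_on UNIV (\<lambda>t. basis_density es (y - t *\<^sub>R a))" unfolding sh by (intro continuous_intros) (use Y in auto)
    then show "(\<lambda>t. basis_density es (y - t *\<^sub>R a)) \<in> borel_measurable borel" by (rule borel_measurable_continuous_onI)
  qed (use Y in simp)
  also have "?F ?Y - ?F 0 = basis_density (a # es) y" using Y by (simp del: of_nat_Suc)
  finally show ?thesis .
qed

text \<open>A further vector \<open>a\<close> convolves the density with its ray. Seen backwards
  from \<open>y\<close>, the ray leaves the orthant at parameter \<open>coord a y\<close>, so what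
  remains is the integral of a power of the coordinate.\<close>

lemma rays_basis_multiple:
  assumes bs: "distinct bs" "set bs = B" and pos: "\<And>b. b \<in> B \<Longrightarrow> 0 < w \<bullet> b"
    and es: "set es \<subseteq> B" and "f \<in> borel_measurable borel"
  shows "rays (es @ bs) f 0 = (\<integral>\<^sup>+y. f y * (indicator orthant y * ennreal (basis_density es y)) \<partial>lborel)"
  using es assms(5)
proof (induction es arbitrary: f)
  case Nil
  then show ?case using rays_basis[OF bs pos] by simp
next
  case (Cons a es)
  note [measurable] = Cons.prems(2) open_orthant[THEN borel_open]
    borel_measurable_real_polynomial[OF real_polynomial_basis_density]
  have a: "a \<in> B" and es: "set es \<subseteq> B" using Cons.prems by auto
  let ?g = "\<lambda>y. indicator orthant y * ennreal (basis_density es y)"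
  have [measurable]: "?g \<in> borel_measurable borel" by measurable
  have "rays ((a # es) @ bs) f 0 = (\<integral>\<^sup>+t. rays (es @ bs) f (0 + t *\<^sub>R a) * indicator {0..} t \<partial>lborel)"
    by (simp add: rays_Cons ray_def)
  also have "\<dots> = (\<integral>\<^sup>+t. \<integral>\<^sup>+y. f y * (?g (y - t *\<^sub>R a) * indicator {0..} t) \<partial>lborel \<partial>lborel)"
  proof (rule nn_integral_cong)
    fix t
    have "rays (es @ bs) f (0 + t *\<^sub>R a) = rays (es @ bs) (\<lambda>x. f (x + t *\<^sub>R a)) 0" by (rule rays_shift[symmetric])
    also have "\<dots> = (\<integral>\<^sup>+y. f (y + t *\<^sub>R a) * ?g y \<partial>lborel)" by (rule Cons.IH[OF es]) measurable
    also have "\<dots> = (\<integral>\<^sup>+y. f (y + t *\<^sub>R a) * ?g (y + t *\<^sub>R a - t *\<^sub>R a) \<partial>lborel)" by simp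
    also have "\<dots> = (\<integral>\<^sup>+y. f y * ?g (y - t *\<^sub>R a) \<partial>lborel)" by (rule nn_integral_lborel_shift) measurable
    finally have eq: "rays (es @ bs) f (0 + t *\<^sub>R a) = (\<integral>\<^sup>+y. f y * ?g (y - t *\<^sub>R a) \<partial>lborel)" .
    show "rays (es @ bs) f (0 + t *\<^sub>R a) * indicator {0..} t = (\<integral>\<^sup>+y. f y * (?g (y - t *\<^sub>R a) * indicator {0..} t) \<partial>lborel)"
      unfolding eq by (cases "t \<ge> 0") simp_all
  qed
  also have "\<dots> = (\<integral>\<^sup>+y. \<integral>\<^sup>+t. f y * (?g (y - t *\<^sub>R a) * indicator {0..} t) \<partial>lborel \<partial>lborel)"
    by (rule lborel_pair.Fubini') measurable
  also have "\<dots> = (\<integral>\<^sup>+y. f y * (indicator orthant y * ennreal (basis_density (a # es) y)) \<partial>lborel)"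
  proof (rule nn_integral_cong)
    fix y
    have c: "coord b (y - t *\<^sub>R a) = coord b y - (if b = a then t else 0)" for b t
      using a by (simp add: coord_diff coord_scaleR coord_basis)
    have inner: "(\<integral>\<^sup>+t. ?g (y - t *\<^sub>R a) * indicator {0..} t \<partial>lborel) = indicator orthant y * ennreal (basis_density (a # es) y)"
    proof (cases "y \<in> orthant")
      case True
      have o: "y - t *\<^sub>R a \<in> orthant \<longleftrightarrow> t < coord a y" for t
        using True a by (auto simp: orthant_def c)
      have "(\<integral>\<^sup>+t. ?g (y - t *\<^sub>R a) * indicator {0..} t \<partial>lborel) =
          (\<integral>\<^sup>+t. ennreal (basis_density es (y - t *\<^sub>R a)) * indicator {0..coord a y} t \<partial>lborel)"
        using AE_lborel_singleton[of "coord a y"]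
        by (intro nn_integral_cong_AE, eventually_elim) (auto simp: o indicator_def)
      also have "\<dots> = ennreal (basis_density (a # es) y)" by (rule basis_density_integral[OF a es True])
      finally show ?thesis using True by simp
    next
      case False
      have z: "?g (y - t *\<^sub>R a) * indicator {0..} t = 0" for t
      proof (cases "t \<ge> 0 \<and> y - t *\<^sub>R a \<in> orthant")
        case True
        have "0 < coord b y" if b: "b \<in> B" for b
        proof -
          have "0 < coord b (y - t *\<^sub>R a)" using True b unfolding orthant_def by blast
          then show ?thesis using True unfolding c by (cases "b = a") simp_all
        qed
        then have "y \<in> orthant" unfolding orthant_def by blast
        with False show ?thesis by simp
      qed auto
      show ?thesis unfolding z using False by simp
    qed
    show "(\<integral>\<^sup>+t. f y * (?g (y - t *\<^sub>R a) * indicator {0..} t) \<partial>lborel) = f y * (indicator orthant y * ennreal (basis_density (a # es) y))"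
      unfolding inner[symmetric] by (rule nn_integral_cmult) measurable
  qed
  finally show ?case .
qed

lemma local_density_basis:
  assumes bs: "distinct bs" "set bs = B" and pos: "\<And>b. b \<in> B \<Longrightarrow> 0 < w \<bullet> b"
    and es: "set es \<subseteq> B" and u: "u \<in> orthant"
  shows "local_density (es @ bs) u = basis_density es"
proof -
  obtain e where e: "0 < e" "ball u e \<subseteq> orthant" using open_orthant u open_contains_ball by blast
  have "density_near (es @ bs) u (basis_density es) e"
    unfolding density_near_def
  proof (intro conjI ballI impI)
    fix f :: "'v \<Rightarrow> ennreal" assume f: "f \<in> borel_measurable borel" "\<forall>x. x \<notin> ball u e \<longrightarrow> f x = 0"
    have "rays (es @ bs) f 0 = (\<integral>\<^sup>+y. f y * (indicator orthant y * ennreal (basis_density es y)) \<partial>lborel)"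
      by (rule rays_basis_multiple[OF bs pos es f(1)])
    also have "\<dots> = (\<integral>\<^sup>+y. f y * ennreal (basis_density es y) \<partial>lborel)"
    proof (rule nn_integral_cong)
      fix y
      show "f y * (indicator orthant y * ennreal (basis_density es y)) = f y * ennreal (basis_density es y)"
      proof (cases "y \<in> orthant")
        case False
        then have "y \<notin> ball u e" using e(2) by blast
        then show ?thesis using f(2) by simp
      qed simp
    qed
    finally show "rays (es @ bs) f 0 = (\<integral>\<^sup>+y. f y * ennreal (basis_density es y) \<partial>lborel)" .
  qed (use e basis_density_nonneg[OF _ es] real_polynomial_basis_density in auto)
  then show ?thesis by (rule local_density_eq)
qed

end

section \<open>The quasi-polynomial side of the formula\<close>

locale pointed_lattice = lattice E \<Lambda> for E \<Lambda> :: "'v::euclidean_space set" +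
  fixes w :: 'v
begin

definition vol :: real where "vol = measure lborel (half_open_parallelepiped E)"

definition positive :: "'v set" where "positive = {a \<in> \<Lambda>. 0 < w \<bullet> a}"

definition quasi :: "'v list \<Rightarrow> 'v \<Rightarrow> 'v \<Rightarrow> complex" where
  "quasi X u l = (\<Sum>p\<in>toric_points \<Lambda> X. p l * char_poly vol X p u l)"

definition defect :: "'v list \<Rightarrow> 'v \<Rightarrow> 'v \<Rightarrow> complex" where
  "defect X u l = of_nat (partition_function X l) - quasi X u l"

lemma positive_lat: "set X \<subseteq> positive \<Longrightarrow> set X \<subseteq> \<Lambda>"
  and positive_inner: "\<lbrakk>set X \<subseteq> positive; a \<in> set X\<rbrakk> \<Longrightarrow> 0 < w \<bullet> a"
  by (auto simp: positive_def)

lemma toric_filter: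
  assumes "set X \<subseteq> positive"
  shows "p \<in> toric_points \<Lambda> X \<longleftrightarrow> is_char p \<and> span (set (filter (\<lambda>a. p a = 1) X)) = UNIV"
proof -
  have "set (filter (\<lambda>a. p a = 1) X) = {a \<in> set X. p a = 1}" by auto
  then show ?thesis using toric_points_iff[OF positive_lat[OF assms]] by simp
qed

text \<open>Characters attached to \<open>a # X\<close> but not to \<open>X\<close> may be added to
  the sum for \<open>X\<close>, because there the remaining vectors do not span. After that the
  identity holds character by character.\<close>

lemma quasi_difference:
  assumes X: "set (a # X) \<subseteq> positive" and u: "u \<notin> singular_points (a # X)" and l: "l \<in> \<Lambda>"
  shows "quasi (a # X) u l - quasi (a # X) u (l - a) = quasi X u l"
proof -
  let ?T = "toric_points \<Lambda> (a # X)" and ?S = "toric_points \<Lambda> X"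
  have X': "set X \<subseteq> positive" and a: "a \<in> \<Lambda>" using X by (auto simp: positive_def)
  have u': "u \<notin> singular_points X" using u singular_points_mono[of X "a # X"] by auto
  have fin: "finite ?T" by (rule finite_toric_points[OF positive_lat[OF X]])
  have ST: "?S \<subseteq> ?T" unfolding toric_points_def by fastforce
  have "quasi X u l = (\<Sum>p\<in>?T. p l * char_poly vol X p u l)" unfolding quasi_def
  proof (rule sum.mono_neutral_left[OF fin ST], rule ballI)
    fix p assume p: "p \<in> ?T - ?S"
    then have "span (set (filter (\<lambda>a. p a = 1) X)) \<noteq> UNIV"
      using toric_filter[OF X'] toric_filter[OF X] by blast
    from char_poly_not_spanning[OF this u'] show "p l * char_poly vol X p u l = 0" by simp
  qed
  also have "\<dots> = (\<Sum>p\<in>?T. p l * char_poly vol (a # X) p u l - p (l - a) * char_poly vol (a # X) p u (l - a))"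
  proof (rule sum.cong[OF refl])
    fix p assume "p \<in> ?T"
    then have p: "is_char p" using toric_filter[OF X] by blast
    have d: "char_poly vol (a # X) p u l - inverse (p a) * char_poly vol (a # X) p u (l - a) = char_poly vol X p u l"
      by (rule char_poly_difference[where c = p and w = w, OF _ u char_nonzero[OF p a]]) (erule positive_inner[OF X])
    then show "p l * char_poly vol X p u l = p l * char_poly vol (a # X) p u l - p (l - a) * char_poly vol (a # X) p u (l - a)"
      unfolding d[symmetric] by (simp add: char_diff[OF p l a] algebra_simps)
  qed
  also have "\<dots> = quasi (a # X) u l - quasi (a # X) u (l - a)" by (simp add: quasi_def sum_subtractf)
  finally show ?thesis ..
qed

lemma defect_difference:
  assumes X: "set (a # X) \<subseteq> positive" and u: "u \<notin> singular_points (a # X)" and l: "l \<in> \<Lambda>"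
  shows "defect (a # X) u l - defect (a # X) u (l - a) = defect X u l"
proof -
  have "partition_function (a # X) l = partition_function X l + partition_function (a # X) (l - a)"
    by (rule partition_function_difference[where w = w]) (erule positive_inner[OF X])
  then show ?thesis using quasi_difference[OF assms] by (simp add: defect_def algebra_simps)
qed

lemma defect_permute:
  assumes ms: "mset X = mset Y" and X: "set X \<subseteq> positive" and u: "u \<notin> singular_points X"
  shows "defect X u l = defect Y u l"
proof -
  have "set X = set Y" using ms by (metis set_mset_mset)
  then have "toric_points \<Lambda> X = toric_points \<Lambda> Y" by (simp add: toric_points_def)
  moreover have "char_poly vol X p u = char_poly vol Y p u" for p
    by (rule char_poly_permute[OF ms positive_inner[OF X] u])
  moreover have "partition_function X l = partition_function Y l"
    by (rule partition_function_permute[OF ms positive_inner[OF X]])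
  ultimately show ?thesis by (simp add: defect_def quasi_def)
qed

text \<open>Positivity is a premise inside the definition, so the moves can be stated for arbitrary
  lists. The exceptional null set is chosen before \<open>l\<close>, as the moves use one
  \<open>u\<close> with several shifted lattice points.\<close>

definition generic_identity :: "'v list \<Rightarrow> bool" where
  "generic_identity X \<longleftrightarrow> (set X \<subseteq> positive \<longrightarrow>
     (AE u in lborel. \<forall>l\<in>\<Lambda>. u - l \<in> zonotope X \<longrightarrow> defect X u l = 0))"

text \<open>There are no toric points, so the quasi-polynomial is zero. For \<open>u\<close> off the
  span no \<open>l\<close> in \<open>u\<close> minus the zonotope lies in the cone, since adding a
  zonotope point would put \<open>u\<close> into the span.\<close>

lemma generic_identity_not_spanning:
  assumes "span (set X) \<noteq> UNIV" shows "generic_identity X"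
  unfolding generic_identity_def
proof
  assume X: "set X \<subseteq> positive"
  have "toric_points \<Lambda> X = {}"
  proof -
    have "span (set (filter (\<lambda>a. p a = 1) X)) \<noteq> UNIV" for p :: "'v \<Rightarrow> complex"
      using assms span_mono[of "set (filter (\<lambda>a. p a = 1) X)" "set X"] by auto
    then show ?thesis using toric_filter[OF X] by blast
  qed
  then have q: "quasi X u l = 0" for u l by (simp add: quasi_def)
  have "AE u in lborel. u \<notin> span (set X)" by (rule AE_not_in_proper_subspace[OF assms])
  then show "AE u in lborel. \<forall>l\<in>\<Lambda>. u - l \<in> zonotope X \<longrightarrow> defect X u l = 0"
  proof (eventually_elim, intro ballI impI)
    fix u l assume u: "u \<notin> span (set X)" and z: "u - l \<in> zonotope X"
    have "l \<notin> cone_of (set X)"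
    proof
      assume "l \<in> cone_of (set X)"
      then have "l + (u - l) \<in> cone_of (set X)" using z zonotope_subset_cone by (intro cone_of_add) blast+
      then show False using u cone_of_subset_span by auto
    qed
    then show "defect X u l = 0" by (simp add: defect_def q partition_function_outside_cone)
  qed
qed

end

lemma count_list_distinct: "distinct xs \<Longrightarrow> count_list xs a = (if a \<in> set xs then 1 else 0)"
  by (induction xs) auto

lemma sum_in_int_span: "(\<And>i. i \<in> I \<Longrightarrow> f i \<in> int_span B) \<Longrightarrow> (\<Sum>i\<in>I. f i) \<in> int_span B"
  by (induction I rule: infinite_finite_induct) (auto intro: int_span_add)

lemma fps_dir_const: "fps_dir S a (\<lambda>_. k) = (\<lambda>_. fps_nth S 0 * k)"
proof
  fix x
  have "dir_deriv a (\<lambda>_. k) = (\<lambda>_. 0)" by (simp add: dir_deriv_def fun_eq_iff)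
  then have "(dir_deriv a ^^ j) (\<lambda>_. k) = (\<lambda>_. 0)" if j: "j \<ge> 1" for j
  proof -
    obtain i where "j = Suc i" using j by (cases j) auto
    then show ?thesis using \<open>dir_deriv a (\<lambda>_. k) = (\<lambda>_. 0)\<close>
      by (simp add: funpow_Suc_right dir_deriv_power_zero del: funpow.simps)
  qed
  from fps_dir_eq_sum[OF this] show "fps_dir S a (\<lambda>_. k) x = fps_nth S 0 * k" by simp
qed

lemma (in euclidean_basis) partition_function_basis:
  assumes bs: "distinct bs" "set bs = B" and l: "l \<in> int_span B" "l \<in> cone_of B"
  shows "partition_function bs l = 1"
proof -
  let ?n = "length bs"
  let ?ns = "map (\<lambda>b. nat \<lfloor>coord b l\<rfloor>) bs"
  have val: "real (nat \<lfloor>coord b l\<rfloor>) = coord b l" if "b \<in> B" for b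
  proof -
    have "coord b l \<in> \<int>" "0 \<le> coord b l" using l that by (simp_all add: int_span_iff cone_of_B)
    then show ?thesis by (auto elim: Ints_cases)
  qed
  have bij: "bij_betw ((!) bs) {..<?n} B" using bij_betw_nth[OF bs(1)] bs(2) by auto
  have reindex: "(\<Sum>i<?n. t (bs ! i) *\<^sub>R bs ! i) = (\<Sum>b\<in>B. t b *\<^sub>R b)" for t
    using sum.reindex_bij_betw[OF bij, of "\<lambda>b. t b *\<^sub>R b"] by simp
  have "solutions bs l = {?ns}"
  proof (intro equalityI subsetI)
    fix ns assume "ns \<in> solutions bs l"
    then have ns: "length ns = ?n" "(\<Sum>i<?n. real (ns ! i) *\<^sub>R bs ! i) = l" by (auto simp: solutions_def)
    have "coord (bs ! j) l = real (ns ! j)" if j: "j < ?n" for j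
    proof -
      have jB: "bs ! j \<in> B" using bs(2) j by auto
      interpret bounded_linear "coord (bs ! j)" by (rule bounded_linear_coord)
      have "coord (bs ! j) l = (\<Sum>i<?n. real (ns ! i) * coord (bs ! j) (bs ! i))"
        unfolding ns(2)[symmetric] by (simp add: sum scaleR)
      also have "\<dots> = (\<Sum>i<?n. if i = j then real (ns ! i) else 0)"
      proof (rule sum.cong[OF refl])
        fix i assume "i \<in> {..<?n}"
        then have i: "i < ?n" "bs ! i \<in> B" using bs(2) by auto
        show "real (ns ! i) * coord (bs ! j) (bs ! i) = (if i = j then real (ns ! i) else 0)"
          unfolding coord_basis[OF i(2)] using nth_eq_iff_index_eq[OF bs(1) j i(1)] by simp
      qed
      finally show ?thesis using j by simp
    qed
    then have "ns = ?ns" using ns(1) by (intro nth_equalityI) auto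
    then show "ns \<in> {?ns}" by simp
  next
    fix ns assume "ns \<in> {?ns}"
    moreover have "(\<Sum>i<?n. real (?ns ! i) *\<^sub>R bs ! i) = (\<Sum>i<?n. coord (bs ! i) l *\<^sub>R bs ! i)"
    proof (rule sum.cong[OF refl])
      fix i assume "i \<in> {..<?n}"
      then have "i < ?n" "bs ! i \<in> B" using bs(2) by auto
      then show "real (?ns ! i) *\<^sub>R bs ! i = coord (bs ! i) l *\<^sub>R bs ! i" using val[of "bs ! i"] by simp
    qed
    then have "(\<Sum>i<?n. real (?ns ! i) *\<^sub>R bs ! i) = l" unfolding reindex by (simp add: sum_coord)
    ultimately show "ns \<in> solutions bs l" by (simp add: solutions_def)
  qed
  then show ?thesis by (simp add: partition_function_eq)
qed

lemma (in euclidean_basis) zonotope_coord: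
  assumes "set X \<subseteq> B" "z \<in> zonotope X" "b \<in> B"
  shows "coord b z \<le> count_list X b"
  using assms(1,2)
proof (induction X arbitrary: z)
  case (Cons a X)
  then obtain t y where z: "z = t *\<^sub>R a + y" "0 \<le> t" "t \<le> 1" "y \<in> zonotope X" by auto
  have "coord b z = (if b = a then t else 0) + coord b y" using Cons.prems by (simp add: z(1) coord_add coord_scaleR coord_basis)
  then show ?case using Cons.IH[of y] Cons.prems z by auto
qed (simp add: representation_zero)

context pointed_lattice
begin

context
  fixes B bs u
  assumes B: "euclidean_basis B" "B \<subseteq> positive" and bs: "distinct bs" "set bs = B"
    and u: "u \<in> euclidean_basis.orthant B"
begin

interpretation B: euclidean_basis B by (rule B(1))

lemma BL: "B \<subseteq> \<Lambda>" and posB: "b \<in> B \<Longrightarrow> 0 < w \<bullet> b" using B(2) by (auto simp: positive_def)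

definition basis_poly :: "'v list \<Rightarrow> 'v \<Rightarrow> complex" where
  "basis_poly es = foldr (\<lambda>a. fps_dir (char_series 1) a) (es @ bs) (\<lambda>x. of_real (vol * B.basis_density es x))"

lemma char_poly_basis:
  assumes "set es \<subseteq> B" "\<And>b. b \<in> B \<Longrightarrow> p b = 1" shows "char_poly vol (es @ bs) p u = basis_poly es"
proof -
  have "char_poly vol (es @ bs) p u = char_poly vol (es @ bs) (\<lambda>_. 1) u"
    by (rule char_poly_cong) (use assms bs in auto)
  also have "\<dots> = basis_poly es"
    by (simp add: char_poly_def basis_poly_def B.local_density_basis[OF bs posB assms(1) u])
  finally show ?thesis .
qed

lemma not_singular: "set es \<subseteq> B \<Longrightarrow> u \<notin> singular_points (es @ bs)"
  by (rule B.orthant_not_singular[OF _ u]) (use bs in auto)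

lemma basis_poly_difference:
  assumes "set (a # es) \<subseteq> B"
  shows "basis_poly (a # es) x - basis_poly (a # es) (x - a) = basis_poly es x"
proof -
  have "\<And>b. b \<in> set (a # es @ bs) \<Longrightarrow> 0 < w \<bullet> b" using assms bs posB by auto
  moreover have "u \<notin> singular_points (a # es @ bs)" using not_singular[OF assms] by simp
  ultimately have "char_poly vol (a # es @ bs) (\<lambda>_. 1) u x - inverse 1 * char_poly vol (a # es @ bs) (\<lambda>_. 1) u (x - a) =
      char_poly vol (es @ bs) (\<lambda>_. 1) u x"
    by (rule char_poly_difference[where c = "\<lambda>_. 1"]) simp_all
  moreover have "char_poly vol ((a # es) @ bs) (\<lambda>_. 1) u = basis_poly (a # es)" by (rule char_poly_basis[OF assms refl])
  moreover have "char_poly vol (es @ bs) (\<lambda>_. 1) u = basis_poly es" by (rule char_poly_basis) (use assms in auto)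
  ultimately show ?thesis by simp
qed

text \<open>Repeated use turns the polynomial into a constant times a product of binomial
  coefficients in the coordinates, which is the number of ways to distribute a coordinate over equal
  vectors.\<close>

lemma basis_poly_Cons:
  assumes a: "set (a # es) \<subseteq> B"
  shows "basis_poly (a # es) x = (of_real (B.coord a x) + of_nat (Suc (count_list es a))) / of_nat (Suc (count_list es a)) * basis_poly es x"
proof -
  let ?m = "Suc (count_list es a)"
  let ?g = "\<lambda>x. complex_of_real (vol * B.basis_density es x)"
  have aB: "a \<in> B" and es: "set es \<subseteq> B" using a by auto
  have cnt: "?m = count_list (es @ bs) a" using bs aB by (simp add: count_list_append count_list_distinct)
  have g: "polynomial_function ?g"
    by (intro polynomial_function_of_real real_polynomial_function.intros(4) real_polynomial_function.intros(2) B.real_polynomial_basis_density)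
  have pos: "\<And>b. b \<in> set (a # es @ bs) \<Longrightarrow> 0 < w \<bullet> b" using a bs posB by auto
  have ns: "u \<notin> singular_points (a # es @ bs)" using not_singular[OF a] by simp
  have D: "dir_deriv a (\<lambda>x. complex_of_real (B.basis_density (a # es) x)) = (\<lambda>x. of_real (B.basis_density es x))"
    using dir_deriv_local_density[OF pos ns] B.local_density_basis[OF bs posB a u] B.local_density_basis[OF bs posB es u]
    by (simp del: B.basis_density.simps)
  have lg: "(\<lambda>x. of_real (B.coord a x) * ?g x) = (\<lambda>x. of_real (?m * vol) * complex_of_real (B.basis_density (a # es) x))"
    by (simp add: fun_eq_iff del: of_nat_Suc)
  have "polynomial_function (\<lambda>x. complex_of_real (B.basis_density (a # es) x))"
    by (intro polynomial_function_of_real B.real_polynomial_basis_density)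
  from dir_deriv_cmult[OF this, of a "of_real (?m * vol)"]
  have d: "dir_deriv a (\<lambda>x. of_real (B.coord a x) * ?g x) = (\<lambda>x. of_nat ?m * ?g x)"
    unfolding lg D by (simp add: fun_eq_iff del: of_nat_Suc)
  have fe: "(\<lambda>x. complex_of_real (vol * B.basis_density (a # es) x)) = (\<lambda>x. (1 / of_nat ?m) * (of_real (B.coord a x) * ?g x))"
    by (simp add: fun_eq_iff del: of_nat_Suc)
  have "basis_poly (a # es) = foldr (\<lambda>a. fps_dir (char_series 1) a) (a # es @ bs) (\<lambda>x. (1 / of_nat ?m) * (of_real (B.coord a x) * ?g x))"
    unfolding basis_poly_def fe append_Cons ..
  then have "basis_poly (a # es) x = foldr (\<lambda>a. fps_dir (char_series 1) a) (a # es @ bs) (\<lambda>x. (1 / of_nat ?m) * (of_real (B.coord a x) * ?g x)) x"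
    by simp
  also have "\<dots> = (of_real (B.coord a x) + of_nat ?m) / of_nat ?m * foldr (\<lambda>a. fps_dir (char_series 1) a) (es @ bs) ?g x"
  proof (rule foldr_todd_step[OF g B.bounded_linear_coord _ _ cnt _ d])
    show "B.coord a a = 1" using aB by (simp add: B.coord_basis)
    show "B.coord a b = 0" if "b \<in> set (es @ bs)" "b \<noteq> a" for b
    proof -
      have "b \<in> B" using that(1) es bs(2) by auto
      from B.coord_basis[OF this, of a] show ?thesis using that(2) by simp
    qed
  qed simp
  finally show ?thesis by (simp add: basis_poly_def)
qed

text \<open>The index of \<open>int_span B\<close> is both the number of characters and the ratio of
  the volumes, so it cancels against the normalized constant density.\<close>

lemma basis_poly_Nil: "of_nat (card (dual B)) * basis_poly [] x = 1"
proof -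
  have c: "foldr (\<lambda>a. fps_dir (char_series 1) a) X (\<lambda>_. k) = (\<lambda>_. k)" for X :: "'v list" and k
    by (induction X) (simp_all add: fps_dir_const todd_nth_0)
  have "basis_poly [] x = of_real (vol / measure lborel (half_open_parallelepiped B))"
    by (simp add: basis_poly_def c)
  also have meq: "measure lborel (half_open_parallelepiped B) = real (card (dual B)) * vol"
    using volume_parallelepiped[OF B(1) BL] card_dual[OF B(1) BL] by (simp add: vol_def)
  finally have e: "basis_poly [] x = of_real (vol / (real (card (dual B)) * vol))" .
  have "real (card (dual B)) * vol \<noteq> 0"
    using B.emeasure_parallelepiped(2) unfolding meq by (rule less_imp_neq[THEN not_sym])
  then have "real (card (dual B)) * (vol / (real (card (dual B)) * vol)) = 1" by simp
  then show ?thesis unfolding e by (metis of_real_1 of_real_mult of_real_of_nat_eq)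
qed

text \<open>
  The polynomial vanishes on the hyperplanes with coordinate \<open>-1, \<dots>, 1 - m\<close> just outside the cone, \<open>m\<close>
  being the multiplicity; this is why the identity extends beyond the cone by part of the zonotope.
\<close>

lemma basis_poly_count:
  assumes "set es \<subseteq> B" "l \<in> int_span B" "\<And>b. b \<in> B \<Longrightarrow> B.coord b l > - real (count_list (es @ bs) b)"
  shows "of_nat (card (dual B)) * basis_poly es l = of_nat (partition_function (es @ bs) l)"
  using assms
proof (induction es arbitrary: l)
  case Nil
  have "0 \<le> B.coord b l" if b: "b \<in> B" for b
  proof -
    have "B.coord b l > - 1" using Nil.prems(3)[OF b] bs b by (simp add: count_list_distinct)
    moreover have "B.coord b l \<in> \<int>" using Nil.prems(2) b by (simp add: B.int_span_iff)
    ultimately show ?thesis by (auto elim!: Ints_cases)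
  qed
  then have "l \<in> cone_of B" by (simp add: B.cone_of_B)
  then show ?case using basis_poly_Nil B.partition_function_basis[OF bs Nil.prems(2)] by simp
next
  case (Cons a es)
  let ?m = "Suc (count_list es a)"
  have a: "a \<in> B" and es: "set es \<subseteq> B" using Cons.prems(1) by auto
  have cnt: "count_list (es @ bs) a = ?m" using bs a by (simp add: count_list_append count_list_distinct)
  have pos: "\<And>b. b \<in> set (a # es @ bs) \<Longrightarrow> 0 < w \<bullet> b" using a es bs posB by auto
  have setX: "set (a # es @ bs) = B" using a es bs by auto
  have ca: "B.coord b (y - a) = B.coord b y - (if b = a then 1 else 0)" for b y
    using a by (simp add: B.coord_diff B.coord_basis)
  \<comment> \<open>Inner induction along the line in direction \<open>a\<close>. It starts at the
    coordinate \<open>- ?m\<close>: there the factor from \<open>basis_poly_Cons\<close> is zero and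
    so is the partition function, the point being outside the cone. From there both sides obey the
    same difference equation.\<close>
  have "of_nat (card (dual B)) * basis_poly (a # es) l = of_nat (partition_function (a # es @ bs) l)"
    if "B.coord a l = real n - ?m" "l \<in> int_span B"
      "\<And>b. b \<in> B \<Longrightarrow> b \<noteq> a \<Longrightarrow> B.coord b l > - real (count_list (es @ bs) b)" for n l
    using that
  proof (induction n arbitrary: l)
    case 0
    have "basis_poly (a # es) l = 0" unfolding basis_poly_Cons[OF Cons.prems(1)] using 0(1) by simp
    moreover have "l \<notin> cone_of (set (a # es @ bs))" unfolding setX B.cone_of_B using a 0(1) by fastforce
    then have "partition_function (a # es @ bs) l = 0" by (rule partition_function_outside_cone)
    ultimately show ?case by simp
  next
    case (Suc n)
    have "of_nat (card (dual B)) * basis_poly (a # es) (l - a) = of_nat (partition_function (a # es @ bs) (l - a))"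
    proof (rule Suc.IH)
      show "l - a \<in> int_span B" by (rule int_span_diff[OF Suc.prems(2) int_span_base[OF B.finite_B a]])
    qed (use Suc.prems in \<open>auto simp: ca\<close>)
    moreover have "of_nat (card (dual B)) * basis_poly es l = of_nat (partition_function (es @ bs) l)"
    proof (rule Cons.IH[OF es Suc.prems(2)])
      fix b assume "b \<in> B"
      then show "- real (count_list (es @ bs) b) < B.coord b l"
        using Suc.prems cnt by (cases "b = a") auto
    qed
    moreover have "partition_function (a # es @ bs) l = partition_function (es @ bs) l + partition_function (a # es @ bs) (l - a)"
      by (rule partition_function_difference[OF pos])
    moreover have "basis_poly (a # es) l = basis_poly es l + basis_poly (a # es) (l - a)"
      using basis_poly_difference[OF Cons.prems(1), of l] by (simp add: algebra_simps)
    ultimately show ?case by (simp add: distrib_left)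
  qed
  note step = this
  have "B.coord a l \<in> \<int>" using Cons.prems(2) a by (simp add: B.int_span_iff)
  then obtain k where k: "B.coord a l = of_int k" by (auto elim: Ints_cases)
  have "B.coord a l > - real (Suc ?m)" using Cons.prems(3)[OF a] cnt by simp
  then have "k \<ge> - int ?m" unfolding k by linarith
  then have "B.coord a l = real (nat (k + int ?m)) - ?m" unfolding k by simp
  from step[OF this Cons.prems(2)] Cons.prems(3) show ?case by fastforce
qed

end

text \<open>All vectors are trivial under each toric point, so a single polynomial remains,
  multiplied by the sum of the characters at \<open>l\<close>. That sum vanishes off
  \<open>int_span (set X)\<close>, where there are no solutions either, and is the index on
  it.\<close>

lemma generic_identity_basis:
  assumes "independent (set X)" "span (set X) = UNIV" shows "generic_identity X"
  unfolding generic_identity_def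
proof
  assume X: "set X \<subseteq> positive"
  let ?B = "set X"
  have B: "euclidean_basis ?B" using assms by (simp add: euclidean_basis_def)
  interpret B: euclidean_basis ?B by (rule B)
  have BL: "?B \<subseteq> \<Lambda>" by (rule positive_lat[OF X])
  define bs where "bs = remdups X"
  have bs: "distinct bs" "set bs = ?B" by (simp_all add: bs_def)
  have "mset bs \<subseteq># mset X" unfolding bs_def
    by (rule mset_remdups_subset_eq)
  then obtain es where es: "mset X = mset (es @ bs)"
    by (metis ex_mset mset_append subset_mset.le_iff_add add.commute)
  have esB: "set es \<subseteq> ?B" using es by (metis Un_iff mset_append set_append set_mset_mset subsetI)
  have toric: "toric_points \<Lambda> X = dual ?B"
  proof (intro equalityI subsetI)
    fix p assume "p \<in> toric_points \<Lambda> X"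
    then have p: "is_char p" "span {a \<in> ?B. p a = 1} = UNIV" using toric_points_iff[OF BL] by auto
    have "p b = 1" if "b \<in> ?B" for b
    proof (rule ccontr)
      assume "p b \<noteq> 1"
      then have "b \<in> ?B - {a \<in> ?B. p a = 1}" using that by blast
      from B.span_subset_B[OF _ this] p(2) show False by blast
    qed
    then show "p \<in> dual ?B" using p by (simp add: dual_def)
  next
    fix p assume "p \<in> dual ?B"
    then have "is_char p" "{a \<in> ?B. p a = 1} = ?B" by (auto simp: dual_def)
    then show "p \<in> toric_points \<Lambda> X" using toric_points_iff[OF BL] assms(2) by simp
  qed
  have cnt: "count_list X b = count_list (es @ bs) b" for b using es by (metis count_mset)
  show "AE u in lborel. \<forall>l\<in>\<Lambda>. u - l \<in> zonotope X \<longrightarrow> defect X u l = 0"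
    using AE_not_singular[of X]
  proof (eventually_elim, intro ballI impI)
    fix u l assume u: "u \<notin> singular_points X" and l: "l \<in> \<Lambda>" and z: "u - l \<in> zonotope X"
    show "defect X u l = 0"
    proof (cases "u \<in> cone_of ?B")
      case False
      have "l \<notin> cone_of ?B"
      proof
        assume "l \<in> cone_of ?B"
        then have "l + (u - l) \<in> cone_of ?B" using z zonotope_subset_cone by (intro cone_of_add) blast+
        then show False using False by simp
      qed
      then have "partition_function X l = 0" by (rule partition_function_outside_cone)
      moreover have "char_poly vol X p u l = 0" for p
      proof -
        have "u \<notin> cone_of (set (filter (\<lambda>a. p a = 1) X))"
          using False cone_of_mono[of "set (filter (\<lambda>a. p a = 1) X)" ?B] by auto
        then have "local_density (filter (\<lambda>a. p a = 1) X) u = (\<lambda>_. 0)" by (rule local_density_outside_cone)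
        moreover have "foldr (\<lambda>a. fps_dir (S a) a) X (\<lambda>_. 0) = (\<lambda>_. 0)" for S :: "'v \<Rightarrow> complex fps"
          by (induction X) (simp_all add: fps_dir_const)
        ultimately show ?thesis by (simp add: char_poly_def)
      qed
      ultimately show ?thesis by (simp add: defect_def quasi_def)
    next
      case True
      have o: "u \<in> B.orthant" by (rule B.cone_not_singular[OF refl u True])
      have val: "char_poly vol X p u l = basis_poly ?B bs es l" if p: "p \<in> dual ?B" for p
      proof -
        have "char_poly vol X p u = char_poly vol (es @ bs) p u"
          by (rule char_poly_permute[OF es positive_inner[OF X] u])
        also have "\<dots> = basis_poly ?B bs es"
          by (rule char_poly_basis[OF B X bs o esB]) (use p in \<open>simp add: dual_def\<close>)
        finally show ?thesis by simp
      qed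
      have "quasi X u l = (\<Sum>p\<in>dual ?B. p l) * basis_poly ?B bs es l"
        unfolding quasi_def toric by (simp add: val sum_distrib_right)
      also have "\<dots> = of_nat (partition_function X l)"
      proof (cases "l \<in> int_span ?B")
        case True
        \<comment> \<open>The coordinates of \<open>u\<close> are strictly positive, which makes the
          bound strict; the values allowed for \<open>l\<close> are then exactly those treated by
          \<open>basis_poly_count\<close>.\<close>
        have "B.coord b l > - real (count_list (es @ bs) b)" if b: "b \<in> ?B" for b
        proof -
          have "B.coord b (u - l) \<le> count_list X b" by (rule B.zonotope_coord[OF subset_refl z b])
          moreover have "0 < B.coord b u" using o b by (simp add: B.orthant_def)
          ultimately show ?thesis by (simp add: B.coord_diff cnt)
        qed
        then show ?thesis
          using basis_poly_count[OF B X bs o esB True] True partition_function_permute[OF es positive_inner[OF X], of l]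
          by (simp add: sum_dual[OF B BL l])
      next
        case False
        have "solutions X l = {}"
        proof (rule ccontr)
          assume "solutions X l \<noteq> {}"
          then obtain ns where ns: "(\<Sum>i<length X. real (ns ! i) *\<^sub>R X ! i) = l" by (auto simp: solutions_def)
          have "of_int (int (ns ! i)) *\<^sub>R X ! i \<in> int_span ?B" if "i < length X" for i
            using that by (intro int_span_scale int_span_base) auto
          then have "(\<Sum>i\<in>{..<length X}. real (ns ! i) *\<^sub>R X ! i) \<in> int_span ?B"
            by (intro sum_in_int_span) auto
          then show False using ns False by simp
        qed
        then show ?thesis using False by (simp add: sum_dual[OF B BL l] partition_function_eq)
      qed
      finally show ?thesis by (simp add: defect_def)
    qed
  qed
qed

end

section \<open>Reduction to linearly independent supports\<close>

context pointed_lattice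
begin

lemma positive_add: "\<lbrakk>a \<in> positive; b \<in> positive\<rbrakk> \<Longrightarrow> a + b \<in> positive"
  by (auto simp: positive_def inner_add_right intro: lat_add)

lemma positive_scale: "\<lbrakk>a \<in> positive; n > 0\<rbrakk> \<Longrightarrow> real n *\<^sub>R a \<in> positive"
  by (auto simp: positive_def intro: lat_scale_nat)

lemma generic_identity_permute:
  assumes ms: "mset X = mset Y" and id: "generic_identity X" shows "generic_identity Y"
  unfolding generic_identity_def
proof
  assume Y: "set Y \<subseteq> positive"
  have "set X = set Y" using ms by (metis set_mset_mset)
  with Y have X: "set X \<subseteq> positive" by simp
  have "AE u in lborel. \<forall>l\<in>\<Lambda>. u - l \<in> zonotope X \<longrightarrow> defect X u l = 0" using id X by (simp add: generic_identity_def)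
  then show "AE u in lborel. \<forall>l\<in>\<Lambda>. u - l \<in> zonotope Y \<longrightarrow> defect Y u l = 0"
    using AE_not_singular[of X]
    by eventually_elim (use defect_permute[OF ms X] zonotope_permute[OF ms] in simp)
qed

text \<open>
  Both moves below compare the given list with the longer list that contains the old and the new
  vectors: by the difference equation the two shorter lists are differences of the longer one.
\<close>

lemma generic_identity_multiple:
  assumes n: "n > 0" and id: "generic_identity ((real n *\<^sub>R a) # R)" shows "generic_identity (a # R)"
  unfolding generic_identity_def
proof
  assume X: "set (a # R) \<subseteq> positive"
  let ?b = "real n *\<^sub>R a"
  let ?Y = "a # ?b # R" and ?Z = "?b # a # R"
  have ms: "mset ?Y = mset ?Z" by simp
  have a: "a \<in> positive" "a \<in> \<Lambda>" using X by (auto simp: positive_def)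
  have Y: "set ?Y \<subseteq> positive" "set ?Z \<subseteq> positive" and bR: "set (?b # R) \<subseteq> positive"
    using X positive_scale[OF a(1) n] by auto
  have "AE u in lborel. \<forall>l\<in>\<Lambda>. u - l \<in> zonotope (?b # R) \<longrightarrow> defect (?b # R) u l = 0"
    using id bR by (simp add: generic_identity_def)
  then show "AE u in lborel. \<forall>l\<in>\<Lambda>. u - l \<in> zonotope (a # R) \<longrightarrow> defect (a # R) u l = 0"
    using AE_not_singular[of ?Y]
  proof (eventually_elim, intro ballI impI)
    fix u l
    assume id: "\<forall>l\<in>\<Lambda>. u - l \<in> zonotope (?b # R) \<longrightarrow> defect (?b # R) u l = 0"
      and u: "u \<notin> singular_points ?Y" and l: "l \<in> \<Lambda>" and z: "u - l \<in> zonotope (a # R)"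
    have u': "u \<notin> singular_points ?Z" using u by (simp add: singular_points_def insert_commute)
    obtain t y where ty: "u - l = t *\<^sub>R a + y" "0 \<le> t" "t \<le> 1" "y \<in> zonotope R" using z by auto
    have lj: "l - real j *\<^sub>R a \<in> \<Lambda>" for j by (intro lat_diff l lat_scale_nat a)
    have zero: "defect ?Y u (l - real j *\<^sub>R a) - defect ?Y u (l - real (Suc j) *\<^sub>R a) = 0" if j: "j < n" for j
    proof -
      \<comment> \<open>The shift by \<open>j\<close> copies of \<open>a\<close> is absorbed by the
        longer segment of \<open>?b\<close>, whose parameter becomes \<open>(t + j) / n\<close>;
        this works for \<open>j < n\<close>, the range of the telescoping sum below.\<close>
      have "u - (l - real j *\<^sub>R a) = ((t + real j) / real n) *\<^sub>R ?b + y"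
      proof -
        have "((t + real j) / real n) *\<^sub>R ?b = (t + real j) *\<^sub>R a" using n by simp
        then show ?thesis using ty(1) by (simp add: algebra_simps)
      qed
      moreover have "0 \<le> (t + real j) / real n" "(t + real j) / real n \<le> 1" using ty(2,3) j by (auto simp: field_simps)
      ultimately have "u - (l - real j *\<^sub>R a) \<in> zonotope (?b # R)" using ty(4) by (rule zonotope_ConsI)
      then have "defect (?b # R) u (l - real j *\<^sub>R a) = 0" using id lj by blast
      moreover have "l - real (Suc j) *\<^sub>R a = l - real j *\<^sub>R a - a" by (simp add: algebra_simps)
      ultimately show ?thesis using defect_difference[OF Y(1) u lj, of j] by (simp only:)
    qed
    have "defect (a # R) u l = defect ?Z u l - defect ?Z u (l - ?b)" by (rule defect_difference[OF Y(2) u' l, symmetric])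
    also have "\<dots> = defect ?Y u (l - real 0 *\<^sub>R a) - defect ?Y u (l - real n *\<^sub>R a)"
      using defect_permute[OF ms Y(1) u] by simp
    also have "\<dots> = (\<Sum>j<n. defect ?Y u (l - real j *\<^sub>R a) - defect ?Y u (l - real (Suc j) *\<^sub>R a))"
      by (rule sum_lessThan_telescope'[symmetric])
    also have "\<dots> = 0" by (rule sum.neutral) (use zero in blast)
    finally show "defect (a # R) u l = 0" .
  qed
qed

lemma generic_identity_merge:
  assumes id1: "generic_identity ((a + b) # b # R)" and id2: "generic_identity ((a + b) # a # R)"
  shows "generic_identity (a # b # R)"
  unfolding generic_identity_def
proof
  assume X: "set (a # b # R) \<subseteq> positive"
  let ?c = "a + b"
  let ?Y1 = "a # ?c # b # R" and ?Y2 = "b # ?c # a # R" and ?Y3 = "?c # a # b # R"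
  have ab: "a \<in> positive" "b \<in> positive" "a \<in> \<Lambda>" "b \<in> \<Lambda>" using X by (auto simp: positive_def)
  have Y: "set ?Y1 \<subseteq> positive" "set ?Y2 \<subseteq> positive" "set ?Y3 \<subseteq> positive" using X positive_add[OF ab(1,2)] by auto
  have ms: "mset ?Y3 = mset ?Y1" "mset ?Y3 = mset ?Y2" by (simp_all add: add_mset_commute)
  have A1: "AE u in lborel. \<forall>l\<in>\<Lambda>. u - l \<in> zonotope (?c # b # R) \<longrightarrow> defect (?c # b # R) u l = 0"
    using id1 Y by (simp add: generic_identity_def)
  have A2: "AE u in lborel. \<forall>l\<in>\<Lambda>. u - l \<in> zonotope (?c # a # R) \<longrightarrow> defect (?c # a # R) u l = 0"
    using id2 Y by (simp add: generic_identity_def)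
  show "AE u in lborel. \<forall>l\<in>\<Lambda>. u - l \<in> zonotope (a # b # R) \<longrightarrow> defect (a # b # R) u l = 0"
    using A1 A2 AE_not_singular[of ?Y3]
  proof (eventually_elim, intro ballI impI)
    fix u l
    assume i1: "\<forall>l\<in>\<Lambda>. u - l \<in> zonotope (?c # b # R) \<longrightarrow> defect (?c # b # R) u l = 0"
      and i2: "\<forall>l\<in>\<Lambda>. u - l \<in> zonotope (?c # a # R) \<longrightarrow> defect (?c # a # R) u l = 0"
      and u: "u \<notin> singular_points ?Y3" and l: "l \<in> \<Lambda>" and z: "u - l \<in> zonotope (a # b # R)"
    have u1: "u \<notin> singular_points ?Y1" "u \<notin> singular_points ?Y2"
      using u singular_points_mono[of ?Y1 ?Y3] singular_points_mono[of ?Y2 ?Y3] by auto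
    have lat: "l - a \<in> \<Lambda>" "l - b \<in> \<Lambda>" by (intro lat_diff l ab)+
    obtain s t y where st: "u - l = s *\<^sub>R a + (t *\<^sub>R b + y)" "0 \<le> s" "s \<le> 1" "0 \<le> t" "t \<le> 1" "y \<in> zonotope R"
      using z by auto
    let ?D = "defect ?Y3 u"
    have d1: "?D v - ?D (v - a) = defect (?c # b # R) u v" if "v \<in> \<Lambda>" for v
      using defect_difference[OF Y(1) u1(1) that] defect_permute[OF ms(1) Y(3) u] by simp
    have d2: "?D v - ?D (v - b) = defect (?c # a # R) u v" if "v \<in> \<Lambda>" for v
      using defect_difference[OF Y(2) u1(2) that] defect_permute[OF ms(2) Y(3) u] by simp
    have d3: "?D l - ?D (l - ?c) = defect (a # b # R) u l" by (rule defect_difference[OF Y(3) u l])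
    show "defect (a # b # R) u l = 0"
    \<comment> \<open>The diagonal of the parallelogram decides on the way from \<open>l\<close> to
      \<open>l - ?c\<close>: through \<open>l - a\<close> if \<open>s \<le> t\<close>, through
      \<open>l - b\<close> otherwise. In each case both steps remain in the region of the list that
      governs them.\<close>
    proof (cases "s \<le> t")
      case True
      have "u - l = s *\<^sub>R ?c + ((t - s) *\<^sub>R b + y)" using st(1) by (simp add: algebra_simps)
      then have "u - l \<in> zonotope (?c # b # R)" by (rule zonotope_ConsI) (use st True in \<open>auto intro: zonotope_ConsI[OF refl] simp del: zonotope.simps\<close>)
      moreover have "u - (l - a) = t *\<^sub>R ?c + ((1 + s - t) *\<^sub>R a + y)" using st(1) by (simp add: algebra_simps)
      then have "u - (l - a) \<in> zonotope (?c # a # R)" by (rule zonotope_ConsI) (use st True in \<open>auto intro: zonotope_ConsI[OF refl] simp del: zonotope.simps\<close>)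
      ultimately have "?D l - ?D (l - a) = 0" "?D (l - a) - ?D (l - a - b) = 0"
        using i1 i2 l lat d1[OF l] d2[OF lat(1)] by auto
      then show ?thesis using d3 by (simp add: diff_diff_add)
    next
      case False
      have "u - l = t *\<^sub>R ?c + ((s - t) *\<^sub>R a + y)" using st(1) by (simp add: algebra_simps)
      then have "u - l \<in> zonotope (?c # a # R)" by (rule zonotope_ConsI) (use st False in \<open>auto intro: zonotope_ConsI[OF refl] simp del: zonotope.simps\<close>)
      moreover have "u - (l - b) = s *\<^sub>R ?c + ((1 + t - s) *\<^sub>R b + y)" using st(1) by (simp add: algebra_simps)
      then have "u - (l - b) \<in> zonotope (?c # b # R)" by (rule zonotope_ConsI) (use st False in \<open>auto intro: zonotope_ConsI[OF refl] simp del: zonotope.simps\<close>)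
      ultimately have "?D l - ?D (l - b) = 0" "?D (l - b) - ?D (l - b - a) = 0"
        using i1 i2 l lat d2[OF l] d1[OF lat(2)] by auto
      then show ?thesis using d3 by (simp add: diff_diff_add add.commute)
    qed
  qed
qed

lemma generic_identity_multiples:
  assumes "\<And>x. n x > 0" and "generic_identity (map (\<lambda>x. real (n x) *\<^sub>R x) X @ R)"
  shows "generic_identity (X @ R)"
  using assms(2)
proof (induction X arbitrary: R)
  case (Cons a X)
  let ?s = "\<lambda>x. real (n x) *\<^sub>R x"
  have "generic_identity (a # map ?s X @ R)" by (rule generic_identity_multiple[OF assms(1)[of a]]) (use Cons.prems in simp)
  then have "generic_identity (map ?s X @ a # R)" by (rule generic_identity_permute[rotated]) simp
  then have "generic_identity (X @ a # R)" by (rule Cons.IH)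
  then show ?case by (rule generic_identity_permute[rotated]) simp
qed simp

text \<open>Vectors occur with multiplicity, and one merge consumes only one copy. Merging is
  repeated until no copy of \<open>a\<close> or none of \<open>b\<close> is left; only then has a
  vector really been replaced. The condition on \<open>k\<close> records that \<open>a + b\<close>
  is present by then.\<close>

lemma generic_identity_merge_all:
  assumes "\<And>i j k. \<lbrakk>i = 0 \<or> j = 0; k > 0\<rbrakk> \<Longrightarrow>
      generic_identity (replicate k (a + b) @ replicate i a @ replicate j b @ R)"
    and "(i > 0 \<and> j > 0) \<or> k > 0"
  shows "generic_identity (replicate k (a + b) @ replicate i a @ replicate j b @ R)"
  using assms(2)
proof (induction "i + j" arbitrary: i j k rule: less_induct)
  case less
  show ?case
  proof (cases "i = 0 \<or> j = 0")
    case True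
    then show ?thesis using assms(1)[OF True] less.prems by auto
  next
    case False
    then obtain i' j' where ij: "i = Suc i'" "j = Suc j'" by (metis not0_implies_Suc)
    let ?S = "replicate k (a + b) @ replicate i' a @ replicate j' b @ R"
    have "generic_identity (replicate (Suc k) (a + b) @ replicate i' a @ replicate j b @ R)"
      by (rule less.hyps) (use ij in auto)
    then have 1: "generic_identity ((a + b) # b # ?S)" by (rule generic_identity_permute[rotated]) (simp add: ij)
    have "generic_identity (replicate (Suc k) (a + b) @ replicate i a @ replicate j' b @ R)"
      by (rule less.hyps) (use ij in auto)
    then have 2: "generic_identity ((a + b) # a # ?S)" by (rule generic_identity_permute[rotated]) (simp add: ij)
    have "generic_identity (a # b # ?S)" by (rule generic_identity_merge[OF 1 2])
    then show ?thesis by (rule generic_identity_permute[rotated]) (simp add: ij)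
  qed
qed

text \<open>Two vectors on the same side of the relation are merged, after which one of them has
  disappeared from the list. Either their sum was already there, and the number of distinct vectors
  has dropped, or it is new, and the relation has become shorter. A relation between single vectors
  contradicts disjointness.\<close>

lemma generic_identity_relation:
  assumes small: "\<And>Y. card (set Y) \<le> k \<Longrightarrow> generic_identity Y"
    and "card (set X) \<le> Suc k" and "P \<subseteq> set X" "N \<subseteq> set X" "P \<inter> N = {}" "P \<noteq> {}" "N \<noteq> {}" and "\<Sum>P = \<Sum>N"
  shows "generic_identity X"
  using assms(2-)
proof (induction "card P + card N" arbitrary: X P N rule: less_induct)
  case less
  show ?case
  proof (cases "set X \<subseteq> positive")
    case False
    then show ?thesis by (simp add: generic_identity_def)
  next
    case X: True
  have fin: "finite P" "finite N" using less.prems finite_subset[OF _ finite_set[of X]] by auto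
  \<comment> \<open>Formulated for any pair of sides, since it is applied to \<open>P, N\<close> and
    to \<open>N, P\<close>.\<close>
  have main: "generic_identity X"
    if PN: "P \<subseteq> set X" "N \<subseteq> set X" "P \<inter> N = {}" "N \<noteq> {}" "\<Sum>P = \<Sum>N" "finite P" "finite N" and two: "card P \<ge> 2"
      and hyp: "\<And>X' P' N'. \<lbrakk>card P' + card N' < card P + card N; card (set X') \<le> Suc k; P' \<subseteq> set X'; N' \<subseteq> set X'; P' \<inter> N' = {};
         P' \<noteq> {}; N' \<noteq> {}; \<Sum>P' = \<Sum>N'\<rbrakk> \<Longrightarrow> generic_identity X'" for P N
  proof -
    obtain a b where ab: "a \<in> P" "b \<in> P" "a \<noteq> b"
      using two by (metis card_le_Suc0_iff_eq PN(6) not_less_eq_eq numeral_2_eq_2)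
    let ?R = "filter (\<lambda>x. x \<noteq> a \<and> x \<noteq> b) X"
    have ms: "mset (replicate 0 (a + b) @ replicate (count_list X a) a @ replicate (count_list X b) b @ ?R) = mset X"
      using ab(3) by (induction X) (auto simp: add_mset_commute)
    have nz: "a \<noteq> 0" "b \<noteq> 0" using X ab PN(1) by (auto simp: positive_def)
    have pos: "count_list X a > 0" "count_list X b > 0" using ab PN(1) by (metis count_list_0_iff not_gr_zero subsetD)+
    have setR: "set ?R = set X - {a, b}" by auto
    have "generic_identity (replicate m (a + b) @ replicate i a @ replicate j b @ ?R)"
      if ij: "i = 0 \<or> j = 0" and m: "m > 0" for i j m
    proof -
      let ?X = "replicate m (a + b) @ replicate i a @ replicate j b @ ?R"
      have sub: "set ?X \<subseteq> insert (a + b) (set X - {a}) \<or> set ?X \<subseteq> insert (a + b) (set X - {b})"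
        using ij ab PN(1) by (auto simp: setR split: if_splits)
      have sup: "insert (a + b) (set X - {a, b}) \<subseteq> set ?X" using m by (auto simp: setR)
      have ca: "card (set X - {a}) = card (set X) - 1" "card (set X - {b}) = card (set X) - 1"
        using ab PN(1) by (auto simp: card_Diff_singleton subset_iff)
      have cpos: "card (set X) > 0" using ab PN(1) by (auto simp: card_gt_0_iff)
      have ne: "a + b \<noteq> a" "a + b \<noteq> b" using nz by simp_all
      show ?thesis
      \<comment> \<open>This also covers \<open>a + b\<close> lying in \<open>P\<close> or in
        \<open>N\<close>. In the other case the new vector is outside both, so the shortened
        relation still has disjoint sides.\<close>
      proof (cases "a + b \<in> set X")
        case True
        then have eq: "insert (a + b) (set X - {a}) = set X - {a}" "insert (a + b) (set X - {b}) = set X - {b}"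
          using ne by (simp_all add: insert_absorb)
        have "card (set ?X) \<le> card (set X) - 1" using sub unfolding eq
        proof
          assume "set ?X \<subseteq> set X - {a}"
          from card_mono[OF _ this] show ?thesis by (simp add: ca)
        next
          assume "set ?X \<subseteq> set X - {b}"
          from card_mono[OF _ this] show ?thesis by (simp add: ca)
        qed
        then show ?thesis using less.prems(1) by (intro small) linarith
      next
        case nX: False
        let ?P = "insert (a + b) (P - {a, b})"
        have "card (set ?X) \<le> Suc (card (set X) - 1)" using sub
        proof
          assume "set ?X \<subseteq> insert (a + b) (set X - {a})"
          from card_mono[OF _ this] show ?thesis by (simp add: ca card_insert_if split: if_splits)
        next
          assume "set ?X \<subseteq> insert (a + b) (set X - {b})"
          from card_mono[OF _ this] show ?thesis by (simp add: ca card_insert_if split: if_splits)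
        qed
        then have c: "card (set ?X) \<le> Suc k" using less.prems(1) cpos by linarith
        have PP: "?P \<subseteq> set ?X" by (rule order_trans[OF _ sup]) (use PN(1) in blast)
        have "N \<subseteq> insert (a + b) (set X - {a, b})" using PN(2,3) ab(1,2) by blast
        then have NN: "N \<subseteq> set ?X" using sup by (rule order_trans)
        have dis: "?P \<inter> N = {}" using PN(2,3) nX by blast
        have nP: "a + b \<notin> P - {a, b}" using nX PN(1) by blast
        have ins: "P = insert a (insert b (P - {a, b}))" using ab(1,2) by blast
        have "\<Sum>P = \<Sum>(insert a (insert b (P - {a, b})))" using ins by (rule arg_cong)
        also have "\<dots> = a + (b + \<Sum>(P - {a, b}))" using ab(3) PN(6) by (subst sum.insert; simp)+
        finally have sm: "\<Sum>?P = \<Sum>N" using PN(5,6) nP by (simp add: add.assoc)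
        have "card ?P = Suc (card (P - {a, b}))" using nP PN(6) by simp
        also have "card (P - {a, b}) = card P - 2" using ab PN(6) by (simp add: card_Diff_subset)
        finally have lt: "card ?P + card N < card P + card N" using two by simp
        show ?thesis by (rule hyp[OF lt c PP NN dis insert_not_empty PN(4) sm])
      qed
    qed
    from generic_identity_merge_all[OF this, of "count_list X a" "count_list X b" 0] pos
    have "generic_identity (replicate 0 (a + b) @ replicate (count_list X a) a @ replicate (count_list X b) b @ ?R)" by blast
    then show ?thesis by (rule generic_identity_permute[OF ms])
  qed
  consider "card P \<ge> 2" | "card N \<ge> 2" | "card P = 1" "card N = 1"
    using less.prems(5,6) fin by (metis One_nat_def Suc_leI card_gt_0_iff le_antisym not_less_eq_eq numeral_2_eq_2)
  then show ?thesis
  proof cases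
    case 1
    show ?thesis
      by (rule main[OF less.prems(2,3,4,6,7) fin 1]) (rule less.hyps)
  next
    case 2
    have "N \<inter> P = {}" using less.prems(4) by blast
    show ?thesis
      by (rule main[OF less.prems(3,2) \<open>N \<inter> P = {}\<close> less.prems(5) less.prems(7)[symmetric] fin(2,1) 2])
        (subst (asm) add.commute[of "card N" "card P"], rule less.hyps)
  next
    case 3
    then obtain p q where "P = {p}" "N = {q}" by (auto simp: card_1_singleton_iff)
    then show ?thesis using less.prems(4,7) by simp
  qed
  qed
qed

theorem generic_identity: "generic_identity X"
proof (induction "card (set X)" arbitrary: X rule: less_induct)
  case less
  consider "\<not> set X \<subseteq> positive" | "span (set X) \<noteq> UNIV" | "independent (set X)" "span (set X) = UNIV"
    | "set X \<subseteq> positive" "span (set X) = UNIV" "\<not> independent (set X)" by blast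
  then show ?case
  proof cases
    case 1
    then show ?thesis by (simp add: generic_identity_def)
  next
    case 4
    note X = \<open>set X \<subseteq> positive\<close>
    obtain B where BX: "B \<subseteq> set X" and ind: "independent B" and sub: "set X \<subseteq> span B"
      by (rule maximal_independent_subset)
    have "span (set X) \<subseteq> span B" using span_mono[OF sub] by (simp add: span_span)
    then have B: "euclidean_basis B" using ind 4(2) by (auto simp: euclidean_basis_def)
    interpret B: euclidean_basis B by (rule B)
    have "B \<noteq> set X" using ind 4(3) by blast
    then obtain c where c: "c \<in> set X" "c \<notin> B" using BX by blast
    have BL: "B \<subseteq> \<Lambda>" and cL: "c \<in> \<Lambda>" using BX X c by (auto simp: positive_def)
    obtain n where n: "n > 0" and nc: "real n *\<^sub>R c \<in> int_span B" by (rule multiple_in_int_span[OF B BL cL])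
    obtain k where k: "real n *\<^sub>R c = (\<Sum>b\<in>B. of_int (k b) *\<^sub>R b)" using nc unfolding int_span_def by blast
    \<comment> \<open>Scaling by the absolute values of the coefficients turns the relation into an
      equality of two sums with coefficients \<open>1\<close>. The default \<open>1\<close> keeps
      the factors positive where the coefficient is zero; outside \<open>B\<close> and
      \<open>c\<close> any positive factor would do.\<close>
    define s where "s x = (if x = c then n else if k x = 0 then 1 else nat \<bar>k x\<bar>)" for x
    have s: "s x > 0" for x using n by (simp add: s_def)
    let ?f = "\<lambda>x. real (s x) *\<^sub>R x"
    define N where "N = {b \<in> B. k b > 0}"
    define M where "M = {b \<in> B. k b < 0}"
    have fin: "finite N" "finite M" using B.finite_B by (simp_all add: N_def M_def)
    have sb: "real (s b) = \<bar>of_int (k b)\<bar>" if "b \<in> N \<union> M" for b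
    proof -
      have "b \<noteq> c" "k b \<noteq> 0" using that c(2) by (auto simp: N_def M_def)
      then show ?thesis by (simp add: s_def)
    qed
    have "real n *\<^sub>R c = (\<Sum>b\<in>N \<union> M. of_int (k b) *\<^sub>R b)" unfolding k
      by (rule sum.mono_neutral_right[OF B.finite_B]) (auto simp: N_def M_def)
    also have "\<dots> = (\<Sum>b\<in>N. of_int (k b) *\<^sub>R b) + (\<Sum>b\<in>M. of_int (k b) *\<^sub>R b)"
      by (rule sum.union_disjoint[OF fin]) (auto simp: N_def M_def)
    also have "(\<Sum>b\<in>N. of_int (k b) *\<^sub>R b) = (\<Sum>b\<in>N. ?f b)"
      by (rule sum.cong[OF refl]) (use sb in \<open>auto simp: N_def\<close>)
    also have "(\<Sum>b\<in>M. of_int (k b) *\<^sub>R b) = (\<Sum>b\<in>M. - ?f b)"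
      by (rule sum.cong[OF refl]) (use sb in \<open>auto simp: M_def\<close>)
    finally have "?f c + (\<Sum>b\<in>M. ?f b) = (\<Sum>b\<in>N. ?f b)" by (simp add: s_def sum_negf)
    moreover have "c \<notin> M" using c(2) by (simp add: M_def)
    ultimately have rel: "(\<Sum>b\<in>insert c M. ?f b) = (\<Sum>b\<in>N. ?f b)" using fin by simp
    have MX: "insert c M \<subseteq> set X" and NX: "N \<subseteq> set X" using c BX by (auto simp: M_def N_def)
    have posf: "0 < w \<bullet> ?f x" if "x \<in> set X" for x using positive_inner[OF X that] s[of x] by simp
    \<comment> \<open>The other side contains \<open>c\<close> and all its terms are positive on
      \<open>w\<close>, so its sum cannot be zero.\<close>
    have "N \<noteq> {}"
    proof
      assume "N = {}"
      then have "(\<Sum>b\<in>insert c M. ?f b) = 0" using rel by simp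
      then have "(\<Sum>b\<in>insert c M. w \<bullet> ?f b) = 0" by (metis inner_sum_right inner_zero_right)
      moreover have "(\<Sum>b\<in>insert c M. w \<bullet> ?f b) > 0"
        by (rule sum_pos) (use fin posf MX in blast)+
      ultimately show False by simp
    qed
    have small: "generic_identity Y" if "card (set Y) \<le> card (set X) - 1" for Y
    proof (rule less.hyps)
      have "card (set X) > 0" using c(1) by (auto simp: card_gt_0_iff)
      then show "card (set Y) < card (set X)" using that by linarith
    qed
    have "generic_identity (map ?f X)"
    \<comment> \<open>Scaling may make distinct vectors coincide; this only helps, as the number of
      distinct vectors drops.\<close>
    proof (cases "inj_on ?f (set X)")
      case True
      have im: "\<Sum>(?f ` A) = (\<Sum>b\<in>A. ?f b)" if "A \<subseteq> set X" for A
        using sum.reindex[OF inj_on_subset[OF True that], of "\<lambda>x. x"] by (simp add: comp_def)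
      show ?thesis
      proof (rule generic_identity_relation[OF small])
        show "card (set (map ?f X)) \<le> Suc (card (set X) - 1)"
          using card_image_le[of "set X" ?f] by simp
        show "?f ` insert c M \<subseteq> set (map ?f X)" "?f ` N \<subseteq> set (map ?f X)"
          unfolding set_map by (rule image_mono[OF MX], rule image_mono[OF NX])
        have "insert c M \<inter> N = {}" using c(2) by (auto simp: N_def M_def)
        then show "?f ` insert c M \<inter> ?f ` N = {}" using inj_on_image_Int[OF True MX NX] by simp
        show "\<Sum>(?f ` insert c M) = \<Sum>(?f ` N)" unfolding im[OF MX] im[OF NX] by (rule rel)
      qed (use \<open>N \<noteq> {}\<close> in simp_all)
    next
      case False
      then have "card (set (map ?f X)) < card (set X)"
        using inj_on_iff_eq_card[of "set X" ?f] card_image_le[of "set X" ?f] by (simp add: le_less)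
      then show ?thesis by (intro small) linarith
    qed
    then show ?thesis using generic_identity_multiples[of s X "[]"] s by simp
  qed (use generic_identity_not_spanning generic_identity_basis in blast)+
qed

end

section \<open>Lattice points near a regular point\<close>

lemma local_density_eventually_eq:
  assumes "\<And>a. a \<in> set Y \<Longrightarrow> 0 < w \<bullet> a" "v \<notin> singular_points Y"
  shows "\<forall>\<^sub>F u in nhds v. local_density Y u = local_density Y v"
proof -
  obtain e where e: "density_near Y v (local_density Y v) e" by (rule density_near_local_density[OF assms])
  have "\<forall>\<^sub>F u in nhds v. u \<in> ball v e"
    using density_nearD(2)[OF e] by (intro eventually_nhds_in_open) auto
  then show ?thesis by eventually_elim (rule local_density_ball[OF e])
qed

lemma box_in_zonotope:
  assumes "B \<subseteq> set X" "\<And>b. b \<in> B \<Longrightarrow> 0 \<le> t b \<and> t b \<le> 1"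
  shows "(\<Sum>b\<in>B. t b *\<^sub>R b) \<in> zonotope X"
  using assms
proof (induction X arbitrary: B)
  case (Cons a X)
  have "finite B" using Cons.prems(1) finite_subset by blast
  have z: "(\<Sum>b\<in>B - {a}. t b *\<^sub>R b) \<in> zonotope X" by (rule Cons.IH) (use Cons.prems in auto)
  show ?case
  proof (cases "a \<in> B")
    case True
    show ?thesis
      by (rule zonotope_ConsI[OF sum.remove[OF \<open>finite B\<close> True] _ _ z]) (use Cons.prems(2)[OF True] in auto)
  next
    case False
    then show ?thesis using z by (intro zonotope_ConsI[OF _ _ _ z, of _ 0]) simp_all
  qed
qed simp

lemma AE_ex_in_open:
  fixes U :: "'v::euclidean_space set"
  assumes "AE u in lborel. P u" "open U" "U \<noteq> {}" obtains u where "u \<in> U" "P u"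
proof -
  have "\<exists>u\<in>U. P u"
  proof (rule ccontr)
    assume "\<not> (\<exists>u\<in>U. P u)"
    then have "AE u in lborel. u \<notin> U" using assms(1) by (auto elim: eventually_mono)
    then have "emeasure lborel U = 0" using assms(2) by (subst (asm) AE_iff_measurable[OF _ refl]) auto
    then have "negligible U" using assms(2) by (simp add: negligible_iff_null_sets null_sets_def borel_open emeasure_completion)
    then show False using open_not_negligible assms(2,3) by blast
  qed
  then show ?thesis using that by blast
qed

text \<open>The open box over \<open>B\<close> with corner \<open>v\<close> lies in \<open>v\<close>
  plus the zonotope and has \<open>v\<close> in its closure, so it meets \<open>S\<close> in a
  nonempty open set, which is not negligible.\<close>

lemma (in euclidean_basis) ex_near_in_zonotope:
  assumes "B \<subseteq> set X" "open S" "v \<in> S" "AE u in lborel. P u"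
  obtains u where "u \<in> S" "u - v \<in> zonotope X" "P u"
proof -
  define U where "U = S \<inter> (\<Inter>b\<in>B. {u. 0 < coord b (u - v)} \<inter> {u. coord b (u - v) < 1})"
  have cont: "continuous_on UNIV (\<lambda>u. coord b (u - v))" for b
    by (intro bounded_linear.continuous_on[OF bounded_linear_coord] continuous_intros)
  have "open U" unfolding U_def
    by (intro open_Int open_INT finite_B ballI open_Collect_less cont continuous_intros assms(2))
  \<comment> \<open>Points on the diagonal of the box, tending to its corner
    \<open>v\<close>.\<close>
  let ?y = "\<lambda>r. v + r *\<^sub>R \<Sum>B"
  have c: "coord b (?y r - v) = r" if "b \<in> B" for b r
    using coord_sum[OF that, of "\<lambda>_. r"] by (simp add: scaleR_sum_right)
  have "isCont ?y 0" by (intro continuous_intros)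
  then have "\<forall>\<^sub>F r in at 0. ?y r \<in> S" using topological_tendstoD[of ?y v "at 0" S] assms(2,3) by (simp add: isCont_def)
  then obtain d where d: "d > 0" "\<And>r. r \<noteq> 0 \<Longrightarrow> dist r 0 < d \<Longrightarrow> ?y r \<in> S" unfolding eventually_at by blast
  define r where "r = min (1 / 2) (d / 2)"
  have r: "0 < r" "r < 1" "r < d" using d(1) by (auto simp: r_def min_def)
  then have "?y r \<in> S" by (intro d(2)) auto
  then have "?y r \<in> U" using r c unfolding U_def by auto
  then obtain u where u: "u \<in> U" "P u" using AE_ex_in_open[OF assms(4) \<open>open U\<close>] by blast
  have "(\<Sum>b\<in>B. coord b (u - v) *\<^sub>R b) \<in> zonotope X"
    by (rule box_in_zonotope[OF assms(1)]) (use u(1) in \<open>auto simp: U_def intro: less_imp_le\<close>)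
  then have "u - v \<in> zonotope X" by (simp only: sum_coord)
  moreover have "u \<in> S" using u(1) by (simp add: U_def)
  ultimately show ?thesis using u(2) that by blast
qed

context pointed_lattice
begin

text \<open>The point \<open>v\<close> itself may belong to the exceptional null set. But
  \<open>quasi\<close> depends on the chamber point only through finitely many local densities, each
  constant near \<open>v\<close>, so \<open>v\<close> can be exchanged for a generic
  \<open>u\<close> nearby while the evaluation point stays \<open>v\<close>.\<close>

theorem partition_function_eq_quasi:
  assumes X: "set X \<subseteq> positive" "span (set X) = UNIV" and v: "v \<in> \<Lambda>" "v \<notin> singular_points X"
  shows "of_nat (partition_function X v) = quasi X v v"
proof -
  let ?T = "toric_points \<Lambda> X" and ?Y = "\<lambda>p. filter (\<lambda>a. p a = 1) X"
  have "\<forall>\<^sub>F u in nhds v. \<forall>p\<in>?T. local_density (?Y p) u = local_density (?Y p) v"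
  proof (rule eventually_ball_finite[OF finite_toric_points[OF positive_lat[OF X(1)]]], rule ballI)
    fix p
    have "v \<notin> singular_points (?Y p)" using v(2) singular_points_mono[of "?Y p" X] by auto
    then show "\<forall>\<^sub>F u in nhds v. local_density (?Y p) u = local_density (?Y p) v"
      by (rule local_density_eventually_eq[rotated]) (use positive_inner[OF X(1)] in auto)
  qed
  then obtain S where S: "open S" "v \<in> S" "\<And>u p. u \<in> S \<Longrightarrow> p \<in> ?T \<Longrightarrow> local_density (?Y p) u = local_density (?Y p) v"
    unfolding eventually_nhds by blast
  obtain B where BX: "B \<subseteq> set X" and ind: "independent B" and sub: "set X \<subseteq> span B"
    by (rule maximal_independent_subset)
  have "span (set X) \<subseteq> span B" using span_mono[OF sub] by (simp add: span_span)
  then interpret B: euclidean_basis B using ind X(2) by unfold_locales auto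
  have "AE u in lborel. \<forall>l\<in>\<Lambda>. u - l \<in> zonotope X \<longrightarrow> defect X u l = 0"
    using generic_identity[of X] X(1) by (simp add: generic_identity_def)
  then obtain u where u: "u \<in> S" "u - v \<in> zonotope X" "\<forall>l\<in>\<Lambda>. u - l \<in> zonotope X \<longrightarrow> defect X u l = 0"
    by (rule B.ex_near_in_zonotope[OF BX S(1,2)])
  have "char_poly vol X p u v = char_poly vol X p v v" if "p \<in> ?T" for p
    by (simp add: char_poly_def S(3)[OF u(1) that])
  then have "quasi X u v = quasi X v v" by (simp add: quasi_def)
  moreover have "defect X u v = 0" using u(2,3) v(1) by blast
  ultimately show ?thesis by (simp add: defect_def)
qed

end

text \<open>Strict separation of \<open>0\<close> from the compact convex hull; \<open>w\<close>
  makes the cone pointed.\<close>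

lemma pointed_half_space:
  fixes A :: "'v::euclidean_space set"
  assumes "finite A" "0 \<notin> convex hull A"
  obtains w where "\<And>a. a \<in> A \<Longrightarrow> 0 < w \<bullet> a"
proof -
  have "closed (convex hull A)" by (simp add: assms(1) finite_imp_compact_convex_hull compact_imp_closed)
  then obtain w b where "0 < b" "\<forall>x\<in>convex hull A. b < w \<bullet> x"
    using separating_hyperplane_closed_0[OF convex_convex_hull _ assms(2)] by blast
  then show ?thesis using that[of w] by (meson hull_inc less_trans)
qed

theorem theorem9p22:
  fixes \<Lambda> :: "'v::euclidean_space set"
    and X :: "'v list"
    and rep :: "('v \<Rightarrow> complex) \<Rightarrow> ('v \<Rightarrow> complex)"
    and v :: 'v
  assumes "spanning_lattice \<Lambda>"
    and "set X \<subseteq> \<Lambda>"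
    and "0 \<notin> set X"
    and "span (set X) = UNIV"
    and "0 \<notin> convex hull (set X)"
    and "\<And>p. p \<in> toric_points \<Lambda> X \<Longrightarrow> linear (rep p) \<and> exp_char \<Lambda> (rep p) = p"
    and "v \<in> \<Lambda> \<inter> regular_points X"
  shows "of_nat (partition_function X v) =
    (\<Sum>p\<in>toric_points \<Lambda> X.
       Q_hat X (rep p) (spline \<Lambda> (sublist_at X (rep p)) (params_at X (rep p))) v)"
proof -
  obtain w where w: "\<And>a. a \<in> set X \<Longrightarrow> 0 < w \<bullet> a" using pointed_half_space[OF finite_set assms(5)] by blast
  \<comment> \<open>The same choice as in \<open>lattice_lborel\<close>, so that \<open>vol\<close>
    is precisely its normalizing constant.\<close>
  define E where "E = (SOME B. lattice_basis \<Lambda> B)"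
  have "lattice_basis \<Lambda> E" unfolding E_def by (rule someI_ex) (use assms(1) in \<open>simp add: spanning_lattice_def\<close>)
  then interpret pointed_lattice E \<Lambda> w
    by unfold_locales (auto simp: lattice_basis_def int_span_def)
  have pos: "set X \<subseteq> positive" using assms(2) w by (auto simp: positive_def)
  have v: "v \<in> \<Lambda>" "v \<notin> singular_points X" using assms(7) by (auto simp: regular_points_eq)
  have vol: "lattice_lborel \<Lambda> = scale_measure (inverse (ennreal vol)) lborel" "0 < vol"
    using E.emeasure_parallelepiped by (simp_all add: lattice_lborel_def vol_def E_def[symmetric])
  have "Q_hat X (rep p) (spline \<Lambda> (sublist_at X (rep p)) (params_at X (rep p))) v = p v * char_poly vol X p v v"
    if p: "p \<in> toric_points \<Lambda> X" for p
  proof -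
    have lin: "linear (rep p)" and ex: "exp_char \<Lambda> (rep p) = p" using assms(6)[OF p] by auto
    \<comment> \<open>On lattice points only the character matters, so the right-hand side does not
      depend on the chosen representatives.\<close>
    have val: "exp (rep p a) = p a" if "a \<in> \<Lambda>" for a using that fun_cong[OF ex, of a] by (simp add: exp_char_def)
    have "sublist_at X (rep p) = filter (\<lambda>a. p a = 1) X"
      unfolding sublist_at_def by (rule filter_cong) (use val assms(2) in auto)
    then have "span (set (sublist_at X (rep p))) = UNIV" using toric_filter[OF pos] p by simp
    moreover have "char_poly vol X (\<lambda>a. exp (rep p a)) v = char_poly vol X p v"
      by (rule char_poly_cong) (use val assms(2) in auto)
    ultimately show ?thesis using Q_hat_spline[OF w lin _ vol v(2)] val[OF v(1)] by simp
  qed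
  then show ?thesis using partition_function_eq_quasi[OF pos assms(4) v] by (simp add: quasi_def)
qed

end
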